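(* Let $X$ be a finite simplicial complex (satisfying the standing assumptions in the context) and let $\delta$ be a perversity. Then the category $\mathcal{R}(X,\delta)$ of linear algebra data and the category $\mathfrak{Sh}_c(X,\delta)$ of sheaves of $\mathbb{F}$-vector spaces on $X$ constructible with respect to the $(-\delta)$-perverse triangulation are (canonically) equivalent: $$\mathcal{R}(X,\delta)\simeq \mathfrak{Sh}_c(X,\delta).$$ Here "canonically" means that the equivalence functor does not depend on anything but the triangulation of $X$ and the perversity $\delta$.
   Context: $\mathbb{F}$ is a field of characteristic $0$; all vector spaces are over $\mathbb{F}$. Standing assumptions on $X$: $X$ is a connected finite simplicial complex of dimension $n$, it is a regular cell complex, every set of $r+1$ vertices is the vertex set of at most one $r$-dimensional simplex, and all simplices are nondegenerate. $\hat X$ is the first barycentric subdivision of $X$. Write $\Delta\leftrightarrow\Delta'$ if the simplices $\Delta,\Delta'$ of $X$ are incident (one is a face of the other). Perversity: a function $\delta:\mathbb{Z}_{\ge 0}\to\mathbb{Z}$ with $\delta(0)=0$ such that for every $k\ge 1$ either $\delta(k)=\max_{0\le i\le k-1}\delta(i)+1$ or $\delta(k)=\min_{0\le i\le k-1}\delta(i)-1$ (equivalently, $\delta(0)=0$ and $\delta$ maps every interval $\{0,\dots,k\}$ bijectively onto an interval $\{a,\dots,a+k\}$ with $a\le 0$). In particular $-\delta$ is a perversity if $\delta$ is. For a simplex $\Delta$ put $\delta(\Delta)=\delta(\dim\Delta)$. Perverse simplices: let $\epsilon$ be a perversity. A simplex $\hat\Delta=\{c_1,\dots,c_s\}$ of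 $\hat X$ has as vertices the barycenters $c_i$ of simplices $\Delta_1,\dots,\Delta_s$ of $X$ forming a chain with $\dim\Delta_1<\dots<\dim\Delta_s$; let $\max\hat\Delta$ (with respect to $\epsilon$) be the vertex $c_i$ for which $\epsilon(\Delta_i)$ is maximal among $\epsilon(\Delta_1),\dots,\epsilon(\Delta_s)$. For a simplex $\Delta$ of $X$ with barycenter $c$, the corresponding $\epsilon$-perverse simplex is the disjoint union of (open) simplices ${}^{\epsilon}\Delta=\bigsqcup_{\max\hat\Delta=c}\hat\Delta\subset X$. The decomposition of $X$ into the disjoint union of its $\epsilon$-perverse simplices is called the $\epsilon$-perverse triangulation. Constructible sheaves: a sheaf $\mathbf{A}$ of $\mathbb{F}$-vector spaces on $X$ is constructible with respect to the $\epsilon$-perverse triangulation if for every simplex $\Delta$ of $X$ the restriction $i_\Delta^*\mathbf{A}$ along the inclusion $i_\Delta:{}^{\epsilon}\Delta\hookrightarrow X$ is a constant sheaf associated to a finite-dimensional $\mathbb{F}$-vector space. $\mathfrak{Sh}_c(X,\delta)$ is the category of all sheaves on $X$ constructible with respect to the $(-\delta)$-perverse triangulation. The category $\mathcal{R}(X,\delta)$: an object $\mathbf{S}$ consists of a finite-dimensional vector space $S(\Delta)$ for every simplex $\Delta$ of $X$, and a linear map $s(\Delta,\Delta'):S(\Delta)\to S(\Delta')$ for every pair of simplices with $\delta(\Delta)=\delta(\Delta')+1$ and $\Delta\leftrightarrow\Delta'$, subject to the equivalence axiom: whenever $\delta(\Delta')=k+1$, $\delta(\Delta'')=k-1$, $\delta(\Delta_1)=\delta(\Delta_2)=k$,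 $\Delta'\leftrightarrow\Delta_1\leftrightarrow\Delta''$ and $\Delta'\leftrightarrow\Delta_2\leftrightarrow\Delta''$, one has $s(\Delta_1,\Delta'')\circ s(\Delta',\Delta_1)=s(\Delta_2,\Delta'')\circ s(\Delta',\Delta_2)$. Morphisms are families of linear maps $S(\Delta)\to T(\Delta)$ commuting with these maps. (Equivalently, finite-dimensional left modules over the quotient of the path algebra of the quiver with vertices the simplices of $X$ and an arrow $\Delta\to\Delta'$ whenever $\delta(\Delta)=\delta(\Delta')+1$ and $\Delta\leftrightarrow\Delta'$ by the corresponding relations.) *)

theory Defs
  imports "HOL-Analysis.Analysis" "Jordan_Normal_Form.Missing_VectorSpace"
begin

section \<open>Categories and equivalences\<close>

text \<open>
  Hom-sets need not be disjoint, so composition and the action of a functor on morphisms take the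
  objects involved as explicit arguments: \<open>Cmp \<C> a b c g f\<close> is \<open>g \<circ> f\<close> for
  \<open>f : a \<rightarrow> b\<close> and \<open>g : b \<rightarrow> c\<close>.
\<close>

record ('o, 'm) cat =
  Obj :: "'o set"
  Hom :: "'o \<Rightarrow> 'o \<Rightarrow> 'm set"
  Idn :: "'o \<Rightarrow> 'm"
  Cmp :: "'o \<Rightarrow> 'o \<Rightarrow> 'o \<Rightarrow> 'm \<Rightarrow> 'm \<Rightarrow> 'm"

definition category :: "('o, 'm) cat \<Rightarrow> bool" where
  "category \<C> \<longleftrightarrow>
     (\<forall>a\<in>Obj \<C>. Idn \<C> a \<in> Hom \<C> a a) \<and>
     (\<forall>a\<in>Obj \<C>. \<forall>b\<in>Obj \<C>. \<forall>c\<in>Obj \<C>. \<forall>f\<in>Hom \<C> a b. \<forall>g\<in>Hom \<C> b c.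
        Cmp \<C> a b c g f \<in> Hom \<C> a c) \<and>
     (\<forall>a\<in>Obj \<C>. \<forall>b\<in>Obj \<C>. \<forall>f\<in>Hom \<C> a b.
        Cmp \<C> a a b f (Idn \<C> a) = f \<and> Cmp \<C> a b b (Idn \<C> b) f = f) \<and>
     (\<forall>a\<in>Obj \<C>. \<forall>b\<in>Obj \<C>. \<forall>c\<in>Obj \<C>. \<forall>d\<in>Obj \<C>.
        \<forall>f\<in>Hom \<C> a b. \<forall>g\<in>Hom \<C> b c. \<forall>h\<in>Hom \<C> c d.
        Cmp \<C> a c d h (Cmp \<C> a b c g f) = Cmp \<C> a b d (Cmp \<C> b c d h g) f)"

definition iso_in :: "('o, 'm) cat \<Rightarrow> 'o \<Rightarrow> 'o \<Rightarrow> 'm \<Rightarrow> bool" where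
  "iso_in \<C> a b f \<longleftrightarrow> f \<in> Hom \<C> a b \<and>
     (\<exists>g\<in>Hom \<C> b a. Cmp \<C> a b a g f = Idn \<C> a \<and> Cmp \<C> b a b f g = Idn \<C> b)"

record ('o, 'm, 'p, 'q) functr =
  on_obj :: "'o \<Rightarrow> 'p"
  on_hom :: "'o \<Rightarrow> 'o \<Rightarrow> 'm \<Rightarrow> 'q"

definition is_functor ::
  "('o, 'm) cat \<Rightarrow> ('p, 'q) cat \<Rightarrow> ('o, 'm, 'p, 'q) functr \<Rightarrow> bool" where
  "is_functor \<C> \<D> \<Phi> \<longleftrightarrow> category \<C> \<and> category \<D> \<and>
     (\<forall>a\<in>Obj \<C>. on_obj \<Phi> a \<in> Obj \<D>) \<and>
     (\<forall>a\<in>Obj \<C>. \<forall>b\<in>Obj \<C>. \<forall>f\<in>Hom \<C> a b.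
        on_hom \<Phi> a b f \<in> Hom \<D> (on_obj \<Phi> a) (on_obj \<Phi> b)) \<and>
     (\<forall>a\<in>Obj \<C>. on_hom \<Phi> a a (Idn \<C> a) = Idn \<D> (on_obj \<Phi> a)) \<and>
     (\<forall>a\<in>Obj \<C>. \<forall>b\<in>Obj \<C>. \<forall>c\<in>Obj \<C>. \<forall>f\<in>Hom \<C> a b. \<forall>g\<in>Hom \<C> b c.
        on_hom \<Phi> a c (Cmp \<C> a b c g f) =
        Cmp \<D> (on_obj \<Phi> a) (on_obj \<Phi> b) (on_obj \<Phi> c) (on_hom \<Phi> b c g) (on_hom \<Phi> a b f))"

definition id_functor :: "('o, 'm, 'o, 'm) functr" where
  "id_functor = \<lparr>on_obj = (\<lambda>a. a), on_hom = (\<lambda>a b f. f)\<rparr>"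

definition functor_comp ::
  "('p, 'q, 'r, 's) functr \<Rightarrow> ('o, 'm, 'p, 'q) functr \<Rightarrow> ('o, 'm, 'r, 's) functr" where
  "functor_comp \<Psi> \<Phi> =
     \<lparr>on_obj = (\<lambda>a. on_obj \<Psi> (on_obj \<Phi> a)),
      on_hom = (\<lambda>a b f. on_hom \<Psi> (on_obj \<Phi> a) (on_obj \<Phi> b) (on_hom \<Phi> a b f))\<rparr>"

definition nat_isomorphic ::
  "('o, 'm) cat \<Rightarrow> ('p, 'q) cat \<Rightarrow> ('o, 'm, 'p, 'q) functr \<Rightarrow> ('o, 'm, 'p, 'q) functr \<Rightarrow> bool" where
  "nat_isomorphic \<C> \<D> \<Phi> \<Psi> \<longleftrightarrow>
     (\<exists>\<eta>. (\<forall>a\<in>Obj \<C>. iso_in \<D> (on_obj \<Phi> a) (on_obj \<Psi> a) (\<eta> a)) \<and>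
          (\<forall>a\<in>Obj \<C>. \<forall>b\<in>Obj \<C>. \<forall>f\<in>Hom \<C> a b.
             Cmp \<D> (on_obj \<Phi> a) (on_obj \<Phi> b) (on_obj \<Psi> b) (\<eta> b) (on_hom \<Phi> a b f) =
             Cmp \<D> (on_obj \<Phi> a) (on_obj \<Psi> a) (on_obj \<Psi> b) (on_hom \<Psi> a b f) (\<eta> a)))"

definition equivalence_of_categories ::
  "('o, 'm) cat \<Rightarrow> ('p, 'q) cat \<Rightarrow> ('o, 'm, 'p, 'q) functr \<Rightarrow> bool" where
  "equivalence_of_categories \<C> \<D> \<Phi> \<longleftrightarrow> is_functor \<C> \<D> \<Phi> \<and>
     (\<exists>\<Psi>. is_functor \<D> \<C> \<Psi> \<and>
          nat_isomorphic \<C> \<C> (functor_comp \<Psi> \<Phi>) id_functor \<and>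
          nat_isomorphic \<D> \<D> (functor_comp \<Phi> \<Psi>) id_functor)"


section \<open>Vector spaces\<close>

definition fin_dim_vectorspace :: "'f ring \<Rightarrow> ('f, 'v) module \<Rightarrow> bool" where
  "fin_dim_vectorspace F V \<longleftrightarrow> vectorspace F V \<and> vectorspace.fin_dim F V"

text \<open>
  Linear maps as extensional functions, so that equality of morphisms is equality on the carrier.
\<close>

definition Lin :: "'f ring \<Rightarrow> ('f, 'v) module \<Rightarrow> ('f, 'w) module \<Rightarrow> ('v \<Rightarrow> 'w) set" where
  "Lin F V W = module_hom F V W \<inter> extensional (carrier V)"

text \<open>
  The fields \<open>mult\<close> and \<open>one\<close> are present only because \<open>module\<close> extends the record \<open>ring\<close>.
\<close>

definition pointwise_module ::
  "'p set \<Rightarrow> ('p \<Rightarrow> ('f, 'w) module) \<Rightarrow> ('p \<Rightarrow> 'w) set \<Rightarrow> ('f, 'p \<Rightarrow> 'w) module" where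
  "pointwise_module V M S =
     \<lparr>carrier = S, mult = undefined, one = undefined,
      zero = (\<lambda>x\<in>V. \<zero>\<^bsub>M x\<^esub>),
      add = (\<lambda>s t. \<lambda>x\<in>V. s x \<oplus>\<^bsub>M x\<^esub> t x),
      smult = (\<lambda>c s. \<lambda>x\<in>V. c \<odot>\<^bsub>M x\<^esub> s x)\<rparr>"


section \<open>Sheaves of vector spaces\<close>

text \<open>
  \<open>sec A U\<close> and \<open>res A U V\<close> (restriction from \<open>U\<close> to \<open>V \<subseteq> U\<close>) are only meaningful on open sets.
\<close>

record ('p, 'f, 'v) presheaf =
  sec :: "'p set \<Rightarrow> ('f, 'v) module"
  res :: "'p set \<Rightarrow> 'p set \<Rightarrow> 'v \<Rightarrow> 'v"

definition is_presheaf :: "'f ring \<Rightarrow> 'p topology \<Rightarrow> ('p, 'f, 'v) presheaf \<Rightarrow> bool" where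
  "is_presheaf F T A \<longleftrightarrow>
     (\<forall>U. openin T U \<longrightarrow> vectorspace F (sec A U)) \<and>
     (\<forall>U V. openin T U \<and> openin T V \<and> V \<subseteq> U \<longrightarrow>
        res A U V \<in> module_hom F (sec A U) (sec A V)) \<and>
     (\<forall>U. openin T U \<longrightarrow> (\<forall>s\<in>carrier (sec A U). res A U U s = s)) \<and>
     (\<forall>U V W. openin T U \<and> openin T V \<and> openin T W \<and> W \<subseteq> V \<and> V \<subseteq> U \<longrightarrow>
        (\<forall>s\<in>carrier (sec A U). res A V W (res A U V s) = res A U W s))"

definition is_sheaf :: "'f ring \<Rightarrow> 'p topology \<Rightarrow> ('p, 'f, 'v) presheaf \<Rightarrow> bool" where
  "is_sheaf F T A \<longleftrightarrow> is_presheaf F T A \<and>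
     (\<forall>\<U>. (\<forall>U\<in>\<U>. openin T U) \<longrightarrow>
        (\<forall>s\<in>carrier (sec A (\<Union>\<U>)). \<forall>t\<in>carrier (sec A (\<Union>\<U>)).
           (\<forall>U\<in>\<U>. res A (\<Union>\<U>) U s = res A (\<Union>\<U>) U t) \<longrightarrow> s = t)) \<and>
     (\<forall>\<U> s. (\<forall>U\<in>\<U>. openin T U \<and> s U \<in> carrier (sec A U)) \<and>
        (\<forall>U\<in>\<U>. \<forall>V\<in>\<U>. res A U (U \<inter> V) (s U) = res A V (U \<inter> V) (s V)) \<longrightarrow>
        (\<exists>t\<in>carrier (sec A (\<Union>\<U>)). \<forall>U\<in>\<U>. res A (\<Union>\<U>) U t = s U))"

definition sheaf_homs ::
  "'f ring \<Rightarrow> 'p topology \<Rightarrow> ('p, 'f, 'v) presheaf \<Rightarrow> ('p, 'f, 'w) presheaf \<Rightarrow>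
   ('p set \<Rightarrow> 'v \<Rightarrow> 'w) set" where
  "sheaf_homs F T A B =
     {\<phi> \<in> (\<Pi>\<^sub>E U\<in>{U. openin T U}. Lin F (sec A U) (sec B U)).
        \<forall>U V. openin T U \<and> openin T V \<and> V \<subseteq> U \<longrightarrow>
          (\<forall>s\<in>carrier (sec A U). \<phi> V (res A U V s) = res B U V (\<phi> U s))}"

text \<open>Isomorphism of sheaves whose sections may be drawn from different types.\<close>

definition sheaves_isomorphic ::
  "'f ring \<Rightarrow> 'p topology \<Rightarrow> ('p, 'f, 'v) presheaf \<Rightarrow> ('p, 'f, 'w) presheaf \<Rightarrow> bool" where
  "sheaves_isomorphic F T A B \<longleftrightarrow>
     (\<exists>\<phi>\<in>sheaf_homs F T A B. \<forall>U. openin T U \<longrightarrow>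
        bij_betw (\<phi> U) (carrier (sec A U)) (carrier (sec B U)))"

definition germ ::
  "'p topology \<Rightarrow> ('p, 'f, 'v) presheaf \<Rightarrow> 'p \<Rightarrow> 'p set \<Rightarrow> 'v \<Rightarrow> ('p set \<times> 'v) set" where
  "germ T A x U s =
     {(V, t). openin T V \<and> x \<in> V \<and> t \<in> carrier (sec A V) \<and>
        (\<exists>W. openin T W \<and> x \<in> W \<and> W \<subseteq> U \<inter> V \<and> res A U W s = res A V W t)}"

text \<open>
  The operations on germs are unions over all representatives (all of which contribute the same
  germ), as for the quotient groups of the library.
\<close>

definition stalk ::
  "'p topology \<Rightarrow> ('p, 'f, 'v) presheaf \<Rightarrow> 'p \<Rightarrow> ('f, ('p set \<times> 'v) set) module" where
  "stalk T A x =
     \<lparr>carrier = {germ T A x U s | U s. openin T U \<and> x \<in> U \<and> s \<in> carrier (sec A U)},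
      mult = undefined, one = undefined,
      zero = germ T A x (topspace T) \<zero>\<^bsub>sec A (topspace T)\<^esub>,
      add = (\<lambda>\<xi> \<zeta>. \<Union>(U, s)\<in>\<xi>. \<Union>(V, t)\<in>\<zeta>.
        germ T A x (U \<inter> V) (res A U (U \<inter> V) s \<oplus>\<^bsub>sec A (U \<inter> V)\<^esub> res A V (U \<inter> V) t)),
      smult = (\<lambda>c \<xi>. \<Union>(U, s)\<in>\<xi>. germ T A x U (c \<odot>\<^bsub>sec A U\<^esub> s))\<rparr>"

text \<open>
  The inverse image sheaf \<open>f\<^sup>*A\<close> of a sheaf \<open>A\<close> on \<open>T\<close> along a continuous map \<open>f : Y \<rightarrow> T\<close>: its
  sections over \<open>V\<close> are the families of elements of the stalks of \<open>A\<close> at the points \<open>f y\<close> which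
  are locally given by sections of \<open>A\<close>.
\<close>

definition inverse_image ::
  "'q topology \<Rightarrow> 'p topology \<Rightarrow> ('q \<Rightarrow> 'p) \<Rightarrow> ('p, 'f, 'v) presheaf \<Rightarrow>
   ('q, 'f, 'q \<Rightarrow> ('p set \<times> 'v) set) presheaf" where
  "inverse_image Y T f A =
     \<lparr>sec = (\<lambda>V. pointwise_module V (\<lambda>y. stalk T A (f y))
        {\<sigma> \<in> (\<Pi>\<^sub>E y\<in>V. carrier (stalk T A (f y))).
           \<forall>y\<in>V. \<exists>W U s. openin Y W \<and> y \<in> W \<and> W \<subseteq> V \<and> openin T U \<and> f ` W \<subseteq> U \<and>
             s \<in> carrier (sec A U) \<and> (\<forall>z\<in>W. \<sigma> z = germ T A (f z) U s)}),
      res = (\<lambda>V W \<sigma>. restrict \<sigma> W)\<rparr>"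

definition constant_sheaf ::
  "'q topology \<Rightarrow> ('f, 'w) module \<Rightarrow> ('q, 'f, 'q \<Rightarrow> 'w) presheaf" where
  "constant_sheaf Y M =
     \<lparr>sec = (\<lambda>V. pointwise_module V (\<lambda>y. M)
        {\<sigma> \<in> V \<rightarrow>\<^sub>E carrier M.
           \<forall>y\<in>V. \<exists>W. openin Y W \<and> y \<in> W \<and> W \<subseteq> V \<and> (\<forall>z\<in>W. \<sigma> z = \<sigma> y)}),
      res = (\<lambda>V W \<sigma>. restrict \<sigma> W)\<rparr>"


section \<open>Simplicial complexes and perverse simplices\<close>

text \<open>
  A simplicial complex in the sense of the library is a finite set of closed geometric simplices in
  a Euclidean space. It contains the empty face. Such complexes are regular cell complexes, their
  simplices are nondegenerate, and a simplex is determined by its set of vertices.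
\<close>

definition connected_complex :: "'a::euclidean_space set set \<Rightarrow> nat \<Rightarrow> bool" where
  "connected_complex C n \<longleftrightarrow> simplicial_complex C \<and> connected (\<Union>C) \<and>
     (\<forall>S\<in>C. aff_dim S \<le> int n) \<and> (\<exists>S\<in>C. aff_dim S = int n)"

abbreviation polyhedron_top :: "'a::euclidean_space set set \<Rightarrow> 'a topology" where
  "polyhedron_top C \<equiv> top_of_set (\<Union>C)"

definition simplices :: "'a::euclidean_space set set \<Rightarrow> 'a set set" where
  "simplices C = C - {{}}"

definition sdim :: "'a::euclidean_space set \<Rightarrow> nat" where
  "sdim S = nat (aff_dim S)"

definition incident :: "'a::euclidean_space set \<Rightarrow> 'a set \<Rightarrow> bool" where
  "incident S S' \<longleftrightarrow> S face_of S' \<or> S' face_of S"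

definition barycenter :: "'a::euclidean_space set \<Rightarrow> 'a" where
  "barycenter S = (let V = {v. v extreme_point_of S} in (1 / real (card V)) *\<^sub>R \<Sum>V)"

text \<open>
  A simplex of the barycentric subdivision is represented by the chain of simplices whose
  barycenters are its vertices.
\<close>

definition subdivision_chains :: "'a::euclidean_space set set \<Rightarrow> 'a set set set" where
  "subdivision_chains C =
     {K. K \<noteq> {} \<and> K \<subseteq> simplices C \<and> (\<forall>S\<in>K. \<forall>S'\<in>K. incident S S')}"

definition open_subdivision_simplex :: "'a::euclidean_space set set \<Rightarrow> 'a set" where
  "open_subdivision_simplex K = rel_interior (convex hull (barycenter ` K))"

definition perversity :: "(nat \<Rightarrow> int) \<Rightarrow> bool" where
  "perversity \<delta> \<longleftrightarrow> \<delta> 0 = 0 \<and>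
     (\<forall>k\<ge>1. \<delta> k = Max (\<delta> ` {..<k}) + 1 \<or> \<delta> k = Min (\<delta> ` {..<k}) - 1)"

definition perverse_simplex ::
  "'a::euclidean_space set set \<Rightarrow> (nat \<Rightarrow> int) \<Rightarrow> 'a set \<Rightarrow> 'a set" where
  "perverse_simplex C \<epsilon> S =
     \<Union>{open_subdivision_simplex K | K.
        K \<in> subdivision_chains C \<and> is_arg_max (\<lambda>S'. \<epsilon> (sdim S')) (\<lambda>S'. S' \<in> K) S}"


section \<open>Constructible sheaves\<close>

definition constructible ::
  "'f ring \<Rightarrow> 'a::euclidean_space set set \<Rightarrow> (nat \<Rightarrow> int) \<Rightarrow> ('a, 'f, 'v) presheaf \<Rightarrow> bool" where
  "constructible F C \<epsilon> A \<longleftrightarrow>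
     (\<forall>S\<in>simplices C. \<exists>M :: ('f, 'v) module. fin_dim_vectorspace F M \<and>
        sheaves_isomorphic F (top_of_set (perverse_simplex C \<epsilon> S))
          (inverse_image (top_of_set (perverse_simplex C \<epsilon> S)) (polyhedron_top C) (\<lambda>x. x) A)
          (constant_sheaf (top_of_set (perverse_simplex C \<epsilon> S)) M))"

definition Sh_c ::
  "'f ring \<Rightarrow> 'a::euclidean_space set set \<Rightarrow> (nat \<Rightarrow> int) \<Rightarrow>
   (('a, 'f, 'v) presheaf, 'a set \<Rightarrow> 'v \<Rightarrow> 'v) cat" where
  "Sh_c F C \<delta> =
     \<lparr>Obj = {A. is_sheaf F (polyhedron_top C) A \<and> constructible F C (\<lambda>k. - \<delta> k) A},
      Hom = sheaf_homs F (polyhedron_top C),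
      Idn = (\<lambda>A. \<lambda>U\<in>{U. openin (polyhedron_top C) U}. \<lambda>s\<in>carrier (sec A U). s),
      Cmp = (\<lambda>A B D \<psi> \<phi>. \<lambda>U\<in>{U. openin (polyhedron_top C) U}.
        compose (carrier (sec A U)) (\<psi> U) (\<phi> U))\<rparr>"


section \<open>Linear algebra data\<close>

record ('a, 'f, 'v) lin_data =
  Spc :: "'a set \<Rightarrow> ('f, 'v) module"
  Map :: "'a set \<Rightarrow> 'a set \<Rightarrow> 'v \<Rightarrow> 'v"

definition arrow ::
  "'a::euclidean_space set set \<Rightarrow> (nat \<Rightarrow> int) \<Rightarrow> 'a set \<Rightarrow> 'a set \<Rightarrow> bool" where
  "arrow C \<delta> D D' \<longleftrightarrow> D \<in> simplices C \<and> D' \<in> simplices C \<and>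
     \<delta> (sdim D) = \<delta> (sdim D') + 1 \<and> incident D D'"

text \<open>
  In the equivalence axiom below, the values of the perversity on the two-step paths through
  \<open>D1\<close> and \<open>D2\<close> are \<open>k + 1\<close>, \<open>k\<close>, \<open>k - 1\<close>; this is part of the four \<open>arrow\<close> assumptions.
\<close>

definition R_objects ::
  "'f ring \<Rightarrow> 'a::euclidean_space set set \<Rightarrow> (nat \<Rightarrow> int) \<Rightarrow> ('a, 'f, 'v) lin_data set" where
  "R_objects F C \<delta> = {S.
     (\<forall>D\<in>simplices C. fin_dim_vectorspace F (Spc S D)) \<and>
     (\<forall>D D'. arrow C \<delta> D D' \<longrightarrow> Map S D D' \<in> module_hom F (Spc S D) (Spc S D')) \<and>
     (\<forall>D' D'' D1 D2. arrow C \<delta> D' D1 \<and> arrow C \<delta> D1 D'' \<and> arrow C \<delta> D' D2 \<and> arrow C \<delta> D2 D'' \<longrightarrow>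
        (\<forall>x\<in>carrier (Spc S D'). Map S D1 D'' (Map S D' D1 x) = Map S D2 D'' (Map S D' D2 x)))}"

definition R_cat ::
  "'f ring \<Rightarrow> 'a::euclidean_space set set \<Rightarrow> (nat \<Rightarrow> int) \<Rightarrow>
   (('a, 'f, 'v) lin_data, 'a set \<Rightarrow> 'v \<Rightarrow> 'v) cat" where
  "R_cat F C \<delta> =
     \<lparr>Obj = R_objects F C \<delta>,
      Hom = (\<lambda>S T. {f \<in> (\<Pi>\<^sub>E D\<in>simplices C. Lin F (Spc S D) (Spc T D)).
        \<forall>D D'. arrow C \<delta> D D' \<longrightarrow>
          (\<forall>x\<in>carrier (Spc S D). f D' (Map S D D' x) = Map T D D' (f D x))}),
      Idn = (\<lambda>S. \<lambda>D\<in>simplices C. \<lambda>x\<in>carrier (Spc S D). x),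
      Cmp = (\<lambda>S T U g f. \<lambda>D\<in>simplices C. compose (carrier (Spc S D)) (g D) (f D))\<rparr>"


section \<open>Transport along isomorphisms of triangulated spaces\<close>

definition simplicial_iso ::
  "'a::euclidean_space set set \<Rightarrow> 'a set set \<Rightarrow> ('a \<Rightarrow> 'a) \<Rightarrow> bool" where
  "simplicial_iso C C' h \<longleftrightarrow> bij_betw h (\<Union>C) (\<Union>C') \<and> (\<lambda>S. h ` S) ` C = C' \<and>
     (\<forall>S\<in>C. \<forall>x\<in>S. \<forall>y\<in>S. \<forall>t\<in>{0..1}.
        h ((1 - t) *\<^sub>R x + t *\<^sub>R y) = (1 - t) *\<^sub>R h x + t *\<^sub>R h y)"

definition pull :: "'a set set \<Rightarrow> ('a \<Rightarrow> 'a) \<Rightarrow> 'a set \<Rightarrow> 'a set" where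
  "pull C h V = {x \<in> \<Union>C. h x \<in> V}"

definition transport_R ::
  "'a::euclidean_space set set \<Rightarrow> 'a set set \<Rightarrow> ('a \<Rightarrow> 'a) \<Rightarrow>
   (('a, 'f, 'v) lin_data, 'a set \<Rightarrow> 'v \<Rightarrow> 'v, ('a, 'f, 'v) lin_data, 'a set \<Rightarrow> 'v \<Rightarrow> 'v) functr" where
  "transport_R C C' h =
     \<lparr>on_obj = (\<lambda>S. \<lparr>Spc = (\<lambda>D. Spc S (pull C h D)), Map = (\<lambda>D D'. Map S (pull C h D) (pull C h D'))\<rparr>),
      on_hom = (\<lambda>S T f. \<lambda>D\<in>simplices C'. f (pull C h D))\<rparr>"

text \<open>On sheaves, transport is the direct image along \<open>h\<close>.\<close>

definition transport_Sh ::
  "'a::euclidean_space set set \<Rightarrow> 'a set set \<Rightarrow> ('a \<Rightarrow> 'a) \<Rightarrow>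
   (('a, 'f, 'v) presheaf, 'a set \<Rightarrow> 'v \<Rightarrow> 'v, ('a, 'f, 'v) presheaf, 'a set \<Rightarrow> 'v \<Rightarrow> 'v) functr" where
  "transport_Sh C C' h =
     \<lparr>on_obj = (\<lambda>A. \<lparr>sec = (\<lambda>V. sec A (pull C h V)), res = (\<lambda>V W. res A (pull C h V) (pull C h W))\<rparr>),
      on_hom = (\<lambda>A B \<phi>. \<lambda>V\<in>{V. openin (polyhedron_top C') V}. \<phi> (pull C h V))\<rparr>"

text \<open>
  An assignment of a functor to every triangulation and perversity depends only on the
  triangulation if it is compatible, up to natural isomorphism, with all isomorphisms of
  triangulated spaces (in particular with the automorphisms of a single complex).
\<close>

definition compatible_with_isos ::
  "'f ring \<Rightarrow> ('a::euclidean_space set set \<Rightarrow> (nat \<Rightarrow> int) \<Rightarrow>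
     (('a, 'f, 'v) lin_data, 'a set \<Rightarrow> 'v \<Rightarrow> 'v, ('a, 'f, 'v) presheaf, 'a set \<Rightarrow> 'v \<Rightarrow> 'v) functr) \<Rightarrow> bool" where
  "compatible_with_isos F \<Phi> \<longleftrightarrow>
     (\<forall>C C' n h \<delta>. connected_complex C n \<and> connected_complex C' n \<and> simplicial_iso C C' h \<and> perversity \<delta> \<longrightarrow>
        nat_isomorphic (R_cat F C \<delta>) (Sh_c F C' \<delta>)
          (functor_comp (\<Phi> C' \<delta>) (transport_R C C' h))
          (functor_comp (transport_Sh C C' h) (\<Phi> C \<delta>)))"


section \<open>Size of the ambient type of vectors\<close>

text \<open>
  All vector spaces have their elements in a fixed type \<open>'v\<close>, which plays the role of a universe.
  A constructible sheaf can have infinite-dimensional spaces of sections: over an open set with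
  infinitely many components they contain a copy of the space of sequences in \<open>F\<close> as soon as the
  stalks are nonzero. The type must be able to accommodate this space.
\<close>

definition large_enough :: "'f ring \<Rightarrow> 'v itself \<Rightarrow> bool" where
  "large_enough F _ \<longleftrightarrow> (\<exists>e :: (nat \<Rightarrow> 'f) \<Rightarrow> 'v. inj_on e (UNIV \<rightarrow> carrier F))"

end

theory Submission
  imports Defs
begin

text \<open>
  Call the simplex whose perverse simplex contains \<open>x\<close> the stratum \<open>\<mu> x\<close> of \<open>x\<close>. Passing from \<open>x\<close> to a
  nearby point \<open>y\<close> enlarges the chain of simplices spanning the open simplex of the subdivision
  through the point, so \<open>\<mu> x\<close> and \<open>\<mu> y\<close> are incident and \<open>\<delta>\<close> does not increase; hence they are joined
  by a path of arrows of the quiver. Any two such paths are related by exchanging vertices of the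
  intermediate simplices one at a time, so by the equivalence axiom they induce the same map from
  \<open>S(\<mu> x)\<close> to \<open>S(\<mu> y)\<close>. The sheaf attached to the data \<open>S\<close> consists of the families \<open>\<sigma> x \<in> S(\<mu> x)\<close> that are locally propagated by these maps.

  Conversely, the sections of a constructible sheaf near \<open>x\<close> are determined by their germ at \<open>x\<close>, since
  strata are connected and small balls meet every open simplex of the subdivision in a convex set.
  The resulting maps between stalks depend on the strata only and form linear algebra data. The
  section spaces are embedded into the type of vectors by evaluation on a countable dense subset of
  every stratum.
\<close>

section \<open>Perversities\<close>

text \<open>Two facts about a perversity carry the combinatorics: each value is a strict maximum or
  a strict minimum of the values so far, and the image of an initial segment is an interval. By the
  first, the dimensions along a path of arrows have no interior peak, so a path falls to a smallest
  simplex and then rises. By the second, simplices of any level between two given ones can be found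
  where they are needed. Ends that are not incident have at most one middle simplex, so for a sheaf
  the equivalence axiom has content only for incident ends, where each middle simplex forms a flag
  with them.

  A sheaf over a fixed type of vectors cannot literally consist of the families \<sigma>. The notion
  \<open>represents\<close> therefore admits any presheaf together with a bijection onto the
  families, and morphisms are treated for arbitrary representing pairs. The pair attached to S is an
  arbitrary choice, but two pairs for the same S are compared by the isomorphism that the identity
  of S induces. The same comparison gives compatibility with isomorphisms of complexes.\<close>

lemma perversity_image:
  assumes "perversity \<delta>"
  shows "\<exists>a b. \<delta> ` {..k} = {a..b::int}"
proof (induction k)
  case 0
  have "\<delta> ` {..0} = {0..0}" using assms by (auto simp: perversity_def)
  then show ?case by blast
next
  case (Suc k)
  then obtain a b where ab: "\<delta> ` {..k} = {a..b}" by blast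
  have ne: "a \<le> b" using ab by (metis atLeastatMost_empty_iff2 image_is_empty atMost_iff empty_iff zero_le)
  have "\<delta> ` {..<Suc k} = {a..b}" using ab by (simp add: lessThan_Suc_atMost)
  \<comment> \<open>The recursion adjoins the integer next to one end of the interval.\<close>
  then have "\<delta> (Suc k) = b + 1 \<or> \<delta> (Suc k) = a - 1"
    using assms Max_eqI[of "{a..b}" b] Min_eqI[of "{a..b}" a] ne
    unfolding perversity_def by (metis One_nat_def Suc_le_mono atLeastAtMost_iff finite_atLeastAtMost_int le0 order_refl)
  moreover have "\<delta> ` {..Suc k} = insert (\<delta> (Suc k)) {a..b}" using ab by (simp add: atMost_Suc)
  ultimately have "\<delta> ` {..Suc k} = {a..b+1} \<or> \<delta> ` {..Suc k} = {a-1..b}" using ne by auto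
  then show ?case by blast
qed

text \<open>The form in which the recursion is used below: a dimension above two others cannot have
  a level strictly between theirs.\<close>

lemma perversity_extremal:
  assumes "perversity \<delta>"
  shows "(\<forall>i<k. \<delta> i < \<delta> k) \<or> (\<forall>i<k. \<delta> k < \<delta> i)"
proof (cases "k = 0")
  case False
  then consider "\<delta> k = Max (\<delta> ` {..<k}) + 1" | "\<delta> k = Min (\<delta> ` {..<k}) - 1"
    using assms unfolding perversity_def by (metis One_nat_def Suc_leI gr0I)
  then show ?thesis
  proof cases
    case 1
    have "\<delta> i < \<delta> k" if "i < k" for i
    proof -
      have "\<delta> i \<le> Max (\<delta> ` {..<k})" using that by simp
      then show ?thesis using 1 by linarith
    qed
    then show ?thesis by blast
  next
    case 2
    have "\<delta> k < \<delta> i" if "i < k" for i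
    proof -
      have "Min (\<delta> ` {..<k}) \<le> \<delta> i" using that by simp
      then show ?thesis using 2 by linarith
    qed
    then show ?thesis by blast
  qed
qed auto

text \<open>Of two different arguments the larger one carries a strict extremum. Levels and
  dimensions of simplices thus determine each other.\<close>

lemma perversity_eq_iff:
  assumes "perversity \<delta>"
  shows "\<delta> i = \<delta> j \<longleftrightarrow> i = j"
  using perversity_extremal[OF assms, of i] perversity_extremal[OF assms, of j]
  by (metis nat_neq_iff order_less_irrefl)

text \<open>A discrete intermediate value property, from the image of an initial segment being an
  interval. The bound \<open>l \<le> k\<close> is what allows a simplex of dimension
  \<open>l\<close> to be placed relative to given ones.\<close>

lemma perversity_between:
  assumes "perversity \<delta>" "i \<le> k" "j \<le> k" "\<delta> i \<le> m" "m \<le> \<delta> j"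
  obtains l where "l \<le> k" "\<delta> l = m"
proof -
  obtain a b where ab: "\<delta> ` {..k} = {a..b::int}" using perversity_image[OF assms(1)] by blast
  have "\<delta> i \<in> {a..b}" "\<delta> j \<in> {a..b}" using ab assms by blast+
  then have "m \<in> \<delta> ` {..k}" using ab assms by auto
  then show ?thesis using that by auto
qed

section \<open>Paths of arrows in the face poset\<close>

lemma card_between:
  assumes "A \<subseteq> B" "finite B" "card A \<le> n" "n \<le> card B"
  obtains D where "A \<subseteq> D" "D \<subseteq> B" "card D = n"
  using exists_subset_between[of A n B] assms by metis

text \<open>The sets of size \<open>k\<close> between \<open>Z\<close> and \<open>E\<close> form a
  connected graph under the exchange of one element, so a function that is constant along the edges
  is constant. An edge is handed to \<open>step\<close> with the sizes of both its union and its
  intersection; depending on the situation one or the other is fitted into a simplex.\<close>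

lemma exchange_connected:
  assumes fin: "finite E"
    and P: "Z \<subseteq> A" "A \<subseteq> E" "Z \<subseteq> B" "B \<subseteq> E" "card A = k" "card B = k"
    and step: "\<And>A B. \<lbrakk>Z \<subseteq> A; A \<subseteq> E; Z \<subseteq> B; B \<subseteq> E; card A = k; card B = k;
      card (A \<union> B) = k + 1; card (A \<inter> B) + 1 = k\<rbrakk> \<Longrightarrow> Q A = Q B"
  shows "Q A = Q B"
  using P
proof (induction "card (A - B)" arbitrary: A)
  case 0
  then have "A \<subseteq> B" using fin by (metis card_0_eq finite_Diff finite_subset Diff_eq_empty_iff)
  then have "A = B" using 0 fin by (metis card_subset_eq finite_subset)
  then show ?case by simp
next
  case (Suc n)
  have fA: "finite A" "finite B" using Suc fin finite_subset by blast+
  obtain a where a: "a \<in> A" "a \<notin> B" using Suc(2) by (metis card.empty Diff_eq_empty_iff nat.distinct(1) subsetI)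
  have "card (B - A) = card (A - B)"
    using fA Suc by (simp add: card_Diff_subset_Int Int_commute)
  then obtain b where b: "b \<in> B" "b \<notin> A" using Suc(2) by (metis card.empty Diff_eq_empty_iff nat.distinct(1) subsetI)
  \<comment> \<open>The exchange brings \<open>A\<close> one step closer to \<open>B\<close>. As
    \<open>a\<close> is outside \<open>B\<close> it is outside \<open>Z\<close>, and
    \<open>b\<close> is inside \<open>E\<close>, so the new set stays in the range.\<close>
  define A' where "A' = insert b (A - {a})"
  have cA: "card A > 0" using a fA card_gt_0_iff by blast
  have cA': "card A' = k" using a b fA Suc(7) cA by (simp add: A'_def)
  have ZA': "Z \<subseteq> A'" "A' \<subseteq> E" using a b Suc by (auto simp: A'_def)
  have "A' - B = (A - B) - {a}" using b a by (auto simp: A'_def)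
  then have "card (A' - B) = n" using Suc(2) a fA by simp
  then have "Q A' = Q B" using Suc(1)[of A'] ZA' cA' Suc by auto
  moreover have "Q A = Q A'"
  proof (rule step)
    have "A \<union> A' = insert b A" using a by (auto simp: A'_def)
    then show "card (A \<union> A') = k + 1" using b fA Suc by simp
    have "A \<inter> A' = A - {a}" using b by (auto simp: A'_def)
    then show "card (A \<inter> A') + 1 = k" using a fA Suc cA by simp
  qed (use Suc ZA' cA' in auto)
  ultimately show ?case by simp
qed

text \<open>Simplices enter only through their vertex sets, as a finite family of nonempty finite
  sets closed under nonempty subsets. Everything about paths of arrows is combinatorics of such a
  family.\<close>

locale face_poset =
  fixes X :: "'s set" and V :: "'s \<Rightarrow> 'c set" and \<delta> :: "nat \<Rightarrow> int"
  assumes finite_X: "finite X"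
    and finite_V: "S \<in> X \<Longrightarrow> finite (V S)"
    and V_ne: "S \<in> X \<Longrightarrow> V S \<noteq> {}"
    and V_inj: "S \<in> X \<Longrightarrow> T \<in> X \<Longrightarrow> V S = V T \<Longrightarrow> S = T"
    and V_down: "S \<in> X \<Longrightarrow> A \<subseteq> V S \<Longrightarrow> A \<noteq> {} \<Longrightarrow> \<exists>T\<in>X. V T = A"
    and perv: "perversity \<delta>"
begin

definition dim :: "'s \<Rightarrow> nat" where "dim S = card (V S) - 1"
definition inc :: "'s \<Rightarrow> 's \<Rightarrow> bool" where "inc S T \<longleftrightarrow> V S \<subseteq> V T \<or> V T \<subseteq> V S"
definition lev :: "'s \<Rightarrow> int" where "lev S = \<delta> (dim S)"
definition arr :: "'s \<Rightarrow> 's \<Rightarrow> bool" where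
  "arr S T \<longleftrightarrow> S \<in> X \<and> T \<in> X \<and> lev S = lev T + 1 \<and> inc S T"

lemma card_V: "S \<in> X \<Longrightarrow> card (V S) = dim S + 1"
  using finite_V V_ne by (simp add: dim_def Suc_leI card_gt_0_iff)

lemma inc_sym: "inc S T \<Longrightarrow> inc T S" by (auto simp: inc_def)

lemma inc_refl [simp]: "inc S S" by (auto simp: inc_def)

lemma dim_mono: "S \<in> X \<Longrightarrow> T \<in> X \<Longrightarrow> V S \<subseteq> V T \<Longrightarrow> dim S \<le> dim T"
  using card_V card_mono finite_V by (metis add_le_cancel_right)

lemma sub_eq: "S \<in> X \<Longrightarrow> T \<in> X \<Longrightarrow> V S \<subseteq> V T \<Longrightarrow> dim T \<le> dim S \<Longrightarrow> S = T"
  by (metis V_inj add_le_cancel_right card_V card_seteq finite_V)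

lemma inc_dim: "S \<in> X \<Longrightarrow> T \<in> X \<Longrightarrow> inc S T \<Longrightarrow> dim S \<le> dim T \<Longrightarrow> V S \<subseteq> V T"
  unfolding inc_def using sub_eq by blast

lemma lev_eq: "lev S = lev T \<longleftrightarrow> dim S = dim T"
  by (simp add: lev_def perversity_eq_iff[OF perv])

lemma inc_lev_eq: "S \<in> X \<Longrightarrow> T \<in> X \<Longrightarrow> inc S T \<Longrightarrow> lev S = lev T \<Longrightarrow> S = T"
  unfolding lev_eq inc_def using sub_eq by (metis order_refl)

lemma face_between:
  assumes "S \<in> X" "A \<subseteq> V S" "card A \<le> l + 1" "l \<le> dim S"
  obtains T where "T \<in> X" "A \<subseteq> V T" "V T \<subseteq> V S" "dim T = l"
proof -
  obtain D where D: "A \<subseteq> D" "D \<subseteq> V S" "card D = l + 1"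
    using card_between[OF assms(2) finite_V[OF assms(1)] assms(3)] assms card_V by auto
  then have "D \<noteq> {}" by auto
  then obtain T where "T \<in> X" "V T = D" using V_down[OF assms(1)] D by blast
  then show ?thesis using that D card_V by fastforce
qed

text \<open>A simplex of the intermediate level is found in a full flag through \<open>S\<close> and \<open>T\<close>.\<close>

lemma arr_towards:
  assumes S: "S \<in> X" "T \<in> X" "inc S T" "lev T < lev S"
  obtains A where "arr S A" "inc A T" "lev T \<le> lev A"
proof -
  define k where "k = max (dim S) (dim T)"
  \<comment> \<open>The next simplex must have level \<open>lev S - 1\<close>, hence the dimension
    \<open>l\<close>. Since \<open>l\<close> does not exceed the larger of the two dimensions, such
    a simplex exists as a common face of both or between the two.\<close>
  obtain l where l: "l \<le> k" "\<delta> l = lev S - 1"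
    using perversity_between[OF perv, of "dim T" k "dim S" "lev S - 1"] S
    by (auto simp: lev_def k_def)
  have lS: "l \<noteq> dim S" using l by (auto simp: lev_def)
  show ?thesis
  proof (cases "dim S \<le> dim T")
    case True
    then have sub: "V S \<subseteq> V T" using S inc_dim by blast
    show ?thesis
    proof (cases "l < dim S")
      case True
      obtain A where "A \<in> X" "V A \<subseteq> V S" "dim A = l"
        using face_between[of S "{}" l] S True by (metis card.empty empty_subsetI less_imp_le zero_le)
      then show ?thesis using that[of A] S l sub by (auto simp: arr_def lev_def inc_def)
    next
      case False
      obtain A where "A \<in> X" "V S \<subseteq> V A" "V A \<subseteq> V T" "dim A = l"
        using face_between[of T "V S" l] S True False l sub card_V[of S] by (auto simp: k_def)
      then show ?thesis using that[of A] S l sub by (auto simp: arr_def lev_def inc_def)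
    qed
  next
    case False
    then have sub: "V T \<subseteq> V S" using S inc_dim inc_sym by (metis nat_le_linear)
    show ?thesis
    proof (cases "l < dim T")
      case True
      obtain A where "A \<in> X" "V A \<subseteq> V T" "dim A = l"
        using face_between[of T "{}" l] S True by (metis card.empty empty_subsetI less_imp_le zero_le)
      then show ?thesis using that[of A] S l sub by (auto simp: arr_def lev_def inc_def)
    next
      case f: False
      obtain A where "A \<in> X" "V T \<subseteq> V A" "V A \<subseteq> V S" "dim A = l"
        using face_between[of S "V T" l] S False f l sub card_V[of T] by (auto simp: k_def)
      then show ?thesis using that[of A] S l sub by (auto simp: arr_def lev_def inc_def)
    qed
  qed
qed

text \<open>Were \<open>j\<close> larger than both neighbours, its level would be a strict extremum
  over smaller dimensions, yet it lies strictly between the levels of \<open>i\<close> and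
  \<open>k\<close>. Along a path the dimensions therefore never rise and then fall.\<close>

lemma no_peak:
  assumes "\<delta> i = m + 1" "\<delta> j = m" "\<delta> k < m"
  shows "j < i \<or> j < k"
proof (rule ccontr)
  assume "\<not> ?thesis"
  then have "i < j" "k < j" using assms by (auto simp: not_less le_less)
  then show False using perversity_extremal[OF perv, of j] assms by force
qed

text \<open>Two non-incident simplices are joined by at most one path of length two, since the smallest
  of the three dimensions is attained in the middle and by the intersection of the ends.\<close>

lemma middle_unique:
  assumes a: "arr S A" "arr A T" "arr S B" "arr B T" and ni: "\<not> inc S T"
  shows "A = B"
proof -
  have X: "S \<in> X" "A \<in> X" "B \<in> X" "T \<in> X" using a by (auto simp: arr_def)
  have lv: "lev S = lev A + 1" "lev A = lev T + 1" "lev B = lev A" using a by (auto simp: arr_def)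
  then have dd: "dim B = dim A" using lev_eq by blast
  have sub: "V D \<subseteq> V S \<inter> V T" if D: "arr S D" "arr D T" "dim D = dim A" for D
  proof -
    have DX: "D \<in> X" using D by (auto simp: arr_def)
    have i: "inc S D" "inc D T" using D by (auto simp: arr_def)
    \<comment> \<open>The middle simplex is a proper face of one end. It is then a face of the other
      end too, because containing that end would make the two ends incident.\<close>
    have "dim A < dim S \<or> dim A < dim T"
      using no_peak[of "dim S" "lev A" "dim A" "dim T", folded lev_def, OF lv(1) refl] lv(2) by simp
    then show ?thesis
    proof
      assume "dim A < dim S"
      then have "V D \<subseteq> V S" using i X DX D(3) inc_dim[of D S] inc_sym by auto
      then show ?thesis using i ni unfolding inc_def by blast
    next
      assume "dim A < dim T"
      then have "V D \<subseteq> V T" using i X DX D(3) inc_dim[of D T] by auto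
      then show ?thesis using i ni unfolding inc_def by blast
    qed
  qed
  have sA: "V A \<subseteq> V S \<inter> V T" and sB: "V B \<subseteq> V S \<inter> V T" using sub a dd by auto
  then have "V S \<inter> V T \<noteq> {}" using V_ne X by blast
  then obtain E where E: "E \<in> X" "V E = V S \<inter> V T" using V_down[of S "V S \<inter> V T"] X by blast
  have ES: "dim E < dim S" "dim E < dim T"
    using E X ni sub_eq[of E S] sub_eq[of E T] unfolding inc_def
    by (metis Int_lower1 Int_lower2 not_le)+
  have le: "dim A \<le> dim E" "dim B \<le> dim E" using dim_mono E X sA sB by auto
  have "dim E = dim A"
  proof (rule ccontr)
    \<comment> \<open>Otherwise the level of \<open>E\<close> lies outside the three consecutive
      levels of \<open>T\<close>, \<open>A\<close> and \<open>S\<close>. Between the dimensions of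
      \<open>A\<close> and \<open>E\<close> the levels then pass through \<open>lev T\<close> or
      \<open>lev S\<close>, so one of these is attained in a dimension at most that of
      \<open>E\<close>, although \<open>E\<close> is a proper face of both ends.\<close>
    assume ne: "dim E \<noteq> dim A"
    have nl: "lev E \<noteq> lev A" "lev E \<noteq> lev S" "lev E \<noteq> lev T" using ne ES lev_eq by auto
    show False
    proof (cases "lev E < lev A")
      case True
      then have "lev E < lev T" using nl lv by auto
      then obtain l where "l \<le> dim E" "\<delta> l = lev T"
        using perversity_between[OF perv, of "dim E" "dim E" "dim A" "lev T"] le lv by (auto simp: lev_def)
      then have "l = dim T" by (simp add: lev_def perversity_eq_iff[OF perv])
      then show False using \<open>l \<le> dim E\<close> ES by auto
    next
      case False
      then have "lev S < lev E" using nl lv by auto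
      then obtain l where "l \<le> dim E" "\<delta> l = lev S"
        using perversity_between[OF perv, of "dim A" "dim E" "dim E" "lev S"] le lv by (auto simp: lev_def)
      then have "l = dim S" by (simp add: lev_def perversity_eq_iff[OF perv])
      then show False using \<open>l \<le> dim E\<close> ES by auto
    qed
  qed
  then have "E = A" "E = B" using sub_eq[of A E] sub_eq[of B E] X E sA sB dd by auto
  then show ?thesis by simp
qed

end

text \<open>The composite map is an index of the relation, so that independence of the path becomes
  a statement about two derivations with the same ends. Carriers are left out here; composites are
  compared only on them.\<close>

inductive path_map :: "('s \<Rightarrow> 's \<Rightarrow> bool) \<Rightarrow> ('s \<Rightarrow> 's \<Rightarrow> 'v \<Rightarrow> 'v) \<Rightarrow> 's \<Rightarrow> 's \<Rightarrow> ('v \<Rightarrow> 'v) \<Rightarrow> bool"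
  for ar mp where
  path_refl: "path_map ar mp S S id"
| path_step: "ar S A \<Longrightarrow> path_map ar mp A T g \<Longrightarrow> path_map ar mp S T (g \<circ> mp S A)"

text \<open>On the carrier of the source the choice is harmless by \<open>path_agree\<close>;
  without any path the value is arbitrary.\<close>

definition transition :: "('s \<Rightarrow> 's \<Rightarrow> bool) \<Rightarrow> ('s \<Rightarrow> 's \<Rightarrow> 'v \<Rightarrow> 'v) \<Rightarrow> 's \<Rightarrow> 's \<Rightarrow> 'v \<Rightarrow> 'v" where
  "transition ar mp S T = (SOME g. path_map ar mp S T g)"

lemma path_map_trans:
  "path_map ar mp S T g \<Longrightarrow> path_map ar mp T U h \<Longrightarrow> path_map ar mp S U (h \<circ> g)"
proof (induction rule: path_map.induct)
  case (path_step S A T g)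
  then show ?case using path_map.path_step[OF path_step(1) path_step.IH[OF path_step.prems]]
    by (simp only: comp_assoc)
qed simp

section \<open>Composites along paths depend only on the ends of the path\<close>

locale linear_rep = face_poset X V \<delta>
  for X :: "'s set" and V :: "'s \<Rightarrow> 'c set" and \<delta> +
  fixes F :: "'f ring" and L :: "'s \<Rightarrow> ('f, 'v) module" and mp :: "'s \<Rightarrow> 's \<Rightarrow> 'v \<Rightarrow> 'v"
  assumes L_vs: "S \<in> X \<Longrightarrow> vectorspace F (L S)"
    and mp_hom: "arr S T \<Longrightarrow> mp S T \<in> module_hom F (L S) (L T)"
    and mp_comm: "\<lbrakk>arr S A; arr A T; arr S B; arr B T; x \<in> carrier (L S)\<rbrakk> \<Longrightarrow>
      mp A T (mp S A x) = mp B T (mp S B x)"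
begin

abbreviation "rp \<equiv> path_map arr mp"
abbreviation "tr \<equiv> transition arr mp"

lemma path_in: "rp S T g \<Longrightarrow> S \<in> X \<Longrightarrow> T \<in> X"
  by (induction rule: path_map.induct) (auto simp: arr_def)

lemma path_lev: "rp S T g \<Longrightarrow> lev T \<le> lev S"
  by (induction rule: path_map.induct) (auto simp: arr_def)

lemma path_same_lev: "rp S T g \<Longrightarrow> lev S \<le> lev T \<Longrightarrow> S = T \<and> g = id"
  by (erule path_map.cases) (auto simp: arr_def dest: path_lev)

lemma path_hom: "rp S T g \<Longrightarrow> S \<in> X \<Longrightarrow> g \<in> module_hom F (L S) (L T)"
proof (induction rule: path_map.induct)
  case (path_refl S)
  then show ?case by (auto simp: module_hom_def)
next
  case (path_step S A T g)
  have "A \<in> X" using path_step(1) by (auto simp: arr_def)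
  then have g: "g \<in> module_hom F (L A) (L T)" using path_step by auto
  then show ?case using mp_hom[OF path_step(1)] by (auto simp: module_hom_def Pi_iff)
qed

lemma inc_path:
  assumes "S \<in> X" "T \<in> X" "inc S T" "lev T \<le> lev S"
  shows "\<exists>g. rp S T g"
  using assms
proof (induction "nat (lev S - lev T)" arbitrary: S rule: less_induct)
  case less
  show ?case
  proof (cases "lev S = lev T")
    case True
    then have "S = T" using less inc_lev_eq by blast
    then show ?thesis by (metis path_map.path_refl)
  next
    case False
    then obtain A where A: "arr S A" "inc A T" "lev T \<le> lev A" using arr_towards[of S T] less by force
    then have "\<exists>g. rp A T g" using less by (intro less) (auto simp: arr_def)
    then show ?thesis using A path_step by metis
  qed
qed

text \<open>The source of an arrow that raises the dimension has the least dimension among all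
  levels not above its own. A smaller \<open>l\<close> would have a level below
  \<open>lev B\<close>, and \<open>dim B\<close>, larger than both \<open>l\<close> and
  \<open>dim A\<close>, would carry a level strictly between theirs.\<close>

lemma lev_dim_between:
  "\<lbrakk>arr A B; dim A < dim B; \<delta> l \<le> lev A; l < dim A\<rbrakk> \<Longrightarrow> False"
proof -
  assume a: "arr A B" "dim A < dim B" "\<delta> l \<le> lev A" "l < dim A"
  have "\<delta> l \<noteq> lev A" "\<delta> l \<noteq> lev B" using a by (auto simp: lev_def perversity_eq_iff[OF perv])
  then have "\<delta> l < lev B" "lev B < lev A" using a by (auto simp: arr_def)
  moreover have "l < dim B" using a by simp
  ultimately show False
    using perversity_extremal[OF perv, of "dim B"] a(2) by (metis lev_def less_asym)
qed

text \<open>After one rise in dimension every further arrow rises, since a fall would create a peak.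
  So all later simplices of the path contain \<open>B\<close>.\<close>

lemma path_up:
  "rp B T g \<Longrightarrow> arr A B \<Longrightarrow> dim A < dim B \<Longrightarrow> V B \<subseteq> V T"
proof (induction arbitrary: A rule: path_map.induct)
  case (path_step S B T g)
  have "dim S < dim A \<or> dim S < dim B"
    using no_peak[of "dim A" "lev S" "dim S" "dim B", folded lev_def] path_step(1,4) by (auto simp: arr_def)
  then have d: "dim S < dim B" using path_step by auto
  then have "V S \<subseteq> V B" using path_step(1) inc_dim by (auto simp: arr_def)
  then show ?case using path_step d by blast
qed simp

text \<open>The simplices of a path first decrease and then increase; \<open>Z\<close> is the smallest one.\<close>

lemma path_valley:
  "rp A T g \<Longrightarrow> A \<in> X \<Longrightarrow> \<exists>Z\<in>X. V Z \<subseteq> V A \<and> V Z \<subseteq> V T \<and> lev Z \<le> lev A \<and> lev T \<le> lev Z \<and>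
     (\<forall>l. \<delta> l \<le> lev A \<and> lev T \<le> \<delta> l \<longrightarrow> dim Z \<le> l)"
proof (induction rule: path_map.induct)
  case (path_refl S)
  have "l = dim S" if "\<delta> l = lev S" for l using that by (simp add: lev_def perversity_eq_iff[OF perv])
  then show ?case using path_refl by (intro bexI[of _ S]) (auto intro: eq_refl dest: antisym)
next
  case (path_step A B T g)
  have B: "A \<in> X" "B \<in> X" "lev A = lev B + 1" "inc A B" using path_step(1) by (auto simp: arr_def)
  show ?case
  proof (cases "dim A < dim B")
    case True
    \<comment> \<open>If the first arrow rises, the whole path rises, and its starting simplex is
      the smallest one.\<close>
    then have "V A \<subseteq> V B" "V B \<subseteq> V T" using path_up[OF path_step(2,1)] B inc_dim[of A B] by auto
    then have "V A \<subseteq> V T" by blast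
    moreover have "dim A \<le> l" if "\<delta> l \<le> lev A" for l
      using lev_dim_between[OF path_step(1) True that] by force
    ultimately show ?thesis using B path_lev[OF path_step(2)] by (intro bexI[of _ A]) auto
  next
    case False
    obtain Z where Z: "Z \<in> X" "V Z \<subseteq> V B" "V Z \<subseteq> V T" "lev Z \<le> lev B" "lev T \<le> lev Z"
      "\<forall>l. \<delta> l \<le> lev B \<and> lev T \<le> \<delta> l \<longrightarrow> dim Z \<le> l"
      using path_step B by blast
    have sub: "V B \<subseteq> V A" using False B inc_dim[of B A] inc_sym by auto
    have "dim Z \<le> l" if l: "\<delta> l \<le> lev A" "lev T \<le> \<delta> l" for l
    proof (cases "\<delta> l = lev A")
      case True
      then have "l = dim A" by (simp add: lev_def perversity_eq_iff[OF perv])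
      then show ?thesis using dim_mono[of Z A] Z sub B by auto
    next
      case False
      then have "\<delta> l \<le> lev B" using l B by auto
      then show ?thesis using Z l by blast
    qed
    then show ?thesis using Z sub B by (intro bexI[of _ Z]) auto
  qed
qed

definition agree :: "'s \<Rightarrow> 's \<Rightarrow> bool" where
  "agree S T \<longleftrightarrow> (\<forall>g h x. rp S T g \<longrightarrow> rp S T h \<longrightarrow> x \<in> carrier (L S) \<longrightarrow> g x = h x)"

text \<open>Two detours that meet in \<open>B\<close> are compared by one use of the equivalence
  axiom: from \<open>A\<close> and from \<open>A'\<close> any continuation to \<open>T\<close> may
  be replaced by the one through \<open>B\<close>.\<close>

lemma agree_square:
  assumes a: "arr S A" "arr S A'" "arr A B" "arr A' B" "rp B T k"
    and ag: "agree A T" "agree A' T" and x: "x \<in> carrier (L S)"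
    and p: "rp A T g" "rp A' T g'"
  shows "g (mp S A x) = g' (mp S A' x)"
proof -
  have mx: "mp S A x \<in> carrier (L A)" "mp S A' x \<in> carrier (L A')"
    using mp_hom[OF a(1)] mp_hom[OF a(2)] x by (auto simp: module_hom_def)
  have "g (mp S A x) = (k \<circ> mp A B) (mp S A x)"
    using ag(1) p(1) path_map.path_step[OF a(3,5)] mx(1) unfolding agree_def by blast
  also have "\<dots> = k (mp A B (mp S A x))" by simp
  also have "\<dots> = k (mp A' B (mp S A' x))" using mp_comm[OF a(1,3,2,4) x] by simp
  also have "\<dots> = (k \<circ> mp A' B) (mp S A' x)" by simp
  also have "\<dots> = g' (mp S A' x)"
    using ag(2) p(2) path_map.path_step[OF a(4,5)] mx(2) unfolding agree_def by blast
  finally show ?thesis .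
qed

text \<open>The coherence theorem of the quiver. By induction on the drop of the level only the
  first arrows of the two paths matter: the result at \<open>T\<close> is a function
  \<open>val\<close> of the first simplex after \<open>S\<close>, and \<open>val\<close> has to be
  constant. Simplices with a common successor on the way to \<open>T\<close> have the same value.
  The cases are the possible shapes of the paths: rising at once, falling once and then rising,
  falling at least twice.\<close>

lemma path_agree: "S \<in> X \<Longrightarrow> agree S T"
proof (induction "nat (lev S - lev T)" arbitrary: S rule: less_induct)
  case less
  note SX = less(2)
  show ?case unfolding agree_def
  proof (intro allI impI)
    fix g h x assume g: "rp S T g" and h: "rp S T h" and x: "x \<in> carrier (L S)"
    have TX: "T \<in> X" using path_in[OF g] SX by blast
    show "g x = h x"
    proof (cases "lev S \<le> lev T")
      case True
      then show ?thesis using path_same_lev g h by blast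
    next
      case False
      have ag: "agree A T" if "arr S A" for A
        using that False by (intro less(1)) (auto simp: arr_def)
      obtain A1 g1 where A1: "arr S A1" "rp A1 T g1" "g = g1 \<circ> mp S A1"
        using g False by (cases rule: path_map.cases) auto
      obtain A2 g2 where A2: "arr S A2" "rp A2 T g2" "h = g2 \<circ> mp S A2"
        using h False by (cases rule: path_map.cases) auto
      have A12: "A1 \<in> X" "A2 \<in> X" "inc S A1" "inc S A2" using A1 A2 by (auto simp: arr_def)
      have lv: "lev S = lev A1 + 1" "lev A2 = lev A1" using A1(1) A2(1) by (auto simp: arr_def)
      then have dA: "dim A2 = dim A1" using lev_eq by blast
      define a where "a = dim A1"
      \<comment> \<open>The induction hypothesis makes \<open>val\<close> independent of the
        continuation from \<open>A\<close> to \<open>T\<close>.\<close>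
      define val where "val A = (SOME w. \<exists>g. rp A T g \<and> w = g (mp S A x))" for A
      have val: "val A = g (mp S A x)" if "arr S A" "rp A T g" for A g
      proof -
        have "mp S A x \<in> carrier (L A)" using mp_hom[OF that(1)] x by (auto simp: module_hom_def)
        then show ?thesis using ag[OF that(1)] that(2) unfolding val_def agree_def
          by (intro some_equality) blast+
      qed
      have sq: "val A = val A'"
        if "arr S A" "arr S A'" "arr A B" "arr A' B" "rp B T k" for A A' B k
      proof -
        have p: "rp A T (k \<circ> mp A B)" "rp A' T (k \<circ> mp A' B)"
          using path_map.path_step[of arr] that by blast+
        show ?thesis
          using agree_square[OF that ag[OF that(1)] ag[OF that(2)] x p] val[OF that(1) p(1)] val[OF that(2) p(2)]
          by simp
      qed
      have arrI: "arr S A" if "A \<in> X" "inc S A" "dim A = a" for A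
        using that A1(1) lev_eq[of A A1] by (auto simp: arr_def a_def)
      \<comment> \<open>\<open>val\<close> as a function of vertex sets, to which the exchange
        argument applies.\<close>
      define Q where "Q D = val (THE A. A \<in> X \<and> V A = D)" for D
      have Q: "Q (V A) = val A" if "A \<in> X" for A
        unfolding Q_def using that V_inj by (intro arg_cong[where f=val] the_equality) auto
      have "val A1 = val A2"
      proof (cases "lev A1 \<le> lev T")
        case True
        then have "A1 = T" "A2 = T" using path_same_lev A1(2) A2(2) lv by auto
        then show ?thesis by simp
      next
        case lA: False
        obtain B1 k1 where B1: "arr A1 B1" "rp B1 T k1"
          using A1(2) lA by (cases rule: path_map.cases) auto
        obtain B2 k2 where B2: "arr A2 B2" "rp B2 T k2"
          using A2(2) lA lv by (cases rule: path_map.cases) auto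
        have B12: "B1 \<in> X" "B2 \<in> X" "inc A1 B1" "inc A2 B2" using B1 B2 by (auto simp: arr_def)
        have lB: "lev A1 = lev B1 + 1" "lev B2 = lev B1" using B1(1) B2(1) lv by (auto simp: arr_def)
        have lTB: "lev T \<le> lev B1" using path_lev[OF B1(2)] .
        define b where "b = dim B1"
        have dB: "dim B2 = b" using lB lev_eq b_def by blast
        have arrB: "arr A B" if "A \<in> X" "B \<in> X" "inc A B" "dim A = a" "dim B = b" for A B
          using that B1(1) lev_eq[of A A1] lev_eq[of B B1] by (auto simp: arr_def a_def b_def)
        have lvb: "lev B = lev B1" if "dim B = b" for B using that lev_eq b_def by simp
        have ab: "a \<noteq> b" using lB lev_eq[of A1 B1] a_def b_def by auto
        have aS: "a \<noteq> dim S" using lv lev_eq[of A1 S] a_def by auto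
        have sA1: "card (V A1) = a + 1" "card (V A2) = a + 1" using card_V A12 dA a_def by auto
        \<comment> \<open>If the second arrows rise, both paths rise from there on to
          \<open>T\<close>, so the first simplices are faces of \<open>T\<close>.\<close>
        have up: "V A1 \<subseteq> V T \<and> V A2 \<subseteq> V T \<and> b \<le> dim T" if "a < b"
        proof -
          have "V B1 \<subseteq> V T" "V B2 \<subseteq> V T"
            using path_up[OF B1(2) B1(1)] path_up[OF B2(2) B2(1)] that dA dB a_def b_def by auto
          moreover have "V A1 \<subseteq> V B1" "V A2 \<subseteq> V B2"
            using inc_dim[of A1 B1] inc_dim[of A2 B2] A12 B12 that dA dB a_def b_def by auto
          ultimately show ?thesis using dim_mono[of B1 T] B12 TX b_def by blast
        qed
        \<comment> \<open>Two neighbours have \<open>a + 2\<close> vertices together, at most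
          \<open>b + 1\<close>, so they fit into a face \<open>B\<close> of \<open>T\<close> of
          dimension \<open>b\<close>, which is a common successor.\<close>
        have step_up: "Q D = Q D'"
          if ab: "a < b" and D: "D \<subseteq> V T" "D' \<subseteq> V T" "card D = a + 1" "card D' = a + 1"
            "card (D \<union> D') = a + 1 + 1" and iD: "V S \<subseteq> D \<or> D \<subseteq> V S" "V S \<subseteq> D' \<or> D' \<subseteq> V S"
          for D D'
        proof -
          have "D \<noteq> {}" "D' \<noteq> {}" using D by auto
          then obtain A A' where A: "A \<in> X" "V A = D" "A' \<in> X" "V A' = D'"
            using V_down[OF TX] D by metis
          then have dm: "dim A = a" "dim A' = a" using D card_V by fastforce+
          obtain B where B: "B \<in> X" "D \<union> D' \<subseteq> V B" "V B \<subseteq> V T" "dim B = b"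
            using face_between[OF TX, of "D \<union> D'" b] D ab up[OF ab] by auto
          obtain k where "rp B T k"
            using inc_path[OF B(1) TX] B lvb[OF B(4)] lTB by (auto simp: inc_def)
          then have "val A = val A'"
            using A B dm iD by (intro sq[of A A' B] arrI arrB) (auto simp: inc_def)
          then show ?thesis using Q A by auto
        qed
        show ?thesis
        proof (cases "dim S < a")
          case True
          have "dim S < dim A1 \<or> dim B1 > dim A1"
            using True by (simp add: a_def)
          \<comment> \<open>A rise from \<open>S\<close> followed by a fall would be a peak.\<close>
          have "a < b"
            using no_peak[of "dim S" "lev A1" "dim A1" "dim B1", folded lev_def] lv lB True
            by (auto simp: a_def b_def)
          moreover have "V S \<subseteq> V A1" "V S \<subseteq> V A2" using inc_dim[OF SX] A12 True dA a_def by auto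
          ultimately have f: "a < b" "V S \<subseteq> V A1" "V S \<subseteq> V A2" by auto
          have "Q (V A1) = Q (V A2)"
            by (rule exchange_connected[of "V T" "V S" _ _ "a + 1" Q])
              (use f up sA1 finite_V[OF TX] in \<open>auto intro: step_up\<close>)
          then show ?thesis using Q A12 by simp
        next
          case False
          then have aS: "a < dim S" using aS by auto
          then have sS: "V A1 \<subseteq> V S" "V A2 \<subseteq> V S"
            using inc_dim[of A1 S] inc_dim[of A2 S] A12 SX dA a_def inc_sym by auto
          show ?thesis
          proof (cases "a < b")
            case True
            \<comment> \<open>Falling once and then rising: the first simplices are faces of both
              \<open>S\<close> and \<open>T\<close>, and the exchanges stay inside the intersection
              of the two.\<close>
            have "Q (V A1) = Q (V A2)"
              by (rule exchange_connected[of "V S \<inter> V T" "{}" _ _ "a + 1" Q])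
                (use True up sA1 finite_V[OF TX] sS in \<open>auto intro: step_up\<close>)
            then show ?thesis using Q A12 by simp
          next
            case False
            then have ba: "b < a" using ab by auto
            \<comment> \<open>Falling at least twice: the first simplices need not be faces of
              \<open>T\<close>, so they cannot be exchanged there. They are compared through the
              smallest simplices of the two paths, which are faces of both \<open>S\<close> and
              \<open>T\<close>.\<close>
            have valley: "\<exists>Z\<in>X. V Z \<subseteq> V A \<and> V Z \<subseteq> V T \<and> lev Z \<le> lev A1 \<and> lev T \<le> lev Z \<and>
                (\<forall>l. \<delta> l \<le> lev A1 \<and> lev T \<le> \<delta> l \<longrightarrow> dim Z \<le> l)" if "A = A1 \<or> A = A2" for A
              using path_valley[OF A1(2)] path_valley[OF A2(2)] A12 lv that by auto
            obtain Z1 where Z1: "Z1 \<in> X" "V Z1 \<subseteq> V A1" "V Z1 \<subseteq> V T" "lev Z1 \<le> lev A1" "lev T \<le> lev Z1"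
                "\<And>l. \<delta> l \<le> lev A1 \<Longrightarrow> lev T \<le> \<delta> l \<Longrightarrow> dim Z1 \<le> l" using valley[of A1] by blast
            obtain Z2 where Z2: "Z2 \<in> X" "V Z2 \<subseteq> V A2" "V Z2 \<subseteq> V T" "lev Z2 \<le> lev A1" "lev T \<le> lev Z2"
                "\<And>l. \<delta> l \<le> lev A1 \<Longrightarrow> lev T \<le> \<delta> l \<Longrightarrow> dim Z2 \<le> l" using valley[of A2] by blast
            define z where "z = dim Z1"
            \<comment> \<open>The dimension of the smallest simplex is the least one whose level
              lies between the levels of the ends, hence the same for both paths.\<close>
            have dZ: "dim Z2 = z" using Z1(6)[of "dim Z2"] Z2(6)[of "dim Z1"] Z1(4,5) Z2(4,5)
              by (auto simp: z_def lev_def)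
            have zb: "z \<le> b" using Z1(6)[of b] lTB lB by (auto simp: z_def b_def lev_def)
            then have za: "z < a" using ba by simp
            have lZ: "lev T \<le> lev Z \<and> lev Z \<le> lev B1" if "dim Z = z" for Z
            proof -
              have "lev Z = lev Z1" using that lev_eq z_def by simp
              moreover have "lev Z1 \<noteq> lev A1" using za lev_eq[of Z1 A1] z_def a_def by auto
              ultimately show ?thesis using Z1(4,5) lB by auto
            qed
            \<comment> \<open>With \<open>Z\<close> fixed, the first simplices range between
              \<open>Z\<close> and \<open>S\<close>. Two neighbours meet in a simplex of dimension
              \<open>a - 1\<close>, which has a face \<open>B\<close> of dimension \<open>b\<close>
              containing \<open>Z\<close>; this is a common successor from which \<open>T\<close> is
              reached through \<open>Z\<close>.\<close>
            have same: "val A = val A'"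
              if Z: "Z \<in> X" "V Z \<subseteq> V T" "dim Z = z" and A: "A \<in> X" "A' \<in> X" "V Z \<subseteq> V A" "V Z \<subseteq> V A'"
                "V A \<subseteq> V S" "V A' \<subseteq> V S" "dim A = a" "dim A' = a" for Z A A'
            proof -
              have "Q (V A) = Q (V A')"
              proof (rule exchange_connected[of "V S" "V Z" _ _ "a + 1" Q])
                fix D D' assume D: "V Z \<subseteq> D" "D \<subseteq> V S" "V Z \<subseteq> D'" "D' \<subseteq> V S" "card D = a + 1"
                  "card D' = a + 1" "card (D \<inter> D') + 1 = a + 1"
                have ne: "D \<noteq> {}" "D' \<noteq> {}" "D \<inter> D' \<noteq> {}" using D V_ne[OF Z(1)] by auto
                then obtain C C' I where C: "C \<in> X" "V C = D" "C' \<in> X" "V C' = D'" "I \<in> X" "V I = D \<inter> D'"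
                  using V_down[OF SX] D by (metis inf.coboundedI1)
                then have dm: "dim C = a" "dim C' = a" "dim I + 1 = a"
                  using D card_V[of C] card_V[of C'] card_V[of I] by auto
                obtain B where B: "B \<in> X" "V Z \<subseteq> V B" "V B \<subseteq> V I" "dim B = b"
                  using face_between[OF C(5), of "V Z" b] C D dm ba zb card_V[OF Z(1)] Z(3) by auto
                obtain k1 where "rp B Z k1"
                  using inc_path[OF B(1) Z(1)] B lvb[OF B(4)] lZ[OF Z(3)] by (auto simp: inc_def)
                moreover obtain k2 where "rp Z T k2"
                  using inc_path[OF Z(1) TX] Z lZ[OF Z(3)] by (auto simp: inc_def)
                ultimately have "rp B T (k2 \<circ> k1)" by (rule path_map_trans)
                then have "val C = val C'"
                  using C B D dm by (intro sq[of C C' B] arrI arrB) (auto simp: inc_def)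
                then show "Q D = Q D'" using Q C by auto
              qed (use A finite_V[OF SX] card_V in auto)
              then show ?thesis using Q A by simp
            qed
            \<comment> \<open>By the preceding step the value depends on the smallest simplex alone,
              so it can be regarded as a function of the latter.\<close>
            define R where "R D = (SOME w. \<exists>A\<in>X. D \<subseteq> V A \<and> V A \<subseteq> V S \<and> dim A = a \<and> w = val A)" for D
            have R: "R (V Z) = val A" if "Z \<in> X" "V Z \<subseteq> V T" "dim Z = z" "A \<in> X" "V Z \<subseteq> V A"
              "V A \<subseteq> V S" "dim A = a" for Z A
              unfolding R_def
            proof (rule some_equality)
              fix w assume "\<exists>A\<in>X. V Z \<subseteq> V A \<and> V A \<subseteq> V S \<and> dim A = a \<and> w = val A"
              then show "w = val A" using same that by blast
            qed (use that in blast)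
            \<comment> \<open>Two neighbouring smallest simplices have \<open>z + 2\<close> vertices
              together, at most \<open>a + 1\<close>, so some face of \<open>S\<close> of dimension
              \<open>a\<close> lies above both.\<close>
            have "R (V Z1) = R (V Z2)"
            proof (rule exchange_connected[of "V S \<inter> V T" "{}" _ _ "z + 1" R])
              fix D D' assume D: "D \<subseteq> V S \<inter> V T" "D' \<subseteq> V S \<inter> V T" "card D = z + 1"
                  "card D' = z + 1" "card (D \<union> D') = z + 1 + 1"
              then have ne: "D \<noteq> {}" "D' \<noteq> {}" by auto
              then obtain C C' where C: "C \<in> X" "V C = D" "C' \<in> X" "V C' = D'"
                using V_down[OF SX] D by (metis Int_subset_iff)
              then have dm: "dim C = z" "dim C' = z" using D card_V[of C] card_V[of C'] by auto
              obtain A where A: "A \<in> X" "D \<union> D' \<subseteq> V A" "V A \<subseteq> V S" "dim A = a"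
                using face_between[OF SX, of "D \<union> D'" a] D za aS by auto
              have "R (V C) = val A" "R (V C') = val A" using A C D dm by (intro R; auto)+
              then show "R D = R D'" using C by simp
            qed (use Z1 Z2 sS finite_V[OF SX] card_V dZ z_def in auto)
            moreover have "R (V Z1) = val A1" "R (V Z2) = val A2"
              using Z1 Z2 sS A12 dA dZ z_def a_def by (intro R; auto)+
            ultimately show ?thesis by simp
          qed
        qed
      qed
      then show ?thesis using val A1 A2 by simp
    qed
  qed
qed

lemma tr_path:
  assumes "S \<in> X" "T \<in> X" "inc S T" "lev T \<le> lev S"
  shows "rp S T (tr S T)"
  unfolding transition_def using inc_path[OF assms] by (rule someI_ex)

lemma tr_eq: "rp S T g \<Longrightarrow> S \<in> X \<Longrightarrow> x \<in> carrier (L S) \<Longrightarrow> tr S T x = g x"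
  unfolding transition_def using path_agree[of S T] someI[of "rp S T" g] unfolding agree_def by blast

lemma tr_hom:
  assumes "S \<in> X" "T \<in> X" "inc S T" "lev T \<le> lev S"
  shows "tr S T \<in> module_hom F (L S) (L T)"
  using tr_path[OF assms] path_hom assms by blast

lemma tr_refl: "S \<in> X \<Longrightarrow> x \<in> carrier (L S) \<Longrightarrow> tr S S x = x"
  using tr_eq[OF path_refl] by simp

lemma tr_arr: "arr S T \<Longrightarrow> x \<in> carrier (L S) \<Longrightarrow> tr S T x = mp S T x"
  using tr_eq[OF path_step[OF _ path_refl]] by (simp add: arr_def)

lemma tr_trans:
  assumes "S \<in> X" "T \<in> X" "U \<in> X" "inc S T" "inc T U" "inc S U" "lev T \<le> lev S" "lev U \<le> lev T"
    and x: "x \<in> carrier (L S)"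
  shows "tr T U (tr S T x) = tr S U x"
  using tr_eq[OF path_map_trans[OF tr_path[of S T] tr_path[of T U]]] assms by simp

end

section \<open>Barycentric coordinates and the open simplices of the barycentric subdivision\<close>

text \<open>The points need not be affinely independent, so positive coefficients have to be
  produced. The segment from the average \<open>a\<close> to \<open>z\<close> can be prolonged
  beyond \<open>z\<close> inside the hull; mixing a representation of the prolonged end with the one
  of \<open>a\<close> makes every coefficient positive.\<close>

lemma rel_interior_convex_hull_finite:
  fixes B :: "'a::euclidean_space set"
  assumes "finite B" "B \<noteq> {}"
  shows "rel_interior (convex hull B) =
    {y. \<exists>u. (\<forall>x\<in>B. 0 < u x) \<and> sum u B = 1 \<and> (\<Sum>x\<in>B. u x *\<^sub>R x) = y}"
proof
  show "{y. \<exists>u. (\<forall>x\<in>B. 0 < u x) \<and> sum u B = 1 \<and> (\<Sum>x\<in>B. u x *\<^sub>R x) = y} \<subseteq> rel_interior (convex hull B)"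
    using explicit_subset_rel_interior_convex_hull_minimal assms by blast
  show "rel_interior (convex hull B) \<subseteq>
    {y. \<exists>u. (\<forall>x\<in>B. 0 < u x) \<and> sum u B = 1 \<and> (\<Sum>x\<in>B. u x *\<^sub>R x) = y}"
  proof
    fix z assume z: "z \<in> rel_interior (convex hull B)"
    define n where "n = real (card B)"
    have n: "n > 0" using assms by (simp add: n_def card_gt_0_iff)
    define a where "a = (\<Sum>x\<in>B. (1 / n) *\<^sub>R x)"
    have "(\<Sum>x\<in>B. 1 / n) = 1" using n by (simp add: n_def)
    then have a: "a \<in> convex hull B"
      unfolding convex_hull_finite[OF assms(1)] a_def using n
      by (intro CollectI exI[of _ "\<lambda>_. 1 / n"]) simp
    obtain e where e: "e > 1" "(1 - e) *\<^sub>R a + e *\<^sub>R z \<in> convex hull B"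
      using z a convex_rel_interior_iff[of "convex hull B" z] by (metis convex_convex_hull empty_iff)
    then obtain d where d: "\<forall>x\<in>B. 0 \<le> d x" "sum d B = 1" "(\<Sum>x\<in>B. d x *\<^sub>R x) = (1 - e) *\<^sub>R a + e *\<^sub>R z"
      unfolding convex_hull_finite[OF assms(1)] by auto
    \<comment> \<open>Solved for \<open>z\<close>: it is \<open>1 / e\<close> times the prolonged
      end plus \<open>1 - 1 / e\<close> times the average.\<close>
    define u where "u x = (1 / e) * d x + (1 - 1 / e) * (1 / n)" for x
    have "1 - 1 / e > 0" using e by simp
    then have "\<forall>x\<in>B. 0 < u x" using d e n unfolding u_def
      by (intro ballI add_nonneg_pos mult_nonneg_nonneg mult_pos_pos) auto
    moreover have "sum u B = 1"
    proof -
      have "sum u B = (1 / e) * sum d B + (1 - 1 / e) * (\<Sum>x\<in>B. 1 / n)"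
        unfolding u_def by (simp add: sum.distrib sum_distrib_left)
      then show ?thesis using d \<open>(\<Sum>x\<in>B. 1 / n) = 1\<close> by simp
    qed
    moreover have "(\<Sum>x\<in>B. u x *\<^sub>R x) = z"
    proof -
      have "(\<Sum>x\<in>B. u x *\<^sub>R x) = (1 / e) *\<^sub>R (\<Sum>x\<in>B. d x *\<^sub>R x) + (1 - 1 / e) *\<^sub>R a"
        unfolding u_def a_def by (simp add: scaleR_add_left sum.distrib scaleR_sum_right)
      also have "\<dots> = ((1 / e) * (1 - e) + (1 - 1 / e)) *\<^sub>R a + ((1 / e) * e) *\<^sub>R z"
        unfolding d by (simp add: scaleR_add_right scaleR_add_left)
      also have "(1 / e) * (1 - e) + (1 - 1 / e) = 0" using e by (simp add: field_simps)
      finally show ?thesis using e by simp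
    qed
    ultimately show "z \<in> {y. \<exists>u. (\<forall>x\<in>B. 0 < u x) \<and> sum u B = 1 \<and> (\<Sum>x\<in>B. u x *\<^sub>R x) = y}" by blast
  qed
qed

text \<open>The layer-cake formula: a positive function is a positive combination of the indicators
  of its superlevel sets, and these form a chain. The induction peels off the minimum of
  \<open>f\<close>, which is the weight of the bottom layer \<open>V\<close>.\<close>

lemma chain_decomposition:
  fixes f :: "'b \<Rightarrow> real"
  assumes "finite V" "\<forall>v\<in>V. 0 < f v" "V \<noteq> {}"
  shows "\<exists>\<A> c. finite \<A> \<and> \<A> \<noteq> {} \<and> (\<forall>A\<in>\<A>. A \<noteq> {} \<and> A \<subseteq> V \<and> 0 < c A) \<and>
    (\<forall>A\<in>\<A>. \<forall>B\<in>\<A>. A \<subseteq> B \<or> B \<subseteq> A) \<and> (\<forall>v\<in>V. f v = (\<Sum>A\<in>\<A>. if v \<in> A then c A else 0))"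
  using assms
proof (induction "card V" arbitrary: V f rule: less_induct)
  case less
  define m where "m = Min (f ` V)"
  have m: "m \<in> f ` V" "\<And>v. v \<in> V \<Longrightarrow> m \<le> f v" using less by (auto simp: m_def)
  then have m0: "m > 0" using less by auto
  define W where "W = {v \<in> V. m < f v}"
  have WV: "W \<subset> V" using m by (force simp: W_def)
  show ?case
  proof (cases "W = {}")
    case True
    then have "f v = m" if "v \<in> V" for v using that m(2)[of v] by (force simp: W_def)
    then show ?thesis using less m0
      by (intro exI[of _ "{V}"] exI[of _ "\<lambda>_. m"]) auto
  next
    case False
    have "card W < card V" using WV less by (simp add: psubset_card_mono)
    then obtain \<A> c where A: "finite \<A>" "\<forall>A\<in>\<A>. A \<noteq> {} \<and> A \<subseteq> W \<and> 0 < c A"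
      "\<forall>A\<in>\<A>. \<forall>B\<in>\<A>. A \<subseteq> B \<or> B \<subseteq> A" "\<forall>v\<in>W. f v - m = (\<Sum>A\<in>\<A>. if v \<in> A then c A else 0)"
      using less(1)[of W "\<lambda>v. f v - m"] False less(2) WV finite_subset[of W V]
      by (auto simp: W_def)
    have nV: "V \<notin> \<A>" using A WV by blast
    define c' where "c' = c(V := m)"
    have "f v = (\<Sum>A\<in>insert V \<A>. if v \<in> A then c' A else 0)" if v: "v \<in> V" for v
    proof -
      have "(\<Sum>A\<in>insert V \<A>. if v \<in> A then c' A else 0) = m + (\<Sum>A\<in>\<A>. if v \<in> A then c A else 0)"
        using nV A v by (auto simp: c'_def intro!: sum.cong)
      also have "\<dots> = f v"
      proof (cases "v \<in> W")
        case True
        then show ?thesis using A by (metis add.commute diff_add_cancel)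
      next
        case False
        then have "f v = m" using m(2)[OF v] v by (auto simp: W_def)
        moreover have "(\<Sum>A\<in>\<A>. if v \<in> A then c A else 0) = 0" using A False by (intro sum.neutral) auto
        ultimately show ?thesis by simp
      qed
      finally show ?thesis by simp
    qed
    moreover have "\<forall>A\<in>insert V \<A>. A \<noteq> {} \<and> A \<subseteq> V \<and> 0 < c' A"
      using A(2) WV less(4) m0 nV by (auto simp: c'_def)
    moreover have "\<forall>A\<in>insert V \<A>. \<forall>B\<in>insert V \<A>. A \<subseteq> B \<or> B \<subseteq> A" using A(2,3) WV by blast
    ultimately show ?thesis using A(1) by (intro exI[of _ "insert V \<A>"] exI[of _ c'] conjI) blast+
  qed
qed

definition vts :: "'a::euclidean_space set \<Rightarrow> 'a set" where
  "vts S = {v. v extreme_point_of S}"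

text \<open>The coefficients vanish outside the vertices, so that coordinates taken in different
  simplices are comparable as functions.\<close>

definition bary :: "'a::euclidean_space set \<Rightarrow> 'a \<Rightarrow> ('a \<Rightarrow> real) \<Rightarrow> bool" where
  "bary S x u \<longleftrightarrow> (\<forall>v. v \<notin> vts S \<longrightarrow> u v = 0) \<and> (\<forall>v. 0 \<le> u v) \<and> sum u (vts S) = 1 \<and>
     (\<Sum>v\<in>vts S. u v *\<^sub>R v) = x"

definition lam :: "'a::euclidean_space set set \<Rightarrow> 'a \<Rightarrow> 'a \<Rightarrow> real" where
  "lam C x = (SOME u. \<exists>S\<in>C. bary S x u)"

text \<open>The simplices of \<open>C\<close> whose barycenters span the open simplex of the subdivision containing \<open>x\<close>:
  their vertex sets are the superlevel sets of the barycentric coordinates of \<open>x\<close>.\<close>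

definition carrier_chain :: "'a::euclidean_space set set \<Rightarrow> 'a \<Rightarrow> 'a set set" where
  "carrier_chain C x = {S \<in> simplices C. \<forall>v\<in>vts S. 0 < lam C x v \<and>
     (\<forall>w\<in>\<Union>(vts ` C) - vts S. lam C x w < lam C x v)}"

locale simplicial_cx =
  fixes C :: "'a::euclidean_space set set"
  assumes sc: "simplicial_complex C"
begin

lemma finite_C: "finite C" using sc by (simp add: simplicial_complex_def)

lemma vts_props:
  assumes "S \<in> C"
  shows "finite (vts S)" "\<not> affine_dependent (vts S)" "convex hull (vts S) = S"
proof -
  obtain n where "n simplex S" using sc assms by (auto simp: simplicial_complex_def)
  then obtain D where D: "finite D" "\<not> affine_dependent D" "S = convex hull D" by (auto simp: simplex)
  then have "vts S = D"
    using extreme_point_of_convex_hull_affine_independent[OF D(2)] by (auto simp: vts_def)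
  then show "finite (vts S)" "\<not> affine_dependent (vts S)" "convex hull (vts S) = S" using D by auto
qed

lemma vts_inj: "S \<in> C \<Longrightarrow> T \<in> C \<Longrightarrow> vts S = vts T \<Longrightarrow> S = T"
  using vts_props(3) by metis

lemma vts_down:
  assumes "S \<in> C" "A \<subseteq> vts S"
  shows "convex hull A \<in> C" "vts (convex hull A) = A"
proof -
  have "convex hull A face_of S"
    using assms face_of_convex_hull_affine_independent[OF vts_props(2)[OF assms(1)], of "convex hull A"]
      vts_props(3)[OF assms(1)] by auto
  then show "convex hull A \<in> C" using sc assms by (auto simp: simplicial_complex_def)
  have "\<not> affine_dependent A" using assms vts_props(2) affine_dependent_subset by blast
  then show "vts (convex hull A) = A"
    using extreme_point_of_convex_hull_affine_independent by (auto simp: vts_def)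
qed

lemma face_iff: "S \<in> C \<Longrightarrow> T \<in> C \<Longrightarrow> S face_of T \<longleftrightarrow> vts S \<subseteq> vts T"
proof
  assume "S \<in> C" "T \<in> C" "S face_of T"
  then show "vts S \<subseteq> vts T" by (auto simp: vts_def dest: extreme_point_of_face)
next
  assume "S \<in> C" "T \<in> C" "vts S \<subseteq> vts T"
  then show "S face_of T"
    using face_of_convex_hull_affine_independent[OF vts_props(2)[of T], of S] vts_props(3) by metis
qed

lemma incident_iff: "S \<in> C \<Longrightarrow> T \<in> C \<Longrightarrow> incident S T \<longleftrightarrow> vts S \<subseteq> vts T \<or> vts T \<subseteq> vts S"
  by (simp add: incident_def face_iff)

lemma vts_ne: "S \<in> simplices C \<Longrightarrow> vts S \<noteq> {}"
  using vts_props(3)[of S] by (auto simp: simplices_def)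

lemma sdim_eq: "S \<in> simplices C \<Longrightarrow> sdim S = card (vts S) - 1"
proof -
  assume S: "S \<in> simplices C"
  then have SC: "S \<in> C" by (simp add: simplices_def)
  have "aff_dim S = int (card (vts S)) - 1"
    using aff_dim_convex_hull[of "vts S"] aff_dim_affine_independent[OF vts_props(2)[OF SC]] vts_props(3)[OF SC]
    by simp
  then show ?thesis by (simp add: sdim_def)
qed

lemma bary_in: "S \<in> C \<Longrightarrow> bary S x u \<Longrightarrow> x \<in> S"
  using vts_props(3)[of S] convex_hull_finite[OF vts_props(1), of S] unfolding bary_def by blast

lemma bary_ex:
  assumes "S \<in> C" "x \<in> S"
  shows "\<exists>u. bary S x u"
proof -
  obtain u where u: "\<forall>v\<in>vts S. 0 \<le> u v" "sum u (vts S) = 1" "(\<Sum>v\<in>vts S. u v *\<^sub>R v) = x"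
    using assms vts_props(3)[of S] convex_hull_finite[OF vts_props(1), of S] by blast
  have "bary S x (\<lambda>v. if v \<in> vts S then u v else 0)"
    using u by (auto simp: bary_def cong: sum.cong)
  then show ?thesis by blast
qed

lemma bary_unique:
  assumes "S \<in> C" "bary S x u" "bary S x u'"
  shows "u = u'"
proof
  fix v
  have fi: "finite (vts S)" using vts_props assms by auto
  have "sum (\<lambda>v. u v - u' v) (vts S) = 0" "(\<Sum>v\<in>vts S. (u v - u' v) *\<^sub>R v) = 0"
    using assms by (auto simp: bary_def sum_subtractf scaleR_diff_left)
  then have "\<forall>v\<in>vts S. u v - u' v = 0"
    using affine_dependent_explicit_finite[OF fi] vts_props(2)[OF assms(1)] by auto
  then show "u v = u' v" using assms by (cases "v \<in> vts S") (auto simp: bary_def)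
qed

lemma bary_face:
  assumes "T \<in> C" "vts S \<subseteq> vts T" "bary S x u"
  shows "bary T x u"
proof -
  have fT: "finite (vts T)" using vts_props assms by auto
  have z: "\<forall>v\<in>vts T - vts S. u v = 0" using assms by (auto simp: bary_def)
  have "sum u (vts T) = sum u (vts S)" by (rule sum.mono_neutral_right[OF fT assms(2) z])
  moreover have "(\<Sum>v\<in>vts T. u v *\<^sub>R v) = (\<Sum>v\<in>vts S. u v *\<^sub>R v)"
    using z by (intro sum.mono_neutral_right[OF fT assms(2)]) auto
  ultimately show ?thesis using assms unfolding bary_def by auto
qed

text \<open>Two simplices through \<open>x\<close> meet in a common face. Coordinates in that face
  extend by zero to both simplices, and uniqueness in each of them forces equality. The choice in
  \<open>lam\<close> is therefore immaterial.\<close>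

lemma lam_eqI:
  assumes "S \<in> C" "bary S x u"
  shows "lam C x = u"
proof -
  have "\<exists>T\<in>C. bary T x (lam C x)" unfolding lam_def by (rule someI[of _ u]) (use assms in blast)
  then obtain T where T: "T \<in> C" "bary T x (lam C x)" by blast
  have x: "x \<in> S \<inter> T" using bary_in assms T by blast
  have f: "S \<inter> T face_of S" "T \<inter> S face_of T" using sc assms T by (auto simp: simplicial_complex_def)
  then have I: "S \<inter> T \<in> C" using sc assms by (auto simp: simplicial_complex_def)
  then obtain u' where u': "bary (S \<inter> T) x u'" using bary_ex x by blast
  have "vts (S \<inter> T) \<subseteq> vts S" "vts (S \<inter> T) \<subseteq> vts T"
    using f I assms T face_iff by (auto simp: Int_commute)
  then have "bary S x u'" "bary T x u'" using bary_face u' assms T by auto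
  then show ?thesis using bary_unique T assms by metis
qed

lemma bary_lam: "S \<in> C \<Longrightarrow> x \<in> S \<Longrightarrow> bary S x (lam C x)"
  using bary_ex lam_eqI by metis

lemma lam_outside: "S \<in> C \<Longrightarrow> x \<in> S \<Longrightarrow> v \<notin> vts S \<Longrightarrow> lam C x v = 0"
  using bary_lam unfolding bary_def by blast

text \<open>A convex combination of coordinate vectors of one simplex is again a coordinate vector
  of that simplex, hence by uniqueness the one of the combined point.\<close>

lemma lam_convex:
  assumes "T \<in> C" "finite I" "\<And>i. i \<in> I \<Longrightarrow> y i \<in> T \<and> 0 \<le> c i" "sum c I = (1::real)"
  shows "(\<Sum>i\<in>I. c i *\<^sub>R y i) \<in> T" "lam C (\<Sum>i\<in>I. c i *\<^sub>R y i) v = (\<Sum>i\<in>I. c i * lam C (y i) v)"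
proof -
  have b: "bary T (y i) (lam C (y i))" if "i \<in> I" for i using bary_lam assms that by blast
  have "(\<Sum>v\<in>vts T. \<Sum>i\<in>I. c i * lam C (y i) v) = (\<Sum>i\<in>I. c i * (\<Sum>v\<in>vts T. lam C (y i) v))"
    by (subst sum.swap) (simp add: sum_distrib_left)
  also have "\<dots> = 1" using b assms by (simp add: bary_def cong: sum.cong)
  finally have 1: "(\<Sum>v\<in>vts T. \<Sum>i\<in>I. c i * lam C (y i) v) = 1" .
  have "(\<Sum>v\<in>vts T. (\<Sum>i\<in>I. c i * lam C (y i) v) *\<^sub>R v) = (\<Sum>i\<in>I. c i *\<^sub>R (\<Sum>v\<in>vts T. lam C (y i) v *\<^sub>R v))"
    by (simp add: scaleR_sum_left scaleR_sum_right) (subst sum.swap, simp)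
  also have "\<dots> = (\<Sum>i\<in>I. c i *\<^sub>R y i)" using b by (intro sum.cong) (auto simp: bary_def)
  finally have 2: "(\<Sum>v\<in>vts T. (\<Sum>i\<in>I. c i * lam C (y i) v) *\<^sub>R v) = (\<Sum>i\<in>I. c i *\<^sub>R y i)" .
  have "bary T (\<Sum>i\<in>I. c i *\<^sub>R y i) (\<lambda>v. \<Sum>i\<in>I. c i * lam C (y i) v)"
    unfolding bary_def using 1 2 b assms(3) by (auto simp: bary_def intro!: sum_nonneg sum.neutral)
  then show "(\<Sum>i\<in>I. c i *\<^sub>R y i) \<in> T" "lam C (\<Sum>i\<in>I. c i *\<^sub>R y i) v = (\<Sum>i\<in>I. c i * lam C (y i) v)"
    using bary_in lam_eqI assms(1) by auto
qed

lemma bary_barycenter: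
  assumes "S \<in> simplices C"
  shows "bary S (barycenter S) (\<lambda>v. if v \<in> vts S then 1 / card (vts S) else 0)"
proof -
  have SC: "S \<in> C" using assms by (simp add: simplices_def)
  have n: "card (vts S) > 0" using vts_ne[OF assms] vts_props(1)[OF SC] by (simp add: card_gt_0_iff)
  have "barycenter S = (1 / real (card (vts S))) *\<^sub>R \<Sum>(vts S)"
    by (simp add: barycenter_def vts_def Let_def)
  then show ?thesis using n by (simp add: bary_def scaleR_sum_right)
qed

lemma barycenter_in: "S \<in> simplices C \<Longrightarrow> barycenter S \<in> S"
  using bary_in bary_barycenter by (auto simp: simplices_def)

lemma lam_barycenter:
  "S \<in> simplices C \<Longrightarrow> lam C (barycenter S) v = (if v \<in> vts S then 1 / card (vts S) else 0)"
  using lam_eqI[OF _ bary_barycenter] by (simp add: simplices_def)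

text \<open>A barycenter remembers its simplex through the set of vertices with nonzero
  coordinate.\<close>

lemma barycenter_inj: "inj_on barycenter (simplices C)"
proof
  fix S T assume S: "S \<in> simplices C" "T \<in> simplices C" and eq: "barycenter S = barycenter T"
  have "v \<in> vts S \<longleftrightarrow> lam C (barycenter S) v \<noteq> 0" "v \<in> vts T \<longleftrightarrow> lam C (barycenter T) v \<noteq> 0" for v
    using S lam_barycenter vts_ne vts_props(1) by (auto simp: simplices_def)
  then have "vts S = vts T" using eq by auto
  then show "S = T" using vts_inj S by (auto simp: simplices_def)
qed

end

section \<open>Open simplices of the subdivision, read off from the coordinates\<close>

context simplicial_cx
begin

lemma sum_sum_subsets:
  fixes g :: "'b set \<Rightarrow> 'b \<Rightarrow> 'c::comm_monoid_add"
  assumes "finite V" "\<And>A. A \<in> \<A> \<Longrightarrow> A \<subseteq> V"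
  shows "(\<Sum>A\<in>\<A>. \<Sum>v\<in>A. g A v) = (\<Sum>v\<in>V. \<Sum>A\<in>\<A>. if v \<in> A then g A v else 0)"
proof -
  have "(\<Sum>v\<in>A. g A v) = (\<Sum>v\<in>V. if v \<in> A then g A v else 0)" if "A \<in> \<A>" for A
  proof -
    have "{v \<in> V. v \<in> A} = A" using assms(2) that by auto
    then show ?thesis using sum.inter_filter[OF assms(1), of "g A" "\<lambda>v. v \<in> A"] by simp
  qed
  then show ?thesis by (simp add: sum.swap[of _ V])
qed

lemma ex_least_value:
  fixes f :: "'b \<Rightarrow> 'c::linorder"
  assumes "finite A" "A \<noteq> {}"
  obtains x where "x \<in> A" "\<And>y. y \<in> A \<Longrightarrow> f x \<le> f y"
proof -
  have "Min (f ` A) \<in> f ` A" using assms by (intro Min_in) auto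
  then obtain x where "x \<in> A" "f x = Min (f ` A)" by auto
  then show ?thesis using that[of x] assms by simp
qed

lemma closed_C: "S \<in> C \<Longrightarrow> closed S"
  using sc closed_simplex unfolding simplicial_complex_def by blast

text \<open>On one simplex the coordinate at \<open>v\<close> is an affine function of the point,
  and finitely many closed simplices cover the complex.\<close>

lemma continuous_lam: "continuous_on (\<Union>C) (\<lambda>x. lam C x v)"
proof -
  have "continuous_on S (\<lambda>x. lam C x v)" if S: "S \<in> C" for S
  proof (cases "v \<in> vts S")
    case False
    then have "lam C x v = 0" if "x \<in> S" for x using lam_outside S that by blast
    then show ?thesis using continuous_on_const[of S 0] by (simp cong: continuous_on_cong)
  next
    case True
    have "independent ((\<lambda>x. - v + x) ` (vts S - {v}))"
      using affine_dependent_iff_dependent2[OF True] vts_props(2)[OF S] by blast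
    \<comment> \<open>The edge vectors at \<open>v\<close> are linearly independent, so some
      functional is \<open>1\<close> on all of them. Applied to \<open>x - v\<close> it measures the
      total coordinate of \<open>x\<close> away from \<open>v\<close>.\<close>
    then obtain g :: "'a \<Rightarrow> real" where g: "linear g" "\<forall>z\<in>(\<lambda>x. - v + x) ` (vts S - {v}). g z = 1"
      using linear_independent_extend[of _ "\<lambda>_. 1"] by blast
    have "lam C x v = 1 - g (x - v)" if x: "x \<in> S" for x
    proof -
      have b: "sum (lam C x) (vts S) = 1" "(\<Sum>w\<in>vts S. lam C x w *\<^sub>R w) = x"
        using bary_lam[OF S x] by (auto simp: bary_def)
      have fin: "finite (vts S)" using vts_props[OF S] by blast
      have "x - v = (\<Sum>w\<in>vts S. lam C x w *\<^sub>R (w - v))"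
        using b by (simp add: scaleR_diff_right sum_subtractf flip: scaleR_sum_left)
      then have "g (x - v) = (\<Sum>w\<in>vts S. lam C x w * g (w - v))"
        using g(1) by (simp add: linear_sum linear_cmul)
      also have "\<dots> = lam C x v * g (v - v) + (\<Sum>w\<in>vts S - {v}. lam C x w * g (w - v))"
        using True fin by (simp add: sum.remove)
      also have "\<dots> = (\<Sum>w\<in>vts S - {v}. lam C x w)"
        using g by (auto simp: linear_0 intro!: sum.cong)
      also have "\<dots> = 1 - lam C x v" using b True fin by (simp add: sum_diff1)
      finally show ?thesis by simp
    qed
    moreover have "continuous_on S (\<lambda>x. 1 - g (x - v))"
      by (intro continuous_on_diff continuous_on_const continuous_on_id
          bounded_linear.continuous_on[OF g(1)[unfolded linear_conv_bounded_linear]])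
    ultimately show ?thesis by (simp cong: continuous_on_cong)
  qed
  then have "continuous_on (\<Union>(id ` C)) (\<lambda>x. lam C x v)"
    using finite_C closed_C by (intro continuous_on_closed_Union) auto
  then show ?thesis by simp
qed

lemma finite_vertices: "finite (\<Union>(vts ` C))"
  using finite_C vts_props by auto

lemma openin_less:
  assumes "continuous_on X f" "continuous_on X (g :: 'a \<Rightarrow> real)"
  shows "openin (top_of_set X) {y \<in> X. f y < g y}"
proof -
  have "{y \<in> X. f y < g y} = X \<inter> (\<lambda>y. g y - f y) -` {0<..}" by auto
  then show ?thesis
    using continuous_openin_preimage_gen[of X "\<lambda>y. g y - f y" "{0<..}"] assms
    by (auto intro!: continuous_intros)
qed

lemma openin_finite_ball:
  assumes "finite I" "\<And>i. i \<in> I \<Longrightarrow> openin (top_of_set X) {y \<in> X. P i y}"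
  shows "openin (top_of_set X) {y \<in> X. \<forall>i\<in>I. P i y}"
proof -
  have "openin (top_of_set X) ((\<Inter>i\<in>I. {y \<in> X. P i y}) \<inter> topspace (top_of_set X))"
    using assms by (intro openin_INT) auto
  moreover have "(\<Inter>i\<in>I. {y \<in> X. P i y}) \<inter> topspace (top_of_set X) = {y \<in> X. \<forall>i\<in>I. P i y}" by auto
  ultimately show ?thesis by simp
qed

text \<open>Belonging to the chain of a point means finitely many strict inequalities between
  continuous coordinates, so it persists nearby. This is why the chain can only grow under small
  displacements.\<close>

lemma star_open:
  assumes "K \<subseteq> simplices C"
  shows "openin (top_of_set (\<Union>C)) {y \<in> \<Union>C. K \<subseteq> carrier_chain C y}"
proof -
  have "openin (top_of_set (\<Union>C)) {y \<in> \<Union>C. \<forall>S\<in>K. \<forall>v\<in>vts S. \<forall>w\<in>\<Union>(vts ` C) - vts S. lam C y w < lam C y v}"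
    using finite_subset[OF assms] finite_C finite_vertices vts_props(1) assms continuous_lam
    by (intro openin_finite_ball openin_less) (auto simp: simplices_def)
  moreover have "openin (top_of_set (\<Union>C)) {y \<in> \<Union>C. \<forall>S\<in>K. \<forall>v\<in>vts S. 0 < lam C y v}"
    using finite_subset[OF assms] finite_C vts_props(1) assms continuous_lam
    by (intro openin_finite_ball openin_less continuous_on_const) (auto simp: simplices_def)
  ultimately have "openin (top_of_set (\<Union>C))
    ({y \<in> \<Union>C. \<forall>S\<in>K. \<forall>v\<in>vts S. \<forall>w\<in>\<Union>(vts ` C) - vts S. lam C y w < lam C y v} \<inter>
     {y \<in> \<Union>C. \<forall>S\<in>K. \<forall>v\<in>vts S. 0 < lam C y v})" by blast
  moreover have "{y \<in> \<Union>C. K \<subseteq> carrier_chain C y} =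
    ({y \<in> \<Union>C. \<forall>S\<in>K. \<forall>v\<in>vts S. \<forall>w\<in>\<Union>(vts ` C) - vts S. lam C y w < lam C y v} \<inter>
     {y \<in> \<Union>C. \<forall>S\<in>K. \<forall>v\<in>vts S. 0 < lam C y v})"
    using assms unfolding carrier_chain_def by blast
  ultimately show ?thesis by simp
qed

lemma chain_finite: "K \<in> subdivision_chains C \<Longrightarrow> finite K"
  using finite_C finite_subset unfolding subdivision_chains_def simplices_def by blast

lemma chain_in: "K \<in> subdivision_chains C \<Longrightarrow> S \<in> K \<Longrightarrow> S \<in> C \<and> S \<in> simplices C"
  unfolding subdivision_chains_def simplices_def by blast

lemma chain_inc:
  "K \<in> subdivision_chains C \<Longrightarrow> S \<in> K \<Longrightarrow> T \<in> K \<Longrightarrow> vts S \<subseteq> vts T \<or> vts T \<subseteq> vts S"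
  using incident_iff[of S T] chain_in[of K S] chain_in[of K T] by (simp add: subdivision_chains_def)

lemma chain_card:
  assumes "K \<in> subdivision_chains C" "S \<in> K" "T \<in> K" "card (vts S) \<le> card (vts T)"
  shows "vts S \<subseteq> vts T"
  using chain_inc[OF assms(1-3)] chain_in[OF assms(1)] assms vts_props(1)
  by (metis card_seteq order_refl)

lemma chain_max:
  assumes "K \<in> subdivision_chains C"
  obtains T where "T \<in> K" "\<And>S. S \<in> K \<Longrightarrow> S \<subseteq> T"
proof -
  have "K \<noteq> {}" using assms by (auto simp: subdivision_chains_def)
  then obtain T where "T \<in> K" "\<And>S. S \<in> K \<Longrightarrow> - int (card (vts T)) \<le> - int (card (vts S))"
    using ex_least_value[OF chain_finite[OF assms], of "\<lambda>S. - int (card (vts S))"] by metis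
  then have T: "T \<in> K" "\<And>S. S \<in> K \<Longrightarrow> card (vts S) \<le> card (vts T)" by auto
  have "S \<subseteq> T" if "S \<in> K" for S
    using chain_card[OF assms that T(1) T(2)[OF that]] hull_mono vts_props(3) chain_in[OF assms] that T(1)
    by metis
  then show ?thesis using that T by blast
qed

text \<open>Distinct simplices have distinct barycenters, so the coefficients may be indexed by the
  simplices of the chain.\<close>

lemma open_subdivision_simplex_combo:
  assumes "K \<in> subdivision_chains C"
  shows "y \<in> open_subdivision_simplex K \<longleftrightarrow>
    (\<exists>c. (\<forall>S\<in>K. 0 < c S) \<and> sum c K = 1 \<and> (\<Sum>S\<in>K. c S *\<^sub>R barycenter S) = y)"
proof -
  have inj: "inj_on barycenter K"
    using barycenter_inj chain_in[OF assms] by (meson inj_on_subset subsetI)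
  have ne: "K \<noteq> {}" using assms by (auto simp: subdivision_chains_def)
  show ?thesis
    unfolding open_subdivision_simplex_def
    using rel_interior_convex_hull_finite[of "barycenter ` K"] chain_finite[OF assms] ne
  proof (simp, intro iffI)
    assume "\<exists>u. (\<forall>x\<in>K. 0 < u (barycenter x)) \<and> sum u (barycenter ` K) = 1 \<and> (\<Sum>x\<in>barycenter ` K. u x *\<^sub>R x) = y"
    then obtain u where "\<forall>x\<in>K. 0 < u (barycenter x)" "sum u (barycenter ` K) = 1" "(\<Sum>x\<in>barycenter ` K. u x *\<^sub>R x) = y" by blast
    then show "\<exists>c. (\<forall>S\<in>K. 0 < c S) \<and> sum c K = 1 \<and> (\<Sum>S\<in>K. c S *\<^sub>R barycenter S) = y"
      using inj by (intro exI[of _ "u \<circ> barycenter"]) (simp add: sum.reindex)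
  next
    assume "\<exists>c. (\<forall>S\<in>K. 0 < c S) \<and> sum c K = 1 \<and> (\<Sum>S\<in>K. c S *\<^sub>R barycenter S) = y"
    then obtain c where "\<forall>S\<in>K. 0 < c S" "sum c K = 1" "(\<Sum>S\<in>K. c S *\<^sub>R barycenter S) = y" by blast
    then show "\<exists>u. (\<forall>x\<in>K. 0 < u (barycenter x)) \<and> sum u (barycenter ` K) = 1 \<and> (\<Sum>x\<in>barycenter ` K. u x *\<^sub>R x) = y"
      using inj by (intro exI[of _ "c \<circ> inv_into K barycenter"]) (simp add: sum.reindex)
  qed
qed

text \<open>Let \<open>d S\<close> be the share that \<open>S\<close> gives to each of its vertices.
  The coordinate of \<open>y\<close> at \<open>v\<close> is the sum of \<open>d\<close> over the
  simplices of the chain containing \<open>v\<close>. These collections \<open>up v\<close> are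
  nested, so the positive superlevel sets of the coordinates are exactly the vertex sets occurring
  in the chain.\<close>

lemma carrier_chain_open_simplex:
  assumes K: "K \<in> subdivision_chains C" and y: "y \<in> open_subdivision_simplex K"
  shows "y \<in> \<Union>C" "carrier_chain C y = K"
proof -
  obtain c where c: "\<forall>S\<in>K. 0 < c S" "sum c K = 1" "(\<Sum>S\<in>K. c S *\<^sub>R barycenter S) = y"
    using y open_subdivision_simplex_combo[OF K] by blast
  obtain T where T: "T \<in> K" "\<And>S. S \<in> K \<Longrightarrow> S \<subseteq> T" using chain_max[OF K] by blast
  have TC: "T \<in> C" using chain_in K T by blast
  have fin: "finite K" using chain_finite K by blast
  have bT: "barycenter S \<in> T \<and> 0 \<le> c S" if "S \<in> K" for S
    using that T(2) barycenter_in chain_in[OF K] c by (metis less_imp_le subsetD)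
  show yX: "y \<in> \<Union>C" using lam_convex(1)[OF TC fin bT c(2)] c(3) TC by auto
  define up where "up v = {S \<in> K. v \<in> vts S}" for v
  define d where "d S = c S / card (vts S)" for S
  have d: "d S > 0" if "S \<in> K" for S
    using that c chain_in[OF K that] vts_ne vts_props(1) by (simp add: d_def card_gt_0_iff)
  have lam: "lam C y v = sum d (up v)" for v
  proof -
    have "lam C y v = (\<Sum>S\<in>K. c S * lam C (barycenter S) v)"
      using lam_convex(2)[OF TC fin bT c(2)] c(3) by simp
    also have "\<dots> = (\<Sum>S\<in>K. if v \<in> vts S then d S else 0)"
      using chain_in[OF K] by (intro sum.cong) (auto simp: lam_barycenter d_def)
    also have "\<dots> = sum d (up v)" using fin by (simp add: up_def sum.inter_filter)
    finally show ?thesis .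
  qed
  have finup: "finite (up v)" "up v \<subseteq> K" for v using fin by (auto simp: up_def)
  have d0: "0 \<le> d S" if "S \<in> up v" for S v using d[of S] that by (auto simp: up_def)
  have mono: "lam C y v \<le> lam C y w" if "up v \<subseteq> up w" for v w
    unfolding lam using finup d0 that by (intro sum_mono2) auto
  have smono: "lam C y v < lam C y w" if vw: "up v \<subset> up w" for v w
  proof -
    obtain S where S: "S \<in> up w - up v" using vw by blast
    then have "0 < d S" using d finup by blast
    then show ?thesis unfolding lam
      using finup d0 vw S by (intro sum_strict_mono2[of _ _ S]) auto
  qed
  have comp: "up w \<subset> up v" if "S \<in> K" "v \<in> vts S" "w \<notin> vts S" for v w S
  proof -
    have "S' \<in> up v" if "S' \<in> up w" for S'
      using chain_inc[OF K \<open>S \<in> K\<close>, of S'] that \<open>v \<in> vts S\<close> \<open>w \<notin> vts S\<close> by (auto simp: up_def)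
    moreover have "S \<in> up v - up w" using that by (auto simp: up_def)
    ultimately show ?thesis by blast
  qed
  show "carrier_chain C y = K"
  proof
    show "K \<subseteq> carrier_chain C y"
    proof
      fix S assume S: "S \<in> K"
      have "0 < lam C y v" if "v \<in> vts S" for v
        unfolding lam using finup d S that by (intro sum_pos2[of _ S]) (use d0 in \<open>auto simp: up_def\<close>)
      then show "S \<in> carrier_chain C y"
        using S chain_in[OF K] smono comp by (auto simp: carrier_chain_def)
    qed
    show "carrier_chain C y \<subseteq> K"
    proof
      fix D assume D: "D \<in> carrier_chain C y"
      then have DC: "D \<in> simplices C" "D \<in> C" by (auto simp: carrier_chain_def simplices_def)
      \<comment> \<open>A superlevel set is recognised by a vertex \<open>v0\<close> with least
        coordinate in it: \<open>D\<close> turns out to be the smallest simplex of the chain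
        containing \<open>v0\<close>.\<close>
      obtain v0 where v0: "v0 \<in> vts D" "\<And>v. v \<in> vts D \<Longrightarrow> lam C y v0 \<le> lam C y v"
        using ex_least_value[OF vts_props(1)[OF DC(2)] vts_ne[OF DC(1)]] by metis
      have "0 < lam C y v0" using D v0 by (auto simp: carrier_chain_def)
      then have "up v0 \<noteq> {}" using lam by auto
      then obtain S0 where S0: "S0 \<in> up v0" "\<And>S. S \<in> up v0 \<Longrightarrow> card (vts S0) \<le> card (vts S)"
        using ex_least_value[OF finup(1), of v0 "\<lambda>S. card (vts S)"] by metis
      have S0K: "S0 \<in> K" "v0 \<in> vts S0" using S0 by (auto simp: up_def)
      have "vts S0 \<subseteq> vts D"
      proof
        fix u assume u: "u \<in> vts S0"
        have "up v0 \<subseteq> up u"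
          using u S0 S0K chain_card[OF K S0K(1)] by (auto simp: up_def)
        then have "lam C y v0 \<le> lam C y u" by (rule mono)
        moreover have "u \<in> \<Union>(vts ` C)" using u S0K chain_in[OF K] by blast
        moreover have "lam C y w < lam C y v0" if "w \<in> \<Union>(vts ` C) - vts D" for w
          using D v0(1) that unfolding carrier_chain_def by blast
        ultimately show "u \<in> vts D" by (meson DiffI leD)
      qed
      moreover have "vts D \<subseteq> vts S0"
      proof
        fix u assume u: "u \<in> vts D"
        show "u \<in> vts S0"
        proof (rule ccontr)
          assume "u \<notin> vts S0"
          then have "lam C y u < lam C y v0" using comp[OF S0K] smono by blast
          then show False using v0(2)[OF u] by simp
        qed
      qed
      ultimately have "D = S0" using vts_inj DC S0K chain_in[OF K] by blast
      then show "D \<in> K" using S0K by simp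
    qed
  qed
qed

text \<open>The layer-cake decomposition of the positive coordinates of \<open>x\<close> has vertex
  sets of a chain of faces as its layers. A layer of height \<open>c\<close> contributes its
  barycenter with the weight \<open>c\<close> times its number of vertices.\<close>

lemma open_simplex_cover:
  assumes x: "x \<in> \<Union>C"
  shows "\<exists>K\<in>subdivision_chains C. x \<in> open_subdivision_simplex K"
proof -
  obtain S where S: "S \<in> C" "x \<in> S" using x by blast
  define f where "f = lam C x"
  have b: "sum f (vts S) = 1" "(\<Sum>w\<in>vts S. f w *\<^sub>R w) = x" "\<And>v. 0 \<le> f v"
    using bary_lam[OF S] by (auto simp: bary_def f_def)
  have finS: "finite (vts S)" using vts_props S by blast
  define V where "V = {v \<in> vts S. 0 < f v}"
  have V: "finite V" "V \<subseteq> vts S" using finS by (auto simp: V_def)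
  have z: "f v = 0" if "v \<in> vts S - V" for v using that b(3)[of v] by (auto simp: V_def)
  have sV: "sum f V = 1" "(\<Sum>w\<in>V. f w *\<^sub>R w) = x"
    using sum.mono_neutral_left[OF finS V(2), of f] sum.mono_neutral_left[OF finS V(2), of "\<lambda>w. f w *\<^sub>R w"] z b
    by auto
  then have Vne: "V \<noteq> {}" by auto
  have Vpos: "\<forall>v\<in>V. 0 < f v" by (auto simp: V_def)
  obtain \<A> c where A: "finite \<A>" "\<A> \<noteq> {}" "\<forall>A\<in>\<A>. A \<noteq> {} \<and> A \<subseteq> V \<and> 0 < c A"
    "\<forall>A\<in>\<A>. \<forall>B\<in>\<A>. A \<subseteq> B \<or> B \<subseteq> A" "\<forall>v\<in>V. f v = (\<Sum>A\<in>\<A>. if v \<in> A then c A else 0)"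
    using chain_decomposition[of V f, OF V(1) Vpos Vne] by (elim exE conjE) (rule that)
  have h: "convex hull A \<in> simplices C" "vts (convex hull A) = A" if "A \<in> \<A>" for A
    using vts_down[OF S(1), of A] A(3) that V(2) by (auto simp: simplices_def)
  have inj: "inj_on (\<lambda>A. convex hull A) \<A>" using h by (metis inj_onI)
  define K where "K = (\<lambda>A. convex hull A) ` \<A>"
  have "incident (convex hull A) (convex hull B)" if "A \<in> \<A>" "B \<in> \<A>" for A B
    using incident_iff[of "convex hull A" "convex hull B"] h[OF that(1)] h[OF that(2)] A(4) that
    by (simp add: simplices_def)
  then have K: "K \<in> subdivision_chains C"
    using A(2) h by (auto simp: subdivision_chains_def K_def)
  have finA: "finite A" if "A \<in> \<A>" for A using that A(3) V(1) finite_subset by blast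
  note dbl = sum_sum_subsets[OF V(1), of \<A>]
  have bc: "barycenter (convex hull A) = (1 / real (card A)) *\<^sub>R \<Sum>A" if "A \<in> \<A>" for A
    using h(2)[OF that] by (simp add: barycenter_def vts_def Let_def)
  define e where "e S = c (vts S) * card (vts S)" for S
  have "\<forall>S\<in>K. 0 < e S" using A(3) h finA by (auto simp: K_def e_def card_gt_0_iff)
  moreover have "sum e K = 1"
  proof -
    have "sum e K = (\<Sum>A\<in>\<A>. \<Sum>v\<in>A. c A)"
      unfolding K_def sum.reindex[OF inj] using h by (auto simp: e_def intro!: sum.cong)
    also have "\<dots> = sum f V" using dbl[of "\<lambda>A v. c A"] A(3,5) by simp
    finally show ?thesis using sV by simp
  qed
  moreover have "(\<Sum>S\<in>K. e S *\<^sub>R barycenter S) = x"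
  proof -
    have "(\<Sum>S\<in>K. e S *\<^sub>R barycenter S) = (\<Sum>A\<in>\<A>. \<Sum>v\<in>A. c A *\<^sub>R v)"
      unfolding K_def sum.reindex[OF inj] using h finA A(3)
      by (auto simp: e_def bc scaleR_sum_right card_eq_0_iff intro!: sum.cong)
    also have "\<dots> = (\<Sum>v\<in>V. \<Sum>A\<in>\<A>. if v \<in> A then c A *\<^sub>R v else 0)"
      using A(3) by (intro dbl) blast
    also have "\<dots> = (\<Sum>v\<in>V. f v *\<^sub>R v)"
    proof (intro sum.cong refl)
      fix v assume "v \<in> V"
      then have "f v *\<^sub>R v = (\<Sum>A\<in>\<A>. (if v \<in> A then c A else 0) *\<^sub>R v)"
        using A(5) by (simp add: scaleR_sum_left)
      then show "(\<Sum>A\<in>\<A>. if v \<in> A then c A *\<^sub>R v else 0) = f v *\<^sub>R v"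
        by (auto intro!: sum.cong)
    qed
    finally show ?thesis using sV by simp
  qed
  ultimately have "x \<in> open_subdivision_simplex K"
    unfolding open_subdivision_simplex_combo[OF K] by (intro exI[of _ e] conjI)
  then show ?thesis using K by blast
qed

lemma carrier_chain_chain:
  assumes "x \<in> \<Union>C"
  shows "carrier_chain C x \<in> subdivision_chains C" "x \<in> open_subdivision_simplex (carrier_chain C x)"
proof -
  obtain K where K: "K \<in> subdivision_chains C" "x \<in> open_subdivision_simplex K"
    using open_simplex_cover[OF assms] by auto
  then show "carrier_chain C x \<in> subdivision_chains C" "x \<in> open_subdivision_simplex (carrier_chain C x)"
    using carrier_chain_open_simplex(2)[OF K] by simp_all
qed

lemma open_simplex_eq:
  assumes "K \<in> subdivision_chains C"
  shows "open_subdivision_simplex K = {x \<in> \<Union>C. carrier_chain C x = K}"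
proof (intro equalityI subsetI)
  fix x assume "x \<in> open_subdivision_simplex K"
  then show "x \<in> {x \<in> \<Union>C. carrier_chain C x = K}"
    using carrier_chain_open_simplex[OF assms] by simp
next
  fix x assume "x \<in> {x \<in> \<Union>C. carrier_chain C x = K}"
  then show "x \<in> open_subdivision_simplex K" using carrier_chain_chain(2) by auto
qed

lemma cell_convex:
  assumes "K \<in> subdivision_chains C"
  shows "convex {x \<in> \<Union>C. carrier_chain C x = K}"
  unfolding open_simplex_eq[OF assms, symmetric] open_subdivision_simplex_def
  by (simp add: convex_rel_interior)

lemma closure_cell:
  assumes "K \<in> subdivision_chains C"
  shows "closure {x \<in> \<Union>C. carrier_chain C x = K} = convex hull (barycenter ` K)"
  unfolding open_simplex_eq[OF assms, symmetric] open_subdivision_simplex_def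
  using chain_finite[OF assms] convex_closure_rel_interior[of "convex hull (barycenter ` K)"]
  by (simp add: compact_imp_closed finite_imp_compact_convex_hull)

text \<open>The closure of an open simplex is the hull of its barycenters and contains the hulls of
  all subchains. Together with the openness of stars this says which chains occur arbitrarily near
  \<open>x\<close>: those that contain the chain of \<open>x\<close>.\<close>

lemma in_closure_cell:
  assumes "K \<in> subdivision_chains C" "x \<in> \<Union>C" "carrier_chain C x \<subseteq> K"
  shows "x \<in> closure {x \<in> \<Union>C. carrier_chain C x = K}"
proof -
  have "x \<in> convex hull (barycenter ` carrier_chain C x)"
    using closure_cell[OF carrier_chain_chain(1)[OF assms(2)]] assms(2)
      closure_subset[of "{y \<in> \<Union>C. carrier_chain C y = carrier_chain C x}"] by auto
  then show ?thesis
    unfolding closure_cell[OF assms(1)] by (rule subsetD[OF hull_mono[OF image_mono[OF assms(3)]]])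
qed

lemma carrier_chain_barycenter:
  assumes "S \<in> simplices C"
  shows "barycenter S \<in> \<Union>C" "carrier_chain C (barycenter S) = {S}"
proof -
  have K: "{S} \<in> subdivision_chains C"
    using assms by (auto simp: subdivision_chains_def incident_iff simplices_def)
  have "barycenter S \<in> open_subdivision_simplex {S}"
    unfolding open_subdivision_simplex_combo[OF K] by (intro exI[of _ "\<lambda>_. 1"]) auto
  then show "barycenter S \<in> \<Union>C" "carrier_chain C (barycenter S) = {S}"
    using carrier_chain_open_simplex[OF K] by auto
qed

end

subsection \<open>Isomorphisms of triangulated spaces\<close>

text \<open>Only bijectivity, preservation of simplices and affinity on segments inside a simplex
  are given; continuity and compatibility with coordinates are derived.\<close>

locale simplicial_isom = A: simplicial_cx C + B: simplicial_cx C'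
  for C C' :: "'a::euclidean_space set set" +
  fixes h :: "'a \<Rightarrow> 'a"
  assumes iso: "simplicial_iso C C' h"
begin

lemma h_bij: "bij_betw h (\<Union>C) (\<Union>C')" and h_C: "(\<lambda>S. h ` S) ` C = C'"
  and h_seg: "\<lbrakk>S \<in> C; x \<in> S; y \<in> S; 0 \<le> t; t \<le> 1\<rbrakk> \<Longrightarrow>
    h ((1 - t) *\<^sub>R x + t *\<^sub>R y) = (1 - t) *\<^sub>R h x + t *\<^sub>R h y"
  using iso by (auto simp: simplicial_iso_def)

lemma h_inj: "inj_on h (\<Union>C)" using h_bij by (simp add: bij_betw_def)

lemma h_in: "x \<in> \<Union>C \<Longrightarrow> h x \<in> \<Union>C'" using h_bij by (auto simp: bij_betw_def)

lemma h_eq_iff: "x \<in> \<Union>C \<Longrightarrow> y \<in> \<Union>C \<Longrightarrow> h x = h y \<longleftrightarrow> x = y"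
  using h_inj by (auto dest: inj_onD)

lemma simplex_convex: "S \<in> C \<Longrightarrow> convex S"
  using A.sc convex_simplex unfolding simplicial_complex_def by blast

lemma iso_segment:
  assumes "S \<in> C" "x \<in> S" "a \<in> S" "b \<in> S"
  shows "h x \<in> open_segment (h a) (h b) \<longleftrightarrow> x \<in> open_segment a b"
proof -
  have X: "x \<in> \<Union>C" "a \<in> \<Union>C" "b \<in> \<Union>C" using assms by auto
  have "h x = (1 - u) *\<^sub>R h a + u *\<^sub>R h b \<longleftrightarrow> x = (1 - u) *\<^sub>R a + u *\<^sub>R b" if u: "0 < u" "u < 1" for u
  proof -
    have "(1 - u) *\<^sub>R a + u *\<^sub>R b \<in> S"
      using convexD[OF simplex_convex[OF assms(1)] assms(3,4), of "1 - u" u] u by simp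
    then have "(1 - u) *\<^sub>R a + u *\<^sub>R b \<in> \<Union>C" using assms(1) by blast
    moreover have "(1 - u) *\<^sub>R h a + u *\<^sub>R h b = h ((1 - u) *\<^sub>R a + u *\<^sub>R b)"
      using h_seg[OF assms(1,3,4), of u] u by simp
    ultimately show ?thesis using h_eq_iff[OF X(1)] by simp
  qed
  then show ?thesis using h_eq_iff[OF X(2,3)] unfolding in_segment by blast
qed

text \<open>Extreme points are defined through open segments, which \<open>h\<close> respects in
  both directions.\<close>

lemma iso_vts:
  assumes "S \<in> C"
  shows "vts (h ` S) = h ` vts S"
proof -
  have "h x \<in> vts (h ` S) \<longleftrightarrow> x \<in> vts S" if "x \<in> S" for x
    using iso_segment[OF assms that] that by (auto simp: vts_def extreme_point_of_def)
  moreover have "vts S \<subseteq> S" "vts (h ` S) \<subseteq> h ` S" by (auto simp: vts_def extreme_point_of_def)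
  ultimately show ?thesis by blast
qed

text \<open>Affinity on segments makes every Euclidean component of \<open>h\<close> both convex and
  concave on a simplex, and Jensen's inequality in both directions extends it to finite convex
  combinations.\<close>

lemma iso_combination:
  assumes S: "S \<in> C" and I: "finite I" "\<And>i. i \<in> I \<Longrightarrow> y i \<in> S" "\<And>i. i \<in> I \<Longrightarrow> 0 \<le> c i" "sum c I = 1"
  shows "h (\<Sum>i\<in>I. c i *\<^sub>R y i) = (\<Sum>i\<in>I. c i *\<^sub>R h (y i))"
proof (rule euclidean_eqI)
  fix b :: 'a assume "b \<in> Basis"
  have ne: "I \<noteq> {}" using I by auto
  have seg: "h (u *\<^sub>R x + v *\<^sub>R z) = u *\<^sub>R h x + v *\<^sub>R h z"
    if "x \<in> S" "z \<in> S" "0 \<le> u" "0 \<le> v" "u + v = 1" for x z u v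
  proof -
    have "u = 1 - v" "v \<le> 1" using that by auto
    then show ?thesis using h_seg[OF S that(1,2,4)] by simp
  qed
  have cx: "convex_on S (\<lambda>x. h x \<bullet> b)" "convex_on S (\<lambda>x. - (h x \<bullet> b))"
    using simplex_convex[OF S] seg by (auto simp: convex_on_def inner_add_left)
  have "h (\<Sum>i\<in>I. c i *\<^sub>R y i) \<bullet> b \<le> (\<Sum>i\<in>I. c i * (h (y i) \<bullet> b))"
    by (rule convex_on_sum[OF I(1) ne cx(1) I(4) I(3) I(2)])
  moreover have "- (h (\<Sum>i\<in>I. c i *\<^sub>R y i) \<bullet> b) \<le> (\<Sum>i\<in>I. c i * (- (h (y i) \<bullet> b)))"
    by (rule convex_on_sum[OF I(1) ne cx(2) I(4) I(3) I(2)])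
  ultimately show "h (\<Sum>i\<in>I. c i *\<^sub>R y i) \<bullet> b = (\<Sum>i\<in>I. c i *\<^sub>R h (y i)) \<bullet> b"
    by (simp add: inner_sum_left sum_negf)
qed

lemma vts_sub: "S \<in> C \<Longrightarrow> vts S \<subseteq> S" by (auto simp: vts_def extreme_point_of_def)

lemma iso_lam:
  assumes x: "x \<in> \<Union>C" and v: "v \<in> \<Union>C"
  shows "lam C' (h x) (h v) = lam C x v"
proof -
  obtain S where S: "S \<in> C" "x \<in> S" using x by blast
  have b: "bary S x (lam C x)" using A.bary_lam S by blast
  define u where "u w = (if w \<in> h ` vts S then lam C x (inv_into (\<Union>C) h w) else 0)" for w
  have sub: "vts S \<subseteq> \<Union>C" using vts_sub S by blast
  have injS: "inj_on h (vts S)" using h_inj sub inj_on_subset by blast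
  have uh: "u (h v) = lam C x v" if "v \<in> vts S" for v
    using that inv_into_f_f[OF h_inj subsetD[OF sub that]] by (simp add: u_def)
  have "bary (h ` S) (h x) u"
    unfolding bary_def iso_vts[OF S(1)]
  proof (intro conjI)
    show "\<forall>v. v \<notin> h ` vts S \<longrightarrow> u v = 0" by (simp add: u_def)
    show "\<forall>v. 0 \<le> u v" using b by (auto simp: u_def bary_def)
    show "sum u (h ` vts S) = 1" using b uh by (simp add: sum.reindex[OF injS] bary_def cong: sum.cong)
    have "(\<Sum>v\<in>h ` vts S. u v *\<^sub>R v) = (\<Sum>v\<in>vts S. lam C x v *\<^sub>R h v)"
      using uh by (simp add: sum.reindex[OF injS] cong: sum.cong)
    also have "\<dots> = h (\<Sum>v\<in>vts S. lam C x v *\<^sub>R v)"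
      using b vts_sub[OF S(1)] A.vts_props(1)[OF S(1)]
      by (intro iso_combination[OF S(1), symmetric]) (auto simp: bary_def)
    also have "\<dots> = h x" using b by (simp add: bary_def)
    finally show "(\<Sum>v\<in>h ` vts S. u v *\<^sub>R v) = h x" .
  qed
  then have *: "lam C' (h x) = u" using B.lam_eqI[of "h ` S"] h_C S by blast
  show ?thesis
  proof (cases "v \<in> vts S")
    case False
    then have "h v \<notin> h ` vts S" using h_eq_iff v sub by blast
    then show ?thesis using False b by (simp add: * u_def bary_def)
  qed (simp add: * uh)
qed

lemma iso_simplices: "simplices C' = (\<lambda>S. h ` S) ` simplices C"
  unfolding simplices_def h_C[symmetric] by auto

lemma iso_carrier_chain:
  assumes x: "x \<in> \<Union>C"
  shows "carrier_chain C' (h x) = (\<lambda>S. h ` S) ` carrier_chain C x"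
proof -
  have V': "\<Union>(vts ` C') = h ` \<Union>(vts ` C)"
    unfolding h_C[symmetric] using iso_vts by auto
  have VX: "\<Union>(vts ` C) \<subseteq> \<Union>C" using vts_sub by blast
  have "h ` S \<in> carrier_chain C' (h x) \<longleftrightarrow> S \<in> carrier_chain C x" if S: "S \<in> simplices C" for S
  proof -
    have SC: "S \<in> C" using S by (simp add: simplices_def)
    have sub: "vts S \<subseteq> \<Union>C" using VX SC by blast
    have d: "\<Union>(vts ` C') - vts (h ` S) = h ` (\<Union>(vts ` C) - vts S)"
      unfolding V' iso_vts[OF SC] using inj_on_image_set_diff[OF h_inj, of "\<Union>(vts ` C)" "vts S"] VX sub by blast
    have "h ` S \<in> simplices C'" using S iso_simplices by blast
    moreover have "lam C' (h x) (h v) = lam C x v" if "v \<in> vts S \<or> v \<in> \<Union>(vts ` C)" for v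
      using that iso_lam[OF x] sub VX by blast
    ultimately show ?thesis
      using S unfolding carrier_chain_def mem_Collect_eq unfolding d unfolding iso_vts[OF SC] by auto
  qed
  moreover have "carrier_chain C' (h x) \<subseteq> (\<lambda>S. h ` S) ` simplices C"
    using iso_simplices by (auto simp: carrier_chain_def)
  moreover have "carrier_chain C x \<subseteq> simplices C" by (auto simp: carrier_chain_def)
  ultimately show ?thesis by blast
qed

text \<open>\<open>h\<close> is the combination of the images of the vertices with the barycentric
  coordinates, which are continuous, as coefficients.\<close>

lemma iso_continuous: "continuous_on (\<Union>C) h"
proof -
  have eq: "h x = (\<Sum>v\<in>\<Union>(vts ` C). lam C x v *\<^sub>R h v)" if x: "x \<in> \<Union>C" for x
  proof -
    obtain S where S: "S \<in> C" "x \<in> S" using x by blast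
    have b: "bary S x (lam C x)" using A.bary_lam S by blast
    have "h x = h (\<Sum>v\<in>vts S. lam C x v *\<^sub>R v)" using b by (simp add: bary_def)
    also have "\<dots> = (\<Sum>v\<in>vts S. lam C x v *\<^sub>R h v)"
      using b vts_sub[OF S(1)] A.vts_props(1)[OF S(1)]
      by (intro iso_combination[OF S(1)]) (auto simp: bary_def)
    also have "\<dots> = (\<Sum>v\<in>\<Union>(vts ` C). lam C x v *\<^sub>R h v)"
      using S b A.finite_vertices by (intro sum.mono_neutral_left) (auto simp: bary_def)
    finally show ?thesis .
  qed
  have c: "continuous_on (\<Union>C) (\<lambda>x. \<Sum>v\<in>\<Union>(vts ` C). lam C x v *\<^sub>R h v)"
    by (intro continuous_on_sum continuous_on_scaleR A.continuous_lam continuous_on_const)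
  show ?thesis by (rule continuous_on_eq[OF c]) (rule eq[symmetric])
qed

lemma pull_image: "S \<subseteq> \<Union>C \<Longrightarrow> pull C h (h ` S) = S"
  using h_eq_iff unfolding pull_def by blast

lemma pull_simplices: "D \<in> simplices C' \<Longrightarrow> pull C h D \<in> simplices C \<and> h ` pull C h D = D"
proof -
  assume "D \<in> simplices C'"
  then obtain S where S: "S \<in> simplices C" "D = h ` S" using iso_simplices by auto
  then have "pull C h D = S" using pull_image[of S] by (auto simp: simplices_def)
  then show ?thesis using S by simp
qed

lemma pull_carrier_chain:
  assumes "x \<in> \<Union>C"
  shows "pull C h ` carrier_chain C' (h x) = carrier_chain C x"
proof -
  have "pull C h (h ` S) = S" if "S \<in> carrier_chain C x" for S
    using that by (intro pull_image) (auto simp: carrier_chain_def simplices_def)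
  then show ?thesis unfolding iso_carrier_chain[OF assms] image_image by (simp cong: image_cong)
qed

lemma pull_open: "openin (top_of_set (\<Union>C')) V \<Longrightarrow> openin (top_of_set (\<Union>C)) (pull C h V)"
proof -
  assume "openin (top_of_set (\<Union>C')) V"
  then have "openin (top_of_set (\<Union>C)) (\<Union>C \<inter> h -` V)"
    using continuous_openin_preimage[OF iso_continuous, of "\<Union>C'" V] h_in by blast
  moreover have "pull C h V = \<Union>C \<inter> h -` V" by (auto simp: pull_def)
  ultimately show ?thesis by simp
qed

lemma sdim_image: "S \<in> simplices C \<Longrightarrow> sdim (h ` S) = sdim S"
proof -
  assume S: "S \<in> simplices C"
  then have SC: "S \<in> C" "h ` S \<in> simplices C'" using iso_simplices by (auto simp: simplices_def)
  have "inj_on h (vts S)" using vts_sub SC(1) h_inj by (meson Union_upper inj_on_subset order_trans)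
  then show ?thesis using A.sdim_eq[OF S] B.sdim_eq[OF SC(2)] iso_vts[OF SC(1)] by (simp add: card_image)
qed

lemma incident_image:
  assumes "S \<in> simplices C" "T \<in> simplices C"
  shows "incident (h ` S) (h ` T) \<longleftrightarrow> incident S T"
proof -
  have SC: "S \<in> C" "T \<in> C" "h ` S \<in> C'" "h ` T \<in> C'" using assms h_C by (auto simp: simplices_def)
  have "vts S \<subseteq> \<Union>C" "vts T \<subseteq> \<Union>C" using vts_sub SC by blast+
  then have "h ` vts S \<subseteq> h ` vts T \<longleftrightarrow> vts S \<subseteq> vts T" "h ` vts T \<subseteq> h ` vts S \<longleftrightarrow> vts T \<subseteq> vts S"
    using h_inj inj_on_image_subset_iff by blast+
  then show ?thesis using A.incident_iff[OF SC(1,2)] B.incident_iff[OF SC(3,4)] iso_vts SC by simp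
qed

text \<open>Applied to the inverse, the results on preimages of open sets also give openness of
  images.\<close>

lemma inverse_iso: "simplicial_iso C' C (inv_into (\<Union>C) h)"
proof -
  have i: "inv_into (\<Union>C) h (h x) = x" if "x \<in> \<Union>C" for x using h_inj that by (rule inv_into_f_f)
  have im: "inv_into (\<Union>C) h ` h ` S = S" if "S \<in> C" for S
    using i that by (force simp: image_image)
  have "bij_betw (inv_into (\<Union>C) h) (\<Union>C') (\<Union>C)" using bij_betw_inv_into[OF h_bij] .
  moreover have "(\<lambda>S. inv_into (\<Union>C) h ` S) ` C' = C"
    unfolding h_C[symmetric] image_image[of _ "\<lambda>S. h ` S"] using im by simp
  moreover have "inv_into (\<Union>C) h ((1 - t) *\<^sub>R x + t *\<^sub>R y) =
      (1 - t) *\<^sub>R inv_into (\<Union>C) h x + t *\<^sub>R inv_into (\<Union>C) h y"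
    if a: "S \<in> C'" "x \<in> S" "y \<in> S" "0 \<le> t" "t \<le> 1" for S x y t
  proof -
    obtain S0 where S0: "S0 \<in> C" "S = h ` S0" using a(1) h_C by blast
    obtain x0 y0 where x0: "x0 \<in> S0" "x = h x0" "y0 \<in> S0" "y = h y0" using a S0 by blast
    have "(1 - t) *\<^sub>R x0 + t *\<^sub>R y0 \<in> S0"
      using convexD[OF simplex_convex[OF S0(1)] x0(1,3), of "1 - t" t] a by simp
    then have "(1 - t) *\<^sub>R x0 + t *\<^sub>R y0 \<in> \<Union>C" "x0 \<in> \<Union>C" "y0 \<in> \<Union>C" using S0 x0 by auto
    then show ?thesis using h_seg[OF S0(1) x0(1,3) a(4,5)] i unfolding x0(2,4) by metis
  qed
  ultimately show ?thesis unfolding simplicial_iso_def by auto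
qed

end

section \<open>Perverse strata\<close>

text \<open>The minimum of \<open>\<delta>\<close> is the maximum of the perversity
  \<open>-\<delta>\<close> that defines the strata. It is attained once, because
  \<open>\<delta>\<close> is injective and a chain has at most one simplex of each
  dimension.\<close>

definition chain_top :: "(nat \<Rightarrow> int) \<Rightarrow> 'a::euclidean_space set set \<Rightarrow> 'a set" where
  "chain_top \<delta> K = (THE S. is_arg_min (\<lambda>S. \<delta> (sdim S)) (\<lambda>S. S \<in> K) S)"

definition stratum_of :: "'a::euclidean_space set set \<Rightarrow> (nat \<Rightarrow> int) \<Rightarrow> 'a \<Rightarrow> 'a set" where
  "stratum_of C \<delta> x = chain_top \<delta> (carrier_chain C x)"

locale perverse_cx = simplicial_cx C for C :: "'a::euclidean_space set set" +
  fixes \<delta> :: "nat \<Rightarrow> int"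
  assumes perversity: "perversity \<delta>"
begin

sublocale face_poset "simplices C" vts \<delta>
proof
  show "finite (simplices C)" using finite_C by (simp add: simplices_def)
  fix S assume S: "S \<in> simplices C"
  show "finite (vts S)" using S vts_props by (simp add: simplices_def)
  show "vts S \<noteq> {}" using S vts_ne by blast
  show "S = T" if "T \<in> simplices C" "vts S = vts T" for T
    using that S vts_inj by (simp add: simplices_def)
  show "\<exists>T\<in>simplices C. vts T = A" if "A \<subseteq> vts S" "A \<noteq> {}" for A
    using vts_down[of S A] S that by (intro bexI[of _ "convex hull A"]) (auto simp: simplices_def)
qed (rule perversity)

abbreviation "X \<equiv> \<Union>C"
abbreviation "opn \<equiv> openin (top_of_set X)"
abbreviation "\<mu> \<equiv> stratum_of C \<delta>"
abbreviation "ch \<equiv> carrier_chain C"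
abbreviation "flags \<equiv> subdivision_chains C"
abbreviation "cell K \<equiv> {x \<in> X. ch x = K}"

lemma dim_sdim: "S \<in> simplices C \<Longrightarrow> dim S = sdim S"
  by (simp add: dim_def sdim_eq)

lemma lev_sdim: "S \<in> simplices C \<Longrightarrow> lev S = \<delta> (sdim S)"
  by (simp add: lev_def dim_sdim)

lemma inc_incident: "S \<in> simplices C \<Longrightarrow> T \<in> simplices C \<Longrightarrow> inc S T = incident S T"
  by (simp add: inc_def incident_iff simplices_def)

lemma arr_arrow: "arr = arrow C \<delta>"
  by (intro ext) (auto simp: arr_def arrow_def lev_sdim inc_incident)

lemma chain_inc': "K \<in> flags \<Longrightarrow> S \<in> K \<Longrightarrow> T \<in> K \<Longrightarrow> inc S T"
  using chain_inc by (simp add: inc_def)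

lemma chain_lev_inj: "K \<in> flags \<Longrightarrow> S \<in> K \<Longrightarrow> T \<in> K \<Longrightarrow> lev S = lev T \<Longrightarrow> S = T"
  using chain_inc' chain_in inc_lev_eq by metis

lemma is_top_iff:
  assumes "K \<in> flags"
  shows "is_arg_min (\<lambda>S. \<delta> (sdim S)) (\<lambda>S. S \<in> K) S \<longleftrightarrow> S \<in> K \<and> (\<forall>T\<in>K. lev S \<le> lev T)"
proof -
  have "\<delta> (sdim T) = lev T" if "T \<in> K" for T using lev_sdim chain_in[OF assms that] by simp
  then show ?thesis by (auto simp: is_arg_min_def not_less)
qed

lemma chain_top_eqI:
  assumes "K \<in> flags" "S \<in> K" "\<And>T. T \<in> K \<Longrightarrow> lev S \<le> lev T"
  shows "chain_top \<delta> K = S"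
  unfolding chain_top_def is_top_iff[OF assms(1)]
proof (rule the_equality)
  fix T assume T: "T \<in> K \<and> (\<forall>Ta\<in>K. lev T \<le> lev Ta)"
  then have "lev T = lev S" using assms by (meson antisym)
  then show "T = S" using chain_lev_inj[OF assms(1)] T assms(2) by blast
qed (use assms in auto)

lemma chain_top:
  assumes "K \<in> flags"
  shows "chain_top \<delta> K \<in> K" "\<And>T. T \<in> K \<Longrightarrow> lev (chain_top \<delta> K) \<le> lev T"
proof -
  have "finite K" "K \<noteq> {}" using chain_finite assms by (auto simp: subdivision_chains_def)
  then obtain S where S: "S \<in> K" "\<And>T. T \<in> K \<Longrightarrow> lev S \<le> lev T"
    using ex_least_value[of K lev] by blast
  then have "chain_top \<delta> K = S" using chain_top_eqI[OF assms] by blast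
  then show "chain_top \<delta> K \<in> K" "\<And>T. T \<in> K \<Longrightarrow> lev (chain_top \<delta> K) \<le> lev T" using S by auto
qed

lemma ch_chain: "x \<in> X \<Longrightarrow> ch x \<in> flags"
  by (rule carrier_chain_chain)

lemma chain_top_simplex: "K \<in> flags \<Longrightarrow> chain_top \<delta> K \<in> simplices C"
  using chain_top chain_in by blast

lemma mu_simplex: "x \<in> X \<Longrightarrow> \<mu> x \<in> simplices C"
  unfolding stratum_of_def by (intro chain_top_simplex ch_chain)

text \<open>Both tops belong to the larger chain and are therefore incident, and enlarging a chain
  can only lower the minimum. So a transition between the strata of nearby points is
  available.\<close>

lemma chain_top_mono:
  assumes "K \<in> flags" "K' \<in> flags" "K \<subseteq> K'"
  shows "inc (chain_top \<delta> K) (chain_top \<delta> K')" "lev (chain_top \<delta> K') \<le> lev (chain_top \<delta> K)"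
  using chain_top[OF assms(1)] chain_top[OF assms(2)] assms chain_inc' by blast+

lemma mu_mono:
  assumes "x \<in> X" "y \<in> X" "ch x \<subseteq> ch y"
  shows "inc (\<mu> x) (\<mu> y)" "lev (\<mu> y) \<le> lev (\<mu> x)"
  using chain_top_mono[OF ch_chain ch_chain] assms by (auto simp: stratum_of_def)

text \<open>The open simplices of the subdivision partition the polyhedron and each has a unique
  top, which turns the strata into the fibres of \<open>\<mu>\<close>.\<close>

lemma perverse_simplex_eq: "perverse_simplex C (\<lambda>k. - \<delta> k) S = {x \<in> X. \<mu> x = S}"
proof -
  have am: "is_arg_max (\<lambda>S'. - \<delta> (sdim S')) (\<lambda>S'. S' \<in> K) S \<longleftrightarrow> chain_top \<delta> K = S" if "K \<in> flags" for K
  proof -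
    have "is_arg_max (\<lambda>S'. - \<delta> (sdim S')) (\<lambda>S'. S' \<in> K) S \<longleftrightarrow> is_arg_min (\<lambda>S. \<delta> (sdim S)) (\<lambda>S. S \<in> K) S"
      by (simp add: is_arg_max_def is_arg_min_def)
    moreover have "chain_top \<delta> K = S \<longleftrightarrow> S \<in> K \<and> (\<forall>T\<in>K. lev S \<le> lev T)"
    proof
      assume "chain_top \<delta> K = S"
      then show "S \<in> K \<and> (\<forall>T\<in>K. lev S \<le> lev T)" using chain_top[OF that] by blast
    next
      assume "S \<in> K \<and> (\<forall>T\<in>K. lev S \<le> lev T)"
      then show "chain_top \<delta> K = S" by (intro chain_top_eqI[OF that]) blast+
    qed
    ultimately show ?thesis unfolding is_top_iff[OF that] by (rule trans[OF _ sym])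
  qed
  show ?thesis
  proof (intro equalityI subsetI)
    fix x assume "x \<in> perverse_simplex C (\<lambda>k. - \<delta> k) S"
    then obtain K where K: "x \<in> open_subdivision_simplex K" "K \<in> flags"
        "is_arg_max (\<lambda>S'. - \<delta> (sdim S')) (\<lambda>S'. S' \<in> K) S"
      unfolding perverse_simplex_def by blast
    then show "x \<in> {x \<in> X. \<mu> x = S}"
      using am[OF K(2)] carrier_chain_open_simplex[OF K(2,1)] by (simp add: stratum_of_def)
  next
    fix x assume x: "x \<in> {x \<in> X. \<mu> x = S}"
    then have "x \<in> open_subdivision_simplex (ch x)" "ch x \<in> flags" using carrier_chain_chain by auto
    moreover have "is_arg_max (\<lambda>S'. - \<delta> (sdim S')) (\<lambda>S'. S' \<in> ch x) S"
      using am[OF ch_chain] x by (simp add: stratum_of_def)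
    ultimately show "x \<in> perverse_simplex C (\<lambda>k. - \<delta> k) S" unfolding perverse_simplex_def by blast
  qed
qed

lemma opn_star: "x \<in> X \<Longrightarrow> opn {y \<in> X. ch x \<subseteq> ch y}"
  by (rule star_open) (auto simp: carrier_chain_def)

lemma opn_sub: "opn U \<Longrightarrow> U \<subseteq> X" by (rule openin_imp_subset)

lemma opn_ball: "opn (ball x e \<inter> X)"
  using openin_open_Int[of "ball x e" X] by (simp add: Int_commute)

text \<open>Small balls meet every open simplex of the subdivision in a convex set.\<close>

lemma good_neighbourhood:
  assumes U: "opn U" "x \<in> U"
  obtains W where "opn W" "x \<in> W" "W \<subseteq> U" "\<And>y. y \<in> W \<Longrightarrow> ch x \<subseteq> ch y"
    "\<And>K. K \<in> flags \<Longrightarrow> connected (W \<inter> cell K)"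
    "\<And>K. K \<in> flags \<Longrightarrow> ch x \<subseteq> K \<Longrightarrow> W \<inter> cell K \<noteq> {}"
proof -
  have x: "x \<in> X" using U opn_sub by blast
  have "opn (U \<inter> {y \<in> X. ch x \<subseteq> ch y})" using U opn_star[OF x] by (rule_tac openin_Int)
  note op = iffD1[OF openin_contains_ball this, THEN conjunct2]
  have "x \<in> U \<inter> {y \<in> X. ch x \<subseteq> ch y}" using U x by blast
  from bspec[OF op this] obtain e where e: "e > 0" "ball x e \<inter> X \<subseteq> U \<inter> {y \<in> X. ch x \<subseteq> ch y}"
    by blast
  define W where "W = ball x e \<inter> X"
  have eq: "W \<inter> cell K = ball x e \<inter> cell K" for K by (auto simp: W_def)
  show ?thesis
  proof (rule that)
    show "opn W" unfolding W_def by (rule opn_ball)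
    show "x \<in> W" using e x by (simp add: W_def)
    show "W \<subseteq> U" using e by (auto simp: W_def)
    show "\<And>y. y \<in> W \<Longrightarrow> ch x \<subseteq> ch y" using e by (auto simp: W_def)
    fix K assume K: "K \<in> flags"
    show "connected (W \<inter> cell K)"
      unfolding eq using cell_convex[OF K] by (intro convex_connected convex_Int convex_ball)
    show "W \<inter> cell K \<noteq> {}" if "ch x \<subseteq> K"
    proof -
      have "x \<in> closure (cell K)" using in_closure_cell[OF K x that] .
      then obtain y where "y \<in> cell K" "dist y x < e" using e(1) unfolding closure_approachable by blast
      then show ?thesis unfolding eq by (auto simp: dist_commute)
    qed
  qed
qed

text \<open>The form in which connectedness of strata and of open simplices is applied: the
  neighbourhoods are open in the polyhedron, not in the subset.\<close>

lemma const_on_connected: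
  assumes A: "connected A" "A \<subseteq> X" "a \<in> A" "b \<in> A"
    and loc: "\<And>x. x \<in> A \<Longrightarrow> \<exists>W. opn W \<and> x \<in> W \<and> (\<forall>y\<in>W \<inter> A. f y = f x)"
  shows "f a = f b"
proof (rule connected_local_const[OF A(1,3,4)], rule ballI)
  fix x assume x: "x \<in> A"
  then obtain W where W: "opn W" "x \<in> W" "\<forall>y\<in>W \<inter> A. f y = f x" using loc by blast
  obtain T where T: "open T" "W = X \<inter> T" using W(1) unfolding openin_open by blast
  have "eventually (\<lambda>y. y \<in> T) (at x within A)"
    using T W by (intro eventually_at_topological[THEN iffD2]) blast
  moreover have "eventually (\<lambda>y. y \<in> A) (at x within A)"
    by (auto simp: eventually_at_filter)
  ultimately show "eventually (\<lambda>b. f x = f b) (at x within A)"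
  proof eventually_elim
    case (elim y)
    then have "y \<in> W \<inter> A" using T(2) A(2) by blast
    then show ?case using W(3) by simp
  qed
qed

lemma cell_connected: "K \<in> flags \<Longrightarrow> connected (cell K)"
  using cell_convex convex_connected by blast

lemma singleton_chain: "S \<in> simplices C \<Longrightarrow> {S} \<in> flags"
  by (auto simp: subdivision_chains_def incident_iff simplices_def)

lemma mu_barycenter:
  assumes "S \<in> simplices C"
  shows "barycenter S \<in> X" "\<mu> (barycenter S) = S"
  using carrier_chain_barycenter[OF assms] chain_top(1)[OF singleton_chain[OF assms]]
  by (auto simp: stratum_of_def)

text \<open>A stratum is connected, since all its open simplices have the barycenter in their closure.\<close>

lemma stratum_connected:
  assumes S: "S \<in> simplices C"
  shows "connected {x \<in> X. \<mu> x = S}"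
proof -
  define \<K> where "\<K> = {K \<in> flags. chain_top \<delta> K = S}"
  have bS: "barycenter S \<in> X" "ch (barycenter S) = {S}" using carrier_chain_barycenter[OF S] by auto
  have "connected (insert (barycenter S) (cell K))" if K: "K \<in> \<K>" for K
  proof -
    have Kc: "K \<in> flags" "S \<in> K" using K chain_top by (auto simp: \<K>_def)
    then have "barycenter S \<in> closure (cell K)" using bS by (intro in_closure_cell) auto
    then show ?thesis
      by (intro connected_intermediate_closure[OF cell_connected[OF Kc(1)]])
        (use closure_subset[of "cell K"] in auto)
  qed
  then have "connected (\<Union>((\<lambda>K. insert (barycenter S) (cell K)) ` \<K>))"
    by (intro connected_Union) auto
  moreover have "\<Union>((\<lambda>K. insert (barycenter S) (cell K)) ` \<K>) = {x \<in> X. \<mu> x = S}"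
    using mu_barycenter[OF S] ch_chain by (auto simp: \<K>_def stratum_of_def)
  ultimately show ?thesis by simp
qed

end

section \<open>Sheaves of sections of linear algebra data\<close>

definition Tr :: "'a::euclidean_space set set \<Rightarrow> (nat \<Rightarrow> int) \<Rightarrow> ('a, 'f, 'v) lin_data \<Rightarrow> 'a set \<Rightarrow> 'a set \<Rightarrow> 'v \<Rightarrow> 'v" where
  "Tr C \<delta> S = transition (arrow C \<delta>) (Map S)"

text \<open>The clause on chains guarantees that \<open>Tr\<close> is used only between incident
  simplices along which the level does not rise; elsewhere its value is arbitrary.\<close>

definition sections ::
  "'a::euclidean_space set set \<Rightarrow> (nat \<Rightarrow> int) \<Rightarrow> ('a, 'f, 'v) lin_data \<Rightarrow> 'a set \<Rightarrow> ('a \<Rightarrow> 'v) set" where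
  "sections C \<delta> S U = {\<sigma> \<in> (\<Pi>\<^sub>E x\<in>U. carrier (Spc S (stratum_of C \<delta> x))).
     \<forall>x\<in>U. \<exists>W. openin (polyhedron_top C) W \<and> x \<in> W \<and> W \<subseteq> U \<and>
       (\<forall>y\<in>W. carrier_chain C x \<subseteq> carrier_chain C y \<and>
         \<sigma> y = Tr C \<delta> S (stratum_of C \<delta> x) (stratum_of C \<delta> y) (\<sigma> x))}"

text \<open>Sections of a sheaf have to be elements of the type of vectors, while the families in
  \<open>sections\<close> are functions of points. So a presheaf is described only up to a bijection
  \<open>\<nu>\<close> onto the families that is linear at every point and respects
  restriction.\<close>

definition represents ::
  "'f ring \<Rightarrow> 'a::euclidean_space set set \<Rightarrow> (nat \<Rightarrow> int) \<Rightarrow> ('a, 'f, 'v) lin_data \<Rightarrow>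
   ('a, 'f, 'w) presheaf \<Rightarrow> ('a set \<Rightarrow> 'w \<Rightarrow> 'a \<Rightarrow> 'v) \<Rightarrow> bool" where
  "represents F C \<delta> S A \<nu> \<longleftrightarrow> is_presheaf F (polyhedron_top C) A \<and>
     (\<forall>U. openin (polyhedron_top C) U \<longrightarrow>
        bij_betw (\<nu> U) (carrier (sec A U)) (sections C \<delta> S U) \<and>
        (\<forall>s\<in>carrier (sec A U). \<forall>t\<in>carrier (sec A U). \<forall>x\<in>U.
           \<nu> U (s \<oplus>\<^bsub>sec A U\<^esub> t) x = \<nu> U s x \<oplus>\<^bsub>Spc S (stratum_of C \<delta> x)\<^esub> \<nu> U t x) \<and>
        (\<forall>c\<in>carrier F. \<forall>s\<in>carrier (sec A U). \<forall>x\<in>U.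
           \<nu> U (c \<odot>\<^bsub>sec A U\<^esub> s) x = c \<odot>\<^bsub>Spc S (stratum_of C \<delta> x)\<^esub> \<nu> U s x)) \<and>
     (\<forall>U V. openin (polyhedron_top C) U \<and> openin (polyhedron_top C) V \<and> V \<subseteq> U \<longrightarrow>
        (\<forall>s\<in>carrier (sec A U). \<nu> V (res A U V s) = restrict (\<nu> U s) V))"

lemma vectorspace_closed:
  assumes "vectorspace F M"
  shows "x \<in> carrier M \<Longrightarrow> y \<in> carrier M \<Longrightarrow> x \<oplus>\<^bsub>M\<^esub> y \<in> carrier M"
    "c \<in> carrier F \<Longrightarrow> x \<in> carrier M \<Longrightarrow> c \<odot>\<^bsub>M\<^esub> x \<in> carrier M"
    "\<zero>\<^bsub>M\<^esub> \<in> carrier M"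
proof -
  interpret vectorspace F M by (rule assms)
  show "x \<in> carrier M \<Longrightarrow> y \<in> carrier M \<Longrightarrow> x \<oplus>\<^bsub>M\<^esub> y \<in> carrier M"
    "c \<in> carrier F \<Longrightarrow> x \<in> carrier M \<Longrightarrow> c \<odot>\<^bsub>M\<^esub> x \<in> carrier M"
    "\<zero>\<^bsub>M\<^esub> \<in> carrier M" by auto
qed

lemma module_homD:
  assumes "f \<in> module_hom F M N"
  shows "x \<in> carrier M \<Longrightarrow> f x \<in> carrier N"
    "x \<in> carrier M \<Longrightarrow> y \<in> carrier M \<Longrightarrow> f (x \<oplus>\<^bsub>M\<^esub> y) = f x \<oplus>\<^bsub>N\<^esub> f y"
    "c \<in> carrier F \<Longrightarrow> x \<in> carrier M \<Longrightarrow> f (c \<odot>\<^bsub>M\<^esub> x) = c \<odot>\<^bsub>N\<^esub> f x"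
  using assms by (auto simp: module_hom_def)

lemma module_hom_zero:
  assumes "f \<in> module_hom F M N" "vectorspace F M" "vectorspace F N"
  shows "f \<zero>\<^bsub>M\<^esub> = \<zero>\<^bsub>N\<^esub>"
proof -
  interpret M: vectorspace F M by (rule assms)
  interpret N: vectorspace F N by (rule assms)
  have z: "f \<zero>\<^bsub>M\<^esub> \<in> carrier N" using module_homD(1)[OF assms(1)] by simp
  have "f \<zero>\<^bsub>M\<^esub> \<oplus>\<^bsub>N\<^esub> f \<zero>\<^bsub>M\<^esub> = f \<zero>\<^bsub>M\<^esub>"
    using module_homD(2)[OF assms(1), of "\<zero>\<^bsub>M\<^esub>" "\<zero>\<^bsub>M\<^esub>"] by simp
  then show ?thesis using z by (metis N.l_zero N.zero_closed N.add.right_cancel)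
qed

section \<open>Families propagated by the transition maps\<close>

locale rep_data = perverse_cx C \<delta> for C :: "'a::euclidean_space set set" and \<delta> +
  fixes F :: "'f ring" and S :: "('a, 'f, 'v) lin_data"
  assumes S_obj: "S \<in> R_objects F C \<delta>"
begin

sublocale linear_rep "simplices C" vts \<delta> F "Spc S" "Map S"
proof (intro linear_rep.intro face_poset_axioms linear_rep_axioms.intro)
  fix D assume "D \<in> simplices C"
  then show "vectorspace F (Spc S D)" using S_obj by (simp add: R_objects_def fin_dim_vectorspace_def)
next
  fix D D' assume "arr D D'"
  then show "Map S D D' \<in> module_hom F (Spc S D) (Spc S D')"
    using S_obj unfolding arr_arrow by (simp add: R_objects_def)
next
  fix D A D' B x assume "arr D A" "arr A D'" "arr D B" "arr B D'" "x \<in> carrier (Spc S D)"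
  then show "Map S A D' (Map S D A x) = Map S B D' (Map S D B x)"
    using S_obj unfolding arr_arrow R_objects_def by blast
qed

lemma tr_Tr: "tr = Tr C \<delta> S" by (simp add: Tr_def arr_arrow)

abbreviation "T' x y \<equiv> Tr C \<delta> S (\<mu> x) (\<mu> y)"
abbreviation "sp x \<equiv> Spc S (\<mu> x)"

lemma sp_vs: "x \<in> X \<Longrightarrow> vectorspace F (sp x)"
  using L_vs mu_simplex by blast

lemma T_hom: "x \<in> X \<Longrightarrow> y \<in> X \<Longrightarrow> ch x \<subseteq> ch y \<Longrightarrow> T' x y \<in> module_hom F (sp x) (sp y)"
  using tr_hom mu_simplex mu_mono unfolding tr_Tr by blast

lemma T_refl: "x \<in> X \<Longrightarrow> \<mu> x = \<mu> y \<Longrightarrow> v \<in> carrier (sp x) \<Longrightarrow> T' x y v = v"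
  using tr_refl[of "\<mu> y" v] mu_simplex[of x] unfolding tr_Tr by simp

lemma T_trans:
  assumes "x \<in> X" "y \<in> X" "z \<in> X" "ch x \<subseteq> ch y" "ch y \<subseteq> ch z" "v \<in> carrier (sp x)"
  shows "T' y z (T' x y v) = T' x z v"
  using tr_trans[of "\<mu> x" "\<mu> y" "\<mu> z" v] mu_mono[OF assms(1,2,4)] mu_mono[OF assms(2,3,5)]
    mu_mono[OF assms(1,3)] assms mu_simplex unfolding tr_Tr by auto

abbreviation "\<Gamma> U \<equiv> sections C \<delta> S U"
abbreviation "star x \<equiv> {y \<in> X. ch x \<subseteq> ch y}"

lemma sectionsD:
  assumes "\<sigma> \<in> \<Gamma> U"
  shows "x \<in> U \<Longrightarrow> \<sigma> x \<in> carrier (sp x)" "x \<notin> U \<Longrightarrow> \<sigma> x = undefined"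
    "\<sigma> \<in> extensional U"
  using assms by (auto simp: sections_def PiE_def extensional_def)

lemma sections_local_ex:
  assumes "\<sigma> \<in> \<Gamma> U" "x \<in> U"
  shows "\<exists>W. opn W \<and> x \<in> W \<and> W \<subseteq> U \<and> (\<forall>y\<in>W. ch x \<subseteq> ch y \<and> \<sigma> y = T' x y (\<sigma> x))"
proof -
  have "\<forall>x\<in>U. \<exists>W. opn W \<and> x \<in> W \<and> W \<subseteq> U \<and> (\<forall>y\<in>W. ch x \<subseteq> ch y \<and> \<sigma> y = T' x y (\<sigma> x))"
    using assms(1) unfolding sections_def mem_Collect_eq by (rule conjunct2)
  then show ?thesis using assms(2) by (rule bspec)
qed

lemma sections_local:
  assumes "\<sigma> \<in> \<Gamma> U" "x \<in> U"
  obtains W where "opn W" "x \<in> W" "W \<subseteq> U" "\<And>y. y \<in> W \<Longrightarrow> ch x \<subseteq> ch y" "\<And>y. y \<in> W \<Longrightarrow> \<sigma> y = T' x y (\<sigma> x)"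
proof -
  obtain W where W: "opn W" "x \<in> W" "W \<subseteq> U" "\<forall>y\<in>W. ch x \<subseteq> ch y \<and> \<sigma> y = T' x y (\<sigma> x)"
    using sections_local_ex[OF assms] by (elim exE conjE) (rule that)
  show ?thesis
    by (rule that[OF W(1-3)]) (rule W(4)[THEN bspec, THEN conjunct1] W(4)[THEN bspec, THEN conjunct2], assumption)+
qed

lemma sectionsI:
  assumes "\<And>x. x \<in> U \<Longrightarrow> \<sigma> x \<in> carrier (sp x)" "\<sigma> \<in> extensional U"
    "\<And>x. x \<in> U \<Longrightarrow> \<exists>W. opn W \<and> x \<in> W \<and> W \<subseteq> U \<and> (\<forall>y\<in>W. ch x \<subseteq> ch y \<and> \<sigma> y = T' x y (\<sigma> x))"
  shows "\<sigma> \<in> \<Gamma> U"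
  unfolding sections_def mem_Collect_eq using assms by (intro conjI ballI PiE_I) (auto simp: extensional_def)

text \<open>A vector at \<open>x\<close> spreads to the open star of \<open>x\<close>.\<close>

lemma spread:
  assumes x: "x \<in> X" and v: "v \<in> carrier (sp x)"
  shows "(\<lambda>y\<in>star x. T' x y v) \<in> \<Gamma> (star x)" "(\<lambda>y\<in>star x. T' x y v) x = v"
proof -
  show "(\<lambda>y\<in>star x. T' x y v) x = v" using x v T_refl[of x x v] by simp
  show "(\<lambda>y\<in>star x. T' x y v) \<in> \<Gamma> (star x)"
  proof (rule sectionsI)
    fix y assume y: "y \<in> star x"
    then show "(\<lambda>y\<in>star x. T' x y v) y \<in> carrier (sp y)"
      using module_homD(1)[OF T_hom[of x y]] x v by simp
    show "\<exists>W. opn W \<and> y \<in> W \<and> W \<subseteq> star x \<and>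
      (\<forall>z\<in>W. ch y \<subseteq> ch z \<and> (\<lambda>y\<in>star x. T' x y v) z = T' y z ((\<lambda>y\<in>star x. T' x y v) y))"
    proof (intro exI conjI ballI)
      show "opn (star y)" using y by (intro opn_star) simp
      show "y \<in> star y" "star y \<subseteq> star x" using y by auto
      fix z assume z: "z \<in> star y"
      then show "ch y \<subseteq> ch z" by simp
      show "(\<lambda>y\<in>star x. T' x y v) z = T' y z ((\<lambda>y\<in>star x. T' x y v) y)"
        using T_trans[of x y z v] x y z v by auto
    qed
  qed simp
qed

text \<open>Near \<open>x\<close> a family is the image of its value at \<open>x\<close> under the
  transitions. Together with \<open>spread\<close> this identifies the stalk at \<open>x\<close>
  with the space attached to the stratum of \<open>x\<close>.\<close>

lemma sections_agree_near:
  assumes "\<sigma> \<in> \<Gamma> U" "\<tau> \<in> \<Gamma> U'" "x \<in> U" "x \<in> U'" "\<sigma> x = \<tau> x"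
  obtains W where "opn W" "x \<in> W" "W \<subseteq> U" "W \<subseteq> U'" "\<And>y. y \<in> W \<Longrightarrow> \<sigma> y = \<tau> y"
proof -
  obtain W1 where W1: "opn W1" "x \<in> W1" "W1 \<subseteq> U" "\<And>y. y \<in> W1 \<Longrightarrow> \<sigma> y = T' x y (\<sigma> x)"
    using sections_local[OF assms(1,3)] by metis
  obtain W2 where W2: "opn W2" "x \<in> W2" "W2 \<subseteq> U'" "\<And>y. y \<in> W2 \<Longrightarrow> \<tau> y = T' x y (\<tau> x)"
    using sections_local[OF assms(2,4)] by metis
  show ?thesis
  proof (rule that)
    show "opn (W1 \<inter> W2)" using W1(1) W2(1) by (rule openin_Int)
    show "x \<in> W1 \<inter> W2" "W1 \<inter> W2 \<subseteq> U" "W1 \<inter> W2 \<subseteq> U'" using W1 W2 by auto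
    show "\<And>y. y \<in> W1 \<inter> W2 \<Longrightarrow> \<sigma> y = \<tau> y" using W1(4) W2(4) assms(5) by simp
  qed
qed

text \<open>Transitions from a stratum to itself are identities. This local constancy is the source
  of constructibility.\<close>

lemma sections_loc_const:
  assumes "\<sigma> \<in> \<Gamma> U" "x \<in> U" "U \<subseteq> X"
  obtains W where "opn W" "x \<in> W" "W \<subseteq> U" "\<And>y. y \<in> W \<Longrightarrow> \<mu> y = \<mu> x \<Longrightarrow> \<sigma> y = \<sigma> x"
proof -
  obtain W where W: "opn W" "x \<in> W" "W \<subseteq> U" "\<And>y. y \<in> W \<Longrightarrow> \<sigma> y = T' x y (\<sigma> x)"
    using sections_local[OF assms(1,2)] by metis
  have "\<sigma> y = \<sigma> x" if "y \<in> W" "\<mu> y = \<mu> x" for y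
    using W(4)[OF that(1)] T_refl[of x y "\<sigma> x"] that sectionsD(1)[OF assms(1,2)] assms by auto
  then show ?thesis using that W by blast
qed

lemma sections_glue:
  assumes "\<sigma> \<in> extensional U" "\<And>x. x \<in> U \<Longrightarrow> \<exists>V. opn V \<and> x \<in> V \<and> V \<subseteq> U \<and> restrict \<sigma> V \<in> \<Gamma> V"
  shows "\<sigma> \<in> \<Gamma> U"
proof (rule sectionsI)
  fix x assume "x \<in> U"
  then obtain V where V: "opn V" "x \<in> V" "V \<subseteq> U" "restrict \<sigma> V \<in> \<Gamma> V" using assms by blast
  show "\<sigma> x \<in> carrier (sp x)" using sectionsD(1)[OF V(4,2)] V by simp
  obtain W where W: "opn W" "x \<in> W" "W \<subseteq> V" "\<And>y. y \<in> W \<Longrightarrow> ch x \<subseteq> ch y"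
    "\<And>y. y \<in> W \<Longrightarrow> restrict \<sigma> V y = T' x y (restrict \<sigma> V x)"
    using sections_local[OF V(4,2)] by metis
  then have *: "\<forall>y\<in>W. ch x \<subseteq> ch y \<and> \<sigma> y = T' x y (\<sigma> x)" using V by (metis restrict_apply' subsetD)
  show "\<exists>W. opn W \<and> x \<in> W \<and> W \<subseteq> U \<and> (\<forall>y\<in>W. ch x \<subseteq> ch y \<and> \<sigma> y = T' x y (\<sigma> x))"
    by (intro exI[of _ W] conjI W(1,2) order_trans[OF W(3) V(3)] *)
qed (rule assms(1))

lemma sections_restrict:
  assumes "\<sigma> \<in> \<Gamma> U" "opn V" "V \<subseteq> U"
  shows "restrict \<sigma> V \<in> \<Gamma> V"
proof (rule sectionsI)
  fix x assume x: "x \<in> V"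
  then show "restrict \<sigma> V x \<in> carrier (sp x)" using sectionsD(1)[OF assms(1)] assms by auto
  obtain W where W: "opn W" "x \<in> W" "W \<subseteq> U" "\<And>y. y \<in> W \<Longrightarrow> ch x \<subseteq> ch y" "\<And>y. y \<in> W \<Longrightarrow> \<sigma> y = T' x y (\<sigma> x)"
    using sections_local[OF assms(1)] x assms by (metis subsetD)
  show "\<exists>W. opn W \<and> x \<in> W \<and> W \<subseteq> V \<and> (\<forall>y\<in>W. ch x \<subseteq> ch y \<and> restrict \<sigma> V y = T' x y (restrict \<sigma> V x))"
  proof (intro exI conjI ballI)
    show "opn (W \<inter> V)" using W(1) assms(2) by (rule openin_Int)
    show "x \<in> W \<inter> V" "W \<inter> V \<subseteq> V" using W(2) x by auto
    fix y assume y: "y \<in> W \<inter> V"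
    then show "ch x \<subseteq> ch y" using W(4) by blast
    show "restrict \<sigma> V y = T' x y (restrict \<sigma> V x)" using W(5)[of y] y x by simp
  qed
qed simp

text \<open>One argument for sums and for scalar multiples: what matters is that the operation on
  the fibres commutes with the transitions.\<close>

lemma sections_map2:
  assumes "\<sigma> \<in> \<Gamma> U" "\<tau> \<in> \<Gamma> U" "U \<subseteq> X"
    and cl: "\<And>x v w. x \<in> X \<Longrightarrow> v \<in> carrier (sp x) \<Longrightarrow> w \<in> carrier (sp x) \<Longrightarrow> p x v w \<in> carrier (sp x)"
    and hm: "\<And>x y v w. x \<in> X \<Longrightarrow> y \<in> X \<Longrightarrow> ch x \<subseteq> ch y \<Longrightarrow> v \<in> carrier (sp x) \<Longrightarrow> w \<in> carrier (sp x) \<Longrightarrow>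
      T' x y (p x v w) = p y (T' x y v) (T' x y w)"
  shows "(\<lambda>x\<in>U. p x (\<sigma> x) (\<tau> x)) \<in> \<Gamma> U"
proof (rule sectionsI)
  fix x assume x: "x \<in> U"
  then have sx: "\<sigma> x \<in> carrier (sp x)" "\<tau> x \<in> carrier (sp x)" "x \<in> X"
    using sectionsD(1)[OF assms(1)] sectionsD(1)[OF assms(2)] assms(3) by blast+
  then show "(\<lambda>x\<in>U. p x (\<sigma> x) (\<tau> x)) x \<in> carrier (sp x)" using cl x by simp
  obtain W1 where W1: "opn W1" "x \<in> W1" "W1 \<subseteq> U" "\<And>y. y \<in> W1 \<Longrightarrow> ch x \<subseteq> ch y" "\<And>y. y \<in> W1 \<Longrightarrow> \<sigma> y = T' x y (\<sigma> x)"
    using sections_local[OF assms(1) x] by metis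
  obtain W2 where W2: "opn W2" "x \<in> W2" "W2 \<subseteq> U" "\<And>y. y \<in> W2 \<Longrightarrow> \<tau> y = T' x y (\<tau> x)"
    using sections_local[OF assms(2) x] by metis
  have "opn (W1 \<inter> W2)" using W1(1) W2(1) by (rule openin_Int)
  moreover have "(\<lambda>x\<in>U. p x (\<sigma> x) (\<tau> x)) y = T' x y ((\<lambda>x\<in>U. p x (\<sigma> x) (\<tau> x)) x)" if "y \<in> W1 \<inter> W2" for y
  proof -
    have y: "y \<in> U" "y \<in> X" "ch x \<subseteq> ch y" "\<sigma> y = T' x y (\<sigma> x)" "\<tau> y = T' x y (\<tau> x)"
      using that W1(3) assms(3) W1(4,5)[of y] W2(4)[of y] by auto
    show ?thesis using hm[OF sx(3) y(2,3) sx(1,2)] y(1) x by (simp add: y(4,5)[symmetric])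
  qed
  moreover have "x \<in> W1 \<inter> W2" "W1 \<inter> W2 \<subseteq> U" "\<And>y. y \<in> W1 \<inter> W2 \<Longrightarrow> ch x \<subseteq> ch y"
    using W1(2,3,4) W2(2) by auto
  ultimately show "\<exists>W. opn W \<and> x \<in> W \<and> W \<subseteq> U \<and> (\<forall>y\<in>W. ch x \<subseteq> ch y \<and>
      (\<lambda>x\<in>U. p x (\<sigma> x) (\<tau> x)) y = T' x y ((\<lambda>x\<in>U. p x (\<sigma> x) (\<tau> x)) x))"
    by (intro exI[of _ "W1 \<inter> W2"] conjI ballI)
qed simp

lemma sections_add:
  assumes "\<sigma> \<in> \<Gamma> U" "\<tau> \<in> \<Gamma> U" "U \<subseteq> X"
  shows "(\<lambda>x\<in>U. \<sigma> x \<oplus>\<^bsub>sp x\<^esub> \<tau> x) \<in> \<Gamma> U"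
  using sections_map2[OF assms, of "\<lambda>x v w. v \<oplus>\<^bsub>sp x\<^esub> w"] vectorspace_closed(1)[OF sp_vs]
    module_homD(2)[OF T_hom] by blast

lemma sections_smult:
  assumes "\<sigma> \<in> \<Gamma> U" "U \<subseteq> X" "c \<in> carrier F"
  shows "(\<lambda>x\<in>U. c \<odot>\<^bsub>sp x\<^esub> \<sigma> x) \<in> \<Gamma> U"
  using sections_map2[OF assms(1,1,2), of "\<lambda>x v w. c \<odot>\<^bsub>sp x\<^esub> v"] vectorspace_closed(2)[OF sp_vs assms(3)]
    module_homD(3)[OF T_hom assms(3)] by blast

lemma sections_zero:
  assumes "opn U"
  shows "(\<lambda>x\<in>U. \<zero>\<^bsub>sp x\<^esub>) \<in> \<Gamma> U"
proof (rule sectionsI)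
  fix x assume x: "x \<in> U"
  then have xX: "x \<in> X" using opn_sub assms by blast
  show "(\<lambda>x\<in>U. \<zero>\<^bsub>sp x\<^esub>) x \<in> carrier (sp x)" using x vectorspace_closed(3)[OF sp_vs[OF xX]] by simp
  show "\<exists>W. opn W \<and> x \<in> W \<and> W \<subseteq> U \<and> (\<forall>y\<in>W. ch x \<subseteq> ch y \<and>
      (\<lambda>x\<in>U. \<zero>\<^bsub>sp x\<^esub>) y = T' x y ((\<lambda>x\<in>U. \<zero>\<^bsub>sp x\<^esub>) x))"
  proof (intro exI conjI ballI)
    show "opn (U \<inter> star x)" using assms opn_star[OF xX] by (rule openin_Int)
    fix y assume "y \<in> U \<inter> star x"
    then show "(\<lambda>x\<in>U. \<zero>\<^bsub>sp x\<^esub>) y = T' x y ((\<lambda>x\<in>U. \<zero>\<^bsub>sp x\<^esub>) x)"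
      using x xX module_hom_zero[OF T_hom[of x y] sp_vs sp_vs] by simp
  qed (use x xX in auto)
qed simp

end

text \<open>The morphism that acts on the stalks by the components of \<open>f\<close>, read through
  the bijections of two representing pairs. For the identity of one object it compares two
  presheaves representing the same data.\<close>

definition rep_hom ::
  "'a::euclidean_space set set \<Rightarrow> (nat \<Rightarrow> int) \<Rightarrow> ('a, 'f, 'w) presheaf \<Rightarrow> ('a set \<Rightarrow> 'w \<Rightarrow> 'a \<Rightarrow> 'v) \<Rightarrow>
   ('a, 'f, 'u) presheaf \<Rightarrow> ('a set \<Rightarrow> 'u \<Rightarrow> 'a \<Rightarrow> 'z) \<Rightarrow> ('a set \<Rightarrow> 'v \<Rightarrow> 'z) \<Rightarrow> 'a set \<Rightarrow> 'w \<Rightarrow> 'u" where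
  "rep_hom C \<delta> A \<nu> B \<nu>' f = (\<lambda>U\<in>{U. openin (polyhedron_top C) U}. \<lambda>s\<in>carrier (sec A U).
     inv_into (carrier (sec B U)) (\<nu>' U) (\<lambda>x\<in>U. f (stratum_of C \<delta> x) (\<nu> U s x)))"

context rep_data
begin

lemma rep_vs: "represents F C \<delta> S A \<nu> \<Longrightarrow> opn U \<Longrightarrow> vectorspace F (sec A U)"
  by (simp add: represents_def is_presheaf_def)

lemma rep_bij: "represents F C \<delta> S A \<nu> \<Longrightarrow> opn U \<Longrightarrow> bij_betw (\<nu> U) (carrier (sec A U)) (\<Gamma> U)"
  by (simp add: represents_def)

lemma rep_in: "represents F C \<delta> S A \<nu> \<Longrightarrow> opn U \<Longrightarrow> s \<in> carrier (sec A U) \<Longrightarrow> \<nu> U s \<in> \<Gamma> U"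
  using rep_bij bij_betwE by blast

lemma rep_inj: "\<lbrakk>represents F C \<delta> S A \<nu>; opn U; s \<in> carrier (sec A U); t \<in> carrier (sec A U); \<nu> U s = \<nu> U t\<rbrakk> \<Longrightarrow> s = t"
  using rep_bij[of A \<nu> U] by (auto simp: bij_betw_def dest: inj_onD)

lemma rep_inv:
  assumes "represents F C \<delta> S A \<nu>" "opn U" "\<sigma> \<in> \<Gamma> U"
  shows "inv_into (carrier (sec A U)) (\<nu> U) \<sigma> \<in> carrier (sec A U)"
    "\<nu> U (inv_into (carrier (sec A U)) (\<nu> U) \<sigma>) = \<sigma>"
  using rep_bij[OF assms(1,2)] assms(3) by (auto simp: bij_betw_def f_inv_into_f inv_into_into)

lemma rep_ext: "represents F C \<delta> S A \<nu> \<Longrightarrow> opn U \<Longrightarrow> s \<in> carrier (sec A U) \<Longrightarrow> \<nu> U s \<in> extensional U"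
  by (rule sectionsD(3)[OF rep_in])

lemma rep_add:
  assumes "represents F C \<delta> S A \<nu>" "opn U" "s \<in> carrier (sec A U)" "t \<in> carrier (sec A U)"
  shows "\<nu> U (s \<oplus>\<^bsub>sec A U\<^esub> t) = (\<lambda>x\<in>U. \<nu> U s x \<oplus>\<^bsub>sp x\<^esub> \<nu> U t x)"
proof
  fix x show "\<nu> U (s \<oplus>\<^bsub>sec A U\<^esub> t) x = (\<lambda>x\<in>U. \<nu> U s x \<oplus>\<^bsub>sp x\<^esub> \<nu> U t x) x"
  proof (cases "x \<in> U")
    case True
    have "\<forall>s\<in>carrier (sec A U). \<forall>t\<in>carrier (sec A U). \<forall>x\<in>U.
        \<nu> U (s \<oplus>\<^bsub>sec A U\<^esub> t) x = \<nu> U s x \<oplus>\<^bsub>sp x\<^esub> \<nu> U t x"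
      using assms(1,2) by (simp add: represents_def)
    then show ?thesis using True assms(3,4) by simp
  next
    case False
    then show ?thesis
      using extensional_arb[OF rep_ext[OF assms(1,2) vectorspace_closed(1)[OF rep_vs[OF assms(1,2)] assms(3,4)]]]
      by simp
  qed
qed

lemma rep_smult:
  assumes "represents F C \<delta> S A \<nu>" "opn U" "s \<in> carrier (sec A U)" "c \<in> carrier F"
  shows "\<nu> U (c \<odot>\<^bsub>sec A U\<^esub> s) = (\<lambda>x\<in>U. c \<odot>\<^bsub>sp x\<^esub> \<nu> U s x)"
proof
  fix x show "\<nu> U (c \<odot>\<^bsub>sec A U\<^esub> s) x = (\<lambda>x\<in>U. c \<odot>\<^bsub>sp x\<^esub> \<nu> U s x) x"
  proof (cases "x \<in> U")
    case True
    have "\<forall>c\<in>carrier F. \<forall>s\<in>carrier (sec A U). \<forall>x\<in>U.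
        \<nu> U (c \<odot>\<^bsub>sec A U\<^esub> s) x = c \<odot>\<^bsub>sp x\<^esub> \<nu> U s x"
      using assms(1,2) by (simp add: represents_def)
    then show ?thesis using True assms(3,4) by simp
  next
    case False
    then show ?thesis
      using extensional_arb[OF rep_ext[OF assms(1,2) vectorspace_closed(2)[OF rep_vs[OF assms(1,2)] assms(4,3)]]]
      by simp
  qed
qed

lemma rep_res:
  assumes "represents F C \<delta> S A \<nu>" "opn U" "opn V" "V \<subseteq> U" "s \<in> carrier (sec A U)"
  shows "res A U V s \<in> carrier (sec A V)" "\<nu> V (res A U V s) = restrict (\<nu> U s) V"
proof -
  have "is_presheaf F (polyhedron_top C) A" using assms(1) by (simp add: represents_def)
  then have "\<forall>U V. opn U \<and> opn V \<and> V \<subseteq> U \<longrightarrow> res A U V \<in> module_hom F (sec A U) (sec A V)"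
    by (simp add: is_presheaf_def)
  then have "res A U V \<in> module_hom F (sec A U) (sec A V)" using assms(2-4) by simp
  then show "res A U V s \<in> carrier (sec A V)" using assms(5) by (rule module_homD(1))
  have "\<forall>U V. opn U \<and> opn V \<and> V \<subseteq> U \<longrightarrow> (\<forall>s\<in>carrier (sec A U). \<nu> V (res A U V s) = restrict (\<nu> U s) V)"
    using assms(1) by (simp add: represents_def)
  then show "\<nu> V (res A U V s) = restrict (\<nu> U s) V" using assms(2-5) by simp
qed

text \<open>The test section by which a morphism of sheaves is recovered from its effect on
  sections; it lives on the open star of \<open>x\<close>.\<close>

definition through where
  "through A \<nu> x v = inv_into (carrier (sec A (star x))) (\<nu> (star x)) (\<lambda>y\<in>star x. T' x y v)"

lemma through:
  assumes r: "represents F C \<delta> S A \<nu>" and x: "x \<in> X" and v: "v \<in> carrier (sp x)"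
  shows "through A \<nu> x v \<in> carrier (sec A (star x))" "\<nu> (star x) (through A \<nu> x v) x = v"
    "y \<in> star x \<Longrightarrow> \<nu> (star x) (through A \<nu> x v) y = T' x y v"
  using rep_inv[OF r opn_star[OF x] spread(1)[OF x v]] spread(2)[OF x v] by (auto simp: through_def)

end

section \<open>Morphisms of data and morphisms of the represented sheaves\<close>

locale rep_pair = A: rep_data C \<delta> F S + B: rep_data C \<delta> F T
  for C :: "'a::euclidean_space set set" and \<delta> and F :: "'f ring"
    and S :: "('a, 'f, 'v) lin_data" and T :: "('a, 'f, 'v) lin_data"
begin

lemma hom_lin:
  assumes "f \<in> Hom (R_cat F C \<delta>) S T" "D \<in> simplices C"
  shows "f D \<in> module_hom F (Spc S D) (Spc T D)" "f D \<in> extensional (carrier (Spc S D))"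
  using assms by (auto simp: R_cat_def Lin_def PiE_def Pi_def)

lemma hom_map:
  assumes "f \<in> Hom (R_cat F C \<delta>) S T" "arrow C \<delta> D D'" "v \<in> carrier (Spc S D)"
  shows "f D' (Map S D D' v) = Map T D D' (f D v)"
  using assms by (auto simp: R_cat_def)

text \<open>The same sequence of arrows carries a composite for \<open>S\<close> and one for
  \<open>T\<close>, and commutation with single arrows adds up along it. Independence of the path
  then gives commutation with the transitions.\<close>

lemma hom_path:
  assumes f: "f \<in> Hom (R_cat F C \<delta>) S T"
  shows "path_map (arrow C \<delta>) (Map S) D D' g \<Longrightarrow> D \<in> simplices C \<Longrightarrow>
    \<exists>g'. path_map (arrow C \<delta>) (Map T) D D' g' \<and> (\<forall>v\<in>carrier (Spc S D). f D' (g v) = g' (f D v))"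
proof (induction rule: path_map.induct)
  case (path_refl D)
  show ?case by (intro exI[of _ id] conjI path_map.path_refl) simp
next
  case (path_step D E D' g)
  have E: "E \<in> simplices C" using path_step(1) by (simp add: arrow_def)
  then obtain g' where g': "path_map (arrow C \<delta>) (Map T) E D' g'" "\<forall>v\<in>carrier (Spc S E). f D' (g v) = g' (f E v)"
    using path_step.IH by blast
  have "f D' ((g \<circ> Map S D E) v) = (g' \<circ> Map T D E) (f D v)" if v: "v \<in> carrier (Spc S D)" for v
  proof -
    have "Map S D E v \<in> carrier (Spc S E)"
      using module_homD(1)[OF A.mp_hom[of D E] v] path_step(1) by (simp add: A.arr_arrow)
    then show ?thesis using g'(2) hom_map[OF f path_step(1) v] by simp
  qed
  then show ?case using path_map.path_step[OF path_step(1) g'(1)] by blast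
qed

lemma hom_T:
  assumes f: "f \<in> Hom (R_cat F C \<delta>) S T" and x: "x \<in> A.X" "y \<in> A.X" "carrier_chain C x \<subseteq> carrier_chain C y"
    and v: "v \<in> carrier (A.sp x)"
  shows "f (A.\<mu> y) (A.T' x y v) = B.T' x y (f (A.\<mu> x) v)"
proof -
  have m: "A.\<mu> x \<in> simplices C" "A.\<mu> y \<in> simplices C" using A.mu_simplex x by auto
  have p: "A.rp (A.\<mu> x) (A.\<mu> y) (A.T' x y)"
    using A.tr_path[OF m A.mu_mono[OF x]] unfolding A.tr_Tr .
  obtain g' where g': "path_map (arrow C \<delta>) (Map T) (A.\<mu> x) (A.\<mu> y) g'"
      "f (A.\<mu> y) (A.T' x y v) = g' (f (A.\<mu> x) v)"
    using hom_path[OF f p[unfolded A.arr_arrow] m(1)] v by blast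
  have "f (A.\<mu> x) v \<in> carrier (B.sp x)" using module_homD(1)[OF hom_lin(1)[OF f m(1)] v] .
  then show ?thesis using B.tr_eq[of "A.\<mu> x" "A.\<mu> y" g'] g' m unfolding A.arr_arrow Tr_def by simp
qed

lemma hom_push:
  assumes f: "f \<in> Hom (R_cat F C \<delta>) S T" and s: "\<sigma> \<in> A.\<Gamma> U" and U: "U \<subseteq> A.X"
  shows "(\<lambda>x\<in>U. f (A.\<mu> x) (\<sigma> x)) \<in> B.\<Gamma> U"
proof (rule B.sectionsI)
  fix x assume x: "x \<in> U"
  then have xX: "x \<in> A.X" using U by blast
  have sx: "\<sigma> x \<in> carrier (A.sp x)" using A.sectionsD(1)[OF s x] .
  show "(\<lambda>x\<in>U. f (A.\<mu> x) (\<sigma> x)) x \<in> carrier (B.sp x)"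
    using module_homD(1)[OF hom_lin(1)[OF f A.mu_simplex[OF xX]] sx] x by simp
  obtain W where W: "A.opn W" "x \<in> W" "W \<subseteq> U" "\<And>y. y \<in> W \<Longrightarrow> carrier_chain C x \<subseteq> carrier_chain C y"
    "\<And>y. y \<in> W \<Longrightarrow> \<sigma> y = A.T' x y (\<sigma> x)"
    using A.sections_local[OF s x] by metis
  show "\<exists>W. A.opn W \<and> x \<in> W \<and> W \<subseteq> U \<and> (\<forall>y\<in>W. carrier_chain C x \<subseteq> carrier_chain C y \<and>
    (\<lambda>x\<in>U. f (A.\<mu> x) (\<sigma> x)) y = B.T' x y ((\<lambda>x\<in>U. f (A.\<mu> x) (\<sigma> x)) x))"
  proof (intro exI[of _ W] conjI W(1-3) ballI)
    fix y assume y: "y \<in> W"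
    show "carrier_chain C x \<subseteq> carrier_chain C y" using W(4) y .
    have yU: "y \<in> U" "y \<in> A.X" using y W(3) U by auto
    have "f (A.\<mu> y) (\<sigma> y) = B.T' x y (f (A.\<mu> x) (\<sigma> x))"
      using hom_T[OF f xX yU(2) W(4)[OF y] sx] W(5)[OF y] by simp
    then show "(\<lambda>x\<in>U. f (A.\<mu> x) (\<sigma> x)) y = B.T' x y ((\<lambda>x\<in>U. f (A.\<mu> x) (\<sigma> x)) x)"
      using x yU by simp
  qed
qed simp

lemma rep_hom_apply:
  assumes "represents F C \<delta> S P \<nu>" "represents F C \<delta> T Q \<nu>'"
    and f: "f \<in> Hom (R_cat F C \<delta>) S T" and U: "A.opn U" and s: "s \<in> carrier (sec P U)"
  shows "rep_hom C \<delta> P \<nu> Q \<nu>' f U s \<in> carrier (sec Q U)"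
    "\<nu>' U (rep_hom C \<delta> P \<nu> Q \<nu>' f U s) = (\<lambda>x\<in>U. f (A.\<mu> x) (\<nu> U s x))"
  using B.rep_inv[OF assms(2) U hom_push[OF f A.rep_in[OF assms(1) U s] A.opn_sub[OF U]]] U s
  by (auto simp: rep_hom_def)

text \<open>Linearity and naturality are equations between sections. As \<open>\<nu>'\<close> is
  injective they may be checked on families, point by point, where they are the linearity of the
  components of \<open>f\<close>.\<close>

lemma rep_hom_in:
  assumes r: "represents F C \<delta> S P \<nu>" "represents F C \<delta> T Q \<nu>'"
    and f: "f \<in> Hom (R_cat F C \<delta>) S T"
  shows "rep_hom C \<delta> P \<nu> Q \<nu>' f \<in> sheaf_homs F (polyhedron_top C) P Q"
proof -
  let ?h = "rep_hom C \<delta> P \<nu> Q \<nu>' f"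
  note ap = rep_hom_apply[OF r f]
  have fl: "f (A.\<mu> x) \<in> module_hom F (A.sp x) (B.sp x)" if "x \<in> A.X" for x
    using hom_lin(1)[OF f A.mu_simplex[OF that]] .
  have val: "\<nu> U s x \<in> carrier (A.sp x)" if "A.opn U" "s \<in> carrier (sec P U)" "x \<in> U" for U s x
    using A.sectionsD(1)[OF A.rep_in[OF r(1) that(1,2)] that(3)] .
  have lin: "?h U \<in> Lin F (sec P U) (sec Q U)" if U: "A.opn U" for U
  proof -
    have UX: "U \<subseteq> A.X" using A.opn_sub[OF U] .
    have cl: "s \<oplus>\<^bsub>sec P U\<^esub> t \<in> carrier (sec P U)" "c \<odot>\<^bsub>sec P U\<^esub> s \<in> carrier (sec P U)"
      if "s \<in> carrier (sec P U)" "t \<in> carrier (sec P U)" "c \<in> carrier F" for s t c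
      using vectorspace_closed[OF A.rep_vs[OF r(1) U]] that by auto
    have cl': "s \<oplus>\<^bsub>sec Q U\<^esub> t \<in> carrier (sec Q U)" "c \<odot>\<^bsub>sec Q U\<^esub> s \<in> carrier (sec Q U)"
      if "s \<in> carrier (sec Q U)" "t \<in> carrier (sec Q U)" "c \<in> carrier F" for s t c
      using vectorspace_closed[OF B.rep_vs[OF r(2) U]] that by auto
    have "?h U \<in> module_hom F (sec P U) (sec Q U)"
      unfolding module_hom_def
    proof (intro CollectI conjI allI impI Pi_I, goal_cases)
      case (1 s)
      then show ?case using ap(1)[OF U] by blast
    next
      case (2 s t)
      then have st: "s \<in> carrier (sec P U)" "t \<in> carrier (sec P U)" by auto
      have stc: "s \<oplus>\<^bsub>sec P U\<^esub> t \<in> carrier (sec P U)"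
        using vectorspace_closed(1)[OF A.rep_vs[OF r(1) U] st] .
      have hc: "?h U s \<oplus>\<^bsub>sec Q U\<^esub> ?h U t \<in> carrier (sec Q U)"
        using vectorspace_closed(1)[OF B.rep_vs[OF r(2) U] ap(1)[OF U st(1)] ap(1)[OF U st(2)]] .
      show ?case
      proof (rule B.rep_inj[OF r(2) U ap(1)[OF U stc] hc], rule ext)
        fix x
        show "\<nu>' U (?h U (s \<oplus>\<^bsub>sec P U\<^esub> t)) x = \<nu>' U (?h U s \<oplus>\<^bsub>sec Q U\<^esub> ?h U t) x"
          unfolding ap(2)[OF U stc] B.rep_add[OF r(2) U ap(1)[OF U st(1)] ap(1)[OF U st(2)]]
            ap(2)[OF U st(1)] ap(2)[OF U st(2)] A.rep_add[OF r(1) U st]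
        proof (cases "x \<in> U")
          case True
          then show "(\<lambda>x\<in>U. f (A.\<mu> x) ((\<lambda>x\<in>U. \<nu> U s x \<oplus>\<^bsub>A.sp x\<^esub> \<nu> U t x) x)) x =
            (\<lambda>x\<in>U. (\<lambda>x\<in>U. f (A.\<mu> x) (\<nu> U s x)) x \<oplus>\<^bsub>B.sp x\<^esub> (\<lambda>x\<in>U. f (A.\<mu> x) (\<nu> U t x)) x) x"
            using module_homD(2)[OF fl[OF subsetD[OF UX True]] val[OF U st(1) True] val[OF U st(2) True]] by simp
        qed simp
      qed
    next
      case (3 c s)
      then have st: "s \<in> carrier (sec P U)" "c \<in> carrier F" by auto
      have stc: "c \<odot>\<^bsub>sec P U\<^esub> s \<in> carrier (sec P U)"
        using vectorspace_closed(2)[OF A.rep_vs[OF r(1) U] st(2,1)] .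
      have hc: "c \<odot>\<^bsub>sec Q U\<^esub> ?h U s \<in> carrier (sec Q U)"
        using vectorspace_closed(2)[OF B.rep_vs[OF r(2) U] st(2) ap(1)[OF U st(1)]] .
      show ?case
      proof (rule B.rep_inj[OF r(2) U ap(1)[OF U stc] hc], rule ext)
        fix x
        show "\<nu>' U (?h U (c \<odot>\<^bsub>sec P U\<^esub> s)) x = \<nu>' U (c \<odot>\<^bsub>sec Q U\<^esub> ?h U s) x"
          unfolding ap(2)[OF U stc] B.rep_smult[OF r(2) U ap(1)[OF U st(1)] st(2)]
            ap(2)[OF U st(1)] A.rep_smult[OF r(1) U st]
        proof (cases "x \<in> U")
          case True
          then show "(\<lambda>x\<in>U. f (A.\<mu> x) ((\<lambda>x\<in>U. c \<odot>\<^bsub>A.sp x\<^esub> \<nu> U s x) x)) x =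
            (\<lambda>x\<in>U. c \<odot>\<^bsub>B.sp x\<^esub> (\<lambda>x\<in>U. f (A.\<mu> x) (\<nu> U s x)) x) x"
            using module_homD(3)[OF fl[OF subsetD[OF UX True]] st(2) val[OF U st(1) True]] by simp
        qed simp
      qed
    qed
    moreover have "?h U \<in> extensional (carrier (sec P U))" using U by (simp add: rep_hom_def)
    ultimately show ?thesis by (simp add: Lin_def)
  qed
  have nat: "?h V (res P U V s) = res Q U V (?h U s)"
    if U: "A.opn U" "A.opn V" "V \<subseteq> U" "s \<in> carrier (sec P U)" for U V s
  proof (rule B.rep_inj[OF r(2) U(2)])
    note rs = A.rep_res[OF r(1) U]
    show "?h V (res P U V s) \<in> carrier (sec Q V)" using ap(1)[OF U(2) rs(1)] .
    note rs' = B.rep_res[OF r(2) U(1-3) ap(1)[OF U(1,4)]]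
    show "res Q U V (?h U s) \<in> carrier (sec Q V)" using rs'(1) .
    show "\<nu>' V (?h V (res P U V s)) = \<nu>' V (res Q U V (?h U s))"
      unfolding rs'(2) ap(2)[OF U(2) rs(1)] rs(2) ap(2)[OF U(1,4)]
      by (rule ext) (use U(3) in auto)
  qed
  have "?h \<in> (\<Pi>\<^sub>E U\<in>{U. A.opn U}. Lin F (sec P U) (sec Q U))"
    using lin by (intro PiE_I) (auto simp: rep_hom_def)
  then show ?thesis unfolding sheaf_homs_def using nat by blast
qed

end

declare Union_iff [simp del]

lemma (in perverse_cx) pair_chain:
  assumes "S \<in> simplices C" "T \<in> simplices C" "inc S T"
  shows "{S, T} \<in> flags"
  using assms incident_iff[of S T] incident_iff[of T S] incident_iff[of S S] incident_iff[of T T]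
  by (auto simp: subdivision_chains_def simplices_def inc_def)

text \<open>Used to pick points with a prescribed chain arbitrarily close to
  \<open>x\<close>.\<close>

lemma (in perverse_cx) cell_meets:
  assumes "opn W" "x \<in> W" "K \<in> flags" "ch x \<subseteq> K"
  shows "\<exists>y. y \<in> W \<and> y \<in> X \<and> ch y = K"
proof (rule good_neighbourhood[OF assms(1,2)])
  fix W' assume W': "W' \<subseteq> W" and "\<And>K. K \<in> flags \<Longrightarrow> ch x \<subseteq> K \<Longrightarrow> W' \<inter> cell K \<noteq> {}"
  from this(2)[OF assms(3,4)] show ?thesis using W' by blast
qed

text \<open>Stated for arbitrary representing pairs, so that inverses of comparison maps and
  naturality squares become computations in the category of data.\<close>

lemma rep_hom_comp:
  fixes P Q R :: "('a::euclidean_space, 'f, 'v) presheaf"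
  assumes "rep_pair C \<delta> F S T"
    and r: "represents F C \<delta> S P \<nu>" "represents F C \<delta> T Q \<nu>'"
    and f: "f \<in> Hom (R_cat F C \<delta>) S T"
  shows "Cmp (Sh_c F C \<delta>) P Q R (rep_hom C \<delta> Q \<nu>' R \<nu>'' g) (rep_hom C \<delta> P \<nu> Q \<nu>' f) =
    rep_hom C \<delta> P \<nu> R \<nu>'' (Cmp (R_cat F C \<delta>) S T U g f)"
proof (rule ext, rule ext)
  interpret rep_pair C \<delta> F S T by fact
  fix V s
  show "Cmp (Sh_c F C \<delta>) P Q R (rep_hom C \<delta> Q \<nu>' R \<nu>'' g) (rep_hom C \<delta> P \<nu> Q \<nu>' f) V s =
    rep_hom C \<delta> P \<nu> R \<nu>'' (Cmp (R_cat F C \<delta>) S T U g f) V s"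
  proof (cases "A.opn V \<and> s \<in> carrier (sec P V)")
    case True
    then have V: "A.opn V" and s: "s \<in> carrier (sec P V)" by auto
    note ap = rep_hom_apply[OF r f V s]
    have "(\<lambda>x\<in>V. g (A.\<mu> x) (\<nu>' V (rep_hom C \<delta> P \<nu> Q \<nu>' f V s) x)) =
      (\<lambda>x\<in>V. Cmp (R_cat F C \<delta>) S T U g f (A.\<mu> x) (\<nu> V s x))"
    proof
      fix x
      show "(\<lambda>x\<in>V. g (A.\<mu> x) (\<nu>' V (rep_hom C \<delta> P \<nu> Q \<nu>' f V s) x)) x =
        (\<lambda>x\<in>V. Cmp (R_cat F C \<delta>) S T U g f (A.\<mu> x) (\<nu> V s x)) x"
      proof (cases "x \<in> V")
        case True
        then have "A.\<mu> x \<in> simplices C" using A.mu_simplex A.opn_sub[OF V] by blast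
        then show ?thesis
          using True A.sectionsD(1)[OF A.rep_in[OF r(1) V s] True]
          by (simp add: ap(2) R_cat_def compose_def)
      qed simp
    qed
    then show ?thesis using V s ap(1) by (simp add: Sh_c_def compose_def rep_hom_def)
  qed (auto simp: Sh_c_def compose_def rep_hom_def)
qed

lemma rep_hom_id:
  fixes P :: "('a::euclidean_space, 'f, 'v) presheaf"
  assumes "rep_data C \<delta> F S" and r: "represents F C \<delta> S P \<nu>"
  shows "rep_hom C \<delta> P \<nu> P \<nu> (Idn (R_cat F C \<delta>) S) = Idn (Sh_c F C \<delta>) P"
proof (rule ext, rule ext)
  interpret rep_data C \<delta> F S by fact
  fix V s
  show "rep_hom C \<delta> P \<nu> P \<nu> (Idn (R_cat F C \<delta>) S) V s = Idn (Sh_c F C \<delta>) P V s"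
  proof (cases "opn V \<and> s \<in> carrier (sec P V)")
    case True
    then have V: "opn V" and s: "s \<in> carrier (sec P V)" by auto
    have "(\<lambda>x\<in>V. Idn (R_cat F C \<delta>) S (\<mu> x) (\<nu> V s x)) = \<nu> V s"
    proof
      fix x
      show "(\<lambda>x\<in>V. Idn (R_cat F C \<delta>) S (\<mu> x) (\<nu> V s x)) x = \<nu> V s x"
      proof (cases "x \<in> V")
        case True
        then have "\<mu> x \<in> simplices C" using mu_simplex opn_sub[OF V] by blast
        then show ?thesis
          using True sectionsD(1)[OF rep_in[OF r V s] True] by (simp add: R_cat_def)
      qed (simp add: sectionsD(2)[OF rep_in[OF r V s]])
    qed
    moreover have "inv_into (carrier (sec P V)) (\<nu> V) (\<nu> V s) = s"
      using bij_betw_imp_inj_on[OF rep_bij[OF r V]] s by (rule inv_into_f_f)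
    ultimately show ?thesis using V s by (simp add: Sh_c_def rep_hom_def)
  qed (auto simp: Sh_c_def rep_hom_def)
qed

context rep_pair
begin

text \<open>The component at \<open>D\<close> is visible at the barycenter of \<open>D\<close>,
  which lies in the stratum of \<open>D\<close>: evaluate there the image of the section through
  \<open>v\<close>.\<close>

lemma rep_hom_faithful:
  assumes r: "represents F C \<delta> S P \<nu>" "represents F C \<delta> T Q \<nu>'"
    and f: "f \<in> Hom (R_cat F C \<delta>) S T" and g: "g \<in> Hom (R_cat F C \<delta>) S T"
    and eq: "rep_hom C \<delta> P \<nu> Q \<nu>' f = rep_hom C \<delta> P \<nu> Q \<nu>' g"
  shows "f = g"
proof
  fix D
  show "f D = g D"
  proof (cases "D \<in> simplices C")
    case D: True
    show ?thesis
    proof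
      fix v show "f D v = g D v"
      proof (cases "v \<in> carrier (Spc S D)")
        case v: True
        define x where "x = barycenter D"
        have x: "x \<in> A.X" "A.\<mu> x = D" using A.mu_barycenter[OF D] by (auto simp: x_def)
        have v': "v \<in> carrier (A.sp x)" using v x by simp
        note t = A.through[OF r(1) x(1) v']
        note op = A.opn_star[OF x(1)]
        have xs: "x \<in> A.star x" using x by simp
        have "\<nu>' (A.star x) (rep_hom C \<delta> P \<nu> Q \<nu>' k (A.star x) (A.through P \<nu> x v)) x = k D v"
          if k: "k \<in> Hom (R_cat F C \<delta>) S T" for k
          unfolding rep_hom_apply(2)[OF r k op t(1)] restrict_apply'[OF xs] t(2) x(2) by (rule refl)
        from this[OF f] this[OF g] show ?thesis unfolding eq by (rule trans[OF sym])
      next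
        case False
        then show ?thesis
          using hom_lin(2)[OF f D] hom_lin(2)[OF g D] by (simp add: extensional_def)
      qed
    qed
  next
    case False
    then show ?thesis using f g by (auto simp: R_cat_def PiE_def extensional_def)
  qed
qed

lemma sheaf_homD:
  assumes "\<phi> \<in> sheaf_homs F (polyhedron_top C) P Q"
  shows "A.opn U \<Longrightarrow> \<phi> U \<in> module_hom F (sec P U) (sec Q U)"
    "A.opn U \<Longrightarrow> \<phi> U \<in> extensional (carrier (sec P U))"
    "\<not> A.opn U \<Longrightarrow> \<phi> U = undefined"
    "\<lbrakk>A.opn U; A.opn V; V \<subseteq> U; s \<in> carrier (sec P U)\<rbrakk> \<Longrightarrow> \<phi> V (res P U V s) = res Q U V (\<phi> U s)"
proof -
  have "\<phi> \<in> (\<Pi>\<^sub>E U\<in>{U. A.opn U}. Lin F (sec P U) (sec Q U))"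
    and nat: "\<forall>U V. A.opn U \<and> A.opn V \<and> V \<subseteq> U \<longrightarrow> (\<forall>s\<in>carrier (sec P U). \<phi> V (res P U V s) = res Q U V (\<phi> U s))"
    using assms by (simp_all add: sheaf_homs_def)
  then show "A.opn U \<Longrightarrow> \<phi> U \<in> module_hom F (sec P U) (sec Q U)"
    "A.opn U \<Longrightarrow> \<phi> U \<in> extensional (carrier (sec P U))" "\<not> A.opn U \<Longrightarrow> \<phi> U = undefined"
    by (auto simp: Lin_def PiE_def Pi_def extensional_def)
  show "\<lbrakk>A.opn U; A.opn V; V \<subseteq> U; s \<in> carrier (sec P U)\<rbrakk> \<Longrightarrow> \<phi> V (res P U V s) = res Q U V (\<phi> U s)"
    using nat by simp
qed

text \<open>Sections with the same value at \<open>x\<close> have the same restriction to some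
  neighbourhood, and morphisms respect restriction. So a morphism of sheaves acts on values at a
  single point.\<close>

lemma sheaf_hom_local:
  assumes r: "represents F C \<delta> S P \<nu>" "represents F C \<delta> T Q \<nu>'"
    and \<phi>: "\<phi> \<in> sheaf_homs F (polyhedron_top C) P Q"
    and s: "A.opn U" "s \<in> carrier (sec P U)" "x \<in> U"
    and t: "A.opn U'" "t \<in> carrier (sec P U')" "x \<in> U'"
    and eq: "\<nu> U s x = \<nu> U' t x"
  shows "\<nu>' U (\<phi> U s) x = \<nu>' U' (\<phi> U' t) x"
proof -
  obtain W where W: "A.opn W" "x \<in> W" "W \<subseteq> U" "W \<subseteq> U'" "\<And>y. y \<in> W \<Longrightarrow> \<nu> U s y = \<nu> U' t y"
    using A.sections_agree_near[OF A.rep_in[OF r(1) s(1,2)] A.rep_in[OF r(1) t(1,2)] s(3) t(3) eq] by metis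
  note rs = A.rep_res[OF r(1) s(1) W(1,3) s(2)] and rt = A.rep_res[OF r(1) t(1) W(1,4) t(2)]
  have "res P U W s = res P U' W t"
    using W(5) by (intro A.rep_inj[OF r(1) W(1) rs(1) rt(1)]) (auto simp: rs(2) rt(2) restrict_def)
  then have e: "res Q U W (\<phi> U s) = res Q U' W (\<phi> U' t)"
    using sheaf_homD(4)[OF \<phi> s(1) W(1,3) s(2)] sheaf_homD(4)[OF \<phi> t(1) W(1,4) t(2)] by simp
  have c: "\<phi> U s \<in> carrier (sec Q U)" "\<phi> U' t \<in> carrier (sec Q U')"
    using module_homD(1)[OF sheaf_homD(1)[OF \<phi> s(1)] s(2)] module_homD(1)[OF sheaf_homD(1)[OF \<phi> t(1)] t(2)] by auto
  have "restrict (\<nu>' U (\<phi> U s)) W x = restrict (\<nu>' U' (\<phi> U' t)) W x"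
    using B.rep_res(2)[OF r(2) s(1) W(1,3) c(1)] B.rep_res(2)[OF r(2) t(1) W(1,4) c(2)] e by simp
  then show ?thesis using W(2) by simp
qed

text \<open>Full: a sheaf morphism acts on the stalk at \<open>x\<close> by a linear map that is locally constant along
  the stratum of \<open>x\<close>, hence constant, because strata are connected.\<close>

lemma rep_hom_full:
  assumes r: "represents F C \<delta> S P \<nu>" "represents F C \<delta> T Q \<nu>'"
    and \<phi>: "\<phi> \<in> sheaf_homs F (polyhedron_top C) P Q"
  shows "\<exists>f\<in>Hom (R_cat F C \<delta>) S T. rep_hom C \<delta> P \<nu> Q \<nu>' f = \<phi>"
proof -
  \<comment> \<open>The map induced on the stalk at \<open>x\<close>, computed on the test
    section.\<close>
  define g where "g x v = \<nu>' (A.star x) (\<phi> (A.star x) (A.through P \<nu> x v)) x" for x v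
  have st: "A.opn (A.star x)" "x \<in> A.star x" if "x \<in> A.X" for x using A.opn_star[OF that] that by auto
  have \<phi>c: "\<phi> U s \<in> carrier (sec Q U)" if "A.opn U" "s \<in> carrier (sec P U)" for U s
    using module_homD(1)[OF sheaf_homD(1)[OF \<phi> that(1)] that(2)] .
  have val: "\<nu> U s x \<in> carrier (A.sp x)" if "A.opn U" "s \<in> carrier (sec P U)" "x \<in> U" for U s x
    using A.sectionsD(1)[OF A.rep_in[OF r(1) that(1,2)] that(3)] .
  have val': "\<nu>' U s x \<in> carrier (B.sp x)" if "A.opn U" "s \<in> carrier (sec Q U)" "x \<in> U" for U s x
    using B.sectionsD(1)[OF B.rep_in[OF r(2) that(1,2)] that(3)] .
  have gval: "\<nu>' U (\<phi> U s) x = g x (\<nu> U s x)"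
    if U: "A.opn U" "s \<in> carrier (sec P U)" "x \<in> U" for U s x
  proof -
    have x: "x \<in> A.X" using U A.opn_sub by blast
    note t = A.through[OF r(1) x val[OF U]]
    show ?thesis unfolding g_def
      by (rule sheaf_hom_local[OF r \<phi> U st(1)[OF x] t(1) st(2)[OF x]]) (rule t(2)[symmetric])
  qed
  have gconst: "g x v = g (barycenter D) v"
    if D: "D \<in> simplices C" and v: "v \<in> carrier (Spc S D)" and x: "x \<in> A.X" "A.\<mu> x = D" for D v x
  proof (rule A.const_on_connected[OF A.stratum_connected[OF D]])
    fix y assume y: "y \<in> {x \<in> A.X. A.\<mu> x = D}"
    then have yX: "y \<in> A.X" and vy: "v \<in> carrier (A.sp y)" using v by auto
    note t = A.through[OF r(1) yX vy]
    let ?t = "A.through P \<nu> y v"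
    obtain W1 where W1: "A.opn W1" "y \<in> W1" "W1 \<subseteq> A.star y"
        "\<And>z. z \<in> W1 \<Longrightarrow> A.\<mu> z = A.\<mu> y \<Longrightarrow> \<nu> (A.star y) ?t z = \<nu> (A.star y) ?t y"
      using A.sections_loc_const[OF A.rep_in[OF r(1) st(1)[OF yX] t(1)] st(2)[OF yX]] by blast
    obtain W2 where W2: "A.opn W2" "y \<in> W2" "W2 \<subseteq> A.star y"
        "\<And>z. z \<in> W2 \<Longrightarrow> A.\<mu> z = A.\<mu> y \<Longrightarrow> \<nu>' (A.star y) (\<phi> (A.star y) ?t) z = \<nu>' (A.star y) (\<phi> (A.star y) ?t) y"
      using B.sections_loc_const[OF B.rep_in[OF r(2) st(1)[OF yX] \<phi>c[OF st(1)[OF yX] t(1)]] st(2)[OF yX]] by blast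
    show "\<exists>W. A.opn W \<and> y \<in> W \<and> (\<forall>z\<in>W \<inter> {x \<in> A.X. A.\<mu> x = D}. g z v = g y v)"
    proof (intro exI conjI ballI)
      show "A.opn (W1 \<inter> W2)" using W1(1) W2(1) by (rule openin_Int)
      show "y \<in> W1 \<inter> W2" using W1 W2 by blast
      fix z assume z: "z \<in> (W1 \<inter> W2) \<inter> {x \<in> A.X. A.\<mu> x = D}"
      then have zz: "z \<in> W1" "z \<in> W2" "A.\<mu> z = A.\<mu> y" "z \<in> A.star y" using y W1(3) by auto
      have "g z v = g z (\<nu> (A.star y) ?t z)" using W1(4)[OF zz(1,3)] t(2) by simp
      also have "\<dots> = \<nu>' (A.star y) (\<phi> (A.star y) ?t) z"
        using gval[OF st(1)[OF yX] t(1) zz(4)] by simp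
      also have "\<dots> = g y (\<nu> (A.star y) ?t y)"
        using W2(4)[OF zz(2,3)] gval[OF st(1)[OF yX] t(1) st(2)[OF yX]] by simp
      finally show "g z v = g y v" using t(2) by simp
    qed
  qed (use x A.mu_barycenter[OF D] in auto)
  define f where "f = (\<lambda>D\<in>simplices C. \<lambda>v\<in>carrier (Spc S D). g (barycenter D) v)"
  have fval: "\<nu>' U (\<phi> U s) x = f (A.\<mu> x) (\<nu> U s x)"
    if U: "A.opn U" "s \<in> carrier (sec P U)" "x \<in> U" for U s x
  proof -
    have x: "x \<in> A.X" using U A.opn_sub by blast
    show ?thesis
      using gval[OF U] gconst[OF A.mu_simplex[OF x] val[OF U] x refl] A.mu_simplex[OF x] val[OF U]
      by (simp add: f_def)
  qed
  have fD: "f D v = \<nu>' (A.star (barycenter D)) (\<phi> (A.star (barycenter D)) (A.through P \<nu> (barycenter D) v)) (barycenter D)"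
    if "D \<in> simplices C" "v \<in> carrier (Spc S D)" for D v
    using that by (simp add: f_def g_def)
  have lin: "f D \<in> module_hom F (Spc S D) (Spc T D)" if D: "D \<in> simplices C" for D
  proof -
    define x where "x = barycenter D"
    have x: "x \<in> A.X" "A.\<mu> x = D" using A.mu_barycenter[OF D] by (auto simp: x_def)
    note op = st(1)[OF x(1)] and xs = st(2)[OF x(1)]
    let ?U = "A.star x"
    have th: "A.through P \<nu> x v \<in> carrier (sec P ?U)" "\<nu> ?U (A.through P \<nu> x v) x = v"
      if "v \<in> carrier (Spc S D)" for v using A.through(1,2)[OF r(1) x(1), of v] that x(2) by auto
    have ph: "\<phi> ?U \<in> module_hom F (sec P ?U) (sec Q ?U)" using sheaf_homD(1)[OF \<phi> op] .
    have fv: "f D (\<nu> ?U s x) = \<nu>' ?U (\<phi> ?U s) x" if "s \<in> carrier (sec P ?U)" for s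
      using fval[OF op that xs] x by simp
    show ?thesis unfolding module_hom_def
    proof (intro CollectI conjI allI impI Pi_I, goal_cases)
      case (1 v)
      then show ?case using fv[OF th(1)] th(2) val'[OF op \<phi>c[OF op th(1)] xs] x by simp
    next
      case (2 v w)
      then have vw: "v \<in> carrier (Spc S D)" "w \<in> carrier (Spc S D)" by auto
      let ?s = "A.through P \<nu> x v" and ?t = "A.through P \<nu> x w"
      have c: "?s \<oplus>\<^bsub>sec P ?U\<^esub> ?t \<in> carrier (sec P ?U)"
        using vectorspace_closed(1)[OF A.rep_vs[OF r(1) op] th(1)[OF vw(1)] th(1)[OF vw(2)]] .
      have "\<nu> ?U (?s \<oplus>\<^bsub>sec P ?U\<^esub> ?t) x = v \<oplus>\<^bsub>Spc S D\<^esub> w"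
        using A.rep_add[OF r(1) op th(1)[OF vw(1)] th(1)[OF vw(2)]] xs th(2) vw x by simp
      then have "f D (v \<oplus>\<^bsub>Spc S D\<^esub> w) = \<nu>' ?U (\<phi> ?U (?s \<oplus>\<^bsub>sec P ?U\<^esub> ?t)) x"
        using fv[OF c] by simp
      also have "\<dots> = \<nu>' ?U (\<phi> ?U ?s \<oplus>\<^bsub>sec Q ?U\<^esub> \<phi> ?U ?t) x"
        using module_homD(2)[OF ph th(1)[OF vw(1)] th(1)[OF vw(2)]] by simp
      also have "\<dots> = f D v \<oplus>\<^bsub>Spc T D\<^esub> f D w"
        using B.rep_add[OF r(2) op \<phi>c[OF op th(1)[OF vw(1)]] \<phi>c[OF op th(1)[OF vw(2)]]] xs x
          fv[OF th(1)[OF vw(1)]] fv[OF th(1)[OF vw(2)]] th(2) vw by simp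
      finally show ?case .
    next
      case (3 c v)
      then have vw: "v \<in> carrier (Spc S D)" "c \<in> carrier F" by auto
      let ?s = "A.through P \<nu> x v"
      have cc: "c \<odot>\<^bsub>sec P ?U\<^esub> ?s \<in> carrier (sec P ?U)"
        using vectorspace_closed(2)[OF A.rep_vs[OF r(1) op] vw(2) th(1)[OF vw(1)]] .
      have "\<nu> ?U (c \<odot>\<^bsub>sec P ?U\<^esub> ?s) x = c \<odot>\<^bsub>Spc S D\<^esub> v"
        using A.rep_smult[OF r(1) op th(1)[OF vw(1)] vw(2)] xs th(2) vw x by simp
      then have "f D (c \<odot>\<^bsub>Spc S D\<^esub> v) = \<nu>' ?U (\<phi> ?U (c \<odot>\<^bsub>sec P ?U\<^esub> ?s)) x"
        using fv[OF cc] by simp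
      also have "\<dots> = \<nu>' ?U (c \<odot>\<^bsub>sec Q ?U\<^esub> \<phi> ?U ?s) x"
        using module_homD(3)[OF ph vw(2) th(1)[OF vw(1)]] by simp
      also have "\<dots> = c \<odot>\<^bsub>Spc T D\<^esub> f D v"
        using B.rep_smult[OF r(2) op \<phi>c[OF op th(1)[OF vw(1)]] vw(2)] xs x fv[OF th(1)[OF vw(1)]] th(2) vw by simp
      finally show ?case .
    qed
  qed
  have comm: "f D' (Map S D D' v) = Map T D D' (f D v)"
    if a: "arrow C \<delta> D D'" and v: "v \<in> carrier (Spc S D)" for D D' v
  proof -
    have aa: "A.arr D D'" using a A.arr_arrow by simp
    have D: "D \<in> simplices C" "D' \<in> simplices C" using a by (auto simp: arrow_def)
    define x where "x = barycenter D"
    have x: "x \<in> A.X" "A.\<mu> x = D" "carrier_chain C x = {D}"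
      using A.mu_barycenter[OF D(1)] A.carrier_chain_barycenter[OF D(1)] by (auto simp: x_def)
    note op = st(1)[OF x(1)] and xs = st(2)[OF x(1)]
    let ?U = "A.star x" let ?t = "A.through P \<nu> x v"
    have v': "v \<in> carrier (A.sp x)" using v x by simp
    note t = A.through[OF r(1) x(1) v']
    \<comment> \<open>Compatibility with an arrow is tested at a point \<open>y\<close> close to the
      barycenter \<open>x\<close> of \<open>D\<close> and with chain \<open>{D, D'}\<close>. Its
      stratum is \<open>D'\<close>, so the transition from \<open>x\<close> to \<open>y\<close> is
      the map of the arrow, for \<open>S\<close> as well as for \<open>T\<close>.\<close>
    have K: "{D, D'} \<in> A.flags"
      using aa by (intro A.pair_chain) (auto simp: A.arr_def)
    have top: "chain_top \<delta> {D, D'} = D'"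
      using aa by (intro A.chain_top_eqI[OF K]) (auto simp: A.arr_def)
    obtain W where W: "A.opn W" "x \<in> W" "W \<subseteq> ?U" "\<forall>y\<in>W. carrier_chain C x \<subseteq> carrier_chain C y \<and>
        \<nu>' ?U (\<phi> ?U ?t) y = B.T' x y (\<nu>' ?U (\<phi> ?U ?t) x)"
      using B.sections_local_ex[OF B.rep_in[OF r(2) op \<phi>c[OF op t(1)]] xs]
      by (elim exE conjE) (rule that)
    have "carrier_chain C x \<subseteq> {D, D'}" using x(3) by simp
    from A.cell_meets[OF W(1,2) K this]
    obtain y where y: "y \<in> W" "y \<in> A.X" "carrier_chain C y = {D, D'}" by (elim exE conjE) (rule that)
    have my: "A.\<mu> y = D'" using y(3) top by (simp add: stratum_of_def)
    have yU: "y \<in> ?U" using W(3) y by blast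
    have fv: "f D v \<in> carrier (Spc T D)" using module_homD(1)[OF lin[OF D(1)] v] .
    have "f D' (Map S D D' v) = f (A.\<mu> y) (\<nu> ?U ?t y)"
      using t(3)[OF yU] A.tr_arr[OF aa v] x my unfolding A.tr_Tr by simp
    also have "\<dots> = \<nu>' ?U (\<phi> ?U ?t) y" using fval[OF op t(1) yU] by simp
    also have "\<dots> = B.T' x y (\<nu>' ?U (\<phi> ?U ?t) x)" using bspec[OF W(4) y(1), THEN conjunct2] .
    also have "\<nu>' ?U (\<phi> ?U ?t) x = f D v" using fD[OF D(1) v] by (simp add: x_def)
    also have "B.T' x y (f D v) = Map T D D' (f D v)"
      using B.tr_arr[OF aa fv] x my unfolding B.tr_Tr by simp
    finally show ?thesis .
  qed
  have f: "f \<in> Hom (R_cat F C \<delta>) S T"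
  proof -
    have "f \<in> (\<Pi>\<^sub>E D\<in>simplices C. Lin F (Spc S D) (Spc T D))"
      using lin by (intro PiE_I) (auto simp: Lin_def f_def)
    then show ?thesis using comm by (simp add: R_cat_def)
  qed
  moreover have "rep_hom C \<delta> P \<nu> Q \<nu>' f = \<phi>"
  proof (rule ext, rule ext)
    fix U s
    show "rep_hom C \<delta> P \<nu> Q \<nu>' f U s = \<phi> U s"
    proof (cases "A.opn U")
      case U: True
      show ?thesis
      proof (cases "s \<in> carrier (sec P U)")
        case s: True
        note ap = rep_hom_apply[OF r f U s]
        show ?thesis
        proof (rule B.rep_inj[OF r(2) U ap(1) \<phi>c[OF U s]], rule ext)
          fix x show "\<nu>' U (rep_hom C \<delta> P \<nu> Q \<nu>' f U s) x = \<nu>' U (\<phi> U s) x"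
            using fval[OF U s, of x] B.sectionsD(2)[OF B.rep_in[OF r(2) U \<phi>c[OF U s]], of x]
            unfolding ap(2) by (cases "x \<in> U") auto
        qed
      next
        case False
        then show ?thesis
          using sheaf_homD(2)[OF \<phi> U] U by (simp add: rep_hom_def extensional_def)
      qed
    next
      case False
      then show ?thesis using sheaf_homD(3)[OF \<phi>] by (simp add: rep_hom_def)
    qed
  qed
  ultimately show ?thesis by blast
qed

end

section \<open>Germs and constructible sheaves\<close>

lemma UN_const1:
  assumes "\<And>U s. (U, s) \<in> A \<Longrightarrow> h U s = g" "a \<in> A"
  shows "(\<Union>(U, s)\<in>A. h U s) = g"
proof -
  have "(\<Union>(U, s)\<in>A. h U s) = (\<Union>p\<in>A. g)"
    by (intro SUP_cong refl) (clarsimp simp: assms(1))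
  then show ?thesis using assms(2) by auto
qed

lemma UN_const2:
  assumes "\<And>U s V t. (U, s) \<in> A \<Longrightarrow> (V, t) \<in> B \<Longrightarrow> h U s V t = g" "a \<in> A" "b \<in> B"
  shows "(\<Union>(U, s)\<in>A. \<Union>(V, t)\<in>B. h U s V t) = g"
  by (rule UN_const1[OF UN_const1[OF assms(1)]]) (use assms(2,3) in auto)

section \<open>Germs and stalks of a presheaf of vector spaces\<close>

locale psheaf =
  fixes F :: "'f ring" and T :: "'p topology" and A :: "('p, 'f, 'v) presheaf"
  assumes psh: "is_presheaf F T A"
begin

lemma p_vs: "openin T U \<Longrightarrow> vectorspace F (sec A U)"
  using psh by (simp add: is_presheaf_def)

lemma p_hom: "\<lbrakk>openin T U; openin T V; V \<subseteq> U\<rbrakk> \<Longrightarrow> res A U V \<in> module_hom F (sec A U) (sec A V)"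
  using psh by (simp add: is_presheaf_def)

lemma p_in: "\<lbrakk>openin T U; openin T V; V \<subseteq> U; s \<in> carrier (sec A U)\<rbrakk> \<Longrightarrow> res A U V s \<in> carrier (sec A V)"
  by (rule module_homD(1)[OF p_hom])

lemma p_id: "openin T U \<Longrightarrow> s \<in> carrier (sec A U) \<Longrightarrow> res A U U s = s"
  using psh by (simp add: is_presheaf_def)

lemma p_comp: "\<lbrakk>openin T U; openin T V; openin T W; W \<subseteq> V; V \<subseteq> U; s \<in> carrier (sec A U)\<rbrakk> \<Longrightarrow>
    res A V W (res A U V s) = res A U W s"
  using psh by (simp add: is_presheaf_def)

lemma p_add: "openin T U \<Longrightarrow> s \<in> carrier (sec A U) \<Longrightarrow> t \<in> carrier (sec A U) \<Longrightarrow> s \<oplus>\<^bsub>sec A U\<^esub> t \<in> carrier (sec A U)"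
  by (rule vectorspace_closed(1)[OF p_vs])

lemma p_smult: "openin T U \<Longrightarrow> c \<in> carrier F \<Longrightarrow> s \<in> carrier (sec A U) \<Longrightarrow> c \<odot>\<^bsub>sec A U\<^esub> s \<in> carrier (sec A U)"
  by (rule vectorspace_closed(2)[OF p_vs])

abbreviation rep_at :: "'p \<Rightarrow> 'p set \<Rightarrow> 'v \<Rightarrow> bool" where
  "rep_at x U s \<equiv> openin T U \<and> x \<in> U \<and> s \<in> carrier (sec A U)"

abbreviation germ_rel where
  "germ_rel x U s V t \<equiv> \<exists>W. openin T W \<and> x \<in> W \<and> W \<subseteq> U \<inter> V \<and> res A U W s = res A V W t"

lemma germ_mem: "(V, t) \<in> germ T A x U s \<longleftrightarrow> rep_at x V t \<and> germ_rel x U s V t"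
  by (auto simp: germ_def)

lemma germ_rel_refl: "rep_at x U s \<Longrightarrow> germ_rel x U s U s" by blast

lemma germ_rel_sym: "germ_rel x U s V t \<Longrightarrow> germ_rel x V t U s" by (metis inf_commute)

lemma germ_rel_trans:
  assumes "rep_at x U s" "rep_at x V t" "rep_at x Y u" "germ_rel x U s V t" "germ_rel x V t Y u"
  shows "germ_rel x U s Y u"
proof -
  obtain W where W: "openin T W" "x \<in> W" "W \<subseteq> U \<inter> V" "res A U W s = res A V W t" using assms by blast
  obtain W' where W': "openin T W'" "x \<in> W'" "W' \<subseteq> V \<inter> Y" "res A V W' t = res A Y W' u" using assms by blast
  let ?W = "W \<inter> W'"
  have o: "openin T ?W" using W W' by (simp add: openin_Int)
  have "res A U ?W s = res A W ?W (res A U W s)" using p_comp[of U W ?W s] W o assms(1) by auto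
  also have "\<dots> = res A V ?W t" using p_comp[of V W ?W t] W o assms(2) by auto
  also have "\<dots> = res A W' ?W (res A V W' t)" using p_comp[of V W' ?W t] W' o assms(2) by auto
  also have "\<dots> = res A Y ?W u" using p_comp[of Y W' ?W u] W' o assms(3) by auto
  finally show ?thesis using o W W' by (intro exI[of _ ?W]) auto
qed

lemma germ_eq_iff:
  assumes "rep_at x U s" "rep_at x V t"
  shows "germ T A x U s = germ T A x V t \<longleftrightarrow> germ_rel x U s V t"
proof
  assume eq: "germ T A x U s = germ T A x V t"
  have "(V, t) \<in> germ T A x V t" using germ_mem germ_rel_refl assms(2) by simp
  then have "(V, t) \<in> germ T A x U s" using eq by simp
  then show "germ_rel x U s V t" by (rule germ_mem[THEN iffD1, THEN conjunct2])
next
  assume r: "germ_rel x U s V t"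
  have "(Y, u) \<in> germ T A x U s \<longleftrightarrow> (Y, u) \<in> germ T A x V t" for Y u
    unfolding germ_mem using germ_rel_trans[OF assms(1,2), of Y u] germ_rel_trans[OF assms(2,1), of Y u] r
      germ_rel_sym[OF r] by blast
  then show "germ T A x U s = germ T A x V t" by auto
qed

lemma germ_res:
  assumes "rep_at x U s" "openin T W" "x \<in> W" "W \<subseteq> U"
  shows "germ T A x W (res A U W s) = germ T A x U s"
proof -
  have r: "rep_at x W (res A U W s)" using assms p_in by blast
  have "res A W W (res A U W s) = res A U W s" using p_id[of W] r by blast
  then show ?thesis unfolding germ_eq_iff[OF r assms(1)] using assms by (intro exI[of _ W]) auto
qed

lemma stalk_carrier: "\<xi> \<in> carrier (stalk T A x) \<longleftrightarrow> (\<exists>U s. rep_at x U s \<and> \<xi> = germ T A x U s)"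
  by (auto simp: stalk_def)

text \<open>On one small neighbourhood all four sections can be restricted, and the two sums
  coincide there. This makes the union that defines addition of germs collapse to a single
  germ.\<close>

lemma germ_sum_cong:
  assumes s: "rep_at x U s" "rep_at x U' s'" "germ T A x U s = germ T A x U' s'"
    and t: "rep_at x V t" "rep_at x V' t'" "germ T A x V t = germ T A x V' t'"
  shows "germ T A x (U \<inter> V) (res A U (U \<inter> V) s \<oplus>\<^bsub>sec A (U \<inter> V)\<^esub> res A V (U \<inter> V) t) =
    germ T A x (U' \<inter> V') (res A U' (U' \<inter> V') s' \<oplus>\<^bsub>sec A (U' \<inter> V')\<^esub> res A V' (U' \<inter> V') t')"
proof -
  obtain W1 where W1: "openin T W1" "x \<in> W1" "W1 \<subseteq> U \<inter> U'" "res A U W1 s = res A U' W1 s'"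
    using germ_eq_iff[OF s(1,2)] s(3) by blast
  obtain W2 where W2: "openin T W2" "x \<in> W2" "W2 \<subseteq> V \<inter> V'" "res A V W2 t = res A V' W2 t'"
    using germ_eq_iff[OF t(1,2)] t(3) by blast
  let ?W = "W1 \<inter> W2"
  have o: "openin T ?W" "openin T (U \<inter> V)" "openin T (U' \<inter> V')" using W1 W2 s t by (auto simp: openin_Int)
  have sub: "?W \<subseteq> U \<inter> V" "?W \<subseteq> U' \<inter> V'" using W1 W2 by auto
  have rs: "res A U (U \<inter> V) s \<in> carrier (sec A (U \<inter> V))" "res A V (U \<inter> V) t \<in> carrier (sec A (U \<inter> V))"
    "res A U' (U' \<inter> V') s' \<in> carrier (sec A (U' \<inter> V'))" "res A V' (U' \<inter> V') t' \<in> carrier (sec A (U' \<inter> V'))"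
    using p_in s t o by auto
  let ?a = "res A U (U \<inter> V) s \<oplus>\<^bsub>sec A (U \<inter> V)\<^esub> res A V (U \<inter> V) t"
  let ?b = "res A U' (U' \<inter> V') s' \<oplus>\<^bsub>sec A (U' \<inter> V')\<^esub> res A V' (U' \<inter> V') t'"
  have "res A (U \<inter> V) ?W ?a = res A U ?W s \<oplus>\<^bsub>sec A ?W\<^esub> res A V ?W t"
    using module_homD(2)[OF p_hom[OF o(2,1) sub(1)] rs(1,2)] p_comp[of U "U \<inter> V" ?W s] p_comp[of V "U \<inter> V" ?W t] s t o sub
    by simp
  also have "res A U ?W s = res A U' ?W s'"
    using p_comp[of U W1 ?W s] p_comp[of U' W1 ?W s'] W1 o s by auto
  also have "res A V ?W t = res A V' ?W t'"
    using p_comp[of V W2 ?W t] p_comp[of V' W2 ?W t'] W2 o t by auto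
  also have "res A U' ?W s' \<oplus>\<^bsub>sec A ?W\<^esub> res A V' ?W t' = res A (U' \<inter> V') ?W ?b"
    using module_homD(2)[OF p_hom[OF o(3,1) sub(2)] rs(3,4)] p_comp[of U' "U' \<inter> V'" ?W s'] p_comp[of V' "U' \<inter> V'" ?W t'] s t o sub
    by simp
  finally have e: "res A (U \<inter> V) ?W ?a = res A (U' \<inter> V') ?W ?b" .
  have ra: "rep_at x (U \<inter> V) ?a" "rep_at x (U' \<inter> V') ?b"
    using o s t p_add[OF o(2) rs(1,2)] p_add[OF o(3) rs(3,4)] by auto
  show ?thesis unfolding germ_eq_iff[OF ra]
    by (intro exI[of _ ?W] conjI o(1) e) (use W1 W2 sub in auto)
qed

lemma stalk_add:
  assumes s: "rep_at x U s" and t: "rep_at x V t"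
  shows "germ T A x U s \<oplus>\<^bsub>stalk T A x\<^esub> germ T A x V t =
    germ T A x (U \<inter> V) (res A U (U \<inter> V) s \<oplus>\<^bsub>sec A (U \<inter> V)\<^esub> res A V (U \<inter> V) t)" (is "_ = ?g")
proof -
  have mem: "rep_at x U' s' \<and> germ T A x U s = germ T A x U' s'"
    if "rep_at x U s" "(U', s') \<in> germ T A x U s" for U s U' s'
  proof -
    have m: "rep_at x U' s'" "germ_rel x U s U' s'" using germ_mem[THEN iffD1, OF that(2)] by blast+
    then show ?thesis using germ_eq_iff[OF that(1) m(1)] by blast
  qed
  have c: "germ T A x (U' \<inter> V') (res A U' (U' \<inter> V') s' \<oplus>\<^bsub>sec A (U' \<inter> V')\<^esub> res A V' (U' \<inter> V') t') = ?g"
    if "(U', s') \<in> germ T A x U s" "(V', t') \<in> germ T A x V t" for U' s' V' t'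
    using germ_sum_cong[OF s mem[OF s that(1), THEN conjunct1] mem[OF s that(1), THEN conjunct2]
        t mem[OF t that(2), THEN conjunct1] mem[OF t that(2), THEN conjunct2]] by (rule sym)
  have ne: "(U, s) \<in> germ T A x U s" "(V, t) \<in> germ T A x V t" using s t germ_mem germ_rel_refl by auto
  show ?thesis unfolding stalk_def ring_record_simps by (rule UN_const2[OF c ne])
qed

lemma stalk_add_same:
  assumes "rep_at x U s" "rep_at x U t"
  shows "germ T A x U s \<oplus>\<^bsub>stalk T A x\<^esub> germ T A x U t = germ T A x U (s \<oplus>\<^bsub>sec A U\<^esub> t)"
  using stalk_add[OF assms] p_id assms by simp

lemma stalk_smult:
  assumes s: "rep_at x U s" and c: "c \<in> carrier F"
  shows "c \<odot>\<^bsub>stalk T A x\<^esub> germ T A x U s = germ T A x U (c \<odot>\<^bsub>sec A U\<^esub> s)" (is "_ = ?g")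
proof -
  have cg: "germ T A x U' (c \<odot>\<^bsub>sec A U'\<^esub> s') = ?g" if mem: "(U', s') \<in> germ T A x U s" for U' s'
  proof -
    note m = germ_mem[THEN iffD1, OF mem]
    have r': "rep_at x U' s'" using m by (rule conjunct1)
    obtain W where W: "openin T W" "x \<in> W" "W \<subseteq> U \<inter> U'" "res A U W s = res A U' W s'"
      using m[THEN conjunct2] by (elim exE conjE) (rule that)
    have "res A U W (c \<odot>\<^bsub>sec A U\<^esub> s) = res A U' W (c \<odot>\<^bsub>sec A U'\<^esub> s')"
      using module_homD(3)[OF p_hom[of U W] c, of s] module_homD(3)[OF p_hom[of U' W] c, of s'] W s r' by auto
    then have e: "res A U' W (c \<odot>\<^bsub>sec A U'\<^esub> s') = res A U W (c \<odot>\<^bsub>sec A U\<^esub> s)" by simp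
    have a: "rep_at x U' (c \<odot>\<^bsub>sec A U'\<^esub> s')" "rep_at x U (c \<odot>\<^bsub>sec A U\<^esub> s)"
      using s r' p_smult c by auto
    show ?thesis unfolding germ_eq_iff[OF a] by (intro exI[of _ W] conjI W(1,2) e) (use W(3) in auto)
  qed
  have ne: "(U, s) \<in> germ T A x U s" using s germ_mem germ_rel_refl by auto
  show ?thesis unfolding stalk_def module.simps by (rule UN_const1[OF cg ne])
qed

end

text \<open>The values of the sections of a constructible sheaf at the points, read off in fixed vector
  spaces \<open>L D\<close>, one for every stratum.\<close>

definition stalk_values ::
  "'f ring \<Rightarrow> 'a::euclidean_space set set \<Rightarrow> (nat \<Rightarrow> int) \<Rightarrow> ('a set \<Rightarrow> ('f, 'v) module) \<Rightarrow>
   ('a, 'f, 'w) presheaf \<Rightarrow> ('a set \<Rightarrow> 'w \<Rightarrow> 'a \<Rightarrow> 'v) \<Rightarrow> bool" where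
  "stalk_values F C \<delta> L A \<nu> \<longleftrightarrow>
     (\<forall>D\<in>simplices C. fin_dim_vectorspace F (L D)) \<and>
     (\<forall>U. openin (polyhedron_top C) U \<longrightarrow> (\<forall>s\<in>carrier (sec A U).
        \<nu> U s \<in> (\<Pi>\<^sub>E x\<in>U. carrier (L (stratum_of C \<delta> x))) \<and>
        (\<forall>x\<in>U. \<exists>W. openin (polyhedron_top C) W \<and> x \<in> W \<and> W \<subseteq> U \<and>
           (\<forall>y\<in>W. stratum_of C \<delta> y = stratum_of C \<delta> x \<longrightarrow> \<nu> U s y = \<nu> U s x)) \<and>
        (\<forall>t\<in>carrier (sec A U). \<forall>x\<in>U. \<nu> U (s \<oplus>\<^bsub>sec A U\<^esub> t) x = \<nu> U s x \<oplus>\<^bsub>L (stratum_of C \<delta> x)\<^esub> \<nu> U t x) \<and>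
        (\<forall>c\<in>carrier F. \<forall>x\<in>U. \<nu> U (c \<odot>\<^bsub>sec A U\<^esub> s) x = c \<odot>\<^bsub>L (stratum_of C \<delta> x)\<^esub> \<nu> U s x) \<and>
        (\<forall>V. openin (polyhedron_top C) V \<and> V \<subseteq> U \<longrightarrow> \<nu> V (res A U V s) = restrict (\<nu> U s) V) \<and>
        (\<forall>t\<in>carrier (sec A U). \<forall>x\<in>U. \<nu> U s x = \<nu> U t x \<longrightarrow>
           (\<exists>W. openin (polyhedron_top C) W \<and> x \<in> W \<and> W \<subseteq> U \<and> res A U W s = res A U W t)))) \<and>
     (\<forall>x\<in>\<Union>C. \<forall>v\<in>carrier (L (stratum_of C \<delta> x)).
        \<exists>U s. openin (polyhedron_top C) U \<and> x \<in> U \<and> s \<in> carrier (sec A U) \<and> \<nu> U s x = v)"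

lemma sheaf_homs_D:
  assumes "\<phi> \<in> sheaf_homs F T A B"
  shows "openin T U \<Longrightarrow> \<phi> U \<in> module_hom F (sec A U) (sec B U)"
    "\<lbrakk>openin T U; openin T V; V \<subseteq> U; s \<in> carrier (sec A U)\<rbrakk> \<Longrightarrow> \<phi> V (res A U V s) = res B U V (\<phi> U s)"
proof -
  have "\<phi> \<in> (\<Pi>\<^sub>E U\<in>{U. openin T U}. Lin F (sec A U) (sec B U))"
    and nat: "\<forall>U V. openin T U \<and> openin T V \<and> V \<subseteq> U \<longrightarrow> (\<forall>s\<in>carrier (sec A U). \<phi> V (res A U V s) = res B U V (\<phi> U s))"
    using assms by (simp_all add: sheaf_homs_def)
  then show "openin T U \<Longrightarrow> \<phi> U \<in> module_hom F (sec A U) (sec B U)"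
    by (auto simp: Lin_def)
  show "\<lbrakk>openin T U; openin T V; V \<subseteq> U; s \<in> carrier (sec A U)\<rbrakk> \<Longrightarrow> \<phi> V (res A U V s) = res B U V (\<phi> U s)"
    using nat by simp
qed

section \<open>Inverse images on the strata and their trivialisations\<close>

locale cx_presheaf = perverse_cx C \<delta> + psheaf F "polyhedron_top C" A
  for C :: "'a::euclidean_space set set" and \<delta> and F :: "'f ring" and A :: "('a, 'f, 'w) presheaf"
begin

abbreviation "TX \<equiv> polyhedron_top C"
abbreviation "Y D \<equiv> {x \<in> X. \<mu> x = D}"
abbreviation "TY D \<equiv> top_of_set (Y D)"
abbreviation "I D \<equiv> inverse_image (TY D) TX (\<lambda>x. x) A"

lemma open_stratum: "opn U \<Longrightarrow> openin (TY D) (U \<inter> Y D)"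
  unfolding openin_open by (elim exE conjE) (rule_tac x=T in exI, auto)

lemma open_stratum_ex:
  assumes "openin (TY D) W"
  obtains U where "opn U" "W = U \<inter> Y D"
proof -
  obtain O' where "open O'" "W = Y D \<inter> O'" using assms unfolding openin_open by (elim exE conjE) (rule that)
  then show ?thesis using that[of "X \<inter> O'"] by (auto simp: openin_open)
qed

lemma inv_carrier: "\<sigma> \<in> carrier (sec (I D) V) \<longleftrightarrow> \<sigma> \<in> (\<Pi>\<^sub>E y\<in>V. carrier (stalk TX A y)) \<and>
    (\<forall>y\<in>V. \<exists>W U s. openin (TY D) W \<and> y \<in> W \<and> W \<subseteq> V \<and> opn U \<and> W \<subseteq> U \<and>
       s \<in> carrier (sec A U) \<and> (\<forall>z\<in>W. \<sigma> z = germ TX A z U s))"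
  by (simp add: inverse_image_def pointwise_module_def)

lemma inv_res: "res (I D) U V \<sigma> = restrict \<sigma> V"
  by (simp add: inverse_image_def)

lemma inv_add: "\<sigma> \<oplus>\<^bsub>sec (I D) V\<^esub> \<tau> = (\<lambda>x\<in>V. \<sigma> x \<oplus>\<^bsub>stalk TX A x\<^esub> \<tau> x)"
  by (simp add: inverse_image_def pointwise_module_def)

lemma inv_smult: "c \<odot>\<^bsub>sec (I D) V\<^esub> \<sigma> = (\<lambda>x\<in>V. c \<odot>\<^bsub>stalk TX A x\<^esub> \<sigma> x)"
  by (simp add: inverse_image_def pointwise_module_def)

lemma const_carrier: "\<sigma> \<in> carrier (sec (constant_sheaf T M) V) \<longleftrightarrow> \<sigma> \<in> V \<rightarrow>\<^sub>E carrier M \<and>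
    (\<forall>y\<in>V. \<exists>W. openin T W \<and> y \<in> W \<and> W \<subseteq> V \<and> (\<forall>z\<in>W. \<sigma> z = \<sigma> y))"
  by (simp add: constant_sheaf_def pointwise_module_def)

lemma const_res: "res (constant_sheaf T M) U V \<sigma> = restrict \<sigma> V"
  by (simp add: constant_sheaf_def)

lemma const_add: "\<sigma> \<oplus>\<^bsub>sec (constant_sheaf T M) V\<^esub> \<tau> = (\<lambda>x\<in>V. \<sigma> x \<oplus>\<^bsub>M\<^esub> \<tau> x)"
  by (simp add: constant_sheaf_def pointwise_module_def)

lemma const_smult: "c \<odot>\<^bsub>sec (constant_sheaf T M) V\<^esub> \<sigma> = (\<lambda>x\<in>V. c \<odot>\<^bsub>M\<^esub> \<sigma> x)"
  by (simp add: constant_sheaf_def pointwise_module_def)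

text \<open>The canonical map from sections of \<open>A\<close> to sections of its inverse image on
  the stratum of \<open>D\<close>.\<close>

definition germs :: "'a set \<Rightarrow> 'a set \<Rightarrow> 'w \<Rightarrow> 'a \<Rightarrow> ('a set \<times> 'w) set" where
  "germs D U s = (\<lambda>y\<in>U \<inter> Y D. germ TX A y U s)"

lemma germs_in:
  assumes "opn U" "s \<in> carrier (sec A U)"
  shows "germs D U s \<in> carrier (sec (I D) (U \<inter> Y D))"
  unfolding inv_carrier
proof (intro conjI ballI)
  show "germs D U s \<in> (\<Pi>\<^sub>E y\<in>U \<inter> Y D. carrier (stalk TX A y))"
    unfolding germs_def using assms stalk_carrier by (intro restrict_PiE[THEN iffD2] Pi_I) blast
  fix y assume y: "y \<in> U \<inter> Y D"
  show "\<exists>W U' s'. openin (TY D) W \<and> y \<in> W \<and> W \<subseteq> U \<inter> Y D \<and> opn U' \<and> W \<subseteq> U' \<and>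
       s' \<in> carrier (sec A U') \<and> (\<forall>z\<in>W. germs D U s z = germ TX A z U' s')"
    using y assms open_stratum[OF assms(1), of D]
    by (intro exI[of _ "U \<inter> Y D"] exI[of _ U] exI[of _ s]) (simp add: germs_def)
qed

lemma germs_add:
  assumes "opn U" "s \<in> carrier (sec A U)" "t \<in> carrier (sec A U)"
  shows "germs D U (s \<oplus>\<^bsub>sec A U\<^esub> t) = germs D U s \<oplus>\<^bsub>sec (I D) (U \<inter> Y D)\<^esub> germs D U t"
  unfolding inv_add using stalk_add_same[of U _ s t] assms by (intro ext) (simp add: germs_def)

lemma germs_smult:
  assumes "opn U" "s \<in> carrier (sec A U)" "c \<in> carrier F"
  shows "germs D U (c \<odot>\<^bsub>sec A U\<^esub> s) = c \<odot>\<^bsub>sec (I D) (U \<inter> Y D)\<^esub> germs D U s"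
  unfolding inv_smult using stalk_smult[of U _ s c] assms by (intro ext) (simp add: germs_def)

lemma germs_res:
  assumes "opn U" "s \<in> carrier (sec A U)" "opn V" "V \<subseteq> U"
  shows "germs D V (res A U V s) = res (I D) (U \<inter> Y D) (V \<inter> Y D) (germs D U s)"
proof
  fix y
  show "germs D V (res A U V s) y = res (I D) (U \<inter> Y D) (V \<inter> Y D) (germs D U s) y"
    using germ_res[of U y s V] assms by (cases "y \<in> V \<inter> Y D") (auto simp: germs_def inv_res)
qed

text \<open>Constructibility supplies one isomorphism with a constant sheaf for each stratum.
  Applied to the germs of a section along the stratum and evaluated at a point, it turns the section
  into a function with values in fixed vector spaces.\<close>

lemma constructible_stalk_values:
  fixes L :: "'a set \<Rightarrow> ('f, 'v) module"
  assumes fd: "\<And>D. D \<in> simplices C \<Longrightarrow> fin_dim_vectorspace F (L D)"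
    and iso: "\<And>D. D \<in> simplices C \<Longrightarrow> sheaves_isomorphic F (TY D) (I D) (constant_sheaf (TY D) (L D))"
  shows "\<exists>\<nu>. stalk_values F C \<delta> L A \<nu>"
proof -
  let ?K = "\<lambda>D. constant_sheaf (TY D) (L D)"
  have "\<forall>D\<in>simplices C. \<exists>\<phi>. \<phi> \<in> sheaf_homs F (TY D) (I D) (?K D) \<and>
      (\<forall>U. openin (TY D) U \<longrightarrow> bij_betw (\<phi> U) (carrier (sec (I D) U)) (carrier (sec (?K D) U)))"
    using iso unfolding sheaves_isomorphic_def by (intro ballI) (drule meta_spec, drule (1) meta_mp, elim bexE, intro exI conjI)
  from bchoice[OF this] obtain \<phi> where \<phi>: "\<And>D. D \<in> simplices C \<Longrightarrow> \<phi> D \<in> sheaf_homs F (TY D) (I D) (?K D)"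
    "\<And>D U. D \<in> simplices C \<Longrightarrow> openin (TY D) U \<Longrightarrow> bij_betw (\<phi> D U) (carrier (sec (I D) U)) (carrier (sec (?K D) U))"
    by blast
  define \<nu> where "\<nu> U s = (\<lambda>x\<in>U. \<phi> (\<mu> x) (U \<inter> Y (\<mu> x)) (germs (\<mu> x) U s) x)" for U s
  have muD: "\<mu> x \<in> simplices C" "x \<in> U \<inter> Y (\<mu> x)" if "opn U" "x \<in> U" for U x
    using that opn_sub mu_simplex by blast+
  have \<nu>: "\<nu> U s x = \<phi> D (U \<inter> Y D) (germs D U s) x" if "x \<in> U \<inter> Y D" for U s x D
    using that by (simp add: \<nu>_def)
  have gin: "\<phi> D (U \<inter> Y D) (germs D U s) \<in> carrier (sec (?K D) (U \<inter> Y D))"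
    if "D \<in> simplices C" "opn U" "s \<in> carrier (sec A U)" for D U s
    using bij_betwE[OF \<phi>(2)[OF that(1) open_stratum[OF that(2)]]] germs_in[OF that(2,3)] by blast
  have const: "\<exists>W. opn W \<and> x \<in> W \<and> W \<subseteq> U \<and> (\<forall>y\<in>W. \<mu> y = \<mu> x \<longrightarrow> \<nu> U s y = \<nu> U s x)"
    if U: "opn U" "s \<in> carrier (sec A U)" "x \<in> U" for U s x
  proof -
    note D = muD[OF U(1,3)]
    obtain W where W: "openin (TY (\<mu> x)) W" "x \<in> W" "W \<subseteq> U \<inter> Y (\<mu> x)"
      "\<forall>z\<in>W. \<phi> (\<mu> x) (U \<inter> Y (\<mu> x)) (germs (\<mu> x) U s) z = \<phi> (\<mu> x) (U \<inter> Y (\<mu> x)) (germs (\<mu> x) U s) x"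
      using gin[OF D(1) U(1,2), unfolded const_carrier, THEN conjunct2, THEN bspec, OF D(2)]
      by (elim exE conjE) (rule that)
    obtain O' where O: "opn O'" "W = O' \<inter> Y (\<mu> x)" using open_stratum_ex[OF W(1)] .
    show ?thesis
    proof (intro exI conjI ballI impI)
      show "opn (O' \<inter> U)" using O(1) U(1) by (rule openin_Int)
      show "x \<in> O' \<inter> U" "O' \<inter> U \<subseteq> U" using W(2) O(2) U(3) by auto
      fix y assume y: "y \<in> O' \<inter> U" "\<mu> y = \<mu> x"
      then have "y \<in> X" using opn_sub[OF U(1)] by blast
      then have yW: "y \<in> W" "y \<in> U \<inter> Y (\<mu> x)" using y O(2) by auto
      show "\<nu> U s y = \<nu> U s x" unfolding \<nu>[OF yW(2)] \<nu>[OF D(2)] using W(4) yW(1) by (rule bspec)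
    qed
  qed
  have resv: "\<nu> V (res A U V s) = restrict (\<nu> U s) V"
    if U: "opn U" "s \<in> carrier (sec A U)" "opn V" "V \<subseteq> U" for U V s
  proof
    fix x show "\<nu> V (res A U V s) x = restrict (\<nu> U s) V x"
    proof (cases "x \<in> V")
      case True
      note D = muD[OF U(3) True]
      have xU: "x \<in> U \<inter> Y (\<mu> x)" using D U(4) by blast
      have "\<nu> V (res A U V s) x = \<phi> (\<mu> x) (V \<inter> Y (\<mu> x)) (res (I (\<mu> x)) (U \<inter> Y (\<mu> x)) (V \<inter> Y (\<mu> x)) (germs (\<mu> x) U s)) x"
        unfolding \<nu>[OF D(2)] germs_res[OF U] by (rule refl)
      also have "\<dots> = res (?K (\<mu> x)) (U \<inter> Y (\<mu> x)) (V \<inter> Y (\<mu> x)) (\<phi> (\<mu> x) (U \<inter> Y (\<mu> x)) (germs (\<mu> x) U s)) x"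
        using sheaf_homs_D(2)[OF \<phi>(1)[OF D(1)] open_stratum[OF U(1)] open_stratum[OF U(3)] Int_mono[OF U(4) order_refl] germs_in[OF U(1,2)]]
        by (rule fun_cong)
      also have "\<dots> = \<nu> U s x" unfolding const_res \<nu>[OF xU] using D(2) by (rule restrict_apply')
      finally show ?thesis using True by simp
    qed (simp add: \<nu>_def)
  qed
  \<comment> \<open>The trivialisation is injective on sections over open sets, so equality at the
    single point \<open>x\<close> has to be spread first: both value functions are constant near
    \<open>x\<close> along the stratum, and on that smaller set injectivity gives equal
    germs.\<close>
  have inj: "\<exists>W. opn W \<and> x \<in> W \<and> W \<subseteq> U \<and> res A U W s = res A U W t"
    if U: "opn U" "s \<in> carrier (sec A U)" "t \<in> carrier (sec A U)" "x \<in> U" "\<nu> U s x = \<nu> U t x" for U s t x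
  proof -
    obtain W1 where W1: "opn W1" "x \<in> W1" "W1 \<subseteq> U" "\<forall>y\<in>W1. \<mu> y = \<mu> x \<longrightarrow> \<nu> U s y = \<nu> U s x"
      using const[OF U(1,2,4)] by (elim exE conjE) (rule that)
    obtain W2 where W2: "opn W2" "x \<in> W2" "W2 \<subseteq> U" "\<forall>y\<in>W2. \<mu> y = \<mu> x \<longrightarrow> \<nu> U t y = \<nu> U t x"
      using const[OF U(1,3,4)] by (elim exE conjE) (rule that)
    define W where "W = W1 \<inter> W2"
    have W: "opn W" "x \<in> W" "W \<subseteq> U" using W1 W2 by (auto simp: W_def openin_Int)
    let ?D = "\<mu> x"
    note D = muD[OF W(1,2)]
    note r = p_in[OF U(1) W(1,3)]
    have eq: "\<phi> ?D (W \<inter> Y ?D) (germs ?D W (res A U W s)) = \<phi> ?D (W \<inter> Y ?D) (germs ?D W (res A U W t))"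
    proof
      fix y
      show "\<phi> ?D (W \<inter> Y ?D) (germs ?D W (res A U W s)) y = \<phi> ?D (W \<inter> Y ?D) (germs ?D W (res A U W t)) y"
      proof (cases "y \<in> W \<inter> Y ?D")
        case True
        then have "\<nu> U s y = \<nu> U t y" using W1(4) W2(4) U(5) by (simp add: W_def)
        then have "\<nu> W (res A U W s) y = \<nu> W (res A U W t) y"
          using resv[OF U(1,2) W(1,3)] resv[OF U(1,3) W(1,3)] True by simp
        then show ?thesis unfolding \<nu>[OF True] .
      next
        case False
        then show ?thesis
          using gin[OF D(1) W(1) r[OF U(2)]] gin[OF D(1) W(1) r[OF U(3)]] unfolding const_carrier
          by (simp add: PiE_def extensional_def)
      qed
    qed
    have "germs ?D W (res A U W s) = germs ?D W (res A U W t)"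
      by (rule inj_onD[OF bij_betw_imp_inj_on[OF \<phi>(2)[OF D(1) open_stratum[OF W(1)]]] eq
          germs_in[OF W(1) r[OF U(2)]] germs_in[OF W(1) r[OF U(3)]]])
    from fun_cong[OF this, of x] have "germ TX A x W (res A U W s) = germ TX A x W (res A U W t)"
      using D(2) by (simp add: germs_def)
    then obtain W' where W': "opn W'" "x \<in> W'" "W' \<subseteq> W \<inter> W" "res A W W' (res A U W s) = res A W W' (res A U W t)"
      using germ_eq_iff[of W x "res A U W s" W "res A U W t"] W r[OF U(2)] r[OF U(3)] by auto
    then have "res A U W' s = res A U W' t"
      using p_comp[OF U(1) W(1) W'(1) _ W(3)] U(2,3) by simp
    then show ?thesis using W' W(3) by blast
  qed
  \<comment> \<open>The constant section \<open>v\<close> over the whole stratum has a preimage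
    under the trivialisation, and near \<open>x\<close> this preimage consists of the germs of one
    section of \<open>A\<close>.\<close>
  have surj: "\<exists>U s. opn U \<and> x \<in> U \<and> s \<in> carrier (sec A U) \<and> \<nu> U s x = v"
    if x: "x \<in> X" "v \<in> carrier (L (\<mu> x))" for x v
  proof -
    let ?D = "\<mu> x"
    have D: "?D \<in> simplices C" "x \<in> Y ?D" using mu_simplex x by auto
    have oY: "openin (TY ?D) (Y ?D)" by simp
    have "(\<lambda>y\<in>Y ?D. v) \<in> carrier (sec (?K ?D) (Y ?D))"
      unfolding const_carrier using x oY by auto
    then have "(\<lambda>y\<in>Y ?D. v) \<in> \<phi> ?D (Y ?D) ` carrier (sec (I ?D) (Y ?D))"
      unfolding bij_betw_imp_surj_on[OF \<phi>(2)[OF D(1) oY]] .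
    then obtain \<tau> where \<tau>: "(\<lambda>y\<in>Y ?D. v) = \<phi> ?D (Y ?D) \<tau>" "\<tau> \<in> carrier (sec (I ?D) (Y ?D))"
      by (rule imageE)
    obtain W U s where W: "openin (TY ?D) W" "x \<in> W" "W \<subseteq> Y ?D" "opn U" "W \<subseteq> U" "s \<in> carrier (sec A U)"
        "\<forall>z\<in>W. \<tau> z = germ TX A z U s"
      using \<tau>(2)[unfolded inv_carrier, THEN conjunct2, THEN bspec, OF D(2)] by (elim exE conjE) (rule that)
    have xU: "x \<in> U \<inter> Y ?D" using W D by blast
    have sub: "W \<subseteq> U \<inter> Y ?D" using W by blast
    have e: "restrict (germs ?D U s) W = restrict \<tau> W"
    proof
      fix z show "restrict (germs ?D U s) W z = restrict \<tau> W z"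
        using W(7) subsetD[OF sub, of z] by (cases "z \<in> W") (simp_all add: germs_def)
    qed
    have "\<nu> U s x = restrict (\<phi> ?D (U \<inter> Y ?D) (germs ?D U s)) W x" using W(2) \<nu>[OF xU] by simp
    also have "\<dots> = \<phi> ?D W (restrict (germs ?D U s) W) x"
      using sheaf_homs_D(2)[OF \<phi>(1)[OF D(1)] open_stratum[OF W(4)] W(1) sub germs_in[OF W(4,6)]]
      by (simp add: inv_res const_res)
    also have "\<dots> = \<phi> ?D W (restrict \<tau> W) x" unfolding e ..
    also have "\<dots> = restrict (\<lambda>y\<in>Y ?D. v) W x"
      using sheaf_homs_D(2)[OF \<phi>(1)[OF D(1)] oY W(1,3) \<tau>(2)] unfolding \<tau>(1) inv_res const_res by (rule fun_cong)
    also have "\<dots> = v" using W(2) D(2) by simp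
    finally show ?thesis using W(4,5,6) xU by blast
  qed
  have add: "\<nu> U (s \<oplus>\<^bsub>sec A U\<^esub> t) x = \<nu> U s x \<oplus>\<^bsub>L (\<mu> x)\<^esub> \<nu> U t x"
    if U: "opn U" "s \<in> carrier (sec A U)" "t \<in> carrier (sec A U)" "x \<in> U" for U s t x
    unfolding \<nu>[OF muD(2)[OF U(1,4)]] germs_add[OF U(1-3)]
      module_homD(2)[OF sheaf_homs_D(1)[OF \<phi>(1)[OF muD(1)[OF U(1,4)]] open_stratum[OF U(1)]] germs_in[OF U(1,2)] germs_in[OF U(1,3)]]
      const_add by (rule restrict_apply'[OF muD(2)[OF U(1,4)]])
  have smult: "\<nu> U (c \<odot>\<^bsub>sec A U\<^esub> s) x = c \<odot>\<^bsub>L (\<mu> x)\<^esub> \<nu> U s x"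
    if U: "opn U" "s \<in> carrier (sec A U)" "c \<in> carrier F" "x \<in> U" for U s c x
    unfolding \<nu>[OF muD(2)[OF U(1,4)]] germs_smult[OF U(1-3)]
      module_homD(3)[OF sheaf_homs_D(1)[OF \<phi>(1)[OF muD(1)[OF U(1,4)]] open_stratum[OF U(1)]] U(3) germs_in[OF U(1,2)]]
      const_smult by (rule restrict_apply'[OF muD(2)[OF U(1,4)]])
  have ext: "\<nu> U s \<in> (\<Pi>\<^sub>E x\<in>U. carrier (L (\<mu> x)))" if U: "opn U" "s \<in> carrier (sec A U)" for U s
  proof (rule PiE_I)
    fix x assume x: "x \<in> U"
    note D = muD[OF U(1) x]
    show "\<nu> U s x \<in> carrier (L (\<mu> x))"
      unfolding \<nu>[OF D(2)]
      using gin[OF D(1) U, unfolded const_carrier, THEN conjunct1] D(2) by (rule PiE_mem)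
  qed (simp add: \<nu>_def)
  have "stalk_values F C \<delta> L A \<nu>"
    unfolding stalk_values_def
    by (intro conjI ballI allI impI; (elim conjE)?;
        (rule fd ext const add smult resv inj surj; assumption))
  then show ?thesis by blast
qed

end

section \<open>Presheaves whose germs are classified by values in fixed vector spaces\<close>

locale cx_values = cx_presheaf C \<delta> F A
  for C :: "'a::euclidean_space set set" and \<delta> and F :: "'f ring" and A :: "('a, 'f, 'w) presheaf" +
  fixes L :: "'a set \<Rightarrow> ('f, 'v) module" and \<nu> :: "'a set \<Rightarrow> 'w \<Rightarrow> 'a \<Rightarrow> 'v"
  assumes sv: "stalk_values F C \<delta> L A \<nu>"
begin

lemma v_fd: "D \<in> simplices C \<Longrightarrow> fin_dim_vectorspace F (L D)"
  using sv by (simp add: stalk_values_def)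

lemma v_all: "\<lbrakk>opn U; s \<in> carrier (sec A U)\<rbrakk> \<Longrightarrow>
        \<nu> U s \<in> (\<Pi>\<^sub>E x\<in>U. carrier (L (\<mu> x))) \<and>
        (\<forall>x\<in>U. \<exists>W. opn W \<and> x \<in> W \<and> W \<subseteq> U \<and> (\<forall>y\<in>W. \<mu> y = \<mu> x \<longrightarrow> \<nu> U s y = \<nu> U s x)) \<and>
        (\<forall>t\<in>carrier (sec A U). \<forall>x\<in>U. \<nu> U (s \<oplus>\<^bsub>sec A U\<^esub> t) x = \<nu> U s x \<oplus>\<^bsub>L (\<mu> x)\<^esub> \<nu> U t x) \<and>
        (\<forall>c\<in>carrier F. \<forall>x\<in>U. \<nu> U (c \<odot>\<^bsub>sec A U\<^esub> s) x = c \<odot>\<^bsub>L (\<mu> x)\<^esub> \<nu> U s x) \<and>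
        (\<forall>V. opn V \<and> V \<subseteq> U \<longrightarrow> \<nu> V (res A U V s) = restrict (\<nu> U s) V) \<and>
        (\<forall>t\<in>carrier (sec A U). \<forall>x\<in>U. \<nu> U s x = \<nu> U t x \<longrightarrow>
           (\<exists>W. opn W \<and> x \<in> W \<and> W \<subseteq> U \<and> res A U W s = res A U W t))"
  using sv unfolding stalk_values_def by (elim conjE) (drule spec, drule (1) mp, drule (1) bspec)

lemma v_PiE: "\<lbrakk>opn U; s \<in> carrier (sec A U)\<rbrakk> \<Longrightarrow> \<nu> U s \<in> (\<Pi>\<^sub>E x\<in>U. carrier (L (\<mu> x)))"
  by (rule v_all[THEN conjunct1])

lemma v_in: "\<lbrakk>opn U; s \<in> carrier (sec A U); x \<in> U\<rbrakk> \<Longrightarrow> \<nu> U s x \<in> carrier (L (\<mu> x))"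
  by (rule PiE_mem[OF v_PiE])

lemma v_const: "\<lbrakk>opn U; s \<in> carrier (sec A U); x \<in> U\<rbrakk> \<Longrightarrow>
    \<exists>W. opn W \<and> x \<in> W \<and> W \<subseteq> U \<and> (\<forall>y\<in>W. \<mu> y = \<mu> x \<longrightarrow> \<nu> U s y = \<nu> U s x)"
  by (rule v_all[THEN conjunct2, THEN conjunct1, THEN bspec])

lemma v_add: "\<lbrakk>opn U; s \<in> carrier (sec A U); t \<in> carrier (sec A U); x \<in> U\<rbrakk> \<Longrightarrow>
    \<nu> U (s \<oplus>\<^bsub>sec A U\<^esub> t) x = \<nu> U s x \<oplus>\<^bsub>L (\<mu> x)\<^esub> \<nu> U t x"
  by (rule v_all[THEN conjunct2, THEN conjunct2, THEN conjunct1, THEN bspec, THEN bspec])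

lemma v_smult: "\<lbrakk>opn U; s \<in> carrier (sec A U); c \<in> carrier F; x \<in> U\<rbrakk> \<Longrightarrow>
    \<nu> U (c \<odot>\<^bsub>sec A U\<^esub> s) x = c \<odot>\<^bsub>L (\<mu> x)\<^esub> \<nu> U s x"
  by (rule v_all[THEN conjunct2, THEN conjunct2, THEN conjunct2, THEN conjunct1, THEN bspec, THEN bspec])

lemma v_res: "\<lbrakk>opn U; s \<in> carrier (sec A U); opn V; V \<subseteq> U\<rbrakk> \<Longrightarrow> \<nu> V (res A U V s) = restrict (\<nu> U s) V"
  using v_all[of U s, THEN conjunct2, THEN conjunct2, THEN conjunct2, THEN conjunct2, THEN conjunct1] by simp

lemma v_inj: "\<lbrakk>opn U; s \<in> carrier (sec A U); t \<in> carrier (sec A U); x \<in> U; \<nu> U s x = \<nu> U t x\<rbrakk> \<Longrightarrow>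
    \<exists>W. opn W \<and> x \<in> W \<and> W \<subseteq> U \<and> res A U W s = res A U W t"
  using v_all[of U s, THEN conjunct2, THEN conjunct2, THEN conjunct2, THEN conjunct2, THEN conjunct2] by simp

lemma v_surj: "\<lbrakk>x \<in> X; v \<in> carrier (L (\<mu> x))\<rbrakk> \<Longrightarrow> \<exists>U s. opn U \<and> x \<in> U \<and> s \<in> carrier (sec A U) \<and> \<nu> U s x = v"
  using sv unfolding stalk_values_def by (elim conjE) (drule (1) bspec, drule (1) bspec)

text \<open>The injectivity clause concerns two sections over one open set; restriction to the
  intersection extends it to different domains.\<close>

lemma v_agree_near:
  assumes s: "rep_at x U s" and t: "rep_at x V t" and eq: "\<nu> U s x = \<nu> V t x"
  shows "\<exists>W. opn W \<and> x \<in> W \<and> W \<subseteq> U \<inter> V \<and> res A U W s = res A V W t"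
proof -
  let ?W = "U \<inter> V"
  have W: "opn ?W" "x \<in> ?W" "?W \<subseteq> U" "?W \<subseteq> V" using s t by (auto simp: openin_Int)
  have c: "res A U ?W s \<in> carrier (sec A ?W)" "res A V ?W t \<in> carrier (sec A ?W)"
    using p_in s t W by auto
  have "\<nu> ?W (res A U ?W s) x = \<nu> ?W (res A V ?W t) x"
    using v_res[of U s ?W] v_res[of V t ?W] s t W eq by simp
  from v_inj[OF W(1) c W(2) this]
  obtain W' where W': "opn W'" "x \<in> W'" "W' \<subseteq> ?W" "res A ?W W' (res A U ?W s) = res A ?W W' (res A V ?W t)"
    by (elim exE conjE) (rule that)
  have "res A U W' s = res A V W' t"
    using p_comp[of U ?W W' s] p_comp[of V ?W W' t] s t W W' by simp
  then show ?thesis using W' by (intro exI[of _ W']) simp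
qed

lemma germ_val:
  assumes s: "rep_at x U s" and t: "rep_at x V t"
  shows "germ TX A x U s = germ TX A x V t \<longleftrightarrow> \<nu> U s x = \<nu> V t x"
proof
  assume "\<nu> U s x = \<nu> V t x"
  then show "germ TX A x U s = germ TX A x V t"
    unfolding germ_eq_iff[OF s t] using v_agree_near[OF s t] by simp
next
  assume "germ TX A x U s = germ TX A x V t"
  then obtain W where W: "opn W" "x \<in> W" "W \<subseteq> U \<inter> V" "res A U W s = res A V W t"
    unfolding germ_eq_iff[OF s t] by (elim exE conjE) (rule that)
  then have "restrict (\<nu> U s) W x = restrict (\<nu> V t) W x"
    using v_res[of U s W] v_res[of V t W] s t by simp
  then show "\<nu> U s x = \<nu> V t x" using W by simp
qed

text \<open>The comparison of the stalk with \<open>L (\<mu> x)\<close>. The choice is immaterial,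
  as all representatives of a germ have the same value at \<open>x\<close> by
  \<open>germ_val\<close>.\<close>

definition ev :: "'a \<Rightarrow> ('a set \<times> 'w) set \<Rightarrow> 'v" where
  "ev x \<xi> = (SOME v. \<exists>U s. rep_at x U s \<and> \<xi> = germ TX A x U s \<and> v = \<nu> U s x)"

lemma ev_germ:
  assumes "rep_at x U s"
  shows "ev x (germ TX A x U s) = \<nu> U s x"
  unfolding ev_def
proof (rule some_equality)
  fix v assume "\<exists>U' s'. rep_at x U' s' \<and> germ TX A x U s = germ TX A x U' s' \<and> v = \<nu> U' s' x"
  then obtain U' s' where *: "rep_at x U' s'" "germ TX A x U s = germ TX A x U' s'" "v = \<nu> U' s' x"
    by (elim exE conjE) (rule that, intro conjI)
  then show "v = \<nu> U s x" using germ_val[OF assms *(1)] by simp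
qed (use assms in blast)

lemma ev_in: "\<xi> \<in> carrier (stalk TX A x) \<Longrightarrow> ev x \<xi> \<in> carrier (L (\<mu> x))"
  unfolding stalk_carrier using ev_germ v_in by (elim exE conjE) simp

lemma ev_inj: "\<xi> \<in> carrier (stalk TX A x) \<Longrightarrow> \<zeta> \<in> carrier (stalk TX A x) \<Longrightarrow> ev x \<xi> = ev x \<zeta> \<Longrightarrow> \<xi> = \<zeta>"
  unfolding stalk_carrier
proof (elim exE conjE)
  fix U s V t assume a: "ev x \<xi> = ev x \<zeta>" "opn U" "x \<in> U" "s \<in> carrier (sec A U)" "\<xi> = germ TX A x U s"
    "opn V" "x \<in> V" "t \<in> carrier (sec A V)" "\<zeta> = germ TX A x V t"
  then show "\<xi> = \<zeta>" using germ_val[of U x s V t] ev_germ[of U x s] ev_germ[of V x t] by simp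
qed

lemma ev_add:
  assumes "\<xi> \<in> carrier (stalk TX A x)" "\<zeta> \<in> carrier (stalk TX A x)"
  shows "ev x (\<xi> \<oplus>\<^bsub>stalk TX A x\<^esub> \<zeta>) = ev x \<xi> \<oplus>\<^bsub>L (\<mu> x)\<^esub> ev x \<zeta>"
proof -
  obtain U s where s: "rep_at x U s" "\<xi> = germ TX A x U s" using iffD1[OF stalk_carrier assms(1)]
          by (elim exE conjE) (rule that, intro conjI)
  obtain V t where t: "rep_at x V t" "\<zeta> = germ TX A x V t" using iffD1[OF stalk_carrier assms(2)]
          by (elim exE conjE) (rule that, intro conjI)
  let ?W = "U \<inter> V"
  have W: "opn ?W" "x \<in> ?W" "?W \<subseteq> U" "?W \<subseteq> V" using s t by (auto simp: openin_Int)
  have r: "rep_at x ?W (res A U ?W s)" "rep_at x ?W (res A V ?W t)" using p_in s t W by auto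
  have e: "\<xi> = germ TX A x ?W (res A U ?W s)" "\<zeta> = germ TX A x ?W (res A V ?W t)"
    using germ_res[of U x s ?W] germ_res[of V x t ?W] s t W by auto
  have c: "rep_at x ?W (res A U ?W s \<oplus>\<^bsub>sec A ?W\<^esub> res A V ?W t)" using r p_add by simp
  show ?thesis unfolding e stalk_add_same[OF r] ev_germ[OF c] ev_germ[OF r(1)] ev_germ[OF r(2)]
    using v_add[of ?W] r by simp
qed

lemma ev_smult:
  assumes "\<xi> \<in> carrier (stalk TX A x)" "c \<in> carrier F"
  shows "ev x (c \<odot>\<^bsub>stalk TX A x\<^esub> \<xi>) = c \<odot>\<^bsub>L (\<mu> x)\<^esub> ev x \<xi>"
proof -
  obtain U s where s: "rep_at x U s" "\<xi> = germ TX A x U s" using iffD1[OF stalk_carrier assms(1)]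
          by (elim exE conjE) (rule that, intro conjI)
  have c: "rep_at x U (c \<odot>\<^bsub>sec A U\<^esub> s)" using s p_smult assms(2) by simp
  show ?thesis unfolding s(2) stalk_smult[OF s(1) assms(2)] ev_germ[OF c] ev_germ[OF s(1)]
    using v_smult[of U s c x] s assms(2) by simp
qed

text \<open>The converse of \<open>constructible_stalk_values\<close>: evaluating germs point by
  point trivialises the inverse image. Through this lemma represented presheaves are seen to be
  constructible.\<close>

lemma stratum_isomorphic:
  assumes D: "D \<in> simplices C"
  shows "sheaves_isomorphic F (TY D) (I D) (constant_sheaf (TY D) (L D))"
proof -
  let ?K = "constant_sheaf (TY D) (L D)"
  define \<phi> where "\<phi> = (\<lambda>V\<in>{V. openin (TY D) V}. \<lambda>\<sigma>\<in>carrier (sec (I D) V). \<lambda>y\<in>V. ev y (\<sigma> y))"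
  have VY: "V \<subseteq> Y D" if "openin (TY D) V" for V using that openin_imp_subset by blast
  have app: "\<phi> V \<sigma> = (\<lambda>y\<in>V. ev y (\<sigma> y))" if "openin (TY D) V" "\<sigma> \<in> carrier (sec (I D) V)" for V \<sigma>
    using that by (simp add: \<phi>_def)
  have stk: "\<sigma> y \<in> carrier (stalk TX A y)" if "\<sigma> \<in> carrier (sec (I D) V)" "y \<in> V" for \<sigma> V y
    using that(1)[unfolded inv_carrier, THEN conjunct1] that(2) by (rule PiE_mem)
  have mem: "\<phi> V \<sigma> \<in> carrier (sec ?K V)" if V: "openin (TY D) V" "\<sigma> \<in> carrier (sec (I D) V)" for V \<sigma>
    unfolding app[OF V] const_carrier
  proof (intro conjI ballI)
    show "(\<lambda>y\<in>V. ev y (\<sigma> y)) \<in> V \<rightarrow>\<^sub>E carrier (L D)"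
      using ev_in[OF stk[OF V(2)]] VY[OF V(1)] by (intro restrict_PiE[THEN iffD2] Pi_I) blast
    fix y assume y: "y \<in> V"
    then have yY: "y \<in> X" "\<mu> y = D" using VY[OF V(1)] by auto
    obtain W U s where W: "openin (TY D) W" "y \<in> W" "W \<subseteq> V" "opn U" "W \<subseteq> U" "s \<in> carrier (sec A U)"
        "\<forall>z\<in>W. \<sigma> z = germ TX A z U s"
      using V(2)[unfolded inv_carrier, THEN conjunct2, THEN bspec, OF y] by (elim exE conjE) (rule that)
    have yU: "y \<in> U" using W by blast
    obtain W2 where W2: "opn W2" "y \<in> W2" "W2 \<subseteq> U" "\<forall>z\<in>W2. \<mu> z = \<mu> y \<longrightarrow> \<nu> U s z = \<nu> U s y"
      using v_const[OF W(4,6) yU] by (elim exE conjE) (rule that)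
    show "\<exists>W. openin (TY D) W \<and> y \<in> W \<and> W \<subseteq> V \<and>
        (\<forall>z\<in>W. (\<lambda>y\<in>V. ev y (\<sigma> y)) z = (\<lambda>y\<in>V. ev y (\<sigma> y)) y)"
    proof (intro exI conjI ballI)
      show "openin (TY D) (W \<inter> (W2 \<inter> Y D))" using W(1) open_stratum[OF W2(1)] by (rule openin_Int)
      show "y \<in> W \<inter> (W2 \<inter> Y D)" "W \<inter> (W2 \<inter> Y D) \<subseteq> V" using W W2 yY by auto
      fix z assume z: "z \<in> W \<inter> (W2 \<inter> Y D)"
      have e: "ev z' (\<sigma> z') = \<nu> U s z'" if "z' \<in> W" for z'
        using W(7) that ev_germ[of U z' s] W(4,5,6) by auto
      have "\<nu> U s z = \<nu> U s y" using W2(4) z yY by simp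
      then show "(\<lambda>y\<in>V. ev y (\<sigma> y)) z = (\<lambda>y\<in>V. ev y (\<sigma> y)) y"
        using e[of z] e[OF W(2)] z W(3) y by auto
    qed
  qed
  have lin: "\<phi> V \<in> Lin F (sec (I D) V) (sec ?K V)" if V: "openin (TY D) V" for V
  proof -
    have ad: "\<sigma> \<oplus>\<^bsub>sec (I D) V\<^esub> \<tau> \<in> carrier (sec (I D) V)" if st: "\<sigma> \<in> carrier (sec (I D) V)" "\<tau> \<in> carrier (sec (I D) V)" for \<sigma> \<tau>
      unfolding inv_carrier inv_add
    proof (intro conjI ballI)
      show "(\<lambda>x\<in>V. \<sigma> x \<oplus>\<^bsub>stalk TX A x\<^esub> \<tau> x) \<in> (\<Pi>\<^sub>E y\<in>V. carrier (stalk TX A y))"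
      proof (intro restrict_PiE[THEN iffD2] Pi_I)
        fix y assume y: "y \<in> V"
        obtain U s where s: "rep_at y U s" "\<sigma> y = germ TX A y U s" using iffD1[OF stalk_carrier stk[OF st(1) y]]
          by (elim exE conjE) (rule that, intro conjI)
        obtain U' t where t: "rep_at y U' t" "\<tau> y = germ TX A y U' t" using iffD1[OF stalk_carrier stk[OF st(2) y]]
          by (elim exE conjE) (rule that, intro conjI)
        have "rep_at y (U \<inter> U') (res A U (U \<inter> U') s \<oplus>\<^bsub>sec A (U \<inter> U')\<^esub> res A U' (U \<inter> U') t)"
          using s t p_in p_add by (auto simp: openin_Int)
        then show "\<sigma> y \<oplus>\<^bsub>stalk TX A y\<^esub> \<tau> y \<in> carrier (stalk TX A y)"
          unfolding s(2) t(2) stalk_add[OF s(1) t(1)] stalk_carrier by blast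
      qed
      fix y assume y: "y \<in> V"
      obtain W U s where W: "openin (TY D) W" "y \<in> W" "W \<subseteq> V" "opn U" "W \<subseteq> U" "s \<in> carrier (sec A U)"
          "\<forall>z\<in>W. \<sigma> z = germ TX A z U s"
        using st(1)[unfolded inv_carrier, THEN conjunct2, THEN bspec, OF y] by (elim exE conjE) (rule that)
      obtain W' U' t where W': "openin (TY D) W'" "y \<in> W'" "W' \<subseteq> V" "opn U'" "W' \<subseteq> U'" "t \<in> carrier (sec A U')"
          "\<forall>z\<in>W'. \<tau> z = germ TX A z U' t"
        using st(2)[unfolded inv_carrier, THEN conjunct2, THEN bspec, OF y] by (elim exE conjE) (rule that)
      have o: "opn (U \<inter> U')" "openin (TY D) (W \<inter> W')" using W W' by (auto simp: openin_Int)
      have "res A U (U \<inter> U') s \<oplus>\<^bsub>sec A (U \<inter> U')\<^esub> res A U' (U \<inter> U') t \<in> carrier (sec A (U \<inter> U'))"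
        using W W' o p_in p_add by auto
      moreover have "(\<lambda>x\<in>V. \<sigma> x \<oplus>\<^bsub>stalk TX A x\<^esub> \<tau> x) z =
          germ TX A z (U \<inter> U') (res A U (U \<inter> U') s \<oplus>\<^bsub>sec A (U \<inter> U')\<^esub> res A U' (U \<inter> U') t)" if z: "z \<in> W \<inter> W'" for z
      proof -
        have zz: "z \<in> V" "z \<in> W" "z \<in> W'" "z \<in> U" "z \<in> U'" using z W(3,5) W'(5) by auto
        show ?thesis using W(7) W'(7) zz stalk_add[of U z s U' t] W(4,6) W'(4,6) by simp
      qed
      moreover have "y \<in> W \<inter> W'" "W \<inter> W' \<subseteq> V" "W \<inter> W' \<subseteq> U \<inter> U'" using W W' by auto
      ultimately show "\<exists>W U s. openin (TY D) W \<and> y \<in> W \<and> W \<subseteq> V \<and> opn U \<and> W \<subseteq> U \<and> s \<in> carrier (sec A U) \<and>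
          (\<forall>z\<in>W. (\<lambda>x\<in>V. \<sigma> x \<oplus>\<^bsub>stalk TX A x\<^esub> \<tau> x) z = germ TX A z U s)"
        using o by (intro exI conjI ballI)
    qed
    have sm: "c \<odot>\<^bsub>sec (I D) V\<^esub> \<sigma> \<in> carrier (sec (I D) V)" if st: "\<sigma> \<in> carrier (sec (I D) V)" "c \<in> carrier F" for \<sigma> c
      unfolding inv_carrier inv_smult
    proof (intro conjI ballI)
      show "(\<lambda>x\<in>V. c \<odot>\<^bsub>stalk TX A x\<^esub> \<sigma> x) \<in> (\<Pi>\<^sub>E y\<in>V. carrier (stalk TX A y))"
      proof (intro restrict_PiE[THEN iffD2] Pi_I)
        fix y assume y: "y \<in> V"
        obtain U s where s: "rep_at y U s" "\<sigma> y = germ TX A y U s" using iffD1[OF stalk_carrier stk[OF st(1) y]]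
          by (elim exE conjE) (rule that, intro conjI)
        have "rep_at y U (c \<odot>\<^bsub>sec A U\<^esub> s)" using s p_smult st(2) by simp
        then show "c \<odot>\<^bsub>stalk TX A y\<^esub> \<sigma> y \<in> carrier (stalk TX A y)"
          unfolding s(2) stalk_smult[OF s(1) st(2)] stalk_carrier by blast
      qed
      fix y assume y: "y \<in> V"
      obtain W U s where W: "openin (TY D) W" "y \<in> W" "W \<subseteq> V" "opn U" "W \<subseteq> U" "s \<in> carrier (sec A U)"
          "\<forall>z\<in>W. \<sigma> z = germ TX A z U s"
        using st(1)[unfolded inv_carrier, THEN conjunct2, THEN bspec, OF y] by (elim exE conjE) (rule that)
      have "(\<lambda>x\<in>V. c \<odot>\<^bsub>stalk TX A x\<^esub> \<sigma> x) z = germ TX A z U (c \<odot>\<^bsub>sec A U\<^esub> s)" if z: "z \<in> W" for z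
        using W(3,7) z stalk_smult[of U z s c] W(4,5,6) st(2) by auto
      then show "\<exists>W U s. openin (TY D) W \<and> y \<in> W \<and> W \<subseteq> V \<and> opn U \<and> W \<subseteq> U \<and> s \<in> carrier (sec A U) \<and>
          (\<forall>z\<in>W. (\<lambda>x\<in>V. c \<odot>\<^bsub>stalk TX A x\<^esub> \<sigma> x) z = germ TX A z U s)"
        using W(1-5) p_smult[OF W(4) st(2) W(6)] by (intro exI conjI ballI)
    qed
    have "\<phi> V \<in> module_hom F (sec (I D) V) (sec ?K V)"
      unfolding module_hom_def
    proof (intro CollectI conjI allI impI Pi_I, goal_cases)
      case (1 \<sigma>)
      then show ?case using mem[OF V] by simp
    next
      case (2 \<sigma> \<tau>)
      then have st: "\<sigma> \<in> carrier (sec (I D) V)" "\<tau> \<in> carrier (sec (I D) V)" by auto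
      have "(\<lambda>y\<in>V. ev y ((\<sigma> \<oplus>\<^bsub>sec (I D) V\<^esub> \<tau>) y)) = (\<lambda>x\<in>V. \<phi> V \<sigma> x \<oplus>\<^bsub>L D\<^esub> \<phi> V \<tau> x)"
      proof (rule ext)
        fix y
        show "(\<lambda>y\<in>V. ev y ((\<sigma> \<oplus>\<^bsub>sec (I D) V\<^esub> \<tau>) y)) y = (\<lambda>x\<in>V. \<phi> V \<sigma> x \<oplus>\<^bsub>L D\<^esub> \<phi> V \<tau> x) y"
        proof (cases "y \<in> V")
          case True
          then have "\<mu> y = D" using VY[OF V] by blast
          then show ?thesis
            using True ev_add[OF stk[OF st(1) True] stk[OF st(2) True]]
            by (simp add: inv_add app[OF V st(1)] app[OF V st(2)])
        qed simp
      qed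
      then show ?case using app[OF V ad[OF st]] by (simp only: const_add)
    next
      case (3 c \<sigma>)
      then have st: "\<sigma> \<in> carrier (sec (I D) V)" "c \<in> carrier F" by auto
      have "(\<lambda>y\<in>V. ev y ((c \<odot>\<^bsub>sec (I D) V\<^esub> \<sigma>) y)) = (\<lambda>x\<in>V. c \<odot>\<^bsub>L D\<^esub> \<phi> V \<sigma> x)"
      proof (rule ext)
        fix y
        show "(\<lambda>y\<in>V. ev y ((c \<odot>\<^bsub>sec (I D) V\<^esub> \<sigma>) y)) y = (\<lambda>x\<in>V. c \<odot>\<^bsub>L D\<^esub> \<phi> V \<sigma> x) y"
        proof (cases "y \<in> V")
          case True
          then have "\<mu> y = D" using VY[OF V] by blast
          then show ?thesis
            using True ev_smult[OF stk[OF st(1) True] st(2)]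
            by (simp add: inv_smult app[OF V st(1)])
        qed simp
      qed
      then show ?case using app[OF V sm[OF st]] by (simp only: const_smult)
    qed
    then show ?thesis using V by (simp add: Lin_def \<phi>_def)
  qed
  have inv_sub: "restrict \<sigma> V \<in> carrier (sec (I D) V)"
    if V: "openin (TY D) U" "openin (TY D) V" "V \<subseteq> U" "\<sigma> \<in> carrier (sec (I D) U)" for U V \<sigma>
    unfolding inv_carrier
  proof (intro conjI ballI)
    show "restrict \<sigma> V \<in> (\<Pi>\<^sub>E y\<in>V. carrier (stalk TX A y))"
      using stk[OF V(4)] V(3) by (intro restrict_PiE[THEN iffD2] Pi_I) blast
    fix y assume y: "y \<in> V"
    obtain W U' s where W: "openin (TY D) W" "y \<in> W" "W \<subseteq> U" "opn U'" "W \<subseteq> U'" "s \<in> carrier (sec A U')"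
        "\<forall>z\<in>W. \<sigma> z = germ TX A z U' s"
      using V(4)[unfolded inv_carrier, THEN conjunct2, THEN bspec, OF subsetD[OF V(3) y]] by (elim exE conjE) (rule that)
    have "openin (TY D) (W \<inter> V)" "y \<in> W \<inter> V" "W \<inter> V \<subseteq> V" "W \<inter> V \<subseteq> U'" "\<forall>z\<in>W \<inter> V. restrict \<sigma> V z = germ TX A z U' s"
      using W V(2) y by (auto simp: openin_Int)
    then show "\<exists>W U s. openin (TY D) W \<and> y \<in> W \<and> W \<subseteq> V \<and> opn U \<and> W \<subseteq> U \<and> s \<in> carrier (sec A U) \<and>
        (\<forall>z\<in>W. restrict \<sigma> V z = germ TX A z U s)"
      using W(4,6) by (intro exI conjI)
  qed
  have "\<phi> \<in> sheaf_homs F (TY D) (I D) ?K"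
    unfolding sheaf_homs_def
  proof (intro CollectI conjI allI impI ballI)
    show "\<phi> \<in> (\<Pi>\<^sub>E U\<in>{U. openin (TY D) U}. Lin F (sec (I D) U) (sec ?K U))"
      using lin by (intro PiE_I) (auto simp: \<phi>_def)
    fix U V \<sigma> assume a: "openin (TY D) U \<and> openin (TY D) V \<and> V \<subseteq> U" "\<sigma> \<in> carrier (sec (I D) U)"
    then have b: "openin (TY D) U" "openin (TY D) V" "V \<subseteq> U" by auto
    show "\<phi> V (res (I D) U V \<sigma>) = res ?K U V (\<phi> U \<sigma>)"
      unfolding inv_res const_res app[OF b(2) inv_sub[OF b a(2)]] app[OF b(1) a(2)]
      by (rule ext) (use b(3) in auto)
  qed
  moreover have "bij_betw (\<phi> V) (carrier (sec (I D) V)) (carrier (sec ?K V))" if V: "openin (TY D) V" for V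
    unfolding bij_betw_def
  proof
    show "inj_on (\<phi> V) (carrier (sec (I D) V))"
    proof
      fix \<sigma> \<tau> assume st: "\<sigma> \<in> carrier (sec (I D) V)" "\<tau> \<in> carrier (sec (I D) V)" and eq: "\<phi> V \<sigma> = \<phi> V \<tau>"
      show "\<sigma> = \<tau>"
      proof
        fix y show "\<sigma> y = \<tau> y"
        proof (cases "y \<in> V")
          case True
          then have "ev y (\<sigma> y) = ev y (\<tau> y)"
            using fun_cong[OF eq, of y] app[OF V st(1)] app[OF V st(2)] by simp
          then show ?thesis using ev_inj stk[OF st(1) True] stk[OF st(2) True] by simp
        next
          case False
          then show ?thesis using st unfolding inv_carrier by (simp add: PiE_def extensional_def)
        qed
      qed
    qed
    show "\<phi> V ` carrier (sec (I D) V) = carrier (sec ?K V)"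
    proof (intro equalityI subsetI)
      fix c assume "c \<in> \<phi> V ` carrier (sec (I D) V)"
      then show "c \<in> carrier (sec ?K V)" using mem[OF V] by (elim imageE) simp
    next
      fix c assume c: "c \<in> carrier (sec ?K V)"
      have cin: "c y \<in> carrier (L (\<mu> y))" "y \<in> X" "\<mu> y = D" if "y \<in> V" for y
      proof -
        show "y \<in> X" "\<mu> y = D" using VY[OF V] that by auto
        then show "c y \<in> carrier (L (\<mu> y))"
          using PiE_mem[OF c[unfolded const_carrier, THEN conjunct1] that] by simp
      qed
      \<comment> \<open>A locally constant function is lifted pointwise. At \<open>y\<close> some
        section has the value \<open>c y\<close>; near \<open>y\<close> its values stay constant
        along the stratum and so does \<open>c\<close>, hence by injectivity of \<open>ev\<close>
        the germs of that one section are the lift on a neighbourhood.\<close>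
      have "\<forall>y\<in>V. \<exists>p. opn (fst p) \<and> y \<in> fst p \<and> snd p \<in> carrier (sec A (fst p)) \<and> \<nu> (fst p) (snd p) y = c y"
      proof
        fix y assume "y \<in> V"
        from v_surj[OF cin(2)[OF this] cin(1)[OF this]]
        obtain U s where "opn U" "y \<in> U" "s \<in> carrier (sec A U)" "\<nu> U s y = c y" by (elim exE conjE) (rule that)
        then show "\<exists>p. opn (fst p) \<and> y \<in> fst p \<and> snd p \<in> carrier (sec A (fst p)) \<and> \<nu> (fst p) (snd p) y = c y"
          by (intro exI[of _ "(U, s)"]) simp
      qed
      from bchoice[OF this] obtain p where p: "\<forall>y\<in>V. opn (fst (p y)) \<and> y \<in> fst (p y) \<and>
          snd (p y) \<in> carrier (sec A (fst (p y))) \<and> \<nu> (fst (p y)) (snd (p y)) y = c y" by (elim exE) (rule that)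
      define \<tau> where "\<tau> = (\<lambda>y\<in>V. germ TX A y (fst (p y)) (snd (p y)))"
      have \<tau>: "\<tau> y \<in> carrier (stalk TX A y)" "ev y (\<tau> y) = c y" if "y \<in> V" for y
      proof -
        have r: "rep_at y (fst (p y)) (snd (p y))" using bspec[OF p that] by simp
        show "\<tau> y \<in> carrier (stalk TX A y)" unfolding stalk_carrier using r that by (auto simp: \<tau>_def)
        show "ev y (\<tau> y) = c y" using ev_germ[OF r] bspec[OF p that] that by (simp add: \<tau>_def)
      qed
      have "\<tau> \<in> carrier (sec (I D) V)"
        unfolding inv_carrier
      proof (intro conjI ballI)
        show "\<tau> \<in> (\<Pi>\<^sub>E y\<in>V. carrier (stalk TX A y))"
          using \<tau>(1) by (intro PiE_I) (simp_all add: \<tau>_def)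
        fix y assume y: "y \<in> V"
        define U s where "U = fst (p y)" and "s = snd (p y)"
        have U: "opn U" "y \<in> U" "s \<in> carrier (sec A U)" "\<nu> U s y = c y"
          using bspec[OF p y] by (auto simp: U_def s_def)
        obtain W1 where W1: "openin (TY D) W1" "y \<in> W1" "W1 \<subseteq> V" "\<forall>z\<in>W1. c z = c y"
          using c[unfolded const_carrier, THEN conjunct2, THEN bspec, OF y] by (elim exE conjE) (rule that)
        obtain W2 where W2: "opn W2" "y \<in> W2" "W2 \<subseteq> U" "\<forall>z\<in>W2. \<mu> z = \<mu> y \<longrightarrow> \<nu> U s z = \<nu> U s y"
          using v_const[OF U(1,3,2)] by (elim exE conjE) (rule that)
        let ?W = "W1 \<inter> (W2 \<inter> Y D)"
        have o: "openin (TY D) ?W" using W1(1) open_stratum[OF W2(1)] by (rule openin_Int)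
        have sub: "y \<in> ?W" "?W \<subseteq> V" "?W \<subseteq> U" using W1(2,3) W2(2,3) cin(2,3)[OF y] by auto
        have "\<forall>z\<in>?W. \<tau> z = germ TX A z U s"
        proof
          fix z assume z: "z \<in> ?W"
          then have zV: "z \<in> V" "z \<in> U" using sub by auto
          have r: "rep_at z U s" using U zV by simp
          have "ev z (\<tau> z) = c z" using \<tau>(2)[OF zV(1)] .
          also have "\<dots> = c y" using z by (intro bspec[OF W1(4)]) simp
          also have "\<dots> = \<nu> U s z" using bspec[OF W2(4), of z] U(4) z cin(3)[OF y] by simp
          also have "\<dots> = ev z (germ TX A z U s)" using ev_germ[OF r] by simp
          finally show "\<tau> z = germ TX A z U s"
            using r stalk_carrier by (intro ev_inj[OF \<tau>(1)[OF zV(1)]]) blast+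
        qed
        then show "\<exists>W U s. openin (TY D) W \<and> y \<in> W \<and> W \<subseteq> V \<and> opn U \<and> W \<subseteq> U \<and> s \<in> carrier (sec A U) \<and>
            (\<forall>z\<in>W. \<tau> z = germ TX A z U s)"
          using o sub U(1,3) by (intro exI conjI)
      qed
      moreover have "\<phi> V \<tau> = c"
        unfolding app[OF V calculation]
      proof
        fix y show "(\<lambda>y\<in>V. ev y (\<tau> y)) y = c y"
          using \<tau>(2) c unfolding const_carrier by (cases "y \<in> V") (simp_all add: PiE_def extensional_def)
      qed
      ultimately show "c \<in> \<phi> V ` carrier (sec (I D) V)" by blast
    qed
  qed
  ultimately show ?thesis unfolding sheaves_isomorphic_def by blast
qed

end

context perverse_cx
begin

lemma cell_ne: "K \<in> flags \<Longrightarrow> \<exists>x. x \<in> X \<and> ch x = K"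
proof -
  assume K: "K \<in> flags"
  let ?S = "chain_top \<delta> K"
  have b: "barycenter ?S \<in> X" "ch (barycenter ?S) = {?S}"
    using carrier_chain_barycenter[OF chain_top_simplex[OF K]] by auto
  have "opn X" by simp
  from cell_meets[OF this b(1) K] show ?thesis using b(2) chain_top(1)[OF K] by auto
qed

lemma flag_pair_top:
  assumes "S \<in> simplices C" "T \<in> simplices C" "inc S T" "lev T \<le> lev S"
  shows "chain_top \<delta> {S, T} = T"
  using assms by (intro chain_top_eqI[OF pair_chain]) auto

lemma flag_single_top: "S \<in> simplices C \<Longrightarrow> chain_top \<delta> {S} = S"
  by (intro chain_top_eqI[OF singleton_chain]) auto

end

text \<open>Near \<open>x\<close>, a section takes a single value on every open simplex, which depends on its value at
  \<open>x\<close> only. This gives transition maps between the open simplices of the subdivision, and then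
  between the strata.\<close>

context cx_values
begin

lemma v_const_at: "\<lbrakk>rep_at x U s; w \<in> U\<rbrakk> \<Longrightarrow>
    \<exists>W. opn W \<and> w \<in> W \<and> W \<subseteq> U \<and> (\<forall>y\<in>W. \<mu> y = \<mu> w \<longrightarrow> \<nu> U s y = \<nu> U s w)"
  by (elim conjE) (rule v_const)

text \<open>A good neighbourhood cuts every open simplex of the subdivision in a connected set. Such
  a set lies in one stratum, along which the values are locally constant.\<close>

lemma v_near:
  assumes s: "rep_at x U s"
  shows "\<exists>W. opn W \<and> x \<in> W \<and> W \<subseteq> U \<and> (\<forall>y\<in>W. ch x \<subseteq> ch y) \<and>
    (\<forall>y\<in>W. \<forall>z\<in>W. ch y = ch z \<longrightarrow> \<nu> U s y = \<nu> U s z)"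
proof -
  have "opn U" "x \<in> U" using s by auto
  then show ?thesis
  proof (rule good_neighbourhood)
    fix W assume W: "opn W" "x \<in> W" "W \<subseteq> U" "\<And>y. y \<in> W \<Longrightarrow> ch x \<subseteq> ch y"
      "\<And>K. K \<in> flags \<Longrightarrow> connected (W \<inter> cell K)"
    have "\<nu> U s y = \<nu> U s z" if yz: "y \<in> W" "z \<in> W" "ch y = ch z" for y z
    proof -
      have yX: "y \<in> X" "z \<in> X" using yz opn_sub[OF W(1)] by auto
      show ?thesis
      proof (rule const_on_connected[OF W(5)[OF ch_chain[OF yX(1)]]])
        show "W \<inter> cell (ch y) \<subseteq> X" "y \<in> W \<inter> cell (ch y)" "z \<in> W \<inter> cell (ch y)" using yz yX by auto
        fix w assume w: "w \<in> W \<inter> cell (ch y)"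
        then have wU: "w \<in> U" using W(3) by blast
        obtain W' where W': "opn W'" "w \<in> W'" "W' \<subseteq> U" "\<forall>y\<in>W'. \<mu> y = \<mu> w \<longrightarrow> \<nu> U s y = \<nu> U s w"
          using v_const_at[OF s wU] by (elim exE conjE) (rule that)
        have "\<forall>v\<in>W' \<inter> (W \<inter> cell (ch y)). \<nu> U s v = \<nu> U s w"
        proof
          fix v assume v: "v \<in> W' \<inter> (W \<inter> cell (ch y))"
          then have "\<mu> v = \<mu> w" using w by (simp add: stratum_of_def)
          then show "\<nu> U s v = \<nu> U s w" using W'(4) v by blast
        qed
        then show "\<exists>W'. opn W' \<and> w \<in> W' \<and> (\<forall>v\<in>W' \<inter> (W \<inter> cell (ch y)). \<nu> U s v = \<nu> U s w)"
          using W'(1,2) by (intro exI[of _ W'] conjI)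
      qed
    qed
    then show ?thesis using W(1-4) by (intro exI[of _ W] conjI ballI impI)
  qed
qed

text \<open>A relation that quantifies over sections, so that existence and uniqueness of the
  propagated value can be proved before any section is chosen.\<close>

definition tvalue :: "'a \<Rightarrow> 'a set set \<Rightarrow> 'v \<Rightarrow> 'v \<Rightarrow> bool" where
  "tvalue x K v w \<longleftrightarrow> (\<exists>U s W. rep_at x U s \<and> \<nu> U s x = v \<and> opn W \<and> x \<in> W \<and> W \<subseteq> U \<and>
     (\<forall>y\<in>W \<inter> cell K. \<nu> U s y = w))"

lemma tvalueI:
  "\<lbrakk>rep_at x U s; \<nu> U s x = v; opn W; x \<in> W; W \<subseteq> U; \<forall>y\<in>W \<inter> cell K. \<nu> U s y = w\<rbrakk> \<Longrightarrow> tvalue x K v w"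
  unfolding tvalue_def by (rule exI[of _ U], rule exI[of _ s], rule exI[of _ W], intro conjI; elim conjE; assumption)

text \<open>Two sections with the same value at \<open>x\<close> agree near \<open>x\<close>, and
  the open simplex of \<open>K\<close> meets every neighbourhood of \<open>x\<close>.\<close>

lemma tvalue_unique:
  assumes K: "K \<in> flags" "ch x \<subseteq> K" and w: "tvalue x K v w" "tvalue x K v w'"
  shows "w = w'"
proof -
  obtain U s W where 1: "rep_at x U s" "\<nu> U s x = v" "opn W" "x \<in> W" "W \<subseteq> U" "\<forall>y\<in>W \<inter> cell K. \<nu> U s y = w"
    using w(1) unfolding tvalue_def by (elim exE conjE) (rule that, intro conjI)
  obtain U' s' W' where 2: "rep_at x U' s'" "\<nu> U' s' x = v" "opn W'" "x \<in> W'" "W' \<subseteq> U'" "\<forall>y\<in>W' \<inter> cell K. \<nu> U' s' y = w'"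
    using w(2) unfolding tvalue_def by (elim exE conjE) (rule that, intro conjI)
  have "\<nu> U s x = \<nu> U' s' x" using 1(2) 2(2) by simp
  from v_agree_near[OF 1(1) 2(1) this]
  obtain N where N: "opn N" "x \<in> N" "N \<subseteq> U \<inter> U'" "res A U N s = res A U' N s'"
    by (elim exE conjE) (rule that)
  have o: "opn (N \<inter> (W \<inter> W'))" "x \<in> N \<inter> (W \<inter> W')" using N(1,2) 1(3,4) 2(3,4) by (auto simp: openin_Int)
  from cell_meets[OF o K] obtain y where y: "y \<in> N" "y \<in> W" "y \<in> W'" "y \<in> X" "ch y = K" by auto
  have "restrict (\<nu> U s) N y = restrict (\<nu> U' s') N y"
    using v_res[of U s N] v_res[of U' s' N] N 1(1) 2(1) by simp
  then have "\<nu> U s y = \<nu> U' s' y" using y by simp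
  then show ?thesis using bspec[OF 1(6), of y] bspec[OF 2(6), of y] y by simp
qed

lemma tvalue_ex:
  assumes K: "K \<in> flags" "ch x \<subseteq> K" and x: "x \<in> X" and v: "v \<in> carrier (L (\<mu> x))"
  shows "\<exists>w. tvalue x K v w"
proof -
  obtain U s where s: "rep_at x U s" "\<nu> U s x = v"
    using v_surj[OF x v] by (elim exE conjE) (rule that, intro conjI)
  obtain W where W: "opn W" "x \<in> W" "W \<subseteq> U" "\<forall>y\<in>W. \<forall>z\<in>W. ch y = ch z \<longrightarrow> \<nu> U s y = \<nu> U s z"
    using v_near[OF s(1)] by (elim exE conjE) (rule that)
  obtain y where y: "y \<in> W" "y \<in> X" "ch y = K" using cell_meets[OF W(1,2) K] by auto
  have "\<nu> U s z = \<nu> U s y" if "z \<in> W \<inter> cell K" for z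
    using bspec[OF bspec[OF W(4), of z] y(1)] that y(3) by simp
  then have "\<forall>z\<in>W \<inter> cell K. \<nu> U s z = \<nu> U s y" by blast
  then have "tvalue x K v (\<nu> U s y)" by (rule tvalueI[OF s W(1-3)])
  then show ?thesis by (rule exI)
qed

text \<open>The base point in the open simplex of \<open>K\<close> is an arbitrary choice, removed
  in \<open>tvalue_tmap\<close>.\<close>

definition tmap :: "'a set set \<Rightarrow> 'a set set \<Rightarrow> 'v \<Rightarrow> 'v" where
  "tmap K K' v = (SOME w. tvalue (SOME x. x \<in> X \<and> ch x = K) K' v w)"

text \<open>The value propagated from \<open>z\<close> is locally constant while \<open>z\<close>
  moves in its open simplex, because one section passes through \<open>v\<close> at all nearby
  points. Open simplices are connected, so the base point does not matter.\<close>

lemma tvalue_tmap: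
  assumes K: "K' \<in> flags" "ch x \<subseteq> K'" and x: "x \<in> X" and v: "v \<in> carrier (L (\<mu> x))"
  shows "tvalue x K' v (tmap (ch x) K' v)"
proof -
  define g where "g z = (SOME w. tvalue z K' v w)" for z
  have mz: "\<mu> z = \<mu> x" if "ch z = ch x" for z using that by (simp add: stratum_of_def)
  have g: "tvalue z K' v (g z)" if "z \<in> X" "ch z = ch x" for z
  proof -
    have "v \<in> carrier (L (\<mu> z))" using v mz[OF that(2)] by simp
    moreover have "ch z \<subseteq> K'" using that(2) K(2) by simp
    ultimately have "\<exists>w. tvalue z K' v w" using tvalue_ex[OF K(1) _ that(1)] by simp
    then show ?thesis unfolding g_def by (rule someI_ex)
  qed
  define x0 where "x0 = (SOME z. z \<in> X \<and> ch z = ch x)"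
  have x0: "x0 \<in> X \<and> ch x0 = ch x" unfolding x0_def by (rule someI[of _ x]) (use x in simp)
  have "g x = g x0"
  proof (rule const_on_connected[OF cell_connected[OF ch_chain[OF x]]])
    fix z assume z: "z \<in> cell (ch x)"
    then have zz: "z \<in> X" "ch z = ch x" by auto
    obtain U s W where 1: "rep_at z U s" "\<nu> U s z = v" "opn W" "z \<in> W" "W \<subseteq> U" "\<forall>y\<in>W \<inter> cell K'. \<nu> U s y = g z"
      using g[OF zz] unfolding tvalue_def by (elim exE conjE) (rule that, intro conjI)
    have r: "opn U" "s \<in> carrier (sec A U)" "z \<in> U" using 1(1) by auto
    obtain W1 where W1: "opn W1" "z \<in> W1" "W1 \<subseteq> U" "\<forall>y\<in>W1. \<mu> y = \<mu> z \<longrightarrow> \<nu> U s y = \<nu> U s z"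
      using v_const[OF r] by (elim exE conjE) (rule that)
    have "g y = g z" if y: "y \<in> (W \<inter> W1) \<inter> cell (ch x)" for y
    proof -
      have yy: "y \<in> X" "ch y = ch x" "y \<in> W" "y \<in> W1" "y \<in> U" using y 1(5) by auto
      have vv: "\<nu> U s y = v" using bspec[OF W1(4) yy(4)] mz[OF yy(2)] mz[OF zz(2)] 1(2) by simp
      have ry: "rep_at y U s" using r(1,2) yy by simp
      have "tvalue y K' v (g z)" by (rule tvalueI[OF ry vv 1(3) yy(3) 1(5,6)])
      then show ?thesis using tvalue_unique[OF K(1), of y v] g[OF yy(1,2)] yy(2) K(2) by simp
    qed
    moreover have "opn (W \<inter> W1)" "z \<in> W \<inter> W1" using 1(3,4) W1(1,2) by (auto simp: openin_Int)
    ultimately show "\<exists>W. opn W \<and> z \<in> W \<and> (\<forall>y\<in>W \<inter> cell (ch x). g y = g z)"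
      by (intro exI[of _ "W \<inter> W1"]) simp
  qed (use x x0 in auto)
  then have "tmap (ch x) K' v = g x" by (simp add: tmap_def g_def x0_def)
  then show ?thesis using g x by simp
qed

lemma v_tmap:
  assumes s: "rep_at x U s"
  shows "\<exists>W. opn W \<and> x \<in> W \<and> W \<subseteq> U \<and> (\<forall>y\<in>W. ch x \<subseteq> ch y \<and> \<nu> U s y = tmap (ch x) (ch y) (\<nu> U s x))"
proof -
  obtain W where W: "opn W" "x \<in> W" "W \<subseteq> U" "\<forall>y\<in>W. ch x \<subseteq> ch y"
      "\<forall>y\<in>W. \<forall>z\<in>W. ch y = ch z \<longrightarrow> \<nu> U s y = \<nu> U s z"
    using v_near[OF s] by (elim exE conjE) (rule that)
  have x: "x \<in> X" using W(2) opn_sub[OF W(1)] by blast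
  have "ch x \<subseteq> ch y \<and> \<nu> U s y = tmap (ch x) (ch y) (\<nu> U s x)" if y: "y \<in> W" for y
  proof
    have yX: "y \<in> X" using y opn_sub[OF W(1)] by blast
    show sub: "ch x \<subseteq> ch y" using W(4) y by blast
    have "\<nu> U s z = \<nu> U s y" if "z \<in> W \<inter> cell (ch y)" for z
      using bspec[OF bspec[OF W(5), of z] y] that by simp
    then have "\<forall>z\<in>W \<inter> cell (ch y). \<nu> U s z = \<nu> U s y" by blast
    then have "tvalue x (ch y) (\<nu> U s x) (\<nu> U s y)"
      by (rule tvalueI[OF s refl W(1-3)])
    then show "\<nu> U s y = tmap (ch x) (ch y) (\<nu> U s x)"
      using tvalue_unique[OF ch_chain[OF yX] sub _ tvalue_tmap[OF ch_chain[OF yX] sub x]] v_in[of U s x] s by simp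
  qed
  then have "\<forall>y\<in>W. ch x \<subseteq> ch y \<and> \<nu> U s y = tmap (ch x) (ch y) (\<nu> U s x)" by (rule ballI)
  then show ?thesis by (intro exI[of _ W] conjI W(1-3))
qed

text \<open>Packages a section through \<open>v\<close> at some point with chain \<open>K\<close>
  and a neighbourhood on which its values are given by \<open>tmap\<close>. Identities between the
  maps are then read off from such sections at suitable nearby points.\<close>

lemma through_ex:
  assumes K: "K \<in> flags" and v: "v \<in> carrier (L (chain_top \<delta> K))"
  obtains x U s W where "x \<in> X" "ch x = K" "rep_at x U s" "\<nu> U s x = v" "opn W" "x \<in> W" "W \<subseteq> U"
    "\<forall>y\<in>W. K \<subseteq> ch y \<and> \<nu> U s y = tmap K (ch y) v"
proof -
  obtain x where x: "x \<in> X" "ch x = K" using cell_ne[OF K] by auto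
  then have "v \<in> carrier (L (\<mu> x))" using v by (simp add: stratum_of_def)
  from v_surj[OF x(1) this] obtain U s where s: "rep_at x U s" "\<nu> U s x = v"
    by (elim exE conjE) (rule that, intro conjI)
  obtain W where "opn W" "x \<in> W" "W \<subseteq> U" "\<forall>y\<in>W. ch x \<subseteq> ch y \<and> \<nu> U s y = tmap (ch x) (ch y) (\<nu> U s x)"
    using v_tmap[OF s(1)] by (elim exE conjE) (rule that)
  then show ?thesis using that[of x U s W] x s by simp
qed

text \<open>Sections through two vectors at the same point can be added on a common neighbourhood;
  the sum is evaluated at one nearby point with chain \<open>K'\<close>.\<close>

lemma tmap_add_smult:
  assumes K: "K \<in> flags" "K' \<in> flags" "K \<subseteq> K'"
  shows "tmap K K' \<in> module_hom F (L (chain_top \<delta> K)) (L (chain_top \<delta> K'))"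
proof -
  have muy: "\<mu> y = chain_top \<delta> (ch y)" for y by (simp add: stratum_of_def)
  show ?thesis unfolding module_hom_def
  proof (intro CollectI conjI allI impI Pi_I, goal_cases)
    case (1 v)
    obtain x U s W where x: "x \<in> X" "ch x = K" "rep_at x U s" "\<nu> U s x = v" "opn W" "x \<in> W" "W \<subseteq> U"
        "\<forall>y\<in>W. K \<subseteq> ch y \<and> \<nu> U s y = tmap K (ch y) v" using through_ex[OF K(1) 1] .
    obtain y where y: "y \<in> W" "y \<in> X" "ch y = K'" using cell_meets[OF x(5,6) K(2)] x(2) K(3) by auto
    have "\<nu> U s y \<in> carrier (L (\<mu> y))" using v_in[of U s y] x(3,7) y(1) by auto
    then show ?case using x(8) y muy by simp
  next
    case (2 v w)
    then have vw: "v \<in> carrier (L (chain_top \<delta> K))" "w \<in> carrier (L (chain_top \<delta> K))" by auto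
    obtain x U s W where x: "x \<in> X" "ch x = K" "rep_at x U s" "\<nu> U s x = v" "opn W" "x \<in> W" "W \<subseteq> U"
        "\<forall>y\<in>W. K \<subseteq> ch y \<and> \<nu> U s y = tmap K (ch y) v" using through_ex[OF K(1) vw(1)] .
    have "w \<in> carrier (L (\<mu> x))" using vw(2) x(2) muy by simp
    from v_surj[OF x(1) this] obtain U' t where t: "rep_at x U' t" "\<nu> U' t x = w"
      by (elim exE conjE) (rule that, intro conjI)
    let ?N = "W \<inter> U'"
    have N: "opn ?N" "x \<in> ?N" "?N \<subseteq> U" "?N \<subseteq> U'" using x(5,6,7) t(1) by (auto simp: openin_Int)
    define a b where "a = res A U ?N s" and "b = res A U' ?N t"
    have ab: "rep_at x ?N a" "rep_at x ?N b" using p_in x(3) t(1) N by (auto simp: a_def b_def)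
    then have abc: "rep_at x ?N (a \<oplus>\<^bsub>sec A ?N\<^esub> b)" using p_add by simp
    have va: "\<nu> ?N a x = v" "\<nu> ?N b x = w"
      using v_res[of U s ?N] v_res[of U' t ?N] x(3,4) t N by (auto simp: a_def b_def)
    have vc: "\<nu> ?N (a \<oplus>\<^bsub>sec A ?N\<^esub> b) x = v \<oplus>\<^bsub>L (chain_top \<delta> K)\<^esub> w"
      using v_add[of ?N a b x] ab va x(2) muy by simp
    obtain W1 where W1: "opn W1" "x \<in> W1" "W1 \<subseteq> ?N" "\<forall>y\<in>W1. ch x \<subseteq> ch y \<and> \<nu> ?N a y = tmap (ch x) (ch y) (\<nu> ?N a x)"
      using v_tmap[OF ab(1)] by (elim exE conjE) (rule that)
    obtain W2 where W2: "opn W2" "x \<in> W2" "W2 \<subseteq> ?N" "\<forall>y\<in>W2. ch x \<subseteq> ch y \<and> \<nu> ?N b y = tmap (ch x) (ch y) (\<nu> ?N b x)"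
      using v_tmap[OF ab(2)] by (elim exE conjE) (rule that)
    obtain W3 where W3: "opn W3" "x \<in> W3" "W3 \<subseteq> ?N" "\<forall>y\<in>W3. ch x \<subseteq> ch y \<and>
        \<nu> ?N (a \<oplus>\<^bsub>sec A ?N\<^esub> b) y = tmap (ch x) (ch y) (\<nu> ?N (a \<oplus>\<^bsub>sec A ?N\<^esub> b) x)"
      using v_tmap[OF abc] by (elim exE conjE) (rule that)
    have "opn (W1 \<inter> (W2 \<inter> W3))" "x \<in> W1 \<inter> (W2 \<inter> W3)" using W1(1,2) W2(1,2) W3(1,2) by (auto simp: openin_Int)
    from cell_meets[OF this K(2)] obtain y where y: "y \<in> W1" "y \<in> W2" "y \<in> W3" "ch y = K'" using x(2) K(3) by auto
    have yN: "y \<in> ?N" using y(1) W1(3) by blast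
    have "tmap K K' (v \<oplus>\<^bsub>L (chain_top \<delta> K)\<^esub> w) = \<nu> ?N (a \<oplus>\<^bsub>sec A ?N\<^esub> b) y"
      using bspec[OF W3(4) y(3)] vc x(2) y(4) by simp
    also have "\<dots> = \<nu> ?N a y \<oplus>\<^bsub>L (\<mu> y)\<^esub> \<nu> ?N b y" using v_add[of ?N a b y] ab yN by simp
    also have "\<dots> = tmap K K' v \<oplus>\<^bsub>L (chain_top \<delta> K')\<^esub> tmap K K' w"
      using bspec[OF W1(4) y(1)] bspec[OF W2(4) y(2)] va x(2) y(4) muy by simp
    finally show ?case .
  next
    case (3 c v)
    then have vw: "v \<in> carrier (L (chain_top \<delta> K))" "c \<in> carrier F" by auto
    obtain x U s W where x: "x \<in> X" "ch x = K" "rep_at x U s" "\<nu> U s x = v" "opn W" "x \<in> W" "W \<subseteq> U"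
        "\<forall>y\<in>W. K \<subseteq> ch y \<and> \<nu> U s y = tmap K (ch y) v" using through_ex[OF K(1) vw(1)] .
    have abc: "rep_at x U (c \<odot>\<^bsub>sec A U\<^esub> s)" using p_smult x(3) vw(2) by simp
    have vc: "\<nu> U (c \<odot>\<^bsub>sec A U\<^esub> s) x = c \<odot>\<^bsub>L (chain_top \<delta> K)\<^esub> v"
      using v_smult[of U s c x] x(2,3,4) vw(2) muy by simp
    obtain W3 where W3: "opn W3" "x \<in> W3" "W3 \<subseteq> U" "\<forall>y\<in>W3. ch x \<subseteq> ch y \<and>
        \<nu> U (c \<odot>\<^bsub>sec A U\<^esub> s) y = tmap (ch x) (ch y) (\<nu> U (c \<odot>\<^bsub>sec A U\<^esub> s) x)"
      using v_tmap[OF abc] by (elim exE conjE) (rule that)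
    have "opn (W \<inter> W3)" "x \<in> W \<inter> W3" using W3(1,2) x(5,6) by (auto simp: openin_Int)
    from cell_meets[OF this K(2)] obtain y where y: "y \<in> W" "y \<in> W3" "ch y = K'" using x(2) K(3) by auto
    have yN: "y \<in> U" using y(2) W3(3) by blast
    have "tmap K K' (c \<odot>\<^bsub>L (chain_top \<delta> K)\<^esub> v) = \<nu> U (c \<odot>\<^bsub>sec A U\<^esub> s) y"
      using bspec[OF W3(4) y(2)] vc x(2) y(3) by simp
    also have "\<dots> = c \<odot>\<^bsub>L (\<mu> y)\<^esub> \<nu> U s y" using v_smult[of U s c y] x(3) yN vw(2) by simp
    also have "\<dots> = c \<odot>\<^bsub>L (chain_top \<delta> K')\<^esub> tmap K K' v"
      using bspec[OF x(8) y(1)] y(3) muy by simp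
    finally show ?case .
  qed
qed

text \<open>Both open simplices lie in one stratum, and along it the values of a section are locally
  constant.\<close>

lemma tmap_same_top:
  assumes K: "K \<in> flags" "K' \<in> flags" "K \<subseteq> K'" "chain_top \<delta> K = chain_top \<delta> K'"
    and v: "v \<in> carrier (L (chain_top \<delta> K))"
  shows "tmap K K' v = v"
proof -
  obtain x U s W where x: "x \<in> X" "ch x = K" "rep_at x U s" "\<nu> U s x = v" "opn W" "x \<in> W" "W \<subseteq> U"
      "\<forall>y\<in>W. K \<subseteq> ch y \<and> \<nu> U s y = tmap K (ch y) v" using through_ex[OF K(1) v] .
  obtain W1 where W1: "opn W1" "x \<in> W1" "W1 \<subseteq> U" "\<forall>y\<in>W1. \<mu> y = \<mu> x \<longrightarrow> \<nu> U s y = \<nu> U s x"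
    using v_const_at[OF x(3) conjunct1[OF conjunct2[OF x(3)]]] by (elim exE conjE) (rule that)
  have "opn (W \<inter> W1)" "x \<in> W \<inter> W1" using W1(1,2) x(5,6) by (auto simp: openin_Int)
  from cell_meets[OF this K(2)] obtain y where y: "y \<in> W" "y \<in> W1" "ch y = K'" using x(2) K(3) by auto
  have "\<mu> y = \<mu> x" using y(3) x(2) K(4) by (simp add: stratum_of_def)
  then show ?thesis using bspec[OF W1(4) y(2)] bspec[OF x(8) y(1)] y(3) x(4) by simp
qed

text \<open>Choose \<open>y\<close> near \<open>x\<close> with chain \<open>K'\<close>, then
  \<open>z\<close> close to \<open>y\<close> with chain \<open>K''\<close> and still in the
  neighbourhood of \<open>x\<close>. A single section computes all three maps.\<close>

lemma tmap_trans:
  assumes K: "K \<in> flags" "K' \<in> flags" "K'' \<in> flags" "K \<subseteq> K'" "K' \<subseteq> K''"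
    and v: "v \<in> carrier (L (chain_top \<delta> K))"
  shows "tmap K' K'' (tmap K K' v) = tmap K K'' v"
proof -
  obtain x U s W where x: "x \<in> X" "ch x = K" "rep_at x U s" "\<nu> U s x = v" "opn W" "x \<in> W" "W \<subseteq> U"
      "\<forall>y\<in>W. K \<subseteq> ch y \<and> \<nu> U s y = tmap K (ch y) v" using through_ex[OF K(1) v] .
  from cell_meets[OF x(5,6) K(2)] obtain y where y: "y \<in> W" "ch y = K'" using x(2) K(4) by auto
  have "rep_at y U s" using x(3,7) y(1) by auto
  from v_tmap[OF this] obtain W1 where W1: "opn W1" "y \<in> W1" "W1 \<subseteq> U"
      "\<forall>z\<in>W1. ch y \<subseteq> ch z \<and> \<nu> U s z = tmap (ch y) (ch z) (\<nu> U s y)"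
    by (elim exE conjE) (rule that)
  have "opn (W \<inter> W1)" "y \<in> W \<inter> W1" using W1(1,2) x(5) y(1) by (auto simp: openin_Int)
  from cell_meets[OF this K(3)] obtain z where z: "z \<in> W" "z \<in> W1" "ch z = K''" using y(2) K(5) by auto
  show ?thesis using bspec[OF W1(4) z(2)] bspec[OF x(8) y(1)] bspec[OF x(8) z(1)] y(2) z(3) by simp
qed

text \<open>A passage between strata, computed on the smallest chains that have the two simplices as
  their tops.\<close>

definition smap :: "'a set \<Rightarrow> 'a set \<Rightarrow> 'v \<Rightarrow> 'v" where
  "smap S T = tmap {S} {S, T}"

text \<open>From \<open>{S}\<close> to \<open>K'\<close> one may pass through \<open>K\<close> or
  through \<open>{S, T}\<close>, where \<open>S\<close> and \<open>T\<close> are the two tops. The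
  steps from \<open>{S}\<close> to \<open>K\<close> and from \<open>{S, T}\<close> to
  \<open>K'\<close> keep the top and are identities.\<close>

lemma tmap_smap:
  assumes K: "K \<in> flags" "K' \<in> flags" "K \<subseteq> K'" and v: "v \<in> carrier (L (chain_top \<delta> K))"
  shows "tmap K K' v = smap (chain_top \<delta> K) (chain_top \<delta> K') v"
proof -
  let ?S = "chain_top \<delta> K" let ?T = "chain_top \<delta> K'"
  have ST: "?S \<in> simplices C" "?T \<in> simplices C" "inc ?S ?T" "lev ?T \<le> lev ?S"
    using chain_top_simplex[OF K(1)] chain_top_simplex[OF K(2)] chain_top_mono[OF K] by auto
  note S1 = singleton_chain[OF ST(1)] and P = pair_chain[OF ST(1-3)]
  note t1 = flag_single_top[OF ST(1)] and t2 = flag_pair_top[OF ST]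
  have sub: "{?S} \<subseteq> K" "{?S, ?T} \<subseteq> K'" "{?S} \<subseteq> K'" using chain_top(1)[OF K(1)] chain_top(1)[OF K(2)] K(3) by auto
  have v1: "v \<in> carrier (L (chain_top \<delta> {?S}))" using v t1 by simp
  have "tmap K K' v = tmap K K' (tmap {?S} K v)" using tmap_same_top[OF S1 K(1) sub(1) t1 v1] by simp
  also have "\<dots> = tmap {?S} K' v" using tmap_trans[OF S1 K(1,2) sub(1) K(3) v1] .
  also have "\<dots> = tmap {?S, ?T} K' (tmap {?S} {?S, ?T} v)" using tmap_trans[OF S1 P K(2) _ sub(2) v1] by simp
  also have "\<dots> = tmap {?S} {?S, ?T} v"
    using tmap_same_top[OF P K(2) sub(2) t2] module_homD(1)[OF tmap_add_smult[OF S1 P] v1] by simp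
  finally show ?thesis by (simp add: smap_def)
qed

lemma smap_hom:
  assumes "S \<in> simplices C" "T \<in> simplices C" "inc S T" "lev T \<le> lev S"
  shows "smap S T \<in> module_hom F (L S) (L T)"
  using tmap_add_smult[OF singleton_chain[OF assms(1)] pair_chain[OF assms(1-3)]]
    flag_single_top[OF assms(1)] flag_pair_top[OF assms] by (simp add: smap_def)

lemma smap_refl:
  assumes "S \<in> simplices C" "v \<in> carrier (L S)"
  shows "smap S S v = v"
  using tmap_same_top[OF singleton_chain[OF assms(1)] singleton_chain[OF assms(1)]] flag_single_top[OF assms(1)] assms(2)
  by (simp add: smap_def)

text \<open>Pairwise incidence makes \<open>{S, T, U}\<close> a chain. Its open simplex lies in the
  stratum of \<open>U\<close> and is adjacent to the open simplices on which the maps from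
  \<open>S\<close> and from \<open>T\<close> are computed.\<close>

lemma smap_flag:
  assumes S: "S \<in> simplices C" "T \<in> simplices C" "U \<in> simplices C"
    and i: "inc S T" "inc T U" "inc S U" and l: "lev T \<le> lev S" "lev U \<le> lev T"
    and v: "v \<in> carrier (L S)"
  shows "smap T U (smap S T v) = smap S U v"
proof -
  have K: "{S, T, U} \<in> flags"
    unfolding subdivision_chains_def
  proof (intro CollectI conjI ballI)
    show "{S, T, U} \<noteq> {}" "{S, T, U} \<subseteq> simplices C" using S by auto
    fix A B assume a: "A \<in> {S, T, U}" "B \<in> {S, T, U}"
    then have "inc A B" using i inc_sym by auto
    moreover have "A \<in> simplices C" "B \<in> simplices C" using a S by auto
    ultimately show "incident A B" using inc_incident[of A B] by simp
  qed
  note S1 = singleton_chain[OF S(1)] and P = pair_chain[OF S(1,2) i(1)]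
  note t1 = flag_single_top[OF S(1)] and t2 = flag_pair_top[OF S(1,2) i(1) l(1)]
  have t3: "chain_top \<delta> {S, T, U} = U" using l by (intro chain_top_eqI[OF K]) auto
  have v1: "v \<in> carrier (L (chain_top \<delta> {S}))" using v t1 by simp
  have sv: "smap S T v \<in> carrier (L T)" using module_homD(1)[OF smap_hom[OF S(1,2) i(1) l(1)] v] .
  have "smap S U v = tmap {S} {S, T, U} v" using tmap_smap[OF S1 K _ v1] t1 t3 by simp
  also have "\<dots> = tmap {S, T} {S, T, U} (tmap {S} {S, T} v)" using tmap_trans[OF S1 P K _ _ v1] by simp
  also have "\<dots> = smap T U (smap S T v)"
    using tmap_smap[OF P K, of "smap S T v"] sv t2 t3 by (simp add: smap_def)
  finally show ?thesis by simp
qed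

definition data :: "('a, 'f, 'v) lin_data" where
  "data = \<lparr>Spc = L, Map = smap\<rparr>"

text \<open>The ends of the square in the equivalence axiom are either incident, and both composites
  are the direct map by \<open>smap_flag\<close>, or they are not, and \<open>middle_unique\<close>
  leaves only one path.\<close>

lemma data_object: "data \<in> R_objects F C \<delta>"
proof -
  have ar: "S \<in> simplices C" "T \<in> simplices C" "inc S T" "lev T \<le> lev S" if "arrow C \<delta> S T" for S T
    using that unfolding arr_arrow[symmetric] arr_def by auto
  have "smap D1 D'' (smap D' D1 v) = smap D2 D'' (smap D' D2 v)"
    if a: "arrow C \<delta> D' D1" "arrow C \<delta> D1 D''" "arrow C \<delta> D' D2" "arrow C \<delta> D2 D''" and v: "v \<in> carrier (L D')"
    for D' D'' D1 D2 v
  proof (cases "inc D' D''")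
    case True
    then show ?thesis
      using smap_flag[of D' D1 D'' v] smap_flag[of D' D2 D'' v] ar[OF a(1)] ar[OF a(2)] ar[OF a(3)] ar[OF a(4)] v by simp
  next
    case False
    then have "D1 = D2" using middle_unique[of D' D1 D'' D2] a arr_arrow by simp
    then show ?thesis by simp
  qed
  then show ?thesis
    using v_fd smap_hom[OF ar] unfolding R_objects_def data_def by simp
qed

end

context cx_values
begin

lemma data_rep: "rep_data C \<delta> F data"
  by (intro rep_data.intro rep_data_axioms.intro perverse_cx_axioms data_object)

text \<open>The formal transition along arrows and the geometric map between strata agree on arrows,
  and both are transitive along the path built by \<open>arr_towards\<close>.\<close>

lemma Tr_smap:
  assumes "S \<in> simplices C" "T \<in> simplices C" "inc S T" "lev T \<le> lev S" "v \<in> carrier (L S)"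
  shows "Tr C \<delta> data S T v = smap S T v"
proof -
  interpret R: rep_data C \<delta> F data by (rule data_rep)
  have sp: "Spc data = L" "Map data = smap" by (simp_all add: data_def)
  show ?thesis using assms
  proof (induction "nat (lev S - lev T)" arbitrary: S v rule: less_induct)
    case less
    show ?case
    proof (cases "lev S = lev T")
      case True
      then have "S = T" using less inc_lev_eq by blast
      then show ?thesis using R.tr_refl[of S v] smap_refl[of S v] less.prems sp R.tr_Tr by simp
    next
      case False
      then obtain A where A: "arr S A" "inc A T" "lev T \<le> lev A"
        using arr_towards[OF less.prems(1-3)] less.prems(4) by (metis order_le_less)
      then have AX: "A \<in> simplices C" "inc S A" "lev S = lev A + 1" by (auto simp: arr_def)
      have sv: "smap S A v \<in> carrier (L A)"
        using module_homD(1)[OF smap_hom[OF less.prems(1) AX(1,2)] less.prems(5)] AX by simp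
      have "Tr C \<delta> data S T v = Tr C \<delta> data A T (Tr C \<delta> data S A v)"
        using R.tr_trans[of S A T v] less.prems A AX sp unfolding R.tr_Tr by simp
      also have "Tr C \<delta> data S A v = smap S A v"
        using R.tr_arr[OF A(1), of v] less.prems(5) sp unfolding R.tr_Tr by simp
      also have "Tr C \<delta> data A T (smap S A v) = smap A T (smap S A v)"
        using less.prems AX A sv False by (intro less.hyps) auto
      also have "\<dots> = smap S T v"
        using smap_flag[OF less.prems(1) AX(1) less.prems(2) AX(2) A(2) less.prems(3) _ A(3) less.prems(5)] AX(3) by simp
      finally show ?thesis .
    qed
  qed
qed

lemma v_sections:
  assumes U: "opn U" and s: "s \<in> carrier (sec A U)"
  shows "\<nu> U s \<in> sections C \<delta> data U"
proof -
  interpret R: rep_data C \<delta> F data by (rule data_rep)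
  show ?thesis
  proof (rule R.sectionsI)
    fix x assume x: "x \<in> U"
    show "\<nu> U s x \<in> carrier (Spc data (\<mu> x))" using v_in[OF U s x] by (simp add: data_def)
    have rx: "rep_at x U s" using U s x by simp
    obtain W where W: "opn W" "x \<in> W" "W \<subseteq> U" "\<forall>y\<in>W. ch x \<subseteq> ch y \<and> \<nu> U s y = tmap (ch x) (ch y) (\<nu> U s x)"
      using v_tmap[OF rx] by (elim exE conjE) (rule that)
    have WX: "W \<subseteq> X" using opn_sub[OF W(1)] .
    show "\<exists>W. opn W \<and> x \<in> W \<and> W \<subseteq> U \<and> (\<forall>y\<in>W. ch x \<subseteq> ch y \<and> \<nu> U s y = Tr C \<delta> data (\<mu> x) (\<mu> y) (\<nu> U s x))"
    proof (intro exI[of _ W] conjI W(1-3) ballI)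
      fix y assume y: "y \<in> W"
      then have xy: "x \<in> X" "y \<in> X" "ch x \<subseteq> ch y" using WX W by auto
      show "ch x \<subseteq> ch y" by fact
      have v: "\<nu> U s x \<in> carrier (L (\<mu> x))" using v_in[OF U s x] .
      have "\<nu> U s y = tmap (ch x) (ch y) (\<nu> U s x)" using W(4) y by blast
      also have "\<dots> = smap (\<mu> x) (\<mu> y) (\<nu> U s x)"
        using tmap_smap[OF ch_chain[OF xy(1)] ch_chain[OF xy(2)] xy(3)] v by (simp add: stratum_of_def)
      also have "\<dots> = Tr C \<delta> data (\<mu> x) (\<mu> y) (\<nu> U s x)"
        using Tr_smap[OF mu_simplex[OF xy(1)] mu_simplex[OF xy(2)] mu_mono[OF xy] v] by simp
      finally show "\<nu> U s y = Tr C \<delta> data (\<mu> x) (\<mu> y) (\<nu> U s x)" .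
    qed
  qed (use v_PiE[OF U s] in \<open>simp add: PiE_def\<close>)
qed

end

section \<open>A constructible sheaf is represented by its data\<close>

locale cx_sheaf_values = cx_values +
  assumes sheaf: "is_sheaf F (polyhedron_top C) A"
begin

lemma sheaf_sep:
  "\<lbrakk>\<forall>U\<in>\<U>. opn U; s \<in> carrier (sec A (\<Union>\<U>)); t \<in> carrier (sec A (\<Union>\<U>));
    \<forall>U\<in>\<U>. res A (\<Union>\<U>) U s = res A (\<Union>\<U>) U t\<rbrakk> \<Longrightarrow> s = t"
  using sheaf unfolding is_sheaf_def by (elim conjE) simp

lemma sheaf_glue:
  "\<lbrakk>\<forall>U\<in>\<U>. opn U \<and> f U \<in> carrier (sec A U);
    \<forall>U\<in>\<U>. \<forall>V\<in>\<U>. res A U (U \<inter> V) (f U) = res A V (U \<inter> V) (f V)\<rbrakk> \<Longrightarrow>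
    \<exists>t\<in>carrier (sec A (\<Union>\<U>)). \<forall>U\<in>\<U>. res A (\<Union>\<U>) U t = f U"
proof -
  assume a: "\<forall>U\<in>\<U>. opn U \<and> f U \<in> carrier (sec A U)"
    "\<forall>U\<in>\<U>. \<forall>V\<in>\<U>. res A U (U \<inter> V) (f U) = res A V (U \<inter> V) (f V)"
  have "\<forall>\<U> s. (\<forall>U\<in>\<U>. opn U \<and> s U \<in> carrier (sec A U)) \<and>
        (\<forall>U\<in>\<U>. \<forall>V\<in>\<U>. res A U (U \<inter> V) (s U) = res A V (U \<inter> V) (s V)) \<longrightarrow>
        (\<exists>t\<in>carrier (sec A (\<Union>\<U>)). \<forall>U\<in>\<U>. res A (\<Union>\<U>) U t = s U)"
    using sheaf unfolding is_sheaf_def by (elim conjE)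
  from this[THEN spec, THEN spec, THEN mp, OF conjI, OF a] show ?thesis .
qed

lemma v_injective:
  assumes U: "opn U" and s: "s \<in> carrier (sec A U)" "t \<in> carrier (sec A U)" and eq: "\<nu> U s = \<nu> U t"
  shows "s = t"
proof -
  define \<U> where "\<U> = {W. opn W \<and> W \<subseteq> U \<and> res A U W s = res A U W t}"
  have "\<Union>\<U> = U"
  proof
    show "\<Union>\<U> \<subseteq> U" by (auto simp: \<U>_def Union_iff)
    show "U \<subseteq> \<Union>\<U>"
    proof
      fix x assume x: "x \<in> U"
      obtain W where "opn W" "x \<in> W" "W \<subseteq> U" "res A U W s = res A U W t"
        using v_inj[OF U s x fun_cong[OF eq]] by (elim exE conjE) (rule that)
      then show "x \<in> \<Union>\<U>" by (intro UnionI[of W]) (auto simp: \<U>_def)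
    qed
  qed
  then show ?thesis using sheaf_sep[of \<U> s t] s by (simp add: \<U>_def)
qed

text \<open>Near each point the family agrees with a section having the same value there. On
  overlaps such sections have equal value functions, hence are equal, and the sheaf axiom glues
  them.\<close>

lemma v_surjective:
  assumes U: "opn U" and \<sigma>: "\<sigma> \<in> sections C \<delta> data U"
  shows "\<exists>s\<in>carrier (sec A U). \<nu> U s = \<sigma>"
proof -
  interpret R: rep_data C \<delta> F data by (rule data_rep)
  have sp: "Spc data = L" by (simp add: data_def)
  define \<U> where "\<U> = {W. opn W \<and> W \<subseteq> U \<and> (\<exists>t\<in>carrier (sec A W). \<nu> W t = restrict \<sigma> W)}"
  have UU: "\<Union>\<U> = U"
  proof
    show "\<Union>\<U> \<subseteq> U" by (auto simp: \<U>_def Union_iff)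
    show "U \<subseteq> \<Union>\<U>"
    proof
      fix x assume x: "x \<in> U"
      then have xX: "x \<in> X" using opn_sub[OF U] by blast
      have "\<sigma> x \<in> carrier (L (\<mu> x))" using R.sectionsD(1)[OF \<sigma> x] sp by simp
      from v_surj[OF xX this] obtain U' s where s: "opn U'" "x \<in> U'" "s \<in> carrier (sec A U')" "\<nu> U' s x = \<sigma> x"
        by (elim exE conjE) (rule that)
      obtain W where W: "opn W" "x \<in> W" "W \<subseteq> U'" "W \<subseteq> U" "\<And>y. y \<in> W \<Longrightarrow> \<nu> U' s y = \<sigma> y"
        using R.sections_agree_near[OF v_sections[OF s(1,3)] \<sigma> s(2) x s(4)] by blast
      have "\<nu> W (res A U' W s) = restrict \<sigma> W"
        unfolding v_res[OF s(1,3) W(1,3)] by (rule ext) (simp add: restrict_def W(5))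
      then have "W \<in> \<U>" using W(1,4) p_in[OF s(1) W(1,3) s(3)] by (auto simp: \<U>_def)
      then show "x \<in> \<Union>\<U>" using W(2) by (rule UnionI)
    qed
  qed
  have "\<forall>W\<in>\<U>. \<exists>t. t \<in> carrier (sec A W) \<and> \<nu> W t = restrict \<sigma> W" by (auto simp: \<U>_def)
  from bchoice[OF this] obtain f where f: "\<forall>W\<in>\<U>. f W \<in> carrier (sec A W) \<and> \<nu> W (f W) = restrict \<sigma> W"
    by (elim exE) (rule that)
  have o: "opn W" "W \<subseteq> U" if "W \<in> \<U>" for W using that by (auto simp: \<U>_def)
  have "\<forall>W\<in>\<U>. \<forall>V\<in>\<U>. res A W (W \<inter> V) (f W) = res A V (W \<inter> V) (f V)"
  proof (intro ballI)
    fix W V assume WV: "W \<in> \<U>" "V \<in> \<U>"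
    have fW: "f W \<in> carrier (sec A W)" "\<nu> W (f W) = restrict \<sigma> W" and fV: "f V \<in> carrier (sec A V)" "\<nu> V (f V) = restrict \<sigma> V"
      using f WV by auto
    have i: "opn (W \<inter> V)" "W \<inter> V \<subseteq> W" "W \<inter> V \<subseteq> V" using o WV by (auto simp: openin_Int)
    show "res A W (W \<inter> V) (f W) = res A V (W \<inter> V) (f V)"
    proof (rule v_injective[OF i(1)])
      show "res A W (W \<inter> V) (f W) \<in> carrier (sec A (W \<inter> V))" "res A V (W \<inter> V) (f V) \<in> carrier (sec A (W \<inter> V))"
        using p_in o(1) WV i fW(1) fV(1) by auto
      show "\<nu> (W \<inter> V) (res A W (W \<inter> V) (f W)) = \<nu> (W \<inter> V) (res A V (W \<inter> V) (f V))"
        unfolding v_res[OF o(1)[OF WV(1)] fW(1) i(1,2)] v_res[OF o(1)[OF WV(2)] fV(1) i(1,3)] fW(2) fV(2)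
        by (rule ext) simp
    qed
  qed
  moreover have "\<forall>W\<in>\<U>. opn W \<and> f W \<in> carrier (sec A W)" using f o(1) by auto
  ultimately obtain t where t: "t \<in> carrier (sec A U)" "\<forall>W\<in>\<U>. res A U W t = f W"
    using sheaf_glue[of \<U> f] unfolding UU by blast
  have "\<nu> U t = \<sigma>"
  proof
    fix x show "\<nu> U t x = \<sigma> x"
    proof (cases "x \<in> U")
      case True
      then have "x \<in> \<Union>\<U>" using UU by simp
      then obtain W where W: "W \<in> \<U>" "x \<in> W" by (rule UnionE)
      have "restrict (\<nu> U t) W x = restrict \<sigma> W x"
        using v_res[OF U t(1) o(1)[OF W(1)] o(2)[OF W(1)]] bspec[OF t(2) W(1)] bspec[OF f W(1)] by simp
      then show ?thesis using W(2) by simp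
    next
      case False
      then show ?thesis using R.sectionsD(2)[OF \<sigma>] v_PiE[OF U t(1)] by (simp add: PiE_def extensional_def)
    qed
  qed
  then show ?thesis using t(1) by blast
qed

lemma data_represents: "represents F C \<delta> data A \<nu>"
proof -
  have b: "bij_betw (\<nu> U) (carrier (sec A U)) (sections C \<delta> data U)" if U: "opn U" for U
    unfolding bij_betw_def
  proof
    show "inj_on (\<nu> U) (carrier (sec A U))" using v_injective[OF U] by (rule inj_onI)
    show "\<nu> U ` carrier (sec A U) = sections C \<delta> data U"
    proof (intro equalityI subsetI)
      fix c assume "c \<in> \<nu> U ` carrier (sec A U)"
      then show "c \<in> sections C \<delta> data U" using v_sections[OF U] by (elim imageE) simp
    next
      fix c assume "c \<in> sections C \<delta> data U"
      from v_surjective[OF U this] show "c \<in> \<nu> U ` carrier (sec A U)" by (elim bexE) (rule image_eqI, simp_all)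
    qed
  qed
  show ?thesis
    unfolding represents_def
    by (intro conjI allI impI ballI psh b; (elim conjE)?; (simp add: v_add v_smult v_res data_def; fail)?)
qed

end

text \<open>Essential surjectivity in the language of representing pairs; \<open>rep_hom_iso\<close>
  turns it into an isomorphism with the chosen sheaf.\<close>

theorem constructible_represented:
  fixes A :: "('a::euclidean_space, 'f, 'v) presheaf"
  assumes cx: "perverse_cx C \<delta>" and sh: "is_sheaf F (polyhedron_top C) A"
    and co: "constructible F C (\<lambda>k. - \<delta> k) A"
  shows "\<exists>S::('a, 'f, 'v) lin_data. S \<in> R_objects F C \<delta> \<and> (\<exists>\<nu>. represents F C \<delta> S A \<nu>)"
proof -
  interpret perverse_cx C \<delta> by (rule cx)
  interpret psheaf F "polyhedron_top C" A using sh by (intro psheaf.intro) (simp add: is_sheaf_def)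
  interpret cx_presheaf C \<delta> F A by (intro cx_presheaf.intro perverse_cx_axioms psheaf_axioms)
  have "\<forall>D\<in>simplices C. \<exists>M :: ('f, 'v) module. fin_dim_vectorspace F M \<and>
      sheaves_isomorphic F (TY D) (I D) (constant_sheaf (TY D) M)"
    using co unfolding constructible_def perverse_simplex_eq .
  from bchoice[OF this] obtain L where L: "\<forall>D\<in>simplices C. fin_dim_vectorspace F (L D :: ('f, 'v) module) \<and>
      sheaves_isomorphic F (TY D) (I D) (constant_sheaf (TY D) (L D))" by (elim exE) (rule that)
  have "\<exists>\<nu>. stalk_values F C \<delta> L A \<nu>" using L by (intro constructible_stalk_values) simp_all
  then obtain \<nu> where sv: "stalk_values F C \<delta> L A \<nu>" ..
  interpret cx_values C \<delta> F A L \<nu> by (intro cx_values.intro cx_values_axioms.intro cx_presheaf_axioms sv)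
  interpret cx_sheaf_values C \<delta> F A L \<nu>
    by (intro cx_sheaf_values.intro cx_sheaf_values_axioms.intro cx_values_axioms sh)
  show ?thesis using data_object data_represents by blast
qed

section \<open>Represented presheaves are constructible sheaves\<close>

context rep_data
begin

text \<open>The condition on families is local, so gluing is gluing of functions, and the bijections
  carry this over to every representing presheaf.\<close>

lemma represented_sheaf:
  assumes r: "represents F C \<delta> S A \<nu>"
  shows "is_sheaf F (polyhedron_top C) A"
proof -
  have p: "is_presheaf F (polyhedron_top C) A" using r by (simp add: represents_def)
  have sep: "s = t" if a: "\<forall>U\<in>\<U>. opn U" "s \<in> carrier (sec A (\<Union>\<U>))" "t \<in> carrier (sec A (\<Union>\<U>))"
      "\<forall>U\<in>\<U>. res A (\<Union>\<U>) U s = res A (\<Union>\<U>) U t" for \<U> s t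
  proof -
    have o: "opn (\<Union>\<U>)" using a(1) by (intro openin_Union) simp
    show ?thesis
    proof (rule rep_inj[OF r o a(2,3)], rule ext)
      fix x show "\<nu> (\<Union>\<U>) s x = \<nu> (\<Union>\<U>) t x"
      proof (cases "x \<in> \<Union>\<U>")
        case True
        then obtain U where U: "U \<in> \<U>" "x \<in> U" by (rule UnionE)
        then have oU: "opn U" "U \<subseteq> \<Union>\<U>" using a(1) by auto
        have "restrict (\<nu> (\<Union>\<U>) s) U x = restrict (\<nu> (\<Union>\<U>) t) U x"
          using rep_res(2)[OF r o oU a(2)] rep_res(2)[OF r o oU a(3)] bspec[OF a(4) U(1)] by simp
        then show ?thesis using U(2) by simp
      next
        case False
        then show ?thesis
          using sectionsD(2)[OF rep_in[OF r o a(2)] False] sectionsD(2)[OF rep_in[OF r o a(3)] False] by simp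
      qed
    qed
  qed
  have glue: "\<exists>t\<in>carrier (sec A (\<Union>\<U>)). \<forall>U\<in>\<U>. res A (\<Union>\<U>) U t = f U"
    if a: "\<forall>U\<in>\<U>. opn U \<and> f U \<in> carrier (sec A U)"
      "\<forall>U\<in>\<U>. \<forall>V\<in>\<U>. res A U (U \<inter> V) (f U) = res A V (U \<inter> V) (f V)" for \<U> f
  proof -
    have o: "opn (\<Union>\<U>)" using a(1) by (intro openin_Union) simp
    have oU: "opn U" "f U \<in> carrier (sec A U)" "U \<subseteq> \<Union>\<U>" if "U \<in> \<U>" for U using a(1) that by auto
    have agree: "\<nu> U (f U) x = \<nu> V (f V) x" if UV: "U \<in> \<U>" "V \<in> \<U>" "x \<in> U" "x \<in> V" for U V x
    proof -
      have i: "opn (U \<inter> V)" "U \<inter> V \<subseteq> U" "U \<inter> V \<subseteq> V" using oU UV by (auto simp: openin_Int)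
      have "restrict (\<nu> U (f U)) (U \<inter> V) x = restrict (\<nu> V (f V)) (U \<inter> V) x"
        using rep_res(2)[OF r oU(1)[OF UV(1)] i(1,2) oU(2)[OF UV(1)]] rep_res(2)[OF r oU(1)[OF UV(2)] i(1,3) oU(2)[OF UV(2)]]
          bspec[OF bspec[OF a(2) UV(1)] UV(2)] by simp
      then show ?thesis using UV(3,4) by simp
    qed
    \<comment> \<open>A member of the cover is chosen at each point; agreement on overlaps makes the
      glued family independent of the choice.\<close>
    define c where "c x = (SOME U. U \<in> \<U> \<and> x \<in> U)" for x
    have c: "c x \<in> \<U> \<and> x \<in> c x" if "x \<in> \<Union>\<U>" for x
      unfolding c_def by (rule someI_ex) (use that in \<open>auto simp: Union_iff\<close>)
    define \<sigma> where "\<sigma> = (\<lambda>x\<in>\<Union>\<U>. \<nu> (c x) (f (c x)) x)"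
    have \<sigma>: "restrict \<sigma> U = \<nu> U (f U)" if U: "U \<in> \<U>" for U
    proof
      fix x show "restrict \<sigma> U x = \<nu> U (f U) x"
      proof (cases "x \<in> U")
        case True
        then have xU: "x \<in> \<Union>\<U>" using oU(3)[OF U] by blast
        then show ?thesis using True agree[OF _ U _ True] c[OF xU] by (simp add: \<sigma>_def)
      next
        case False
        then show ?thesis using sectionsD(2)[OF rep_in[OF r oU(1)[OF U] oU(2)[OF U]] False] by simp
      qed
    qed
    have "\<sigma> \<in> \<Gamma> (\<Union>\<U>)"
    proof (rule sections_glue)
      show "\<sigma> \<in> extensional (\<Union>\<U>)" by (simp add: \<sigma>_def)
      fix x assume "x \<in> \<Union>\<U>"
      then obtain U where U: "U \<in> \<U>" "x \<in> U" by (rule UnionE)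
      show "\<exists>V. opn V \<and> x \<in> V \<and> V \<subseteq> \<Union>\<U> \<and> restrict \<sigma> V \<in> \<Gamma> V"
        using U oU[OF U(1)] \<sigma>[OF U(1)] rep_in[OF r oU(1)[OF U(1)] oU(2)[OF U(1)]] by (intro exI[of _ U]) simp
    qed
    note t = rep_inv[OF r o this]
    let ?t = "inv_into (carrier (sec A (\<Union>\<U>))) (\<nu> (\<Union>\<U>)) \<sigma>"
    have "res A (\<Union>\<U>) U ?t = f U" if U: "U \<in> \<U>" for U
    proof (rule rep_inj[OF r oU(1)[OF U] _ oU(2)[OF U]])
      note rr = rep_res[OF r o oU(1)[OF U] oU(3)[OF U] t(1)]
      show "res A (\<Union>\<U>) U ?t \<in> carrier (sec A U)" using rr(1) .
      show "\<nu> U (res A (\<Union>\<U>) U ?t) = \<nu> U (f U)" unfolding rr(2) t(2) using \<sigma>[OF U] .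
    qed
    then show ?thesis using t(1) by blast
  qed
  show ?thesis
    unfolding is_sheaf_def
  proof (intro conjI allI impI ballI p)
    fix \<U> s t assume "\<forall>U\<in>\<U>. opn U" "s \<in> carrier (sec A (\<Union>\<U>))" "t \<in> carrier (sec A (\<Union>\<U>))"
      "\<forall>U\<in>\<U>. res A (\<Union>\<U>) U s = res A (\<Union>\<U>) U t"
    then show "s = t" by (rule sep)
  next
    fix \<U> f assume "(\<forall>U\<in>\<U>. opn U \<and> f U \<in> carrier (sec A U)) \<and>
       (\<forall>U\<in>\<U>. \<forall>V\<in>\<U>. res A U (U \<inter> V) (f U) = res A V (U \<inter> V) (f V))"
    then show "\<exists>t\<in>carrier (sec A (\<Union>\<U>)). \<forall>U\<in>\<U>. res A (\<Union>\<U>) U t = f U" by (elim conjE) (rule glue)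
  qed
qed

text \<open>Joins the two descriptions: the bijection onto families provides the values that
  \<open>stratum_isomorphic\<close> asks for.\<close>

lemma represented_stalk_values:
  assumes r: "represents F C \<delta> S A \<nu>"
  shows "stalk_values F C \<delta> (Spc S) A \<nu>"
proof -
  have fd: "fin_dim_vectorspace F (Spc S D)" if "D \<in> simplices C" for D
    using S_obj that by (simp add: R_objects_def)
  have PiE: "\<nu> U s \<in> (\<Pi>\<^sub>E x\<in>U. carrier (sp x))" if "opn U" "s \<in> carrier (sec A U)" for U s
    using rep_in[OF r that] unfolding sections_def by simp
  have const: "\<exists>W. opn W \<and> x \<in> W \<and> W \<subseteq> U \<and> (\<forall>y\<in>W. \<mu> y = \<mu> x \<longrightarrow> \<nu> U s y = \<nu> U s x)"
    if U: "opn U" "s \<in> carrier (sec A U)" "x \<in> U" for U s x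
  proof (rule sections_loc_const[OF rep_in[OF r U(1,2)] U(3) opn_sub[OF U(1)]])
    fix W assume W: "opn W" "x \<in> W" "W \<subseteq> U" "\<And>y. y \<in> W \<Longrightarrow> \<mu> y = \<mu> x \<Longrightarrow> \<nu> U s y = \<nu> U s x"
    then have "\<forall>y\<in>W. \<mu> y = \<mu> x \<longrightarrow> \<nu> U s y = \<nu> U s x" by (intro ballI impI)
    then show ?thesis by (intro exI[of _ W] conjI W(1-3))
  qed
  have add: "\<nu> U (s \<oplus>\<^bsub>sec A U\<^esub> t) x = \<nu> U s x \<oplus>\<^bsub>sp x\<^esub> \<nu> U t x"
    if U: "opn U" "s \<in> carrier (sec A U)" "t \<in> carrier (sec A U)" "x \<in> U" for U s t x
    using rep_add[OF r U(1-3)] U(4) by simp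
  have smult: "\<nu> U (c \<odot>\<^bsub>sec A U\<^esub> s) x = c \<odot>\<^bsub>sp x\<^esub> \<nu> U s x"
    if U: "opn U" "s \<in> carrier (sec A U)" "c \<in> carrier F" "x \<in> U" for U s c x
    using rep_smult[OF r U(1-3)] U(4) by simp
  have resv: "\<nu> V (res A U V s) = restrict (\<nu> U s) V"
    if U: "opn U" "s \<in> carrier (sec A U)" "opn V" "V \<subseteq> U" for U V s
    using rep_res(2)[OF r U(1,3,4,2)] .
  have inj: "\<exists>W. opn W \<and> x \<in> W \<and> W \<subseteq> U \<and> res A U W s = res A U W t"
    if U: "opn U" "s \<in> carrier (sec A U)" "t \<in> carrier (sec A U)" "x \<in> U" "\<nu> U s x = \<nu> U t x" for U s t x
  proof (rule sections_agree_near[OF rep_in[OF r U(1,2)] rep_in[OF r U(1,3)] U(4,4,5)])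
    fix W assume W: "opn W" "x \<in> W" "W \<subseteq> U" "\<And>y. y \<in> W \<Longrightarrow> \<nu> U s y = \<nu> U t y"
    note rs = rep_res[OF r U(1) W(1,3) U(2)] and rt = rep_res[OF r U(1) W(1,3) U(3)]
    have "restrict (\<nu> U s) W = restrict (\<nu> U t) W" by (rule ext) (simp add: restrict_def W(4))
    then have "res A U W s = res A U W t"
      using rs(2) rt(2) by (intro rep_inj[OF r W(1) rs(1) rt(1)]) simp
    then show ?thesis by (intro exI[of _ W] conjI W(1-3))
  qed
  have surj: "\<exists>U s. opn U \<and> x \<in> U \<and> s \<in> carrier (sec A U) \<and> \<nu> U s x = v"
    if x: "x \<in> X" "v \<in> carrier (sp x)" for x v
    using through(1,2)[OF r x] opn_star[OF x(1)] x(1)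
    by (intro exI[of _ "star x"] exI[of _ "through A \<nu> x v"]) simp
  show ?thesis
    unfolding stalk_values_def
    by (intro conjI ballI allI impI; (elim conjE)?;
        (rule fd PiE const add smult resv inj surj; assumption))
qed

lemma represented_constructible:
  assumes r: "represents F C \<delta> S A \<nu>"
  shows "constructible F C (\<lambda>k. - \<delta> k) (A :: ('a, 'f, 'v) presheaf)"
proof -
  interpret psheaf F "polyhedron_top C" A using r by (intro psheaf.intro) (simp add: represents_def)
  interpret cx_presheaf C \<delta> F A by (intro cx_presheaf.intro perverse_cx_axioms psheaf_axioms)
  interpret cx_values C \<delta> F A "Spc S" \<nu>
    by (intro cx_values.intro cx_values_axioms.intro cx_presheaf_axioms represented_stalk_values[OF r])
  show ?thesis
    unfolding constructible_def perverse_simplex_eq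
    using v_fd stratum_isomorphic by blast
qed

end

section \<open>The sheaf represented by linear algebra data, with sections in the given type\<close>

text \<open>The axioms hold in every factor of the product and are reflected by the injection
  \<open>d\<close>. Additive inverses are multiples by minus one, so closure under negation need not
  be assumed separately.\<close>

lemma vectorspace_pointwise:
  fixes M :: "('f, 'v) module" and N :: "'p \<Rightarrow> ('f, 'w) module" and d :: "'v \<Rightarrow> 'p \<Rightarrow> 'w"
  assumes fF: "field F" and N: "\<And>x. x \<in> U \<Longrightarrow> vectorspace F (N x)"
    and inj: "inj_on d (carrier M)"
    and d: "\<And>a. a \<in> carrier M \<Longrightarrow> d a \<in> (\<Pi>\<^sub>E x\<in>U. carrier (N x))"
    and z: "\<zero>\<^bsub>M\<^esub> \<in> carrier M" "\<And>x. x \<in> U \<Longrightarrow> d \<zero>\<^bsub>M\<^esub> x = \<zero>\<^bsub>N x\<^esub>"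
    and add: "\<And>a b. a \<in> carrier M \<Longrightarrow> b \<in> carrier M \<Longrightarrow> a \<oplus>\<^bsub>M\<^esub> b \<in> carrier M"
      "\<And>a b x. a \<in> carrier M \<Longrightarrow> b \<in> carrier M \<Longrightarrow> x \<in> U \<Longrightarrow> d (a \<oplus>\<^bsub>M\<^esub> b) x = d a x \<oplus>\<^bsub>N x\<^esub> d b x"
    and sm: "\<And>c a. c \<in> carrier F \<Longrightarrow> a \<in> carrier M \<Longrightarrow> c \<odot>\<^bsub>M\<^esub> a \<in> carrier M"
      "\<And>c a x. c \<in> carrier F \<Longrightarrow> a \<in> carrier M \<Longrightarrow> x \<in> U \<Longrightarrow> d (c \<odot>\<^bsub>M\<^esub> a) x = c \<odot>\<^bsub>N x\<^esub> d a x"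
  shows "vectorspace F M"
proof -
  interpret F: field F by (rule fF)
  have dx: "d a x \<in> carrier (N x)" if "a \<in> carrier M" "x \<in> U" for a x using PiE_mem[OF d] that by blast
  have eqI: "a = b" if "a \<in> carrier M" "b \<in> carrier M" "\<And>x. x \<in> U \<Longrightarrow> d a x = d b x" for a b
    by (rule inj_onD[OF inj _ that(1,2)]) (rule PiE_ext[OF d[OF that(1)] d[OF that(2)] that(3)])
  have md: "Module.module F (N x)" if "x \<in> U" for x using N[OF that] by (simp add: vectorspace_def)
  have ab: "abelian_group (N x)" if "x \<in> U" for x using md[OF that] by (simp add: module_def)
  have am: "abelian_monoid (N x)" if "x \<in> U" for x using ab[OF that] by (simp add: abelian_group_def)
  have "abelian_group M"
  proof (rule abelian_groupI)
    fix a b c assume abc: "a \<in> carrier M" "b \<in> carrier M" "c \<in> carrier M"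
    show "a \<oplus>\<^bsub>M\<^esub> b \<oplus>\<^bsub>M\<^esub> c = a \<oplus>\<^bsub>M\<^esub> (b \<oplus>\<^bsub>M\<^esub> c)"
      using abc add(1) by (intro eqI) (simp_all add: add(2) abelian_monoid.a_assoc[OF am] dx)
  next
    fix a b assume abc: "a \<in> carrier M" "b \<in> carrier M"
    show "a \<oplus>\<^bsub>M\<^esub> b = b \<oplus>\<^bsub>M\<^esub> a"
      using abc add(1) by (intro eqI) (simp_all add: add(2) abelian_monoid.a_comm[OF am] dx)
  next
    fix a assume a: "a \<in> carrier M"
    show "\<zero>\<^bsub>M\<^esub> \<oplus>\<^bsub>M\<^esub> a = a"
      using a add(1) z(1) by (intro eqI) (simp_all add: add(2) z(2) abelian_monoid.l_zero[OF am] dx)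
    have na: "(\<ominus>\<^bsub>F\<^esub> \<one>\<^bsub>F\<^esub>) \<odot>\<^bsub>M\<^esub> a \<in> carrier M" using sm(1) a by simp
    have "(\<ominus>\<^bsub>F\<^esub> \<one>\<^bsub>F\<^esub>) \<odot>\<^bsub>M\<^esub> a \<oplus>\<^bsub>M\<^esub> a = \<zero>\<^bsub>M\<^esub>"
    proof (rule eqI)
      show "(\<ominus>\<^bsub>F\<^esub> \<one>\<^bsub>F\<^esub>) \<odot>\<^bsub>M\<^esub> a \<oplus>\<^bsub>M\<^esub> a \<in> carrier M" using add(1) na a by simp
      fix x assume x: "x \<in> U"
      interpret N: Module.module F "N x" by (rule md[OF x])
      have "d ((\<ominus>\<^bsub>F\<^esub> \<one>\<^bsub>F\<^esub>) \<odot>\<^bsub>M\<^esub> a \<oplus>\<^bsub>M\<^esub> a) x = (\<ominus>\<^bsub>F\<^esub> \<one>\<^bsub>F\<^esub>) \<odot>\<^bsub>N x\<^esub> d a x \<oplus>\<^bsub>N x\<^esub> \<one>\<^bsub>F\<^esub> \<odot>\<^bsub>N x\<^esub> d a x"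
        using a na x dx[OF a x] by (simp add: add(2) sm(2) del: N.smult_l_minus)
      also have "\<dots> = (\<ominus>\<^bsub>F\<^esub> \<one>\<^bsub>F\<^esub> \<oplus>\<^bsub>F\<^esub> \<one>\<^bsub>F\<^esub>) \<odot>\<^bsub>N x\<^esub> d a x"
        using N.smult_l_distr[of "\<ominus>\<^bsub>F\<^esub> \<one>\<^bsub>F\<^esub>" "\<one>\<^bsub>F\<^esub>" "d a x"] dx[OF a x] by (metis F.a_inv_closed F.one_closed)
      also have "\<dots> = \<zero>\<^bsub>N x\<^esub>" using dx[OF a x] by (simp add: F.l_neg)
      finally show "d ((\<ominus>\<^bsub>F\<^esub> \<one>\<^bsub>F\<^esub>) \<odot>\<^bsub>M\<^esub> a \<oplus>\<^bsub>M\<^esub> a) x = d \<zero>\<^bsub>M\<^esub> x" using z(2)[OF x] by simp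
    qed (rule z)
    then show "\<exists>y\<in>carrier M. y \<oplus>\<^bsub>M\<^esub> a = \<zero>\<^bsub>M\<^esub>" using na by blast
  qed (use z add in auto)
  moreover have "Module.module F M"
  proof (rule moduleI)
    show "cring F" by (rule F.is_cring)
    show "abelian_group M" by fact
    fix a b x assume a: "a \<in> carrier F" "b \<in> carrier F" "x \<in> carrier M"
    show "(a \<oplus>\<^bsub>F\<^esub> b) \<odot>\<^bsub>M\<^esub> x = a \<odot>\<^bsub>M\<^esub> x \<oplus>\<^bsub>M\<^esub> b \<odot>\<^bsub>M\<^esub> x"
      using a add(1) sm(1) by (intro eqI) (simp_all add: add(2) sm(2) module.smult_l_distr[OF md] dx)
    show "(a \<otimes>\<^bsub>F\<^esub> b) \<odot>\<^bsub>M\<^esub> x = a \<odot>\<^bsub>M\<^esub> (b \<odot>\<^bsub>M\<^esub> x)"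
      using a sm(1) by (intro eqI) (simp_all add: sm(2) module.smult_assoc1[OF md] dx)
  next
    fix a x y assume a: "a \<in> carrier F" "x \<in> carrier M" "y \<in> carrier M"
    show "a \<odot>\<^bsub>M\<^esub> (x \<oplus>\<^bsub>M\<^esub> y) = a \<odot>\<^bsub>M\<^esub> x \<oplus>\<^bsub>M\<^esub> a \<odot>\<^bsub>M\<^esub> y"
      using a add(1) sm(1) by (intro eqI) (simp_all add: add(2) sm(2) module.smult_r_distr[OF md] dx)
  next
    fix x assume a: "x \<in> carrier M"
    show "\<one>\<^bsub>F\<^esub> \<odot>\<^bsub>M\<^esub> x = x"
      using a sm(1) by (intro eqI) (simp_all add: sm(2) module.smult_one[OF md] dx)
  qed (use sm in auto)
  ultimately show ?thesis using fF by (simp add: vectorspace_def)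
qed

text \<open>A coding of vectors, in general not a linear map: coefficients over a finite spanning
  list are chosen and padded with zeros.\<close>

lemma fin_dim_injection:
  assumes "fin_dim_vectorspace F M"
  shows "\<exists>c :: 'v \<Rightarrow> nat \<Rightarrow> 'f. inj_on c (carrier (M :: ('f, 'v) module)) \<and> c ` carrier M \<subseteq> UNIV \<rightarrow> carrier F"
proof -
  interpret vectorspace F M using assms by (simp add: fin_dim_vectorspace_def)
  obtain A where A: "finite A" "A \<subseteq> carrier M" "span A = carrier M"
    using assms by (auto simp: fin_dim_vectorspace_def fin_dim_def)
  have "\<forall>v\<in>carrier M. \<exists>a. a \<in> A \<rightarrow> carrier F \<and> v = lincomb a A"
  proof
    fix v assume "v \<in> carrier M"
    then have "v \<in> {lincomb a A |a. a \<in> A \<rightarrow> carrier F}" using A(3) finite_span[OF A(1,2)] by simp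
    then show "\<exists>a. a \<in> A \<rightarrow> carrier F \<and> v = lincomb a A" by blast
  qed
  from bchoice[OF this] obtain a where a: "\<forall>v\<in>carrier M. a v \<in> A \<rightarrow> carrier F \<and> v = lincomb (a v) A" by (elim exE) (rule that)
  have aF: "a v \<in> A \<rightarrow> carrier F" and al: "v = lincomb (a v) A" if "v \<in> carrier M" for v
    using bspec[OF a that] by (rule conjunct1, rule conjunct2)
  obtain xs where xs: "set xs = A" using finite_list[OF A(1)] by blast
  define c where "c v = (\<lambda>n. if n < length xs then a v (xs ! n) else \<zero>\<^bsub>F\<^esub>)" for v
  have "v = w" if vw: "v \<in> carrier M" "w \<in> carrier M" "c v = c w" for v w
  proof -
    have "a v x = a w x" if x: "x \<in> A" for x
    proof -
      obtain n where "n < length xs" "x = xs ! n" using x unfolding xs[symmetric] in_set_conv_nth by blast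
      then show ?thesis using fun_cong[OF vw(3), of n] by (simp add: c_def)
    qed
    then have "lincomb (a v) A = lincomb (a w) A"
      using aF[OF vw(2)] A(2) unfolding lincomb_def by (intro finsum_cong') (auto simp: Pi_iff subset_iff)
    then show ?thesis using trans[OF trans[OF al[OF vw(1)]] al[OF vw(2), symmetric]] by blast
  qed
  moreover have "c v \<in> UNIV \<rightarrow> carrier F" if "v \<in> carrier M" for v
    using aF[OF that] xs by (auto simp: c_def Pi_iff)
  ultimately show ?thesis by (intro exI[of _ c]) (auto intro!: inj_onI)
qed

context rep_data
begin

text \<open>A dense subset of the polyhedron would not suffice, since a stratum may have empty
  interior. A countable dense subset is taken in each stratum, along which sections are locally
  constant.\<close>

lemma sections_determined:
  obtains Q where "countable Q"
    "\<And>U \<sigma> \<tau>. opn U \<Longrightarrow> \<sigma> \<in> \<Gamma> U \<Longrightarrow> \<tau> \<in> \<Gamma> U \<Longrightarrow> (\<And>x. x \<in> Q \<inter> U \<Longrightarrow> \<sigma> x = \<tau> x) \<Longrightarrow> \<sigma> = \<tau>"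
proof -
  have "\<forall>D\<in>simplices C. \<exists>T. countable T \<and> T \<subseteq> {x \<in> X. \<mu> x = D} \<and> {x \<in> X. \<mu> x = D} \<subseteq> closure T"
  proof
    fix D
    show "\<exists>T. countable T \<and> T \<subseteq> {x \<in> X. \<mu> x = D} \<and> {x \<in> X. \<mu> x = D} \<subseteq> closure T"
      by (rule separable[of "{x \<in> X. \<mu> x = D}"]) (intro exI conjI)
  qed
  from bchoice[OF this] obtain q where q: "\<forall>D\<in>simplices C. countable (q D) \<and> q D \<subseteq> {x \<in> X. \<mu> x = D} \<and> {x \<in> X. \<mu> x = D} \<subseteq> closure (q D)"
    by (elim exE) (rule that)
  define Q where "Q = \<Union>(q ` simplices C)"
  have "countable Q" unfolding Q_def using q finite_X countable_finite by (intro countable_UN) auto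
  moreover have "\<sigma> = \<tau>" if U: "opn U" and s: "\<sigma> \<in> \<Gamma> U" "\<tau> \<in> \<Gamma> U" and eq: "\<And>x. x \<in> Q \<inter> U \<Longrightarrow> \<sigma> x = \<tau> x" for U \<sigma> \<tau>
  proof
    fix x show "\<sigma> x = \<tau> x"
    proof (cases "x \<in> U")
      case x: True
      then have xX: "x \<in> X" using opn_sub[OF U] by blast
      obtain W1 where W1: "opn W1" "x \<in> W1" "W1 \<subseteq> U" "\<And>y. y \<in> W1 \<Longrightarrow> \<mu> y = \<mu> x \<Longrightarrow> \<sigma> y = \<sigma> x"
        using sections_loc_const[OF s(1) x opn_sub[OF U]] by blast
      obtain W2 where W2: "opn W2" "x \<in> W2" "W2 \<subseteq> U" "\<And>y. y \<in> W2 \<Longrightarrow> \<mu> y = \<mu> x \<Longrightarrow> \<tau> y = \<tau> x"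
        using sections_loc_const[OF s(2) x opn_sub[OF U]] by blast
      have o: "opn (W1 \<inter> W2)" using W1(1) W2(1) by (rule openin_Int)
      obtain T where T: "open T" "W1 \<inter> W2 = X \<inter> T" using o unfolding openin_open by blast
      have D: "\<mu> x \<in> simplices C" using mu_simplex[OF xX] .
      have qD: "q (\<mu> x) \<subseteq> {y \<in> X. \<mu> y = \<mu> x}" "{y \<in> X. \<mu> y = \<mu> x} \<subseteq> closure (q (\<mu> x))" using bspec[OF q D] by blast+
      have "x \<in> closure (q (\<mu> x))" using qD(2) xX by blast
      moreover have "x \<in> T" using T(2) W1(2) W2(2) by blast
      ultimately obtain y where y: "y \<in> q (\<mu> x)" "y \<in> T" using T(1) closure_iff_nhds_not_empty by blast
      then have yy: "y \<in> X" "\<mu> y = \<mu> x" using qD(1) by auto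
      then have yW: "y \<in> W1" "y \<in> W2" using T(2) y(2) by blast+
      have "\<sigma> x = \<sigma> y" using W1(4)[OF yW(1) yy(2)] by simp
      also have "\<dots> = \<tau> y" using y(1) D yW(1) W1(3) by (intro eq) (auto simp: Q_def)
      also have "\<dots> = \<tau> x" using W2(4)[OF yW(2) yy(2)] by simp
      finally show ?thesis .
    next
      case False
      then show ?thesis using sectionsD(2)[OF s(1)] sectionsD(2)[OF s(2)] by simp
    qed
  qed
  ultimately show ?thesis using that by blast
qed

text \<open>The values at the countably many points have countably many coordinates altogether, and
  the pairing of natural numbers arranges them in one sequence, which \<open>e\<close> places in the
  type of vectors.\<close>

lemma sections_injection:
  fixes e :: "(nat \<Rightarrow> 'f) \<Rightarrow> 'v"
  assumes e: "inj_on e (UNIV \<rightarrow> carrier F)" and fF: "field F" and U: "opn U"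
  shows "\<exists>i :: ('a \<Rightarrow> 'v) \<Rightarrow> 'v. inj_on i (\<Gamma> U)"
proof -
  interpret F: field F by (rule fF)
  obtain Q where Q: "countable Q"
    "\<And>U \<sigma> \<tau>. opn U \<Longrightarrow> \<sigma> \<in> \<Gamma> U \<Longrightarrow> \<tau> \<in> \<Gamma> U \<Longrightarrow> (\<And>x. x \<in> Q \<inter> U \<Longrightarrow> \<sigma> x = \<tau> x) \<Longrightarrow> \<sigma> = \<tau>"
    using sections_determined by blast
  have "\<forall>D\<in>simplices C. \<exists>c :: 'v \<Rightarrow> nat \<Rightarrow> 'f. inj_on c (carrier (Spc S D)) \<and> c ` carrier (Spc S D) \<subseteq> UNIV \<rightarrow> carrier F"
  proof
    fix D assume "D \<in> simplices C"
    then have "fin_dim_vectorspace F (Spc S D)" using S_obj by (simp add: R_objects_def)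
    then show "\<exists>c :: 'v \<Rightarrow> nat \<Rightarrow> 'f. inj_on c (carrier (Spc S D)) \<and> c ` carrier (Spc S D) \<subseteq> UNIV \<rightarrow> carrier F"
      by (rule fin_dim_injection)
  qed
  from bchoice[OF this] obtain c where c: "\<forall>D\<in>simplices C. inj_on (c D :: 'v \<Rightarrow> nat \<Rightarrow> 'f) (carrier (Spc S D)) \<and>
      c D ` carrier (Spc S D) \<subseteq> UNIV \<rightarrow> carrier F" by (elim exE) (rule that)
  \<comment> \<open>Enumerated points outside \<open>U\<close> carry no information and receive
    zero, which keeps the sequence in the carrier of \<open>F\<close>.\<close>
  define g where "g \<sigma> = (\<lambda>n. let x = from_nat_into Q (fst (prod_decode n)) in
    if x \<in> U then c (\<mu> x) (\<sigma> x) (snd (prod_decode n)) else \<zero>\<^bsub>F\<^esub>)" for \<sigma>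
  have g: "g \<sigma> \<in> UNIV \<rightarrow> carrier F" if s: "\<sigma> \<in> \<Gamma> U" for \<sigma>
  proof
    fix n :: nat
    define x where "x = from_nat_into Q (fst (prod_decode n))"
    have "c (\<mu> x) (\<sigma> x) (snd (prod_decode n)) \<in> carrier F" if x: "x \<in> U"
    proof -
      have D: "\<mu> x \<in> simplices C" using mu_simplex opn_sub[OF U] x by blast
      have "c (\<mu> x) (\<sigma> x) \<in> UNIV \<rightarrow> carrier F" using bspec[OF c D] sectionsD(1)[OF s x] by blast
      then show ?thesis by auto
    qed
    then show "g \<sigma> n \<in> carrier F" by (simp add: g_def x_def Let_def)
  qed
  have "\<sigma> = \<tau>" if s: "\<sigma> \<in> \<Gamma> U" "\<tau> \<in> \<Gamma> U" and eq: "g \<sigma> = g \<tau>" for \<sigma> \<tau>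
  proof (rule Q(2)[OF U s])
    fix x assume x: "x \<in> Q \<inter> U"
    obtain i where i: "from_nat_into Q i = x" using from_nat_into_surj[OF Q(1)] x by blast
    have D: "\<mu> x \<in> simplices C" using mu_simplex opn_sub[OF U] x by blast
    have "c (\<mu> x) (\<sigma> x) j = c (\<mu> x) (\<tau> x) j" for j
      using fun_cong[OF eq, of "prod_encode (i, j)"] x i by (simp add: g_def Let_def)
    then have "c (\<mu> x) (\<sigma> x) = c (\<mu> x) (\<tau> x)" by blast
    then show "\<sigma> x = \<tau> x"
      using inj_onD[OF conjunct1[OF bspec[OF c D]], of "\<sigma> x" "\<tau> x"] sectionsD(1)[OF s(1)] sectionsD(1)[OF s(2)] x by auto
  qed
  then have "inj_on g (\<Gamma> U)" by (rule inj_onI)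
  moreover have "inj_on e (g ` \<Gamma> U)" by (rule inj_on_subset[OF e]) (use g in blast)
  ultimately have "inj_on (e \<circ> g) (\<Gamma> U)" by (rule comp_inj_on)
  then show ?thesis by blast
qed

text \<open>The linear structure of the families is transported along the coding \<open>e U\<close>.
  Its inverse \<open>d U\<close> is the bijection of the representing pair.\<close>

theorem represented_exists:
  assumes le: "large_enough F TYPE('v)" and fF: "field F"
  shows "\<exists>(A :: ('a, 'f, 'v) presheaf) \<nu>. represents F C \<delta> S A \<nu>"
proof -
  obtain e0 :: "(nat \<Rightarrow> 'f) \<Rightarrow> 'v" where e0: "inj_on e0 (UNIV \<rightarrow> carrier F)" using le by (auto simp: large_enough_def)
  have "\<forall>U\<in>{U. opn U}. \<exists>i :: ('a \<Rightarrow> 'v) \<Rightarrow> 'v. inj_on i (\<Gamma> U)" using sections_injection[OF e0 fF] by simp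
  from bchoice[OF this] obtain e where e: "\<forall>U\<in>{U. opn U}. inj_on (e U :: ('a \<Rightarrow> 'v) \<Rightarrow> 'v) (\<Gamma> U)" by (elim exE) (rule that)
  have e': "inj_on (e U) (\<Gamma> U)" if "opn U" for U using e that by simp
  define d where "d U = inv_into (\<Gamma> U) (e U)" for U
  define M :: "'a set \<Rightarrow> ('f, 'v) module" where "M U = \<lparr>carrier = e U ` \<Gamma> U, mult = undefined, one = undefined,
    zero = e U (\<lambda>x\<in>U. \<zero>\<^bsub>sp x\<^esub>), add = (\<lambda>a b. e U (\<lambda>x\<in>U. d U a x \<oplus>\<^bsub>sp x\<^esub> d U b x)),
    smult = (\<lambda>c a. e U (\<lambda>x\<in>U. c \<odot>\<^bsub>sp x\<^esub> d U a x))\<rparr>" for U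
  define A where "A = \<lparr>sec = M, res = (\<lambda>U V a. e V (restrict (d U a) V))\<rparr>"
  have de: "d U (e U \<sigma>) = \<sigma>" if "opn U" "\<sigma> \<in> \<Gamma> U" for U \<sigma>
    unfolding d_def using e'[OF that(1)] that(2) by (rule inv_into_f_f)
  have d: "d U a \<in> \<Gamma> U" if "opn U" "a \<in> carrier (M U)" for U a
    using that de by (auto simp: M_def)
  have ed: "e U (d U a) = a" if "a \<in> carrier (M U)" for U a
    using that unfolding d_def M_def by (simp add: f_inv_into_f)
  have inj: "inj_on (d U) (carrier (M U))" for U using ed by (metis inj_onI)
  have cl: "(\<lambda>x\<in>U. \<zero>\<^bsub>sp x\<^esub>) \<in> \<Gamma> U" if "opn U" for U using sections_zero[OF that] .
  have cla: "(\<lambda>x\<in>U. d U a x \<oplus>\<^bsub>sp x\<^esub> d U b x) \<in> \<Gamma> U" if "opn U" "a \<in> carrier (M U)" "b \<in> carrier (M U)" for U a b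
    using sections_add[OF d[OF that(1,2)] d[OF that(1,3)] opn_sub[OF that(1)]] .
  have cls: "(\<lambda>x\<in>U. c \<odot>\<^bsub>sp x\<^esub> d U a x) \<in> \<Gamma> U" if "opn U" "a \<in> carrier (M U)" "c \<in> carrier F" for U a c
    using sections_smult[OF d[OF that(1,2)] opn_sub[OF that(1)] that(3)] .
  have Mz: "\<zero>\<^bsub>M U\<^esub> = e U (\<lambda>x\<in>U. \<zero>\<^bsub>sp x\<^esub>)" for U by (simp add: M_def)
  have Ma: "a \<oplus>\<^bsub>M U\<^esub> b = e U (\<lambda>x\<in>U. d U a x \<oplus>\<^bsub>sp x\<^esub> d U b x)" for U a b by (simp add: M_def)
  have Ms: "c \<odot>\<^bsub>M U\<^esub> a = e U (\<lambda>x\<in>U. c \<odot>\<^bsub>sp x\<^esub> d U a x)" for U a c by (simp add: M_def)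
  have eM: "e U \<sigma> \<in> carrier (M U)" if "\<sigma> \<in> \<Gamma> U" for U \<sigma> using that by (simp add: M_def)
  have da: "d U (a \<oplus>\<^bsub>M U\<^esub> b) = (\<lambda>x\<in>U. d U a x \<oplus>\<^bsub>sp x\<^esub> d U b x)"
    if "opn U" "a \<in> carrier (M U)" "b \<in> carrier (M U)" for U a b
    unfolding Ma by (rule de[OF that(1) cla[OF that]])
  have ds: "d U (c \<odot>\<^bsub>M U\<^esub> a) = (\<lambda>x\<in>U. c \<odot>\<^bsub>sp x\<^esub> d U a x)"
    if "opn U" "a \<in> carrier (M U)" "c \<in> carrier F" for U a c
    unfolding Ms by (rule de[OF that(1) cls[OF that]])
  have vs: "vectorspace F (M U)" if U: "opn U" for U
  proof (rule vectorspace_pointwise[OF fF, of U sp "d U"])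
    show "\<And>x. x \<in> U \<Longrightarrow> vectorspace F (sp x)" using sp_vs opn_sub[OF U] by blast
    show "\<zero>\<^bsub>M U\<^esub> \<in> carrier (M U)" unfolding Mz by (rule eM[OF cl[OF U]])
    show "\<And>x. x \<in> U \<Longrightarrow> d U \<zero>\<^bsub>M U\<^esub> x = \<zero>\<^bsub>sp x\<^esub>" unfolding Mz de[OF U cl[OF U]] by simp
    show "\<And>a. a \<in> carrier (M U) \<Longrightarrow> d U a \<in> (\<Pi>\<^sub>E x\<in>U. carrier (sp x))" using d[OF U] by (simp add: sections_def)
    show "\<And>a b. a \<in> carrier (M U) \<Longrightarrow> b \<in> carrier (M U) \<Longrightarrow> a \<oplus>\<^bsub>M U\<^esub> b \<in> carrier (M U)"
      unfolding Ma by (rule eM[OF cla[OF U]])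
    show "\<And>c a. c \<in> carrier F \<Longrightarrow> a \<in> carrier (M U) \<Longrightarrow> c \<odot>\<^bsub>M U\<^esub> a \<in> carrier (M U)"
      unfolding Ms by (rule eM[OF cls[OF U]])
  qed (simp_all add: inj da[OF U] ds[OF U])
  have rs: "restrict (d U a) V \<in> \<Gamma> V" if "opn U" "opn V" "V \<subseteq> U" "a \<in> carrier (M U)" for U V a
    using sections_restrict[OF d[OF that(1,4)] that(2,3)] .
  have A: "sec A U = M U" "res A U V a = e V (restrict (d U a) V)" for U V a by (simp_all add: A_def)
  have dr: "d V (res A U V a) = restrict (d U a) V" if "opn U" "opn V" "V \<subseteq> U" "a \<in> carrier (M U)" for U V a
    unfolding A by (rule de[OF that(2) rs[OF that]])
  have rin: "res A U V a \<in> carrier (M V)" if "opn U" "opn V" "V \<subseteq> U" "a \<in> carrier (M U)" for U V a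
    unfolding A by (rule eM[OF rs[OF that]])
  have addM: "a \<oplus>\<^bsub>M U\<^esub> b \<in> carrier (M U)" if "opn U" "a \<in> carrier (M U)" "b \<in> carrier (M U)" for U a b
    using vectorspace_closed(1)[OF vs[OF that(1)] that(2,3)] .
  have smM: "c \<odot>\<^bsub>M U\<^esub> a \<in> carrier (M U)" if "opn U" "a \<in> carrier (M U)" "c \<in> carrier F" for U a c
    using vectorspace_closed(2)[OF vs[OF that(1)] that(3,2)] .
  have deq: "a = b" if "a \<in> carrier (M U)" "b \<in> carrier (M U)" "d U a = d U b" for U a b
    using inj_onD[OF inj that(3,1,2)] .
  have psh: "is_presheaf F (polyhedron_top C) A"
    unfolding is_presheaf_def A(1)
  proof (intro conjI allI impI ballI)
    fix U assume "opn U" then show "vectorspace F (M U)" by (rule vs)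
  next
    fix U V assume "opn U \<and> opn V \<and> V \<subseteq> U"
    then have o: "opn U" "opn V" "V \<subseteq> U" by auto
    show "res A U V \<in> module_hom F (M U) (M V)"
      unfolding module_hom_def
    proof (intro CollectI conjI allI impI Pi_I, goal_cases)
      case (1 a) then show ?case by (rule rin[OF o])
    next
      case (2 a b)
      then have ab: "a \<in> carrier (M U)" "b \<in> carrier (M U)" by auto
      show ?case
      proof (rule deq[OF rin[OF o addM[OF o(1) ab]] addM[OF o(2) rin[OF o ab(1)] rin[OF o ab(2)]]], rule ext)
        fix x show "d V (res A U V (a \<oplus>\<^bsub>M U\<^esub> b)) x = d V (res A U V a \<oplus>\<^bsub>M V\<^esub> res A U V b) x"
          unfolding dr[OF o addM[OF o(1) ab]] da[OF o(1) ab] da[OF o(2) rin[OF o ab(1)] rin[OF o ab(2)]] dr[OF o ab(1)] dr[OF o ab(2)]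
          using o(3) by (cases "x \<in> V") auto
      qed
    next
      case (3 c a)
      then have ca: "c \<in> carrier F" "a \<in> carrier (M U)" by auto
      show ?case
      proof (rule deq[OF rin[OF o smM[OF o(1) ca(2,1)]] smM[OF o(2) rin[OF o ca(2)] ca(1)]], rule ext)
        fix x show "d V (res A U V (c \<odot>\<^bsub>M U\<^esub> a)) x = d V (c \<odot>\<^bsub>M V\<^esub> res A U V a) x"
          unfolding dr[OF o smM[OF o(1) ca(2,1)]] ds[OF o(1) ca(2,1)] ds[OF o(2) rin[OF o ca(2)] ca(1)] dr[OF o ca(2)]
          using o(3) by (cases "x \<in> V") auto
      qed
    qed
  next
    fix U a assume U: "opn U" "a \<in> carrier (M U)"
    have "restrict (d U a) U = d U a" using sectionsD(3)[OF d[OF U]] by (rule extensional_restrict)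
    then show "res A U U a = a" unfolding A by (simp add: ed[OF U(2)])
  next
    fix U V W a assume "opn U \<and> opn V \<and> opn W \<and> W \<subseteq> V \<and> V \<subseteq> U" and a: "a \<in> carrier (M U)"
    then have o: "opn U" "opn V" "opn W" "W \<subseteq> V" "V \<subseteq> U" "W \<subseteq> U" by auto
    note r1 = rin[OF o(1,2,5) a] and r2 = rin[OF o(1,3,6) a]
    show "res A V W (res A U V a) = res A U W a"
    proof (rule deq[OF rin[OF o(2,3,4) r1] r2], rule ext)
      fix x show "d W (res A V W (res A U V a)) x = d W (res A U W a) x"
        unfolding dr[OF o(2,3,4) r1] dr[OF o(1,2,5) a] dr[OF o(1,3,6) a] using o(4) by (cases "x \<in> W") auto
    qed
  qed
  have "represents F C \<delta> S A d"
    unfolding represents_def A(1)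
  proof (intro conjI allI impI ballI psh)
    fix U assume U: "opn U"
    show "bij_betw (d U) (carrier (M U)) (\<Gamma> U)"
      unfolding bij_betw_def
    proof (intro conjI inj equalityI subsetI)
      fix \<sigma> assume "\<sigma> \<in> d U ` carrier (M U)" then show "\<sigma> \<in> \<Gamma> U" using d[OF U] by (elim imageE) simp
    next
      fix \<sigma> assume s: "\<sigma> \<in> \<Gamma> U"
      show "\<sigma> \<in> d U ` carrier (M U)" using de[OF U s] eM[OF s] by (intro image_eqI[where x = "e U \<sigma>"]) simp_all
    qed
  qed (simp_all add: da ds dr)
  then show ?thesis by blast
qed

end

section \<open>Equivalences of categories\<close>

lemma category_axioms:
  assumes "category C"
  shows "a \<in> Obj C \<Longrightarrow> Idn C a \<in> Hom C a a"
    "\<lbrakk>a \<in> Obj C; b \<in> Obj C; c \<in> Obj C; f \<in> Hom C a b; g \<in> Hom C b c\<rbrakk> \<Longrightarrow> Cmp C a b c g f \<in> Hom C a c"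
    "\<lbrakk>a \<in> Obj C; b \<in> Obj C; f \<in> Hom C a b\<rbrakk> \<Longrightarrow> Cmp C a a b f (Idn C a) = f"
    "\<lbrakk>a \<in> Obj C; b \<in> Obj C; f \<in> Hom C a b\<rbrakk> \<Longrightarrow> Cmp C a b b (Idn C b) f = f"
    "\<lbrakk>a \<in> Obj C; b \<in> Obj C; c \<in> Obj C; d \<in> Obj C; f \<in> Hom C a b; g \<in> Hom C b c; h \<in> Hom C c d\<rbrakk> \<Longrightarrow>
      Cmp C a c d h (Cmp C a b c g f) = Cmp C a b d (Cmp C b c d h g) f"
  using assms unfolding category_def by blast+

lemma functor_axioms:
  assumes "is_functor C D \<Phi>"
  shows "category C" "category D" "a \<in> Obj C \<Longrightarrow> on_obj \<Phi> a \<in> Obj D"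
    "\<lbrakk>a \<in> Obj C; b \<in> Obj C; f \<in> Hom C a b\<rbrakk> \<Longrightarrow> on_hom \<Phi> a b f \<in> Hom D (on_obj \<Phi> a) (on_obj \<Phi> b)"
    "a \<in> Obj C \<Longrightarrow> on_hom \<Phi> a a (Idn C a) = Idn D (on_obj \<Phi> a)"
    "\<lbrakk>a \<in> Obj C; b \<in> Obj C; c \<in> Obj C; f \<in> Hom C a b; g \<in> Hom C b c\<rbrakk> \<Longrightarrow>
      on_hom \<Phi> a c (Cmp C a b c g f) =
      Cmp D (on_obj \<Phi> a) (on_obj \<Phi> b) (on_obj \<Phi> c) (on_hom \<Phi> b c g) (on_hom \<Phi> a b f)"
  using assms unfolding is_functor_def by blast+

text \<open>The usual construction of a quasi-inverse by choice. Equations between morphisms of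
  \<open>C\<close> are obtained by faithfulness from their images in \<open>D\<close>.\<close>

theorem fully_faithful_essentially_surjective:
  assumes ff: "is_functor C D \<Phi>"
    and faithful: "\<And>a b f g. \<lbrakk>a \<in> Obj C; b \<in> Obj C; f \<in> Hom C a b; g \<in> Hom C a b;
      on_hom \<Phi> a b f = on_hom \<Phi> a b g\<rbrakk> \<Longrightarrow> f = g"
    and full: "\<And>a b p. \<lbrakk>a \<in> Obj C; b \<in> Obj C; p \<in> Hom D (on_obj \<Phi> a) (on_obj \<Phi> b)\<rbrakk> \<Longrightarrow>
      \<exists>f\<in>Hom C a b. on_hom \<Phi> a b f = p"
    and surj: "\<And>d. d \<in> Obj D \<Longrightarrow> \<exists>a\<in>Obj C. \<exists>e. iso_in D (on_obj \<Phi> a) d e"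
  shows "equivalence_of_categories C D \<Phi>"
proof -
  note cC = category_axioms[OF functor_axioms(1)[OF ff]]
  note cD = category_axioms[OF functor_axioms(2)[OF ff]]
  note \<Phi> = functor_axioms(3-6)[OF ff]
  \<comment> \<open>One triple for each object of \<open>D\<close>: an object of \<open>C\<close>,
    an isomorphism from its image, and the inverse of that isomorphism.\<close>
  have "\<forall>d\<in>Obj D. \<exists>t. fst t \<in> Obj C \<and> fst (snd t) \<in> Hom D (on_obj \<Phi> (fst t)) d \<and>
      snd (snd t) \<in> Hom D d (on_obj \<Phi> (fst t)) \<and>
      Cmp D (on_obj \<Phi> (fst t)) d (on_obj \<Phi> (fst t)) (snd (snd t)) (fst (snd t)) = Idn D (on_obj \<Phi> (fst t)) \<and>
      Cmp D d (on_obj \<Phi> (fst t)) d (fst (snd t)) (snd (snd t)) = Idn D d"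
  proof
    fix d assume "d \<in> Obj D"
    then obtain a e where a: "a \<in> Obj C" "iso_in D (on_obj \<Phi> a) d e" using surj by blast
    then obtain k where "k \<in> Hom D d (on_obj \<Phi> a)" "Cmp D (on_obj \<Phi> a) d (on_obj \<Phi> a) k e = Idn D (on_obj \<Phi> a)"
      "Cmp D d (on_obj \<Phi> a) d e k = Idn D d" "e \<in> Hom D (on_obj \<Phi> a) d" unfolding iso_in_def by blast
    then show "\<exists>t. fst t \<in> Obj C \<and> fst (snd t) \<in> Hom D (on_obj \<Phi> (fst t)) d \<and>
      snd (snd t) \<in> Hom D d (on_obj \<Phi> (fst t)) \<and>
      Cmp D (on_obj \<Phi> (fst t)) d (on_obj \<Phi> (fst t)) (snd (snd t)) (fst (snd t)) = Idn D (on_obj \<Phi> (fst t)) \<and>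
      Cmp D d (on_obj \<Phi> (fst t)) d (fst (snd t)) (snd (snd t)) = Idn D d"
      using a(1) by (intro exI[of _ "(a, e, k)"]) simp
  qed
  from bchoice[OF this] obtain t where t: "\<forall>d\<in>Obj D. fst (t d) \<in> Obj C \<and> fst (snd (t d)) \<in> Hom D (on_obj \<Phi> (fst (t d))) d \<and>
      snd (snd (t d)) \<in> Hom D d (on_obj \<Phi> (fst (t d))) \<and>
      Cmp D (on_obj \<Phi> (fst (t d))) d (on_obj \<Phi> (fst (t d))) (snd (snd (t d))) (fst (snd (t d))) = Idn D (on_obj \<Phi> (fst (t d))) \<and>
      Cmp D d (on_obj \<Phi> (fst (t d))) d (fst (snd (t d))) (snd (snd (t d))) = Idn D d"
    by (elim exE) (rule that)
  define q where "q d = fst (t d)" for d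
  define e where "e d = fst (snd (t d))" for d
  define k where "k d = snd (snd (t d))" for d
  define P where "P = on_obj \<Phi>"
  have q: "q d \<in> Obj C" and e: "e d \<in> Hom D (P (q d)) d" and k: "k d \<in> Hom D d (P (q d))"
    and ke: "Cmp D (P (q d)) d (P (q d)) (k d) (e d) = Idn D (P (q d))"
    and ek: "Cmp D d (P (q d)) d (e d) (k d) = Idn D d" if "d \<in> Obj D" for d
    using bspec[OF t that] unfolding q_def e_def k_def P_def by simp_all
  have PO: "P a \<in> Obj D" if "a \<in> Obj C" for a using \<Phi>(1)[OF that] by (simp add: P_def)
  have Pq: "P (q d) \<in> Obj D" if "d \<in> Obj D" for d using PO[OF q[OF that]] .
  define H where "H = on_hom \<Phi>"
  have HH: "H a b f \<in> Hom D (P a) (P b)" if "a \<in> Obj C" "b \<in> Obj C" "f \<in> Hom C a b" for a b f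
    using \<Phi>(2)[OF that] by (simp add: P_def H_def)
  have HI: "H a a (Idn C a) = Idn D (P a)" if "a \<in> Obj C" for a using \<Phi>(3)[OF that] by (simp add: P_def H_def)
  have HC: "H a c (Cmp C a b c g f) = Cmp D (P a) (P b) (P c) (H b c g) (H a b f)"
    if "a \<in> Obj C" "b \<in> Obj C" "c \<in> Obj C" "f \<in> Hom C a b" "g \<in> Hom C b c" for a b c f g
    using \<Phi>(4)[OF that] by (simp add: P_def H_def)
  \<comment> \<open>The inverse of \<open>\<Phi>\<close> on morphisms, which exists because
    \<open>\<Phi>\<close> is full and faithful.\<close>
  define R where "R a b p = (SOME f. f \<in> Hom C a b \<and> H a b f = p)" for a b p
  have R: "R a b p \<in> Hom C a b" "H a b (R a b p) = p" if "a \<in> Obj C" "b \<in> Obj C" "p \<in> Hom D (P a) (P b)" for a b p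
  proof -
    have "\<exists>f. f \<in> Hom C a b \<and> H a b f = p" using full[OF that(1,2) that(3)[unfolded P_def]] by (auto simp: H_def)
    from someI_ex[OF this] show "R a b p \<in> Hom C a b" "H a b (R a b p) = p" by (simp_all add: R_def)
  qed
  have inj: "f = g" if "a \<in> Obj C" "b \<in> Obj C" "f \<in> Hom C a b" "g \<in> Hom C a b" "H a b f = H a b g" for a b f g
    using faithful[OF that(1-4)] that(5) by (simp add: H_def)
  \<comment> \<open>Conjugation by the chosen isomorphisms turns a morphism of \<open>D\<close> into
    one between images under \<open>\<Phi>\<close>, which \<open>R\<close> can lift.\<close>
  define K where "K d d' p = Cmp D (P (q d)) d' (P (q d')) (k d') (Cmp D (P (q d)) d d' p (e d))" for d d' p
  have K: "K d d' p \<in> Hom D (P (q d)) (P (q d'))" if "d \<in> Obj D" "d' \<in> Obj D" "p \<in> Hom D d d'" for d d' p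
    unfolding K_def using that by (intro cD(2) Pq e k)
  have Kid: "K d d (Idn D d) = Idn D (P (q d))" if "d \<in> Obj D" for d
    unfolding K_def using cD(4)[OF Pq[OF that] that e[OF that]] ke[OF that] by simp
  have eK: "Cmp D (P (q d)) (P (q d')) d' (e d') (K d d' p) = Cmp D (P (q d)) d d' p (e d)"
    if d: "d \<in> Obj D" "d' \<in> Obj D" "p \<in> Hom D d d'" for d d' p
  proof -
    have h: "Cmp D (P (q d)) d d' p (e d) \<in> Hom D (P (q d)) d'" using d by (intro cD(2) Pq e)
    show ?thesis
      unfolding K_def cD(5)[OF Pq[OF d(1)] d(2) Pq[OF d(2)] d(2) h k[OF d(2)] e[OF d(2)]] ek[OF d(2)]
      by (rule cD(4)[OF Pq[OF d(1)] d(2) h])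
  qed
  have Kcomp: "K a c (Cmp D a b c p' p) = Cmp D (P (q a)) (P (q b)) (P (q c)) (K b c p') (K a b p)"
    if o: "a \<in> Obj D" "b \<in> Obj D" "c \<in> Obj D" and p: "p \<in> Hom D a b" "p' \<in> Hom D b c" for a b c p p'
  proof -
    note Q = Pq[OF o(1)] Pq[OF o(2)] Pq[OF o(3)]
    have h1: "Cmp D (P (q a)) a b p (e a) \<in> Hom D (P (q a)) b" using o p by (intro cD(2) Pq e)
    have h2: "Cmp D (P (q b)) b c p' (e b) \<in> Hom D (P (q b)) c" using o p by (intro cD(2) Pq e)
    have "Cmp D (P (q a)) (P (q b)) (P (q c)) (K b c p') (K a b p) =
        Cmp D (P (q a)) c (P (q c)) (k c) (Cmp D (P (q a)) (P (q b)) c (Cmp D (P (q b)) b c p' (e b)) (K a b p))"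
      unfolding K_def[of b c] cD(5)[OF Q(1,2) o(3) Q(3) K[OF o(1,2) p(1)] h2 k[OF o(3)]] by (rule refl)
    also have "Cmp D (P (q a)) (P (q b)) c (Cmp D (P (q b)) b c p' (e b)) (K a b p) =
        Cmp D (P (q a)) b c p' (Cmp D (P (q a)) (P (q b)) b (e b) (K a b p))"
      unfolding cD(5)[OF Q(1,2) o(2,3) K[OF o(1,2) p(1)] e[OF o(2)] p(2)] by (rule refl)
    also have "\<dots> = Cmp D (P (q a)) a c (Cmp D a b c p' p) (e a)"
      unfolding eK[OF o(1,2) p(1)] cD(5)[OF Q(1) o e[OF o(1)] p] by (rule refl)
    finally show ?thesis unfolding K_def[of a c] by (rule sym)
  qed
  define \<Psi> where "\<Psi> = \<lparr>on_obj = q, on_hom = (\<lambda>d d' p. R (q d) (q d') (K d d' p))\<rparr>"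
  have ff': "is_functor D C \<Psi>"
    unfolding is_functor_def
  proof (intro conjI ballI)
    fix a assume a: "a \<in> Obj D"
    show "on_obj \<Psi> a \<in> Obj C" using q[OF a] by (simp add: \<Psi>_def)
    show "on_hom \<Psi> a a (Idn D a) = Idn C (on_obj \<Psi> a)"
      unfolding \<Psi>_def
      using inj[OF q[OF a] q[OF a] R(1)[OF q[OF a] q[OF a] K[OF a a cD(1)[OF a]]] cC(1)[OF q[OF a]]]
        R(2)[OF q[OF a] q[OF a] K[OF a a cD(1)[OF a]]] HI[OF q[OF a]] Kid[OF a] by simp
    fix b p assume b: "b \<in> Obj D" and p: "p \<in> Hom D a b"
    note r = R[OF q[OF a] q[OF b] K[OF a b p]]
    show "on_hom \<Psi> a b p \<in> Hom C (on_obj \<Psi> a) (on_obj \<Psi> b)" using r by (simp add: \<Psi>_def)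
    fix c p' assume c: "c \<in> Obj D" and p': "p' \<in> Hom D b c"
    note r' = R[OF q[OF b] q[OF c] K[OF b c p']]
    note r'' = R[OF q[OF a] q[OF c] K[OF a c cD(2)[OF a b c p p']]]
    have "R (q a) (q c) (K a c (Cmp D a b c p' p)) =
      Cmp C (q a) (q b) (q c) (R (q b) (q c) (K b c p')) (R (q a) (q b) (K a b p))"
      by (rule inj[OF q[OF a] q[OF c] r''(1) cC(2)[OF q[OF a] q[OF b] q[OF c] r(1) r'(1)]])
        (simp only: HC[OF q[OF a] q[OF b] q[OF c] r(1) r'(1)] r(2) r'(2) r''(2)[unfolded Kcomp[OF a b c p p']] Kcomp[OF a b c p p'])
    then show "on_hom \<Psi> a c (Cmp D a b c p' p) =
        Cmp C (on_obj \<Psi> a) (on_obj \<Psi> b) (on_obj \<Psi> c) (on_hom \<Psi> b c p') (on_hom \<Psi> a b p)"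
      by (simp add: \<Psi>_def)
  qed (rule functor_axioms(1,2)[OF ff])+
  have nat1: "nat_isomorphic D D (functor_comp \<Phi> \<Psi>) id_functor"
    unfolding nat_isomorphic_def
  proof (intro exI[of _ e] conjI ballI)
    fix a assume a: "a \<in> Obj D"
    show "iso_in D (on_obj (functor_comp \<Phi> \<Psi>) a) (on_obj id_functor a) (e a)"
      unfolding iso_in_def functor_comp_def id_functor_def \<Psi>_def
      using e[OF a] k[OF a] ke[OF a] ek[OF a] by (auto simp: P_def)
    fix b p assume b: "b \<in> Obj D" and p: "p \<in> Hom D a b"
    show "Cmp D (on_obj (functor_comp \<Phi> \<Psi>) a) (on_obj (functor_comp \<Phi> \<Psi>) b) (on_obj id_functor b) (e b)
            (on_hom (functor_comp \<Phi> \<Psi>) a b p) =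
          Cmp D (on_obj (functor_comp \<Phi> \<Psi>) a) (on_obj id_functor a) (on_obj id_functor b)
            (on_hom id_functor a b p) (e a)"
      using eK[OF a b p] R(2)[OF q[OF a] q[OF b] K[OF a b p]]
      by (simp add: functor_comp_def id_functor_def \<Psi>_def P_def H_def)
  qed
  \<comment> \<open>The second natural isomorphism is the lift of the first one along
    \<open>\<Phi>\<close>, and \<open>u'\<close> is the lift of its inverse.\<close>
  define u where "u a = R (q (P a)) a (e (P a))" for a
  define u' where "u' a = R a (q (P a)) (k (P a))" for a
  have u: "u a \<in> Hom C (q (P a)) a" "H (q (P a)) a (u a) = e (P a)"
    and u': "u' a \<in> Hom C a (q (P a))" "H a (q (P a)) (u' a) = k (P a)" if "a \<in> Obj C" for a
    unfolding u_def u'_def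
    using R[OF q[OF PO[OF that]] that e[OF PO[OF that]]] R[OF that q[OF PO[OF that]] k[OF PO[OF that]]] by blast+
  have nat2: "nat_isomorphic C C (functor_comp \<Psi> \<Phi>) id_functor"
    unfolding nat_isomorphic_def
  proof (intro exI[of _ u] conjI ballI)
    fix a assume a: "a \<in> Obj C"
    note qa = q[OF PO[OF a]]
    have "Cmp C (q (P a)) a (q (P a)) (u' a) (u a) = Idn C (q (P a))"
      by (rule inj[OF qa qa cC(2)[OF qa a qa u(1)[OF a] u'(1)[OF a]] cC(1)[OF qa]])
        (simp only: HC[OF qa a qa u(1)[OF a] u'(1)[OF a]] u(2)[OF a] u'(2)[OF a] HI[OF qa] ke[OF PO[OF a]])
    moreover have "Cmp C a (q (P a)) a (u a) (u' a) = Idn C a"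
      by (rule inj[OF a a cC(2)[OF a qa a u'(1)[OF a] u(1)[OF a]] cC(1)[OF a]])
        (simp only: HC[OF a qa a u'(1)[OF a] u(1)[OF a]] u(2)[OF a] u'(2)[OF a] HI[OF a] ek[OF PO[OF a]])
    ultimately show "iso_in C (on_obj (functor_comp \<Psi> \<Phi>) a) (on_obj id_functor a) (u a)"
      unfolding iso_in_def functor_comp_def id_functor_def \<Psi>_def
      using u(1)[OF a] u'(1)[OF a] by (auto simp: P_def)
    fix b f assume b: "b \<in> Obj C" and f: "f \<in> Hom C a b"
    note qb = q[OF PO[OF b]]
    note Kf = K[OF PO[OF a] PO[OF b] HH[OF a b f]]
    note r = R[OF qa qb Kf]
    have "Cmp C (q (P a)) (q (P b)) b (u b) (R (q (P a)) (q (P b)) (K (P a) (P b) (H a b f))) =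
        Cmp C (q (P a)) a b f (u a)"
      by (rule inj[OF qa b cC(2)[OF qa qb b r(1) u(1)[OF b]] cC(2)[OF qa a b u(1)[OF a] f]])
        (simp only: HC[OF qa qb b r(1) u(1)[OF b]] HC[OF qa a b u(1)[OF a] f] r(2) u(2)[OF a] u(2)[OF b]
          eK[OF PO[OF a] PO[OF b] HH[OF a b f]])
    then show "Cmp C (on_obj (functor_comp \<Psi> \<Phi>) a) (on_obj (functor_comp \<Psi> \<Phi>) b) (on_obj id_functor b) (u b)
            (on_hom (functor_comp \<Psi> \<Phi>) a b f) =
          Cmp C (on_obj (functor_comp \<Psi> \<Phi>) a) (on_obj id_functor a) (on_obj id_functor b)
            (on_hom id_functor a b f) (u a)"
      by (simp add: functor_comp_def id_functor_def \<Psi>_def P_def H_def)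
  qed
  show ?thesis unfolding equivalence_of_categories_def using ff ff' nat1 nat2 by blast
qed

section \<open>The category laws for linear algebra data and for constructible sheaves\<close>

lemma Lin_id: "(\<lambda>x\<in>carrier V. x) \<in> Lin F V V" if "vectorspace F V"
  using vectorspace_closed[OF that] by (auto simp: Lin_def module_hom_def)

lemma Lin_comp:
  assumes "f \<in> Lin F U V" "g \<in> Lin F V W" "vectorspace F U"
  shows "compose (carrier U) g f \<in> Lin F U W"
  using assms vectorspace_closed[OF assms(3)] by (auto simp: Lin_def module_hom_def Pi_iff compose_def)

lemma category_R_cat: "category (R_cat F C \<delta>)"
proof -
  have vs: "vectorspace F (Spc S D)" if "S \<in> R_objects F C \<delta>" "D \<in> simplices C" for S D
    using that by (simp add: R_objects_def fin_dim_vectorspace_def)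
  have mp: "Map S D D' x \<in> carrier (Spc S D')" "D \<in> simplices C" "D' \<in> simplices C"
    if "S \<in> R_objects F C \<delta>" "arrow C \<delta> D D'" "x \<in> carrier (Spc S D)" for S D D' x
    using that module_homD(1)[of "Map S D D'" F "Spc S D" "Spc S D'" x] by (auto simp: R_objects_def arrow_def)
  have lin: "f D \<in> Lin F (Spc S D) (Spc T D)" if "f \<in> Hom (R_cat F C \<delta>) S T" "D \<in> simplices C" for f S T D
    using that by (auto simp: R_cat_def)
  have nat: "f D' (Map S D D' x) = Map T D D' (f D x)"
    if "f \<in> Hom (R_cat F C \<delta>) S T" "arrow C \<delta> D D'" "x \<in> carrier (Spc S D)" for f S T D D' x
    using that by (simp add: R_cat_def)
  have cmp: "Cmp (R_cat F C \<delta>) S T U g f D = compose (carrier (Spc S D)) (g D) (f D)" if "D \<in> simplices C" for S T U f g D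
    using that by (simp add: R_cat_def)
  have car: "f D x \<in> carrier (Spc T D)" if "f \<in> Hom (R_cat F C \<delta>) S T" "D \<in> simplices C" "x \<in> carrier (Spc S D)" for f S T D x
    using that by (auto simp: R_cat_def PiE_def Pi_def Lin_def module_hom_def)
  have ex: "f D x = undefined" if "f \<in> Hom (R_cat F C \<delta>) S T" "D \<in> simplices C" "x \<notin> carrier (Spc S D)" for f S T D x
    using that by (auto simp: R_cat_def PiE_def Pi_def Lin_def extensional_def)
  have ex': "f D = undefined" if "f \<in> Hom (R_cat F C \<delta>) S T" "D \<notin> simplices C" for f S T D
    using that by (auto simp: R_cat_def PiE_def extensional_def)
  show ?thesis
    unfolding category_def
  proof (intro conjI ballI)
    fix S assume "S \<in> Obj (R_cat F C \<delta>)"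
    then have S: "S \<in> R_objects F C \<delta>" by (simp add: R_cat_def)
    show "Idn (R_cat F C \<delta>) S \<in> Hom (R_cat F C \<delta>) S S"
      unfolding R_cat_def cat.simps mem_Collect_eq
    proof (intro conjI allI impI ballI PiE_I)
      fix D assume D: "D \<in> simplices C"
      show "(\<lambda>D\<in>simplices C. \<lambda>x\<in>carrier (Spc S D). x) D \<in> Lin F (Spc S D) (Spc S D)"
        using Lin_id[OF vs[OF S D]] D by simp
    next
      fix D D' x assume a: "arrow C \<delta> D D'" "x \<in> carrier (Spc S D)"
      show "(\<lambda>D\<in>simplices C. \<lambda>x\<in>carrier (Spc S D). x) D' (Map S D D' x) =
        Map S D D' ((\<lambda>D\<in>simplices C. \<lambda>x\<in>carrier (Spc S D). x) D x)"
        using mp[OF S a] a(2) by simp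
    qed simp
    fix T f assume "T \<in> Obj (R_cat F C \<delta>)" and f: "f \<in> Hom (R_cat F C \<delta>) S T"
    then have T: "T \<in> R_objects F C \<delta>" by (simp add: R_cat_def)
    show "Cmp (R_cat F C \<delta>) S S T f (Idn (R_cat F C \<delta>) S) = f"
      using car[OF f] ex[OF f] ex'[OF f] by (intro ext) (auto simp: R_cat_def compose_def restrict_def)
    show "Cmp (R_cat F C \<delta>) S T T (Idn (R_cat F C \<delta>) T) f = f"
      using car[OF f] ex[OF f] ex'[OF f] by (intro ext) (auto simp: R_cat_def compose_def restrict_def)
    fix U g assume "U \<in> Obj (R_cat F C \<delta>)" and g: "g \<in> Hom (R_cat F C \<delta>) T U"
    show "Cmp (R_cat F C \<delta>) S T U g f \<in> Hom (R_cat F C \<delta>) S U"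
    proof -
      have "Cmp (R_cat F C \<delta>) S T U g f \<in> (\<Pi>\<^sub>E D\<in>simplices C. Lin F (Spc S D) (Spc U D))"
      proof (rule PiE_I)
        fix D assume D: "D \<in> simplices C"
        show "Cmp (R_cat F C \<delta>) S T U g f D \<in> Lin F (Spc S D) (Spc U D)"
          unfolding cmp[OF D] by (rule Lin_comp[OF lin[OF f D] lin[OF g D] vs[OF S D]])
      qed (simp add: R_cat_def)
      moreover have "Cmp (R_cat F C \<delta>) S T U g f D' (Map S D D' x) = Map U D D' (Cmp (R_cat F C \<delta>) S T U g f D x)"
        if a: "arrow C \<delta> D D'" "x \<in> carrier (Spc S D)" for D D' x
      proof -
        have D: "D \<in> simplices C" by (rule mp(2)[OF S a])
        have "Cmp (R_cat F C \<delta>) S T U g f D' (Map S D D' x) = g D' (f D' (Map S D D' x))"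
          unfolding cmp[OF mp(3)[OF S a]] using mp(1)[OF S a] by (simp add: compose_def)
        also have "\<dots> = Map U D D' (g D (f D x))"
          unfolding nat[OF f a] by (rule nat[OF g a(1) car[OF f D a(2)]])
        also have "g D (f D x) = Cmp (R_cat F C \<delta>) S T U g f D x"
          unfolding cmp[OF D] using a(2) by (simp add: compose_def)
        finally show ?thesis .
      qed
      ultimately show ?thesis
        unfolding R_cat_def cat.simps mem_Collect_eq by (intro conjI allI impI ballI) (assumption, blast)
    qed
    fix V k assume k: "k \<in> Hom (R_cat F C \<delta>) U V"
    show "Cmp (R_cat F C \<delta>) S U V k (Cmp (R_cat F C \<delta>) S T U g f) =
        Cmp (R_cat F C \<delta>) S T V (Cmp (R_cat F C \<delta>) T U V k g) f"
      using car[OF f] by (intro ext) (auto simp: R_cat_def compose_def restrict_def)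
  qed
qed

lemma Sh_c_id:
  fixes A :: "('a::euclidean_space, 'f, 'v) presheaf"
  assumes "is_presheaf F (polyhedron_top C) A"
  shows "Idn (Sh_c F C \<delta>) A \<in> Hom (Sh_c F C \<delta>) A A"
proof -
  have vs: "vectorspace F (sec A U)" if "openin (polyhedron_top C) U" for U
    using assms that by (simp add: is_presheaf_def)
  have "res A U V s \<in> carrier (sec A V)"
    if "openin (polyhedron_top C) U" "openin (polyhedron_top C) V" "V \<subseteq> U" "s \<in> carrier (sec A U)" for U V s
    using assms that module_homD(1)[of "res A U V" F "sec A U" "sec A V"] by (simp add: is_presheaf_def)
  then show ?thesis
    unfolding Sh_c_def cat.simps sheaf_homs_def mem_Collect_eq
    by (intro conjI allI impI ballI PiE_I) (simp_all add: Lin_id[OF vs])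
qed

lemma category_Sh_c: "category (Sh_c F C \<delta> :: (('a::euclidean_space, 'f, 'v) presheaf, 'a set \<Rightarrow> 'v \<Rightarrow> 'v) cat)"
proof -
  let ?S = "Sh_c F C \<delta> :: (('a, 'f, 'v) presheaf, 'a set \<Rightarrow> 'v \<Rightarrow> 'v) cat"
  have lin: "f U \<in> Lin F (sec S U) (sec T U)" if "f \<in> Hom ?S S T" "openin (polyhedron_top C) U" for f S T U
    using that by (auto simp: Sh_c_def sheaf_homs_def)
  have nat: "f V (res S U V s) = res T U V (f U s)"
    if "f \<in> Hom ?S S T" "openin (polyhedron_top C) U" "openin (polyhedron_top C) V" "V \<subseteq> U" "s \<in> carrier (sec S U)" for f S T U V s
    using that by (simp add: Sh_c_def sheaf_homs_def)
  have cmp: "Cmp ?S S T U g f D = compose (carrier (sec S D)) (g D) (f D)" if "openin (polyhedron_top C) D" for S T U f g D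
    using that by (simp add: Sh_c_def)
  have car: "f D x \<in> carrier (sec T D)" if "f \<in> Hom ?S S T" "openin (polyhedron_top C) D" "x \<in> carrier (sec S D)" for f S T D x
    using that by (auto simp: Sh_c_def sheaf_homs_def PiE_def Pi_def Lin_def module_hom_def)
  have ex: "f D x = undefined" if "f \<in> Hom ?S S T" "openin (polyhedron_top C) D" "x \<notin> carrier (sec S D)" for f S T D x
    using that by (auto simp: Sh_c_def sheaf_homs_def PiE_def Pi_def Lin_def extensional_def)
  have ex': "f D = undefined" if "f \<in> Hom ?S S T" "\<not> openin (polyhedron_top C) D" for f S T D
    using that by (auto simp: Sh_c_def sheaf_homs_def PiE_def extensional_def)
  show ?thesis
    unfolding category_def
  proof (intro conjI ballI)
    fix S assume "S \<in> Obj ?S"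
    then have S: "is_presheaf F (polyhedron_top C) S" by (simp add: Sh_c_def is_sheaf_def)
    show "Idn ?S S \<in> Hom ?S S S" by (rule Sh_c_id[OF S])
    have vs: "vectorspace F (sec S U)" if "openin (polyhedron_top C) U" for U
      using S that by (simp add: is_presheaf_def)
    have mp: "res S U V s \<in> carrier (sec S V)"
      if "openin (polyhedron_top C) U" "openin (polyhedron_top C) V" "V \<subseteq> U" "s \<in> carrier (sec S U)" for U V s
      using S that module_homD(1)[of "res S U V" F "sec S U" "sec S V"] by (simp add: is_presheaf_def)
    fix T f assume f: "f \<in> Hom ?S S T"
    show "Cmp ?S S S T f (Idn ?S S) = f"
      using car[OF f] ex[OF f] ex'[OF f] by (intro ext) (auto simp: Sh_c_def compose_def restrict_def)
    show "Cmp ?S S T T (Idn ?S T) f = f"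
      using car[OF f] ex[OF f] ex'[OF f] by (intro ext) (auto simp: Sh_c_def compose_def restrict_def)
    fix U g assume g: "g \<in> Hom ?S T U"
    show "Cmp ?S S T U g f \<in> Hom ?S S U"
    proof -
      have "Cmp ?S S T U g f \<in> (\<Pi>\<^sub>E D\<in>{U. openin (polyhedron_top C) U}. Lin F (sec S D) (sec U D))"
      proof (rule PiE_I)
        fix D assume "D \<in> {U. openin (polyhedron_top C) U}"
        then have D: "openin (polyhedron_top C) D" by simp
        show "Cmp ?S S T U g f D \<in> Lin F (sec S D) (sec U D)"
          unfolding cmp[OF D] by (rule Lin_comp[OF lin[OF f D] lin[OF g D] vs[OF D]])
      qed (simp add: Sh_c_def)
      moreover have "Cmp ?S S T U g f D' (res S D D' x) = res U D D' (Cmp ?S S T U g f D x)"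
        if a: "openin (polyhedron_top C) D" "openin (polyhedron_top C) D'" "D' \<subseteq> D" "x \<in> carrier (sec S D)" for D D' x
      proof -
        have "Cmp ?S S T U g f D' (res S D D' x) = g D' (f D' (res S D D' x))"
          unfolding cmp[OF a(2)] using mp[OF a] by (simp add: compose_def)
        also have "\<dots> = res U D D' (g D (f D x))"
          unfolding nat[OF f a] by (rule nat[OF g a(1-3) car[OF f a(1,4)]])
        also have "g D (f D x) = Cmp ?S S T U g f D x"
          unfolding cmp[OF a(1)] using a(4) by (simp add: compose_def)
        finally show ?thesis .
      qed
      ultimately have "Cmp ?S S T U g f \<in> sheaf_homs F (polyhedron_top C) S U"
        unfolding sheaf_homs_def mem_Collect_eq by (intro conjI allI impI ballI) (assumption, blast)
      then show ?thesis by (simp add: Sh_c_def)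
    qed
    fix V k assume k: "k \<in> Hom ?S U V"
    show "Cmp ?S S U V k (Cmp ?S S T U g f) = Cmp ?S S T V (Cmp ?S T U V k g) f"
      using car[OF f] by (intro ext) (auto simp: Sh_c_def compose_def restrict_def)
  qed
qed

section \<open>The equivalence\<close>

text \<open>An arbitrary representing pair. By \<open>rep_hom_iso\<close> the choice affects the
  functor only up to the comparison isomorphisms.\<close>

definition rep_sheaf ::
  "'f ring \<Rightarrow> 'a::euclidean_space set set \<Rightarrow> (nat \<Rightarrow> int) \<Rightarrow> ('a, 'f, 'v) lin_data \<Rightarrow>
   ('a, 'f, 'v) presheaf \<times> ('a set \<Rightarrow> 'v \<Rightarrow> 'a \<Rightarrow> 'v)" where
  "rep_sheaf F C \<delta> S = (SOME p. represents F C \<delta> S (fst p) (snd p))"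

definition rep_functor ::
  "'f ring \<Rightarrow> 'a::euclidean_space set set \<Rightarrow> (nat \<Rightarrow> int) \<Rightarrow>
   (('a, 'f, 'v) lin_data, 'a set \<Rightarrow> 'v \<Rightarrow> 'v, ('a, 'f, 'v) presheaf, 'a set \<Rightarrow> 'v \<Rightarrow> 'v) functr" where
  "rep_functor F C \<delta> =
     \<lparr>on_obj = (\<lambda>S. fst (rep_sheaf F C \<delta> S)),
      on_hom = (\<lambda>S T. rep_hom C \<delta> (fst (rep_sheaf F C \<delta> S)) (snd (rep_sheaf F C \<delta> S))
        (fst (rep_sheaf F C \<delta> T)) (snd (rep_sheaf F C \<delta> T)))\<rparr>"

lemma rep_dataI:
  assumes "simplicial_complex C" "perversity \<delta>" "S \<in> R_objects F C \<delta>"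
  shows "rep_data C \<delta> F S"
  using assms by (intro rep_data.intro perverse_cx.intro simplicial_cx.intro perverse_cx_axioms.intro rep_data_axioms.intro)

lemma rep_sheaf:
  fixes F :: "'f ring" and S :: "('a::euclidean_space, 'f, 'v) lin_data"
  assumes "large_enough F TYPE('v)" "field F" "rep_data C \<delta> F S"
  shows "represents F C \<delta> S (fst (rep_sheaf F C \<delta> S)) (snd (rep_sheaf F C \<delta> S))"
proof -
  obtain A :: "('a, 'f, 'v) presheaf" and \<nu> where "represents F C \<delta> S A \<nu>"
    using rep_data.represented_exists[OF assms(3,1,2)] by blast
  then have "\<exists>p. represents F C \<delta> S (fst p :: ('a, 'f, 'v) presheaf) (snd p)" by (intro exI[of _ "(A, \<nu>)"]) simp
  then show ?thesis unfolding rep_sheaf_def by (rule someI_ex)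
qed

lemma R_id:
  assumes "S \<in> R_objects F C \<delta>"
  shows "Idn (R_cat F C \<delta>) S \<in> Hom (R_cat F C \<delta>) S S"
    "Cmp (R_cat F C \<delta>) S S S (Idn (R_cat F C \<delta>) S) (Idn (R_cat F C \<delta>) S) = Idn (R_cat F C \<delta>) S"
proof -
  have S: "S \<in> Obj (R_cat F C \<delta>)" using assms by (simp add: R_cat_def)
  show i: "Idn (R_cat F C \<delta>) S \<in> Hom (R_cat F C \<delta>) S S" by (rule category_axioms(1)[OF category_R_cat S])
  show "Cmp (R_cat F C \<delta>) S S S (Idn (R_cat F C \<delta>) S) (Idn (R_cat F C \<delta>) S) = Idn (R_cat F C \<delta>) S"
    by (rule category_axioms(3)[OF category_R_cat S S i])
qed

text \<open>The two comparison maps compose, in either order, to the map induced by the identity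
  from a pair to itself, which is the identity. This comparison serves essential surjectivity as
  well as compatibility with isomorphisms.\<close>

lemma rep_hom_iso:
  fixes P Q :: "('a::euclidean_space, 'f, 'v) presheaf" and S :: "('a, 'f, 'v) lin_data"
  assumes S: "rep_data C \<delta> F S" and r: "represents F C \<delta> S P \<nu>" "represents F C \<delta> S Q \<nu>'"
  shows "iso_in (Sh_c F C \<delta>) P Q (rep_hom C \<delta> P \<nu> Q \<nu>' (Idn (R_cat F C \<delta>) S))"
proof -
  have SO: "S \<in> R_objects F C \<delta>" using S by (simp add: rep_data_def rep_data_axioms_def)
  have p: "rep_pair C \<delta> F S S" using S by (rule rep_pair.intro[OF _ S])
  have h: "Hom (Sh_c F C \<delta>) = sheaf_homs F (polyhedron_top C)" by (simp add: Sh_c_def)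
  show ?thesis
    unfolding iso_in_def h
  proof (intro conjI bexI)
    show "rep_hom C \<delta> P \<nu> Q \<nu>' (Idn (R_cat F C \<delta>) S) \<in> sheaf_homs F (polyhedron_top C) P Q"
      by (rule rep_pair.rep_hom_in[OF p r R_id(1)[OF SO]])
    show "rep_hom C \<delta> Q \<nu>' P \<nu> (Idn (R_cat F C \<delta>) S) \<in> sheaf_homs F (polyhedron_top C) Q P"
      by (rule rep_pair.rep_hom_in[OF p r(2,1) R_id(1)[OF SO]])
    show "Cmp (Sh_c F C \<delta>) P Q P (rep_hom C \<delta> Q \<nu>' P \<nu> (Idn (R_cat F C \<delta>) S))
      (rep_hom C \<delta> P \<nu> Q \<nu>' (Idn (R_cat F C \<delta>) S)) = Idn (Sh_c F C \<delta>) P"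
      unfolding rep_hom_comp[OF p r R_id(1)[OF SO], where U = S] R_id(2)[OF SO] by (rule rep_hom_id[OF S r(1)])
    show "Cmp (Sh_c F C \<delta>) Q P Q (rep_hom C \<delta> P \<nu> Q \<nu>' (Idn (R_cat F C \<delta>) S))
      (rep_hom C \<delta> Q \<nu>' P \<nu> (Idn (R_cat F C \<delta>) S)) = Idn (Sh_c F C \<delta>) Q"
      unfolding rep_hom_comp[OF p r(2,1) R_id(1)[OF SO], where U = S] R_id(2)[OF SO] by (rule rep_hom_id[OF S r(2)])
  qed
qed

theorem rep_functor_equivalence:
  fixes F :: "'f ring" and C :: "'a::euclidean_space set set"
  assumes le: "large_enough F TYPE('v)" and fF: "field F" and C: "simplicial_complex C" and pv: "perversity \<delta>"
  shows "equivalence_of_categories (R_cat F C \<delta>) (Sh_c F C \<delta>)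
    (rep_functor F C \<delta> :: (('a, 'f, 'v) lin_data, _, _, _) functr)"
proof (rule fully_faithful_essentially_surjective)
  let ?\<Phi> = "rep_functor F C \<delta> :: (('a, 'f, 'v) lin_data, 'a set \<Rightarrow> 'v \<Rightarrow> 'v, ('a, 'f, 'v) presheaf, 'a set \<Rightarrow> 'v \<Rightarrow> 'v) functr"
  have O: "Obj (R_cat F C \<delta>) = R_objects F C \<delta>" by (simp add: R_cat_def)
  have O': "Obj (Sh_c F C \<delta>) = {A. is_sheaf F (polyhedron_top C) A \<and> constructible F C (\<lambda>k. - \<delta> k) A}"
    and h: "Hom (Sh_c F C \<delta>) = sheaf_homs F (polyhedron_top C)" by (simp_all add: Sh_c_def)
  note rd = rep_dataI[OF C pv]
  note rp = rep_pair.intro[OF rd rd]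
  note r = rep_sheaf[OF le fF rd]
  have \<Phi>: "on_obj ?\<Phi> S = fst (rep_sheaf F C \<delta> S)"
    "on_hom ?\<Phi> S T = rep_hom C \<delta> (fst (rep_sheaf F C \<delta> S)) (snd (rep_sheaf F C \<delta> S))
        (fst (rep_sheaf F C \<delta> T)) (snd (rep_sheaf F C \<delta> T))" for S T
    by (simp_all add: rep_functor_def)
  show "is_functor (R_cat F C \<delta>) (Sh_c F C \<delta>) ?\<Phi>"
    unfolding is_functor_def O
  proof (intro conjI ballI category_R_cat category_Sh_c)
    fix S :: "('a, 'f, 'v) lin_data" assume S: "S \<in> R_objects F C \<delta>"
    show "on_obj ?\<Phi> S \<in> Obj (Sh_c F C \<delta>)"
      unfolding O' mem_Collect_eq \<Phi>
      using rep_data.represented_sheaf[OF rd[OF S] r[OF S]] rep_data.represented_constructible[OF rd[OF S] r[OF S]] by (rule conjI)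
    show "on_hom ?\<Phi> S S (Idn (R_cat F C \<delta>) S) = Idn (Sh_c F C \<delta>) (on_obj ?\<Phi> S)"
      unfolding \<Phi> by (rule rep_hom_id[OF rd[OF S] r[OF S]])
    fix T :: "('a, 'f, 'v) lin_data" and f assume T: "T \<in> R_objects F C \<delta>" and f: "f \<in> Hom (R_cat F C \<delta>) S T"
    show "on_hom ?\<Phi> S T f \<in> Hom (Sh_c F C \<delta>) (on_obj ?\<Phi> S) (on_obj ?\<Phi> T)"
      unfolding \<Phi> h by (rule rep_pair.rep_hom_in[OF rp[OF S T] r[OF S] r[OF T] f])
    fix U :: "('a, 'f, 'v) lin_data" and g
    show "on_hom ?\<Phi> S U (Cmp (R_cat F C \<delta>) S T U g f) =
      Cmp (Sh_c F C \<delta>) (on_obj ?\<Phi> S) (on_obj ?\<Phi> T) (on_obj ?\<Phi> U) (on_hom ?\<Phi> T U g) (on_hom ?\<Phi> S T f)"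
      unfolding \<Phi> by (rule rep_hom_comp[OF rp[OF S T] r[OF S] r[OF T] f, symmetric])
  qed
  fix S T :: "('a, 'f, 'v) lin_data" assume S: "S \<in> Obj (R_cat F C \<delta>)" and T: "T \<in> Obj (R_cat F C \<delta>)"
  note S' = S[unfolded O] and T' = T[unfolded O]
  show "f = g" if "f \<in> Hom (R_cat F C \<delta>) S T" "g \<in> Hom (R_cat F C \<delta>) S T" "on_hom ?\<Phi> S T f = on_hom ?\<Phi> S T g" for f g
    by (rule rep_pair.rep_hom_faithful[OF rp[OF S' T'] r[OF S'] r[OF T'] that(1,2) that(3)[unfolded \<Phi>]])
  show "\<exists>f\<in>Hom (R_cat F C \<delta>) S T. on_hom ?\<Phi> S T f = p"
    if "p \<in> Hom (Sh_c F C \<delta>) (on_obj ?\<Phi> S) (on_obj ?\<Phi> T)" for p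
    unfolding \<Phi> by (rule rep_pair.rep_hom_full[OF rp[OF S' T'] r[OF S'] r[OF T'] that[unfolded \<Phi> h]])
next
  let ?\<Phi> = "rep_functor F C \<delta> :: (('a, 'f, 'v) lin_data, 'a set \<Rightarrow> 'v \<Rightarrow> 'v, ('a, 'f, 'v) presheaf, 'a set \<Rightarrow> 'v \<Rightarrow> 'v) functr"
  fix A :: "('a, 'f, 'v) presheaf" assume "A \<in> Obj (Sh_c F C \<delta>)"
  then have A: "is_sheaf F (polyhedron_top C) A" "constructible F C (\<lambda>k. - \<delta> k) A" by (simp_all add: Sh_c_def)
  have "perverse_cx C \<delta>" using C pv by (intro perverse_cx.intro simplicial_cx.intro perverse_cx_axioms.intro)
  then obtain S :: "('a, 'f, 'v) lin_data" and \<nu> where S: "S \<in> R_objects F C \<delta>" and \<nu>: "represents F C \<delta> S A \<nu>"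
    using constructible_represented[OF _ A] by blast
  have "iso_in (Sh_c F C \<delta>) (on_obj ?\<Phi> S) A
      (rep_hom C \<delta> (fst (rep_sheaf F C \<delta> S)) (snd (rep_sheaf F C \<delta> S)) A \<nu> (Idn (R_cat F C \<delta>) S))"
    using rep_hom_iso[OF rep_dataI[OF C pv S] rep_sheaf[OF le fF rep_dataI[OF C pv S]] \<nu>]
    by (simp add: rep_functor_def)
  then show "\<exists>S\<in>Obj (R_cat F C \<delta>). \<exists>e. iso_in (Sh_c F C \<delta>) (on_obj ?\<Phi> S) A e"
    using S by (intro bexI[of _ S] exI) (assumption, simp add: R_cat_def)
qed

section \<open>Transport\<close>

locale perverse_isom = simplicial_isom C C' h for C C' :: "'a::euclidean_space set set" and h +
  fixes \<delta> :: "nat \<Rightarrow> int"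
  assumes pv: "perversity \<delta>"
begin

sublocale P: perverse_cx C \<delta> using pv by unfold_locales
sublocale Q: perverse_cx C' \<delta> using pv by unfold_locales

abbreviation "pl \<equiv> pull C h"
abbreviation "g \<equiv> inv_into (\<Union>C) h"
abbreviation "TR \<equiv> on_obj (transport_R C C' h)"
abbreviation "TSh \<equiv> on_obj (transport_Sh C C' h)"

lemma g_in: "y \<in> \<Union>C' \<Longrightarrow> g y \<in> \<Union>C" and h_g: "y \<in> \<Union>C' \<Longrightarrow> h (g y) = y" and g_h: "x \<in> \<Union>C \<Longrightarrow> g (h x) = x"
  using bij_betw_inv_into_right[OF h_bij] bij_betw_inv_into_left[OF h_bij]
    bij_betwE[OF bij_betw_inv_into[OF h_bij]] by blast+

lemma simplex_sub: "S \<in> simplices C \<Longrightarrow> S \<subseteq> \<Union>C" by (auto simp: simplices_def)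

text \<open>\<open>h\<close> preserves chains and dimensions, hence levels, so it carries the top of
  a chain to the top of its image.\<close>

lemma mu_iso:
  assumes x: "x \<in> \<Union>C"
  shows "Q.\<mu> (h x) = h ` P.\<mu> x"
proof -
  have lev: "Q.lev (h ` S) = P.lev S" if "S \<in> simplices C" for S
  proof -
    have "h ` S \<in> simplices C'" using that unfolding iso_simplices by (rule imageI)
    then show ?thesis using Q.lev_sdim P.lev_sdim[OF that] sdim_image[OF that] by simp
  qed
  note t = P.chain_top[OF P.ch_chain[OF x]]
  have s: "S \<in> simplices C" if "S \<in> P.ch x" for S using that by (simp add: carrier_chain_def)
  show ?thesis
    unfolding stratum_of_def
  proof (rule Q.chain_top_eqI)
    show "carrier_chain C' (h x) \<in> subdivision_chains C'" by (rule Q.ch_chain[OF h_in[OF x]])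
    show "h ` chain_top \<delta> (P.ch x) \<in> carrier_chain C' (h x)" unfolding iso_carrier_chain[OF x] using t(1) by (rule imageI)
    fix T assume "T \<in> carrier_chain C' (h x)"
    then obtain S where S: "S \<in> P.ch x" "T = h ` S" unfolding iso_carrier_chain[OF x] by blast
    show "Q.lev (h ` chain_top \<delta> (P.ch x)) \<le> Q.lev T"
      unfolding S(2) lev[OF s[OF S(1)]] lev[OF s[OF t(1)]] by (rule t(2)[OF S(1)])
  qed
qed

lemma pull_mu: "x \<in> \<Union>C \<Longrightarrow> pl (Q.\<mu> (h x)) = P.\<mu> x"
  unfolding mu_iso by (rule pull_image[OF simplex_sub[OF P.mu_simplex]])

lemma pull_mu': "y \<in> \<Union>C' \<Longrightarrow> pl (Q.\<mu> y) = P.\<mu> (g y)"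
  using pull_mu[OF g_in] h_g by simp

lemma arrow_pull:
  assumes "arrow C' \<delta> D D'"
  shows "arrow C \<delta> (pl D) (pl D')"
proof -
  have D: "D \<in> simplices C'" "D' \<in> simplices C'" "\<delta> (sdim D) = \<delta> (sdim D') + 1" "incident D D'"
    using assms by (simp_all add: arrow_def)
  note p = pull_simplices[OF D(1)] pull_simplices[OF D(2)]
  show ?thesis
    using D(3,4) p incident_image[of "pl D" "pl D'"] sdim_image[of "pl D"] sdim_image[of "pl D'"]
    by (simp add: arrow_def)
qed

lemma TR_simps: "Spc (TR S) D = Spc S (pl D)" "Map (TR S) D D' = Map S (pl D) (pl D')"
  by (simp_all add: transport_R_def)

lemma TR_obj:
  assumes S: "S \<in> R_objects F C \<delta>"
  shows "TR S \<in> R_objects F C' \<delta>"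
  unfolding R_objects_def mem_Collect_eq TR_simps
proof (intro conjI ballI allI impI)
  fix D assume "D \<in> simplices C'"
  then show "fin_dim_vectorspace F (Spc S (pl D))" using S pull_simplices by (simp add: R_objects_def)
next
  fix D D' assume "arrow C' \<delta> D D'"
  then show "Map S (pl D) (pl D') \<in> module_hom F (Spc S (pl D)) (Spc S (pl D'))"
    using S arrow_pull by (simp add: R_objects_def)
next
  fix D' D'' D1 D2 x
  assume a: "arrow C' \<delta> D' D1 \<and> arrow C' \<delta> D1 D'' \<and> arrow C' \<delta> D' D2 \<and> arrow C' \<delta> D2 D''" and x: "x \<in> carrier (Spc S (pl D'))"
  have b: "arrow C \<delta> (pl D') (pl D1) \<and> arrow C \<delta> (pl D1) (pl D'') \<and> arrow C \<delta> (pl D') (pl D2) \<and> arrow C \<delta> (pl D2) (pl D'')"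
    using a arrow_pull by simp
  have "\<forall>D' D'' D1 D2. arrow C \<delta> D' D1 \<and> arrow C \<delta> D1 D'' \<and> arrow C \<delta> D' D2 \<and> arrow C \<delta> D2 D'' \<longrightarrow>
        (\<forall>x\<in>carrier (Spc S D'). Map S D1 D'' (Map S D' D1 x) = Map S D2 D'' (Map S D' D2 x))"
    using S by (simp add: R_objects_def)
  from this[THEN spec, THEN spec, THEN spec, THEN spec, THEN mp, OF b] x
  show "Map S (pl D1) (pl D'') (Map S (pl D') (pl D1) x) = Map S (pl D2) (pl D'') (Map S (pl D') (pl D2) x)"
    by (rule bspec)
qed

lemma TR_hom:
  assumes f: "f \<in> Hom (R_cat F C \<delta>) S T"
  shows "on_hom (transport_R C C' h) S T f \<in> Hom (R_cat F C' \<delta>) (TR S) (TR T)"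
proof -
  have lin: "f D \<in> Lin F (Spc S D) (Spc T D)" if "D \<in> simplices C" for D using f that by (auto simp: R_cat_def)
  have nat: "f D' (Map S D D' x) = Map T D D' (f D x)" if "arrow C \<delta> D D'" "x \<in> carrier (Spc S D)" for D D' x
    using f that by (simp add: R_cat_def)
  have th: "on_hom (transport_R C C' h) S T f = (\<lambda>D\<in>simplices C'. f (pl D))" by (simp add: transport_R_def)
  show ?thesis
    unfolding R_cat_def cat.simps mem_Collect_eq TR_simps th
  proof (intro conjI allI impI ballI PiE_I)
    fix D assume "D \<in> simplices C'"
    then show "(\<lambda>D\<in>simplices C'. f (pl D)) D \<in> Lin F (Spc S (pl D)) (Spc T (pl D))"
      using lin pull_simplices by simp
  next
    fix D D' x assume a: "arrow C' \<delta> D D'" and x: "x \<in> carrier (Spc S (pl D))"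
    then have "D \<in> simplices C'" "D' \<in> simplices C'" by (simp_all add: arrow_def)
    then show "(\<lambda>D\<in>simplices C'. f (pl D)) D' (Map S (pl D) (pl D') x) =
        Map T (pl D) (pl D') ((\<lambda>D\<in>simplices C'. f (pl D)) D x)"
      using nat[OF arrow_pull[OF a] x] by simp
  qed simp
qed

lemma path_pull:
  "path_map (arrow C' \<delta>) (Map (TR S)) D D' k \<Longrightarrow> path_map (arrow C \<delta>) (Map S) (pl D) (pl D') k"
proof (induction rule: path_map.induct)
  case (path_refl D)
  show ?case by (rule path_map.path_refl)
next
  case (path_step D A T k)
  show ?case unfolding TR_simps by (rule path_map.path_step[OF arrow_pull[OF path_step(1)] path_step.IH])
qed

lemma ch_mono: "x \<in> \<Union>C \<Longrightarrow> y \<in> \<Union>C \<Longrightarrow> P.ch x \<subseteq> P.ch y \<Longrightarrow> Q.ch (h x) \<subseteq> Q.ch (h y)"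
  unfolding iso_carrier_chain by (rule image_mono)

lemma ch_mono': "x \<in> \<Union>C \<Longrightarrow> y \<in> \<Union>C \<Longrightarrow> Q.ch (h x) \<subseteq> Q.ch (h y) \<Longrightarrow> P.ch x \<subseteq> P.ch y"
  unfolding pull_carrier_chain[of x, symmetric] pull_carrier_chain[of y, symmetric] by (rule image_mono)

text \<open>A path of arrows in \<open>C'\<close> pulls back to a path in \<open>C\<close> with
  literally the same composite, and composites do not depend on the path.\<close>

lemma Tr_iso:
  assumes S: "S \<in> R_objects F C \<delta>" and x: "x \<in> \<Union>C" "y \<in> \<Union>C" "P.ch x \<subseteq> P.ch y"
    and v: "v \<in> carrier (Spc S (P.\<mu> x))"
  shows "Tr C' \<delta> (TR S) (Q.\<mu> (h x)) (Q.\<mu> (h y)) v = Tr C \<delta> S (P.\<mu> x) (P.\<mu> y) v"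
proof -
  interpret A: rep_data C \<delta> F S using S by (rule rep_dataI[OF A.sc pv])
  interpret B: rep_data C' \<delta> F "TR S" using TR_obj[OF S] by (rule rep_dataI[OF B.sc pv])
  have "B.rp (Q.\<mu> (h x)) (Q.\<mu> (h y)) (Tr C' \<delta> (TR S) (Q.\<mu> (h x)) (Q.\<mu> (h y)))"
    using B.tr_path[OF Q.mu_simplex[OF h_in[OF x(1)]] Q.mu_simplex[OF h_in[OF x(2)]]
      Q.mu_mono[OF h_in[OF x(1)] h_in[OF x(2)] ch_mono[OF x]]] unfolding B.tr_Tr .
  then have "path_map (arrow C \<delta>) (Map S) (P.\<mu> x) (P.\<mu> y) (Tr C' \<delta> (TR S) (Q.\<mu> (h x)) (Q.\<mu> (h y)))"
    unfolding Q.arr_arrow by (rule path_pull[of S "Q.\<mu> (h x)" "Q.\<mu> (h y)", unfolded pull_mu[OF x(1)] pull_mu[OF x(2)]])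
  then have "A.rp (P.\<mu> x) (P.\<mu> y) (Tr C' \<delta> (TR S) (Q.\<mu> (h x)) (Q.\<mu> (h y)))"
    unfolding P.arr_arrow .
  from A.tr_eq[OF this P.mu_simplex[OF x(1)] v] show ?thesis unfolding A.tr_Tr by (rule sym)
qed

lemma image_open: "P.opn W \<Longrightarrow> Q.opn (h ` W)"
proof -
  assume W: "P.opn W"
  then have WX: "W \<subseteq> \<Union>C" by (rule P.opn_sub)
  interpret I: simplicial_isom C' C g
    by (intro simplicial_isom.intro simplicial_isom_axioms.intro inverse_iso A.simplicial_cx_axioms B.simplicial_cx_axioms)
  have "pull C' g W = h ` W"
    using WX h_in g_h h_g unfolding pull_def by (force simp: subset_iff)
  then show ?thesis using I.pull_open[OF W] by simp
qed

lemma sections_push: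
  assumes S: "S \<in> R_objects F C \<delta>" and V: "Q.opn V" and s: "\<sigma> \<in> sections C \<delta> S (pl V)"
  shows "(\<lambda>y\<in>V. \<sigma> (g y)) \<in> sections C' \<delta> (TR S) V"
proof -
  interpret A: rep_data C \<delta> F S using S by (rule rep_dataI[OF A.sc pv])
  interpret B: rep_data C' \<delta> F "TR S" using TR_obj[OF S] by (rule rep_dataI[OF B.sc pv])
  have VX: "V \<subseteq> \<Union>C'" by (rule Q.opn_sub[OF V])
  have gp: "g y \<in> pl V" "g y \<in> \<Union>C" "h (g y) = y" if "y \<in> V" for y
  proof -
    have "y \<in> \<Union>C'" using VX that by (rule subsetD)
    then show "g y \<in> pl V" "g y \<in> \<Union>C" "h (g y) = y" using that g_in h_g by (simp_all add: pull_def)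
  qed
  show ?thesis
  proof (rule B.sectionsI)
    fix y assume y: "y \<in> V"
    note gy = gp[OF y]
    have sg: "\<sigma> (g y) \<in> carrier (Spc S (P.\<mu> (g y)))" by (rule A.sectionsD(1)[OF s gy(1)])
    show "(\<lambda>y\<in>V. \<sigma> (g y)) y \<in> carrier (Spc (TR S) (Q.\<mu> y))"
      unfolding TR_simps using sg pull_mu[OF gy(2)] gy(3) y by simp
    obtain W where W: "P.opn W" "g y \<in> W" "W \<subseteq> pl V" "\<And>z. z \<in> W \<Longrightarrow> P.ch (g y) \<subseteq> P.ch z"
        "\<And>z. z \<in> W \<Longrightarrow> \<sigma> z = Tr C \<delta> S (P.\<mu> (g y)) (P.\<mu> z) (\<sigma> (g y))"
      by (rule A.sections_local[OF s gy(1)], rule that, assumption+)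
    show "\<exists>W. Q.opn W \<and> y \<in> W \<and> W \<subseteq> V \<and> (\<forall>z\<in>W. Q.ch y \<subseteq> Q.ch z \<and>
      (\<lambda>y\<in>V. \<sigma> (g y)) z = Tr C' \<delta> (TR S) (Q.\<mu> y) (Q.\<mu> z) ((\<lambda>y\<in>V. \<sigma> (g y)) y))"
    proof (intro exI[of _ "h ` W"] conjI ballI)
      show "Q.opn (h ` W)" by (rule image_open[OF W(1)])
      show "y \<in> h ` W" using W(2) gy(3) by force
      show WV: "h ` W \<subseteq> V" using W(3) by (auto simp: pull_def)
      fix z assume "z \<in> h ` W"
      then obtain w where w: "w \<in> W" "z = h w" by blast
      have wX: "w \<in> \<Union>C" using w(1) P.opn_sub[OF W(1)] by blast
      show "Q.ch y \<subseteq> Q.ch z" using ch_mono[OF gy(2) wX W(4)[OF w(1)]] unfolding gy(3) w(2) .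
      have zV: "z \<in> V" using WV w by blast
      have "\<sigma> w = Tr C' \<delta> (TR S) (Q.\<mu> (h (g y))) (Q.\<mu> (h w)) (\<sigma> (g y))"
        unfolding Tr_iso[OF S gy(2) wX W(4)[OF w(1)] sg] by (rule W(5)[OF w(1)])
      then show "(\<lambda>y\<in>V. \<sigma> (g y)) z = Tr C' \<delta> (TR S) (Q.\<mu> y) (Q.\<mu> z) ((\<lambda>y\<in>V. \<sigma> (g y)) y)"
        unfolding gy(3) restrict_apply'[OF zV] restrict_apply'[OF y] unfolding w(2) g_h[OF wX] .
    qed
  qed simp
qed

lemma sections_pull:
  assumes S: "S \<in> R_objects F C \<delta>" and V: "Q.opn V" and s: "\<tau> \<in> sections C' \<delta> (TR S) V"
  shows "(\<lambda>x\<in>pl V. \<tau> (h x)) \<in> sections C \<delta> S (pl V)"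
proof -
  interpret A: rep_data C \<delta> F S using S by (rule rep_dataI[OF A.sc pv])
  interpret B: rep_data C' \<delta> F "TR S" using TR_obj[OF S] by (rule rep_dataI[OF B.sc pv])
  show ?thesis
  proof (rule A.sectionsI)
    fix x assume x: "x \<in> pl V"
    then have xX: "x \<in> \<Union>C" and hx: "h x \<in> V" by (auto simp: pull_def)
    have th: "\<tau> (h x) \<in> carrier (Spc S (P.\<mu> x))"
      using B.sectionsD(1)[OF s hx] unfolding TR_simps pull_mu[OF xX] .
    then show "(\<lambda>x\<in>pl V. \<tau> (h x)) x \<in> carrier (Spc S (P.\<mu> x))" using x by simp
    obtain W where W: "Q.opn W" "h x \<in> W" "W \<subseteq> V" "\<And>z. z \<in> W \<Longrightarrow> Q.ch (h x) \<subseteq> Q.ch z"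
        "\<And>z. z \<in> W \<Longrightarrow> \<tau> z = Tr C' \<delta> (TR S) (Q.\<mu> (h x)) (Q.\<mu> z) (\<tau> (h x))"
      by (rule B.sections_local[OF s hx], rule that, assumption+)
    show "\<exists>W. P.opn W \<and> x \<in> W \<and> W \<subseteq> pl V \<and> (\<forall>z\<in>W. P.ch x \<subseteq> P.ch z \<and>
      (\<lambda>x\<in>pl V. \<tau> (h x)) z = Tr C \<delta> S (P.\<mu> x) (P.\<mu> z) ((\<lambda>x\<in>pl V. \<tau> (h x)) x))"
    proof (intro exI[of _ "pl W"] conjI ballI)
      show "P.opn (pl W)" by (rule pull_open[OF W(1)])
      show "x \<in> pl W" using W(2) xX by (simp add: pull_def)
      show WV: "pl W \<subseteq> pl V" using W(3) by (auto simp: pull_def)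
      fix z assume z: "z \<in> pl W"
      then have zX: "z \<in> \<Union>C" and hz: "h z \<in> W" by (auto simp: pull_def)
      show c: "P.ch x \<subseteq> P.ch z" by (rule ch_mono'[OF xX zX W(4)[OF hz]])
      have zV: "z \<in> pl V" using WV z by blast
      show "(\<lambda>x\<in>pl V. \<tau> (h x)) z = Tr C \<delta> S (P.\<mu> x) (P.\<mu> z) ((\<lambda>x\<in>pl V. \<tau> (h x)) x)"
        unfolding restrict_apply'[OF zV] restrict_apply'[OF x] Tr_iso[OF S xX zX c th, symmetric]
        by (rule W(5)[OF hz])
    qed
  qed simp
qed

lemma sections_bij:
  assumes S: "S \<in> R_objects F C \<delta>" and V: "Q.opn V"
  shows "bij_betw (\<lambda>\<sigma>. \<lambda>y\<in>V. \<sigma> (g y)) (sections C \<delta> S (pl V)) (sections C' \<delta> (TR S) V)"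
proof (rule bij_betw_byWitness[where f' = "\<lambda>\<tau>. \<lambda>x\<in>pl V. \<tau> (h x)"])
  have VX: "V \<subseteq> \<Union>C'" by (rule Q.opn_sub[OF V])
  show "\<forall>\<sigma>\<in>sections C \<delta> S (pl V). (\<lambda>x\<in>pl V. (\<lambda>y\<in>V. \<sigma> (g y)) (h x)) = \<sigma>"
  proof (intro ballI ext)
    fix \<sigma> x assume "\<sigma> \<in> sections C \<delta> S (pl V)"
    then have "\<sigma> \<in> extensional (pl V)" by (auto simp: sections_def PiE_def)
    then show "(\<lambda>x\<in>pl V. (\<lambda>y\<in>V. \<sigma> (g y)) (h x)) x = \<sigma> x"
      using g_h[of x] by (cases "x \<in> pl V") (auto simp: pull_def extensional_def)
  qed
  show "\<forall>\<tau>\<in>sections C' \<delta> (TR S) V. (\<lambda>y\<in>V. (\<lambda>x\<in>pl V. \<tau> (h x)) (g y)) = \<tau>"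
  proof (intro ballI ext)
    fix \<tau> y assume "\<tau> \<in> sections C' \<delta> (TR S) V"
    then have e: "\<tau> \<in> extensional V" by (auto simp: sections_def PiE_def)
    show "(\<lambda>y\<in>V. (\<lambda>x\<in>pl V. \<tau> (h x)) (g y)) y = \<tau> y"
    proof (cases "y \<in> V")
      case True
      then have "y \<in> \<Union>C'" using VX by blast
      then show ?thesis using True g_in h_g by (simp add: pull_def)
    qed (use e in \<open>simp add: extensional_def\<close>)
  qed
  show "(\<lambda>\<sigma>. \<lambda>y\<in>V. \<sigma> (g y)) ` sections C \<delta> S (pl V) \<subseteq> sections C' \<delta> (TR S) V"
    using sections_push[OF S V] by (rule image_subsetI)
  show "(\<lambda>\<tau>. \<lambda>x\<in>pl V. \<tau> (h x)) ` sections C' \<delta> (TR S) V \<subseteq> sections C \<delta> S (pl V)"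
    using sections_pull[OF S V] by (rule image_subsetI)
qed

text \<open>The bijection belonging to the direct image: families on \<open>C\<close> are moved to
  \<open>C'\<close> by composition with the inverse of \<open>h\<close>.\<close>

definition shift :: "('a set \<Rightarrow> 'w \<Rightarrow> 'a \<Rightarrow> 'v) \<Rightarrow> 'a set \<Rightarrow> 'w \<Rightarrow> 'a \<Rightarrow> 'v" where
  "shift \<nu> V s = (\<lambda>y\<in>V. \<nu> (pl V) s (g y))"

lemma TSh_simps: "sec (TSh A) V = sec A (pl V)" "res (TSh A) V W = res A (pl V) (pl W)"
  by (simp_all add: transport_Sh_def)

lemma pull_mono: "V \<subseteq> W \<Longrightarrow> pl V \<subseteq> pl W" by (auto simp: pull_def)

lemma TSh_presheaf:
  assumes "is_presheaf F (polyhedron_top C) A"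
  shows "is_presheaf F (polyhedron_top C') (TSh A)"
  using assms unfolding is_presheaf_def TSh_simps by (intro conjI allI impI ballI) (simp_all add: pull_open pull_mono)

text \<open>Reduces compatibility with \<open>h\<close> to the comparison of two pairs representing
  the same data on \<open>C'\<close>: the chosen one and the direct image.\<close>

lemma TSh_represents:
  assumes S: "S \<in> R_objects F C \<delta>" and r: "represents F C \<delta> S A \<nu>"
  shows "represents F C' \<delta> (TR S) (TSh A) (shift \<nu>)"
proof -
  interpret A: rep_data C \<delta> F S using S by (rule rep_dataI[OF A.sc pv])
  have gp: "g y \<in> pl V" "Spc (TR S) (Q.\<mu> y) = Spc S (P.\<mu> (g y))" if "Q.opn V" "y \<in> V" for y V
  proof -
    have "y \<in> \<Union>C'" using that Q.opn_sub by blast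
    then show "g y \<in> pl V" "Spc (TR S) (Q.\<mu> y) = Spc S (P.\<mu> (g y))"
      using that(2) g_in h_g pull_mu' unfolding TR_simps by (simp_all add: pull_def)
  qed
  show ?thesis
    unfolding represents_def
  proof (intro conjI allI impI ballI)
    show "is_presheaf F (polyhedron_top C') (TSh A)" using r by (intro TSh_presheaf) (simp add: represents_def)
    fix V assume V: "Q.opn V"
    note pV = pull_open[OF V]
    have "bij_betw ((\<lambda>\<sigma>. \<lambda>y\<in>V. \<sigma> (g y)) \<circ> \<nu> (pl V)) (carrier (sec A (pl V))) (sections C' \<delta> (TR S) V)"
      by (rule bij_betw_trans[OF A.rep_bij[OF r pV] sections_bij[OF S V]])
    then show "bij_betw (shift \<nu> V) (carrier (sec (TSh A) V)) (sections C' \<delta> (TR S) V)"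
      unfolding TSh_simps comp_def shift_def[abs_def] .
    fix s assume s: "s \<in> carrier (sec (TSh A) V)"
    note s' = s[unfolded TSh_simps]
    show "shift \<nu> V (c \<odot>\<^bsub>sec (TSh A) V\<^esub> s) y = c \<odot>\<^bsub>Spc (TR S) (Q.\<mu> y)\<^esub> shift \<nu> V s y"
      if "c \<in> carrier F" "y \<in> V" for c y
      using A.rep_smult[OF r pV s' that(1)] that gp[OF V that(2)] unfolding TSh_simps by (simp add: shift_def)
    fix t assume t: "t \<in> carrier (sec (TSh A) V)"
    show "shift \<nu> V (s \<oplus>\<^bsub>sec (TSh A) V\<^esub> t) y = shift \<nu> V s y \<oplus>\<^bsub>Spc (TR S) (Q.\<mu> y)\<^esub> shift \<nu> V t y"
      if "y \<in> V" for y
      using A.rep_add[OF r pV s' t[unfolded TSh_simps]] that gp[OF V that] unfolding TSh_simps by (simp add: shift_def)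
  next
    fix V W s assume a: "Q.opn V \<and> Q.opn W \<and> W \<subseteq> V" and s: "s \<in> carrier (sec (TSh A) V)"
    have "\<nu> (pl W) (res A (pl V) (pl W) s) = restrict (\<nu> (pl V) s) (pl W)"
      using A.rep_res[OF r] a s[unfolded TSh_simps] pull_open pull_mono by simp
    then have "shift \<nu> W (res (TSh A) V W s) = (\<lambda>y\<in>W. restrict (\<nu> (pl V) s) (pl W) (g y))"
      unfolding TSh_simps shift_def by (rule arg_cong)
    also have "\<dots> = restrict (shift \<nu> V s) W"
    proof (intro ext)
      fix y show "(\<lambda>y\<in>W. restrict (\<nu> (pl V) s) (pl W) (g y)) y = restrict (shift \<nu> V s) W y"
        using a gp(1)[of W y] by (cases "y \<in> W") (auto simp: shift_def)
    qed
    finally show "shift \<nu> W (res (TSh A) V W s) = restrict (shift \<nu> V s) W" .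
  qed
qed

text \<open>Both sides are determined by their effect on families, and composition with the inverse
  of \<open>h\<close> commutes with a map applied in each fibre.\<close>

lemma TSh_rep_hom:
  assumes S: "S \<in> R_objects F C \<delta>" and T: "T \<in> R_objects F C \<delta>"
    and r: "represents F C \<delta> S A \<nu>" "represents F C \<delta> T B \<nu>'"
    and f: "f \<in> Hom (R_cat F C \<delta>) S T"
  shows "on_hom (transport_Sh C C' h) A B (rep_hom C \<delta> A \<nu> B \<nu>' f) =
    rep_hom C' \<delta> (TSh A) (shift \<nu>) (TSh B) (shift \<nu>') (on_hom (transport_R C C' h) S T f)"
proof (intro ext)
  interpret rep_pair C \<delta> F S T by (intro rep_pair.intro rep_dataI[OF A.sc pv] S T)
  interpret T': rep_data C' \<delta> F "TR T" using TR_obj[OF T] by (rule rep_dataI[OF simplicial_isom.axioms(2)[OF simplicial_isom_axioms, THEN simplicial_cx.sc] pv])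
  fix V s
  have th: "on_hom (transport_Sh C C' h) A B k = (\<lambda>V\<in>{V. Q.opn V}. k (pl V))" for k
    by (simp add: transport_Sh_def)
  show "on_hom (transport_Sh C C' h) A B (rep_hom C \<delta> A \<nu> B \<nu>' f) V s =
    rep_hom C' \<delta> (TSh A) (shift \<nu>) (TSh B) (shift \<nu>') (on_hom (transport_R C C' h) S T f) V s"
  proof (cases "Q.opn V")
    case V: True
    note pV = pull_open[OF V]
    show ?thesis
    proof (cases "s \<in> carrier (sec A (pl V))")
      case s: True
      define t where "t = rep_hom C \<delta> A \<nu> B \<nu>' f (pl V) s"
      note ap = rep_hom_apply[OF r f pV s, folded t_def]
      have "shift \<nu>' V t = (\<lambda>y\<in>V. on_hom (transport_R C C' h) S T f (Q.\<mu> y) (shift \<nu> V s y))"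
      proof
        fix y
        show "shift \<nu>' V t y = (\<lambda>y\<in>V. on_hom (transport_R C C' h) S T f (Q.\<mu> y) (shift \<nu> V s y)) y"
        proof (cases "y \<in> V")
          case y: True
          then have yX: "y \<in> \<Union>C'" using Q.opn_sub[OF V] by blast
          have "g y \<in> pl V" using g_in[OF yX] h_g[OF yX] y by (simp add: pull_def)
          then show ?thesis
            using y Q.mu_simplex[OF yX] pull_mu'[OF yX] by (simp add: shift_def ap(2) transport_R_def)
        qed (simp add: shift_def)
      qed
      moreover have "inv_into (carrier (sec B (pl V))) (shift \<nu>' V) (shift \<nu>' V t) = t"
        using bij_betw_imp_inj_on[OF T'.rep_bij[OF TSh_represents[OF T r(2)] V]] ap(1)
        unfolding TSh_simps by (rule inv_into_f_f)
      ultimately show ?thesis using V s by (simp add: th rep_hom_def[of C'] TSh_simps t_def)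
    next
      case False
      then show ?thesis using V pV by (simp add: th rep_hom_def TSh_simps)
    qed
  qed (simp add: th rep_hom_def)
qed

end

text \<open>The natural isomorphism is the comparison induced by the identity of the transported
  data. Both ways around the naturality square are induced by the transported morphism, composed
  with an identity on one side or on the other.\<close>

theorem rep_functor_compatible:
  fixes F :: "'f ring"
  assumes le: "large_enough F TYPE('v)" and fF: "field F"
  shows "compatible_with_isos F
    (rep_functor F :: 'a::euclidean_space set set \<Rightarrow> _ \<Rightarrow> (('a, 'f, 'v) lin_data, _, _, _) functr)"
  unfolding compatible_with_isos_def
proof (intro allI impI)
  fix C C' :: "'a set set" and n h \<delta>
  assume a: "connected_complex C n \<and> connected_complex C' n \<and> simplicial_iso C C' h \<and> perversity \<delta>"
  let ?\<Phi> = "rep_functor F :: 'a set set \<Rightarrow> _ \<Rightarrow> (('a, 'f, 'v) lin_data, 'a set \<Rightarrow> 'v \<Rightarrow> 'v, ('a, 'f, 'v) presheaf, 'a set \<Rightarrow> 'v \<Rightarrow> 'v) functr"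
  have sc: "simplicial_complex C" "simplicial_complex C'" and pv: "perversity \<delta>"
    using a by (simp_all add: connected_complex_def)
  interpret perverse_isom C C' h \<delta>
    using a sc by (intro perverse_isom.intro perverse_isom_axioms.intro simplicial_isom.intro
      simplicial_isom_axioms.intro simplicial_cx.intro) simp_all
  let ?A = "\<lambda>C S. fst (rep_sheaf F C \<delta> S) :: ('a, 'f, 'v) presheaf"
  let ?n = "\<lambda>C S. snd (rep_sheaf F C \<delta> S) :: 'a set \<Rightarrow> 'v \<Rightarrow> 'a \<Rightarrow> 'v"
  define \<eta> where "\<eta> S = rep_hom C' \<delta> (?A C' (TR S)) (?n C' (TR S)) (TSh (?A C S)) (shift (?n C S)) (Idn (R_cat F C' \<delta>) (TR S))" for S
  have ob: "on_obj (functor_comp (?\<Phi> C' \<delta>) (transport_R C C' h)) S = ?A C' (TR S)"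
    "on_obj (functor_comp (transport_Sh C C' h) (?\<Phi> C \<delta>)) S = TSh (?A C S)" for S
    by (simp_all add: functor_comp_def rep_functor_def)
  have hm: "on_hom (functor_comp (?\<Phi> C' \<delta>) (transport_R C C' h)) S T f =
      rep_hom C' \<delta> (?A C' (TR S)) (?n C' (TR S)) (?A C' (TR T)) (?n C' (TR T)) (on_hom (transport_R C C' h) S T f)"
    "on_hom (functor_comp (transport_Sh C C' h) (?\<Phi> C \<delta>)) S T f =
      on_hom (transport_Sh C C' h) (?A C S) (?A C T) (rep_hom C \<delta> (?A C S) (?n C S) (?A C T) (?n C T) f)" for S T f
    by (simp_all add: functor_comp_def rep_functor_def)
  have rd': "rep_data C' \<delta> F (TR S)" and r: "represents F C \<delta> S (?A C S) (?n C S)"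
    and r': "represents F C' \<delta> (TR S) (?A C' (TR S)) (?n C' (TR S))" if "S \<in> R_objects F C \<delta>" for S
    using rep_dataI[OF sc(2) pv TR_obj[OF that]] rep_sheaf[OF le fF] rep_dataI[OF sc(1) pv that] by blast+
  show "nat_isomorphic (R_cat F C \<delta>) (Sh_c F C' \<delta>)
      (functor_comp (?\<Phi> C' \<delta>) (transport_R C C' h)) (functor_comp (transport_Sh C C' h) (?\<Phi> C \<delta>))"
    unfolding nat_isomorphic_def ob hm
  proof (intro exI[of _ \<eta>] conjI ballI)
    fix S :: "('a, 'f, 'v) lin_data" assume "S \<in> Obj (R_cat F C \<delta>)"
    then have S: "S \<in> R_objects F C \<delta>" by (simp add: R_cat_def)
    note q = TSh_represents[OF S r[OF S]]
    show "iso_in (Sh_c F C' \<delta>) (?A C' (TR S)) (TSh (?A C S)) (\<eta> S)"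
      unfolding \<eta>_def by (rule rep_hom_iso[OF rd'[OF S] r'[OF S] q])
    fix T :: "('a, 'f, 'v) lin_data" and f assume "T \<in> Obj (R_cat F C \<delta>)" and f: "f \<in> Hom (R_cat F C \<delta>) S T"
    then have T: "T \<in> R_objects F C \<delta>" by (simp add: R_cat_def)
    note Tf = TR_hom[OF f]
    have o: "TR S \<in> Obj (R_cat F C' \<delta>)" "TR T \<in> Obj (R_cat F C' \<delta>)" using TR_obj S T by (simp_all add: R_cat_def)
    note p = rep_pair.intro[OF rd'[OF S] rd'[OF T]] rep_pair.intro[OF rd'[OF S] rd'[OF S]]
    show "Cmp (Sh_c F C' \<delta>) (?A C' (TR S)) (?A C' (TR T)) (TSh (?A C T)) (\<eta> T)
        (rep_hom C' \<delta> (?A C' (TR S)) (?n C' (TR S)) (?A C' (TR T)) (?n C' (TR T)) (on_hom (transport_R C C' h) S T f)) =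
      Cmp (Sh_c F C' \<delta>) (?A C' (TR S)) (TSh (?A C S)) (TSh (?A C T))
        (on_hom (transport_Sh C C' h) (?A C S) (?A C T) (rep_hom C \<delta> (?A C S) (?n C S) (?A C T) (?n C T) f)) (\<eta> S)"
      unfolding \<eta>_def TSh_rep_hom[OF S T r[OF S] r[OF T] f]
        rep_hom_comp[OF p(1) r'[OF S] r'[OF T] Tf, where U = "TR T"]
        rep_hom_comp[OF p(2) r'[OF S] q R_id(1)[OF TR_obj[OF S]], where U = "TR T"]
        category_axioms(3,4)[OF category_R_cat o Tf] by (rule refl)
  qed
qed

theorem theoremB:
  fixes F :: "'f ring"
  assumes "field F"
    and char_0: "\<And>m::nat. m > 0 \<Longrightarrow> [m] \<cdot>\<^bsub>F\<^esub> \<one>\<^bsub>F\<^esub> \<noteq> \<zero>\<^bsub>F\<^esub>"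
    and "large_enough F TYPE('v)"
  shows "\<exists>\<Phi> :: 'a::euclidean_space set set \<Rightarrow> (nat \<Rightarrow> int) \<Rightarrow>
           (('a, 'f, 'v) lin_data, 'a set \<Rightarrow> 'v \<Rightarrow> 'v, ('a, 'f, 'v) presheaf, 'a set \<Rightarrow> 'v \<Rightarrow> 'v) functr.
         (\<forall>C n \<delta>. connected_complex C n \<and> perversity \<delta> \<longrightarrow>
            equivalence_of_categories (R_cat F C \<delta>) (Sh_c F C \<delta>) (\<Phi> C \<delta>)) \<and>
         compatible_with_isos F \<Phi>"
proof (intro exI[of _ "rep_functor F"] conjI allI impI)
  fix C :: "'a set set" and n \<delta> assume "connected_complex C n \<and> perversity \<delta>"
  then show "equivalence_of_categories (R_cat F C \<delta>) (Sh_c F C \<delta>)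
      (rep_functor F C \<delta> :: (('a, 'f, 'v) lin_data, _, _, _) functr)"
    by (intro rep_functor_equivalence assms(1,3)) (simp_all add: connected_complex_def)
qed (rule rep_functor_compatible[OF assms(3,1)])

end
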